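(* Let $\mathbb F_q$ be a fixed finite field and let $\chi$ be a character of $U_n$. Then $$(\hat\rho\circ\rho)\big(ch(\chi\uparrow_{U_n}^{G_n})\big)=ch(\chi\uparrow_{U_n}^{G_n}),$$ where $\rho$ is the plethysm map and $\hat\rho$ is the algebra map defined in the context.
   Context: Groups and symmetric functions. $\mathbb F_q$ is the field with $q$ elements, $\bar{\mathbb F}_q$ its algebraic closure, $G_n=GL_n(\mathbb F_q)$, $U_n\le G_n$ the group of unipotent upper-triangular matrices. For a set $Z$ of infinitely many variables, $\Lambda_{\mathbb C}(Z)$ is the ring of symmetric functions in $Z$ over $\mathbb C$, with complete functions $h_\lambda$, power sums $p_\lambda$, Schur functions $s_\lambda$; $Y=\{y_1,y_2,\ldots\}$. $P_\lambda(Z;t)$ is the Hall-Littlewood symmetric function (Macdonald's normalization), and with $n(\lambda)=\sum_{i\ge1}(i-1)\lambda_i$ put $\tilde P_\lambda(Z;q)=q^{-n(\lambda)}P_\lambda(Z;q^{-1})$. Index sets. $F:z\mapsto z^q$ is the Frobenius. $\Phi$ is the set of $F$-orbits in $\bar{\mathbb F}_q^\times$, identified with the monic irreducible polynomials $f\neq x$ in $\mathbb F_q[x]$; $d(f)=\deg f$; $f_z\in\Phi$ is the orbit of $z$. Let $M_n=\mathbb F_{q^n}^\times$ and $\hat M_n=\mathrm{Hom}(M_n,\mathbb C^\times)$; for $m\mid n$ embed $\hat M_m\subset\hat M_n$ by composing with the norm $M_n\to M_m$. $\Theta$ is the set of orbits of $\xi\mapsto\xi^q$ on $\bigcup_n\hat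 M_n$; $d(\varphi)=\deg(\varphi)=|\varphi|$. If $\xi\in\varphi$ and $d(\varphi)\mid n$ then $\xi\in\hat M_n$ and $\xi(z)$, $z\in M_n$, is its value there. For a partition-valued function $\bm\mu$ on $\Phi$, $\|\bm\mu\|=\sum_f d(f)|\bm\mu(f)|$, and $\mathcal P^\Phi_n=\{\bm\mu:\|\bm\mu\|=n\}$; similarly $\mathcal P^\Theta_n$. For $\bm\lambda\in\mathcal P^\Theta_n$, $ht(\bm\lambda)=\max\{l(\bm\lambda(\varphi)):\varphi\in\Theta\}$ ($l$ = number of parts). Characteristic map. For $f\in\Phi$ and $\varphi\in\Theta$ let $X_f$ and $Y^\varphi$ be infinite sets of variables (of degree $d(f)$, resp. $d(\varphi)$). $\Lambda_{\mathbb C}=\otimes_{f\in\Phi}\Lambda_{\mathbb C}(X_f)$ is identified with $\otimes_{\varphi\in\Theta}\Lambda_{\mathbb C}(Y^\varphi)$ by $p_k(Y^\varphi)=(-1)^{n-1}\sum_{z\in M_n}\xi(z)\,p_{n/d(f_z)}(X_{f_z})$, where $\xi\in\varphi$, $n=k\,d(\varphi)$. Put $\tilde P_{\bm\mu}=\prod_f\tilde P_{\bm\mu(f)}(X_f;q^{d(f)})$ and $S_{\bm\lambda}=\prod_\varphi s_{\bm\lambda(\varphi)}(Y^\varphi)$. For $\bm\mu\in\mathcal P^\Phi_n$, $\pi_{\bm\mu}$ is the indicator function of the conjugacy class $K^{\bm\mu}$ of those $g\in G_n$ making $\mathbb F_q^n$ an $\mathbb F_q[x]$-module isomorphic to $\bigoplus_f\bigoplus_i\mathbb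 F_q[x]/(f^{\bm\mu(f)_i})$. $ch$ is the linear map from the direct sum over $n\ge0$ of the spaces of class functions on $G_n$ to $\Lambda_{\mathbb C}$ with $\pi_{\bm\mu}\mapsto\tilde P_{\bm\mu}$; it is a (Hopf algebra) isomorphism, and it maps the irreducible characters $\chi^{\bm\lambda}$ of $G_n$ bijectively to the $S_{\bm\lambda}$, $\bm\lambda\in\mathcal P_n^\Theta$. Plethysm map. $\rho:\Lambda_{\mathbb C}\to\Lambda_{\mathbb C}(Y)$ is the $\mathbb C$-algebra homomorphism with $\rho(h_a(Y^\varphi))=h_a[p_b]:=h_a(y_1^b,y_2^b,\ldots)$, $b=d(\varphi)$. Linear characters and $\rho_n$. Fix a nontrivial additive character $\psi:\mathbb F_q\to\mathbb C^\times$. For $q_1,\ldots,q_{n-1}\in\mathbb F_q^\times$, $\chi^{(n)}_{(q_1,\ldots,q_{n-1})}(u)=\prod_{i=1}^{n-1}\psi(q_iu_{i,i+1})$ for $u\in U_n$; $\uparrow_{U_n}^{G_n}$ denotes induction. The induced character does not depend on $q_1,\ldots,q_{n-1}$, and $\rho_n:=\rho\big(ch(\chi^{(n)}_{(q_1,\ldots,q_{n-1})}\uparrow_{U_n}^{G_n})\big)$ for $n\ge1$. For a partition $\lambda=(\lambda_1,\ldots,\lambda_l)$, $\rho_\lambda=\rho_{\lambda_1}\cdots\rho_{\lambda_l}$ (empty product $1$); the $\rho_\lambda$ form a $\mathbb C$-basis of $\Lambda_{\mathbb C}(Y)$. The map $\hat\rho$. $\hat\rho:\Lambda_{\mathbb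 C}(Y)\to\mathbb C\text{-span}\{S_{\bm\lambda}\}=\Lambda_{\mathbb C}$ is the linear map with $\hat\rho(\rho_n)=\sum_{\bm\lambda\in\mathcal P^\Theta_n,\ ht(\bm\lambda)=1}S_{\bm\lambda}=ch(\chi^{(n)}_{(q_1,\ldots,q_{n-1})}\uparrow_{U_n}^{G_n})$ for $n\ge1$ and $\hat\rho(\rho_\lambda)=\hat\rho(\rho_{\lambda_1})\cdots\hat\rho(\rho_{\lambda_l})$. *)

theory Defs
  imports
    "HOL-Library.Multiset"
    "HOL-Library.Cardinality"
    "HOL-Combinatorics.Permutations"
    "HOL-Algebra.Algebraic_Closure_Type"
    "Jordan_Normal_Form.Matrix"
begin

section \<open>Formal power series in arbitrarily many variables\<close>

text \<open>
  A monomial in variables indexed by \<open>'v\<close> is a finite multiset over \<open>'v\<close>; a power series is an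
  arbitrary function from monomials to coefficients.
\<close>

typedef 'v mps = "UNIV :: ('v multiset \<Rightarrow> complex) set"
  morphisms mcoeff Abs_mps ..

setup_lifting type_definition_mps

lemma mps_eqI: "(\<And>m. mcoeff f m = mcoeff g m) \<Longrightarrow> f = g"
  by (simp add: mcoeff_inject[symmetric] fun_eq_iff)

lemma finite_submultisets [simp]: "finite {a. a \<subseteq># (m :: 'v multiset)}"
proof (induction m)
  case (add x m)
  have sub: "{a. a \<subseteq># add_mset x m} \<subseteq> {a. a \<subseteq># m} \<union> add_mset x ` {a. a \<subseteq># m}"
  proof
    fix a assume "a \<in> {a. a \<subseteq># add_mset x m}"
    hence a: "a \<subseteq># add_mset x m" by simp
    show "a \<in> {a. a \<subseteq># m} \<union> add_mset x ` {a. a \<subseteq># m}"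
    proof (cases "x \<in># a")
      case True
      then obtain b where b: "a = add_mset x b" by (metis multi_member_split)
      with a show ?thesis by auto
    next
      case False
      with a show ?thesis
        by (metis (no_types, lifting) UnI1 diff_single_trivial mem_Collect_eq
            add_mset_remove_trivial subset_eq_diff_conv add_mset_add_single)
    qed
  qed
  show ?case by (rule finite_subset[OF sub]) (use add in simp)
qed simp

instantiation mps :: (type) comm_ring_1
begin

lift_definition zero_mps :: "'a mps" is "\<lambda>_. 0" .
lift_definition one_mps :: "'a mps" is "\<lambda>m. if m = {#} then 1 else 0" .
lift_definition plus_mps :: "'a mps \<Rightarrow> 'a mps \<Rightarrow> 'a mps" is "\<lambda>f g m. f m + g m" .
lift_definition minus_mps :: "'a mps \<Rightarrow> 'a mps \<Rightarrow> 'a mps" is "\<lambda>f g m. f m - g m" .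
lift_definition uminus_mps :: "'a mps \<Rightarrow> 'a mps" is "\<lambda>f m. - f m" .
lift_definition times_mps :: "'a mps \<Rightarrow> 'a mps \<Rightarrow> 'a mps"
  is "\<lambda>f g m. \<Sum>a | a \<subseteq># m. f a * g (m - a)" .

instance
proof
  fix f g h :: "'a mps"
  show "f * g * h = f * (g * h)"
  proof (rule mps_eqI)
    fix m :: "'a multiset"
    let ?F = "\<lambda>(a, b). mcoeff f a * mcoeff g b * mcoeff h (m - a - b)"
    have "mcoeff (f * g * h) m =
        (\<Sum>(c, a) \<in> Sigma {c. c \<subseteq># m} (\<lambda>c. {a. a \<subseteq># c}).
           mcoeff f a * mcoeff g (c - a) * mcoeff h (m - c))"
      by (simp add: times_mps.rep_eq sum_distrib_right sum.Sigma)
    also have "\<dots> = sum ?F (Sigma {a. a \<subseteq># m} (\<lambda>a. {b. b \<subseteq># m - a}))"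
      by (rule sum.reindex_bij_witness[of _ "\<lambda>(a, b). (a + b, a)" "\<lambda>(c, a). (a, c - a)"])
         (auto simp: subset_mset.le_diff_conv2 add.commute subset_mset.add_diff_inverse
           subset_mset.diff_add subset_mset.diff_diff_right
           intro: subset_mset.order_trans)
    also have "\<dots> = mcoeff (f * (g * h)) m"
      by (simp add: times_mps.rep_eq sum_distrib_left sum.Sigma mult.assoc)
    finally show "mcoeff (f * g * h) m = mcoeff (f * (g * h)) m" .
  qed
  show "f * g = g * f"
  proof (rule mps_eqI)
    fix m :: "'a multiset"
    show "mcoeff (f * g) m = mcoeff (g * f) m"
      unfolding times_mps.rep_eq
      by (rule sum.reindex_bij_witness[of _ "\<lambda>a. m - a" "\<lambda>a. m - a"])
         (auto simp: subset_mset.diff_diff_right)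
  qed
  show "1 * f = f"
  proof (rule mps_eqI)
    fix m :: "'a multiset"
    have "mcoeff (1 * f) m = (\<Sum>a | a \<subseteq># m. if a = {#} then mcoeff f m else 0)"
      unfolding times_mps.rep_eq one_mps.rep_eq by (rule sum.cong) auto
    thus "mcoeff (1 * f) m = mcoeff f m" by simp
  qed
  show "(f + g) * h = f * h + g * h"
    by (rule mps_eqI) (simp add: times_mps.rep_eq plus_mps.rep_eq algebra_simps sum.distrib)
  show "(0 :: 'a mps) \<noteq> 1"
    by transfer (auto simp: fun_eq_iff)
qed (rule mps_eqI; simp add: plus_mps.rep_eq minus_mps.rep_eq uminus_mps.rep_eq zero_mps.rep_eq)+

end

lift_definition scalar :: "complex \<Rightarrow> 'v mps" is "\<lambda>c m. if m = {#} then c else 0" .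

lift_definition var :: "'v \<Rightarrow> 'v mps" is "\<lambda>i m. if m = {#i#} then 1 else 0" .

definition linear_on_mps :: "'v mps set \<Rightarrow> ('v mps \<Rightarrow> 'w mps) \<Rightarrow> bool" where
  "linear_on_mps A F \<longleftrightarrow>
     (\<forall>f\<in>A. \<forall>g\<in>A. F (f + g) = F f + F g) \<and> (\<forall>c. \<forall>f\<in>A. F (scalar c * f) = scalar c * F f)"

definition alg_hom_on :: "'v mps set \<Rightarrow> ('v mps \<Rightarrow> 'w mps) \<Rightarrow> bool" where
  "alg_hom_on A F \<longleftrightarrow>
     linear_on_mps A F \<and> F 1 = 1 \<and> (\<forall>f\<in>A. \<forall>g\<in>A. F (f * g) = F f * F g)"

section \<open>Symmetric functions\<close>

text \<open>The ring of symmetric functions over \<open>\<complex>\<close> in the variables indexed by \<open>nat\<close>.\<close>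

definition sym_fun :: "nat mps set" where
  "sym_fun = {f. (\<exists>d. \<forall>m. mcoeff f m \<noteq> 0 \<longrightarrow> size m \<le> d) \<and>
                 (\<forall>\<sigma> m. bij \<sigma> \<longrightarrow> mcoeff f (image_mset \<sigma> m) = mcoeff f m)}"

definition is_partition :: "nat list \<Rightarrow> bool" where
  "is_partition l \<longleftrightarrow> sorted_wrt (\<ge>) l \<and> 0 \<notin> set l"

text \<open>\<open>power_sum k\<close> is meant for \<open>k \<ge> 1\<close>.\<close>

lift_definition power_sum :: "nat \<Rightarrow> nat mps"
  is "\<lambda>k m. if \<exists>i. m = replicate_mset k i then 1 else 0" .

lift_definition complete_h :: "nat \<Rightarrow> nat mps" is "\<lambda>a m. if size m = a then 1 else 0" .

text \<open>
  The plethysm $h_a[p_b] = h_a(y_1^b, y_2^b, \ldots)$: the sum of the \<open>b\<close>-th powers of all monomials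
  of degree \<open>a\<close>.
\<close>

lift_definition complete_pleth :: "nat \<Rightarrow> nat \<Rightarrow> nat mps"
  is "\<lambda>a b m. if \<exists>m'. size m' = a \<and> m = repeat_mset b m' then 1 else 0" .

definition cells :: "nat list \<Rightarrow> (nat \<times> nat) set" where
  "cells l = {(r, c). r < length l \<and> c < l ! r}"

definition is_ssyt :: "nat list \<Rightarrow> (nat \<times> nat \<Rightarrow> nat) \<Rightarrow> bool" where
  "is_ssyt l T \<longleftrightarrow>
     (\<forall>x. x \<notin> cells l \<longrightarrow> T x = 0) \<and>
     (\<forall>r c. (r, Suc c) \<in> cells l \<longrightarrow> T (r, c) \<le> T (r, Suc c)) \<and>
     (\<forall>r c. (Suc r, c) \<in> cells l \<longrightarrow> T (r, c) < T (Suc r, c))"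

text \<open>Schur functions as generating functions of semistandard tableaux.\<close>

lift_definition schur :: "nat list \<Rightarrow> nat mps"
  is "\<lambda>l m. of_nat (card {T. is_ssyt l T \<and> image_mset T (mset_set (cells l)) = m})" .

subsection \<open>Hall-Littlewood functions\<close>

text \<open>Setting all variables with index \<open>\<ge> n\<close> to zero.\<close>

lift_definition truncate_vars :: "nat \<Rightarrow> nat mps \<Rightarrow> nat mps"
  is "\<lambda>n f m. if set_mset m \<subseteq> {..<n} then f m else 0" .

definition vandermonde :: "nat \<Rightarrow> nat mps" where
  "vandermonde n = (\<Prod>j<n. \<Prod>i<j. var i - var j)"

definition HL_v :: "nat \<Rightarrow> complex \<Rightarrow> complex" where
  "HL_v m t = (\<Prod>j=1..m. (1 - t ^ j) / (1 - t))"

definition HL_norm :: "nat \<Rightarrow> nat list \<Rightarrow> complex \<Rightarrow> complex" where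
  "HL_norm n l t = HL_v (n - length l) t * (\<Prod>k\<in>set l. HL_v (count (mset l) k) t)"

definition HL_numerator :: "nat \<Rightarrow> nat list \<Rightarrow> complex \<Rightarrow> nat mps" where
  "HL_numerator n l t =
     (\<Sum>w | w permutes {..<n}. of_int (sign w) *
        (\<Prod>i<length l. var (w i) ^ (l ! i)) *
        (\<Prod>j<n. \<Prod>i<j. var (w i) - scalar t * var (w j)))"

text \<open>
  Macdonald defines $P_\lambda(x_1,\ldots,x_n;t) = v_\lambda(t)^{-1} \sum_{w \in S_n}
  w\big(x^\lambda \prod_{i<j} (x_i - t x_j)/(x_i - x_j)\big)$ for $n \ge l(\lambda)$, and
  $P_\lambda$ as the symmetric function with these specialisations. The denominators are cleared
  here: $w$ multiplies $\prod_{i<j}(x_i - x_j)$ by the sign of $w$. Only $t$ with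
  $v_\lambda(t) \neq 0$ and $t \neq 1$ are relevant.
\<close>

definition hall_littlewood :: "nat list \<Rightarrow> complex \<Rightarrow> nat mps" where
  "hall_littlewood l t =
     (THE P. P \<in> sym_fun \<and>
        (\<forall>n\<ge>length l. scalar (HL_norm n l t) * vandermonde n * truncate_vars n P
                         = HL_numerator n l t))"

definition n_stat :: "nat list \<Rightarrow> nat" where
  "n_stat l = (\<Sum>i<length l. i * l ! i)"

definition HL_tilde :: "nat list \<Rightarrow> nat \<Rightarrow> nat mps" where
  "HL_tilde l Q =
     scalar (inverse (of_nat Q ^ n_stat l)) * hall_littlewood l (inverse (of_nat Q))"

section \<open>The index sets\<close>

text \<open>
  The finite field $\mathbb F_q$ is the type \<open>'a :: {field, finite}\<close>, so that \<open>q = CARD('a)\<close>, and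
  its algebraic closure is \<open>'a alg_closure\<close>.
\<close>

definition frob_orbit :: "('a :: {field, finite}) alg_closure \<Rightarrow> 'a alg_closure set" where
  "frob_orbit z = {z ^ (CARD('a) ^ k) | k. True}"

definition Phi :: "('a :: {field, finite}) alg_closure set set" where
  "Phi = {frob_orbit z | z. z \<noteq> 0}"

text \<open>The monic irreducible polynomial over \<open>'a\<close> corresponding to an orbit.\<close>

definition orbit_poly :: "('a :: {field, finite}) alg_closure set \<Rightarrow> 'a poly" where
  "orbit_poly f = (THE p. map_poly to_ac p = (\<Prod>z\<in>f. [:- z, 1:]))"

definition field_units :: "nat \<Rightarrow> ('a :: {field, finite}) alg_closure set" where
  "field_units n = {z. z \<noteq> 0 \<and> z ^ (CARD('a) ^ n) = z}"

text \<open>Characters of $M_n$, extended by zero to the whole type.\<close>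

definition field_chars :: "nat \<Rightarrow> (('a :: {field, finite}) alg_closure \<Rightarrow> complex) set" where
  "field_chars n =
     {\<xi>. (\<forall>z\<in>field_units n. \<xi> z \<noteq> 0) \<and>
         (\<forall>z\<in>field_units n. \<forall>w\<in>field_units n. \<xi> (z * w) = \<xi> z * \<xi> w) \<and>
         (\<forall>z. z \<notin> field_units n \<longrightarrow> \<xi> z = 0)}"

text \<open>The norm $M_n \to M_m$ for $m \mid n$, and the embedding of character groups it induces.\<close>

definition field_norm ::
    "nat \<Rightarrow> nat \<Rightarrow> ('a :: {field, finite}) alg_closure \<Rightarrow> 'a alg_closure" where
  "field_norm m n z = (\<Prod>i<n div m. z ^ (CARD('a) ^ (m * i)))"

definition char_embed :: "nat \<Rightarrow> nat \<Rightarrow> (('a :: {field, finite}) alg_closure \<Rightarrow> complex) \<Rightarrow>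
    'a alg_closure \<Rightarrow> complex" where
  "char_embed m n \<xi> = (\<lambda>z. if z \<in> field_units n then \<xi> (field_norm m n z) else 0)"

text \<open>
  The union $\bigcup_n \hat M_n$ is the direct limit along these embeddings. One of its elements is
  the set of all pairs \<open>(n, \<xi>)\<close> with $\xi \in \hat M_n$ that represent it.
\<close>

type_synonym 'a limit_char = "(nat \<times> ('a alg_closure \<Rightarrow> complex)) set"

definition limit_rel :: "((nat \<times> (('a :: {field, finite}) alg_closure \<Rightarrow> complex)) \<times>
    (nat \<times> ('a alg_closure \<Rightarrow> complex))) set" where
  "limit_rel = {((m, \<xi>), (n, \<eta>)) | m \<xi> n \<eta>. 1 \<le> m \<and> 1 \<le> n \<and>
      \<xi> \<in> field_chars m \<and> \<eta> \<in> field_chars n \<and>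
      char_embed m (m * n) \<xi> = char_embed n (m * n) \<eta>}"

definition limit_chars :: "('a :: {field, finite}) limit_char set" where
  "limit_chars = (SIGMA n : {1..}. field_chars n) // limit_rel"

text \<open>For \<open>x\<close> in the limit, its representative in $\hat M_n$ (provided there is one).\<close>

definition char_at :: "nat \<Rightarrow> ('a :: {field, finite}) limit_char \<Rightarrow> 'a alg_closure \<Rightarrow> complex" where
  "char_at n x = (THE \<xi>. (n, \<xi>) \<in> x)"

definition frob_char :: "('a :: {field, finite}) limit_char \<Rightarrow> 'a limit_char" where
  "frob_char x = (\<lambda>(n, \<xi>). (n, \<lambda>z. \<xi> z ^ CARD('a))) ` x"

definition Theta :: "('a :: {field, finite}) limit_char set set" where
  "Theta = {{(frob_char ^^ k) x | k. True} | x. x \<in> limit_chars}"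

text \<open>
  Partition-valued functions of norm \<open>n\<close> on a set of orbits, the weight of an orbit being its
  cardinality.
\<close>

definition partition_funs :: "'b set set \<Rightarrow> nat \<Rightarrow> ('b set \<Rightarrow> nat list) set" where
  "partition_funs I n =
     {\<mu>. (\<forall>f. is_partition (\<mu> f)) \<and> (\<forall>f. f \<notin> I \<longrightarrow> \<mu> f = []) \<and> finite {f. \<mu> f \<noteq> []} \<and>
         (\<Sum>f | \<mu> f \<noteq> []. card f * sum_list (\<mu> f)) = n}"

definition height :: "(('a :: {field, finite}) limit_char set \<Rightarrow> nat list) \<Rightarrow> nat" where
  "height \<nu> = Max ((\<lambda>\<phi>. length (\<nu> \<phi>)) ` Theta)"

section \<open>The ring \<open>\<Lambda>\<close> and its two sets of alphabets\<close>

text \<open>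
  The alphabet $X_f$ consists of the variables \<open>(f, i)\<close> with \<open>i :: nat\<close>;
  \<open>in_alphabet f g\<close> is $g(X_f)$.
\<close>

type_synonym 'a xvar = "'a alg_closure set \<times> nat"

lift_definition in_alphabet ::
    "('a :: {field, finite}) alg_closure set \<Rightarrow> nat mps \<Rightarrow> 'a xvar mps"
  is "\<lambda>f g m. if fst ` set_mset m \<subseteq> {f} then g (image_mset snd m) else 0" .

text \<open>
  The tensor product of the rings of symmetric functions in the $X_f$, realised as the subalgebra
  that they generate inside the power series in all variables. The scalars are the constants in
  any one of these rings.
\<close>

inductive_set Lambda_ring :: "('a :: {field, finite}) xvar mps set" where
  base: "f \<in> Phi \<Longrightarrow> g \<in> sym_fun \<Longrightarrow> in_alphabet f g \<in> Lambda_ring"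
| add: "u \<in> Lambda_ring \<Longrightarrow> v \<in> Lambda_ring \<Longrightarrow> u + v \<in> Lambda_ring"
| mult: "u \<in> Lambda_ring \<Longrightarrow> v \<in> Lambda_ring \<Longrightarrow> u * v \<in> Lambda_ring"

text \<open>The element $p_k(Y^\varphi)$, where \<open>n = k * card \<phi>\<close>.\<close>

definition power_sum_Y ::
    "('a :: {field, finite}) limit_char set \<Rightarrow> nat \<Rightarrow> 'a xvar mps" where
  "power_sum_Y \<phi> k =
     (let n = k * card \<phi>; \<xi> = char_at n (SOME x. x \<in> \<phi>) in
       (- 1) ^ (n - 1) *
       (\<Sum>z\<in>field_units n. scalar (\<xi> z) *
          in_alphabet (frob_orbit z) (power_sum (n div card (frob_orbit z)))))"

text \<open>
  \<open>in_Y \<phi> g\<close> is $g(Y^\varphi)$: the algebra homomorphism on symmetric functions prescribed on the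
  power sums, which are free generators of the ring of symmetric functions over \<open>\<complex>\<close>.
\<close>

definition in_Y :: "('a :: {field, finite}) limit_char set \<Rightarrow> nat mps \<Rightarrow> 'a xvar mps" where
  "in_Y \<phi> = (SOME F. alg_hom_on sym_fun F \<and> (\<forall>k\<ge>1. F (power_sum k) = power_sum_Y \<phi> k))"

definition P_tilde :: "(('a :: {field, finite}) alg_closure set \<Rightarrow> nat list) \<Rightarrow> 'a xvar mps" where
  "P_tilde \<mu> = (\<Prod>f | \<mu> f \<noteq> []. in_alphabet f (HL_tilde (\<mu> f) (CARD('a) ^ card f)))"

definition S_fun :: "(('a :: {field, finite}) limit_char set \<Rightarrow> nat list) \<Rightarrow> 'a xvar mps" where
  "S_fun \<nu> = (\<Prod>\<phi> | \<nu> \<phi> \<noteq> []. in_Y \<phi> (schur (\<nu> \<phi>)))"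

section \<open>The groups, and the characteristic map\<close>

definition GL :: "nat \<Rightarrow> ('k :: field) mat monoid" where
  "GL n = units_of (ring_mat TYPE('k) n ())"

definition UT :: "nat \<Rightarrow> ('k :: field) mat set" where
  "UT n = {A \<in> carrier_mat n n. upper_triangular A \<and> (\<forall>i<n. A $$ (i, i) = 1)}"

text \<open>
  The module structure on \<open>'k\<^sup>n\<close> given by a matrix \<open>g\<close>: the polynomial \<open>p\<close> acts as $p(g)$.
\<close>

definition poly_act :: "nat \<Rightarrow> ('k :: field) mat \<Rightarrow> 'k poly \<Rightarrow> 'k vec \<Rightarrow> 'k vec" where
  "poly_act n g p v = vec n (\<lambda>j. \<Sum>i\<le>Polynomial.degree p. Polynomial.coeff p i * ((g ^\<^sub>m i) *\<^sub>v v) $ j)"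

text \<open>
  The underlying set of $\bigoplus_{f}\bigoplus_i \mathbb F_q[x]/(f^{\mu(f)_i})$, with summands
  indexed by \<open>(f, i)\<close> and residue classes represented by their reduced representatives.
\<close>

definition quotient_sum ::
    "(('a :: {field, finite}) alg_closure set \<Rightarrow> nat list) \<Rightarrow> ('a alg_closure set \<times> nat \<Rightarrow> 'a poly) set"
  where
  "quotient_sum \<mu> =
     {s. \<forall>f i. if i < length (\<mu> f) then s (f, i) mod orbit_poly f ^ (\<mu> f ! i) = s (f, i)
               else s (f, i) = 0}"

definition conj_class ::
    "nat \<Rightarrow> (('a :: {field, finite}) alg_closure set \<Rightarrow> nat list) \<Rightarrow> 'a mat set" where
  "conj_class n \<mu> =
     {g \<in> carrier (GL n).
        \<exists>T. bij_betw T (carrier_vec n) (quotient_sum \<mu>) \<and>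
            (\<forall>v\<in>carrier_vec n. \<forall>w\<in>carrier_vec n. T (v + w) = (\<lambda>x. T v x + T w x)) \<and>
            (\<forall>p. \<forall>v\<in>carrier_vec n.
               T (poly_act n g p v) =
                 (\<lambda>(f, i). (p * T v (f, i)) mod orbit_poly f ^ (\<mu> f ! i)))}"

text \<open>
  A class function on $G_n$ is the combination of the indicator functions $\pi_{\mu}$ whose
  coefficients are its values on the classes; \<open>ch\<close> maps $\pi_{\mu}$ to \<open>P_tilde \<mu>\<close>.
\<close>

definition ch :: "nat \<Rightarrow> (('a :: {field, finite}) mat \<Rightarrow> complex) \<Rightarrow> 'a xvar mps" where
  "ch n \<chi> =
     (\<Sum>\<mu>\<in>partition_funs Phi n. scalar (\<chi> (SOME g. g \<in> conj_class n \<mu>)) * P_tilde \<mu>)"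

definition induced :: "('g, 'r) monoid_scheme \<Rightarrow> 'g set \<Rightarrow> ('g \<Rightarrow> complex) \<Rightarrow> 'g \<Rightarrow> complex" where
  "induced G H \<chi> g =
     (\<Sum>x\<in>carrier G.
        let y = inv\<^bsub>G\<^esub> x \<otimes>\<^bsub>G\<^esub> g \<otimes>\<^bsub>G\<^esub> x in if y \<in> H then \<chi> y else 0) / of_nat (card H)"

definition mat_trace :: "('k :: field) mat \<Rightarrow> 'k" where
  "mat_trace A = (\<Sum>i<dim_row A. A $$ (i, i))"

text \<open>\<open>\<chi>\<close> is the character of a complex representation; its values outside \<open>G\<close> are irrelevant.\<close>

definition is_character :: "('g, 'r) monoid_scheme \<Rightarrow> ('g \<Rightarrow> complex) \<Rightarrow> bool" where
  "is_character G \<chi> \<longleftrightarrow>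
     (\<exists>m. \<exists>R \<in> hom G (GL m :: complex mat monoid). \<forall>g\<in>carrier G. \<chi> g = mat_trace (R g))"

section \<open>The maps \<open>\<rho>\<close> and \<open>\<rho>\<close>-hat\<close>

definition rho :: "('a :: {field, finite}) xvar mps \<Rightarrow> nat mps" where
  "rho = (SOME F. alg_hom_on Lambda_ring F \<and>
            (\<forall>\<phi>\<in>Theta. \<forall>a. F (in_Y \<phi> (complete_h a)) = complete_pleth a (card \<phi>)))"

definition nontrivial_additive_char :: "('k :: field \<Rightarrow> complex) \<Rightarrow> bool" where
  "nontrivial_additive_char \<psi> \<longleftrightarrow>
     (\<forall>x. \<psi> x \<noteq> 0) \<and> (\<forall>x y. \<psi> (x + y) = \<psi> x * \<psi> y) \<and> (\<exists>x. \<psi> x \<noteq> 1)"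

text \<open>
  Below, \<open>c n i\<close> is the parameter \<open>q_i\<close> chosen for the group $U_n$, with \<open>1 \<le> i < n\<close>. Matrix indices
  start at 0, so that the mathematical entry $u_{i,i+1}$ is \<open>u $$ (i - 1, i)\<close>.
\<close>

definition lin_char ::
    "('k :: field \<Rightarrow> complex) \<Rightarrow> (nat \<Rightarrow> nat \<Rightarrow> 'k) \<Rightarrow> nat \<Rightarrow> 'k mat \<Rightarrow> complex" where
  "lin_char \<psi> c n u = (\<Prod>i\<in>{1..<n}. \<psi> (c n i * u $$ (i - 1, i)))"

definition rho_n ::
    "(('a :: {field, finite}) \<Rightarrow> complex) \<Rightarrow> (nat \<Rightarrow> nat \<Rightarrow> 'a) \<Rightarrow> nat \<Rightarrow> nat mps" where
  "rho_n \<psi> c n = rho (ch n (induced (GL n) (UT n) (lin_char \<psi> c n)))"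

definition rho_hat :: "(('a :: {field, finite}) \<Rightarrow> complex) \<Rightarrow> (nat \<Rightarrow> nat \<Rightarrow> 'a) \<Rightarrow>
    nat mps \<Rightarrow> 'a xvar mps" where
  "rho_hat \<psi> c =
     (SOME R. linear_on_mps sym_fun R \<and>
        (\<forall>n\<ge>1. R (rho_n \<psi> c n) = (\<Sum>\<nu> | \<nu> \<in> partition_funs Theta n \<and> height \<nu> = 1. S_fun \<nu>)) \<and>
        (\<forall>l. is_partition l \<longrightarrow>
           R (prod_list (map (rho_n \<psi> c) l)) = prod_list (map (\<lambda>k. R (rho_n \<psi> c k)) l)))"

end

theory Submission
  imports Defs "HOL-Computational_Algebra.Formal_Power_Series" "Jordan_Normal_Form.Char_Poly"
    "HOL-Algebra.Multiplicative_Group" "HOL-Algebra.Sylow"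
begin

text \<open>
  Everything happens in the one alphabet $X_1$ of the orbit of $1$: an element of $G_n$ that is
  conjugate into $U_n$ is unipotent, so the characteristic of the induced character is $g(X_1)$ for
  a symmetric function $g$.

  Orthogonality of the characters of $M_j$ gives $\sum_{|\varphi| \mid j} |\varphi|\,
  p_{j/|\varphi|}(Y^\varphi) = (-1)^{j-1}(q^j-1)\,p_j(X_1)$. This forces $\rho(p_j(X_1)) =
  (-1)^{j-1} p_j$, so that $\rho(g(X_1)) = \omega(g)$; by Newton's identities it also shows that the
  sum of the $S_\lambda$ of height one is $\Gamma_n(X_1)$, where $\sum_n \Gamma_n u^n = E(qu)/E(u)$.
  On the other hand, the Gelfand-Graev character takes the value $(-1)^n \prod_{j \le l} (1-q^j)$ at
  a unipotent element with $l$ Jordan blocks, and by the Pieri formula these values are the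
  coefficients of $\Gamma_n$ in the Hall-Littlewood basis.

  Hence $\hat\rho(\omega(\Gamma_n)) = \Gamma_n(X_1)$. As the products of the $\Gamma_n$ span all
  symmetric functions, $\hat\rho(\rho(g(X_1))) = \hat\rho(\omega(g)) = g(X_1)$ for all $g$.
\<close>

section \<open>Symmetric functions and power sums\<close>

text \<open>\<open>in_Y\<close>, \<open>rho\<close> and \<open>rho_hat\<close> are Hilbert choices
  and \<open>hall_littlewood\<close> is a definite description, so a witness must precede every
  statement about them. The products of power sums form a basis closed under multiplication, which
  provides homomorphisms with prescribed values. For \<open>rho\<close> the witness is omega after
  setting all variables outside X_1 to zero; for \<open>rho_hat\<close> it is g -> (omega g)(X_1).
  The chosen maps need not be pinned down everywhere: the summed identity for the p_k(Y^phi) fixes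
  \<open>rho\<close> on functions of X_1 because q^j - 1 is nonzero, and linearity fixes
  \<open>rho_hat\<close> on the symmetric functions. Hall-Littlewood functions are obtained by
  solving the Pieri formula for one unknown term, so the same formula gives their existence and the
  expansion of Gamma_n. The Gelfand-Graev values come from a recursion on n that sorts the matrices
  x with x^-1 g x in U_n by their first column. Removing that column leaves a sum twisted by a
  linear functional of the next column, so the induction is run with an arbitrary
  functional.\<close>

lemmas mcoeff_simps [simp] =
  zero_mps.rep_eq one_mps.rep_eq plus_mps.rep_eq minus_mps.rep_eq uminus_mps.rep_eq scalar.rep_eq

lemma mcoeff_sum: "mcoeff (sum f A) m = (\<Sum>x\<in>A. mcoeff (f x) m)"
  by (induction A rule: infinite_finite_induct) auto

lemma mcoeff_mult_support:
  assumes "finite A" "\<And>a. mcoeff f a \<noteq> 0 \<Longrightarrow> a \<subseteq># m \<Longrightarrow> a \<in> A" "\<And>a. a \<in> A \<Longrightarrow> a \<subseteq># m"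
  shows "mcoeff (f * g) m = (\<Sum>a\<in>A. mcoeff f a * mcoeff g (m - a))"
  unfolding times_mps.rep_eq by (rule sum.mono_neutral_right) (use assms in auto)

lemma mcoeff_scalar_mult [simp]: "mcoeff (scalar c * f) m = c * mcoeff f m"
  by (subst mcoeff_mult_support[where A = "{{#}}"]) (auto split: if_splits)

lemma scalar_add: "scalar (a + b) = scalar a + scalar b"
  by (rule mps_eqI) simp

lemma scalar_mult: "scalar (a * b) = scalar a * scalar b"
  by (rule mps_eqI) simp

lemma scalar_0 [simp]: "scalar 0 = 0" and scalar_1 [simp]: "scalar 1 = 1"
  by (rule mps_eqI, simp)+

lemma scalar_minus: "scalar (- a) = - scalar a"
  by (rule mps_eqI) simp

lemma scalar_diff: "scalar (a - b) = scalar a - scalar b"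
  by (rule mps_eqI) simp

lemma scalar_power: "scalar (a ^ n) = scalar a ^ n"
  by (induction n) (auto simp: scalar_mult)

lemma scalar_of_nat: "scalar (of_nat n) = of_nat n"
  by (induction n) (auto simp: scalar_add)

lemma scalar_of_int: "scalar (of_int n) = of_int n"
  by (cases n rule: int_diff_cases) (simp add: scalar_diff scalar_of_nat)

lemma scalar_sum: "scalar (sum f A) = (\<Sum>x\<in>A. scalar (f x))"
  by (induction A rule: infinite_finite_induct) (auto simp: scalar_add)

lemma scalar_cancel: "c \<noteq> 0 \<Longrightarrow> scalar c * f = scalar c * g \<longleftrightarrow> f = g"
  by (metis mult.assoc mult.left_neutral scalar_1 scalar_mult field_class.field_inverse)

lemma scalar_neg1: "(-1 :: 'v mps) ^ n = scalar ((-1) ^ n)"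
  by (simp add: scalar_power scalar_minus)

lemma linear_on_mpsD:
  assumes "linear_on_mps A F"
  shows "f \<in> A \<Longrightarrow> g \<in> A \<Longrightarrow> F (f + g) = F f + F g" "f \<in> A \<Longrightarrow> F (scalar c * f) = scalar c * F f"
  using assms by (auto simp: linear_on_mps_def)

lemma alg_hom_onD:
  assumes "alg_hom_on A F"
  shows "f \<in> A \<Longrightarrow> g \<in> A \<Longrightarrow> F (f + g) = F f + F g" "f \<in> A \<Longrightarrow> F (scalar c * f) = scalar c * F f"
    "f \<in> A \<Longrightarrow> g \<in> A \<Longrightarrow> F (f * g) = F f * F g" "F 1 = 1"
  using assms by (auto simp: alg_hom_on_def linear_on_mps_def)

lemma alg_hom_on_scalar: "alg_hom_on A F \<Longrightarrow> 1 \<in> A \<Longrightarrow> F (scalar c) = scalar c"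
  using alg_hom_onD(2)[of A F 1 c] by (simp add: alg_hom_onD(4))

subsection \<open>The algebra of symmetric functions\<close>

lemma sym_funI:
  assumes "\<And>m. mcoeff f m \<noteq> 0 \<Longrightarrow> size m \<le> d"
    and "\<And>\<sigma> m. bij \<sigma> \<Longrightarrow> mcoeff f (image_mset \<sigma> m) = mcoeff f m"
  shows "f \<in> sym_fun"
  using assms by (auto simp: sym_fun_def)

lemma sym_funD: "f \<in> sym_fun \<Longrightarrow> bij \<sigma> \<Longrightarrow> mcoeff f (image_mset \<sigma> m) = mcoeff f m"
  by (auto simp: sym_fun_def)

lemma scalar_sym_fun [simp, intro]: "scalar c \<in> sym_fun"
  by (rule sym_funI[of _ 0]) (auto split: if_splits)

lemma one_sym_fun [simp, intro]: "1 \<in> sym_fun"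
  using scalar_sym_fun[of 1] by simp

lemma zero_sym_fun [simp, intro]: "0 \<in> sym_fun"
  using scalar_sym_fun[of 0] by simp

lemma add_sym_fun [intro]:
  assumes "f \<in> sym_fun" "g \<in> sym_fun"
  shows "f + g \<in> sym_fun"
proof -
  from assms obtain d d' where "\<And>m. mcoeff f m \<noteq> 0 \<Longrightarrow> size m \<le> d" "\<And>m. mcoeff g m \<noteq> 0 \<Longrightarrow> size m \<le> d'"
    by (auto simp: sym_fun_def)
  hence "mcoeff (f + g) m \<noteq> 0 \<Longrightarrow> size m \<le> max d d'" for m
    by (metis add.left_neutral max.coboundedI1 max.coboundedI2 plus_mps.rep_eq)
  thus ?thesis using assms by (intro sym_funI[of _ "max d d'"]) (auto simp: sym_funD)
qed

lemma image_mset_subset_inv: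
  assumes "a \<subseteq># image_mset \<sigma> m"
  shows "\<exists>b. b \<subseteq># m \<and> a = image_mset \<sigma> b"
proof -
  obtain c where "image_mset \<sigma> m = a + c" using assms by (metis subset_mset.add_diff_inverse)
  then obtain b b' where "m = b + b'" "a = image_mset \<sigma> b" by (metis image_mset_eq_plusD)
  thus ?thesis by (intro exI[of _ b]) simp
qed

lemma mult_sym_fun [intro]:
  assumes f: "f \<in> sym_fun" and g: "g \<in> sym_fun"
  shows "f * g \<in> sym_fun"
proof -
  from assms obtain d d' where d: "\<And>m. mcoeff f m \<noteq> 0 \<Longrightarrow> size m \<le> d" "\<And>m. mcoeff g m \<noteq> 0 \<Longrightarrow> size m \<le> d'"
    by (auto simp: sym_fun_def)
  show ?thesis
  proof (rule sym_funI[of _ "d + d'"])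
    fix m assume "mcoeff (f * g) m \<noteq> 0"
    then obtain a where "a \<subseteq># m" "mcoeff f a * mcoeff g (m - a) \<noteq> 0"
      unfolding times_mps.rep_eq by (metis (no_types, lifting) mem_Collect_eq sum.neutral)
    with d[of a] d(2)[of "m - a"] show "size m \<le> d + d'"
      by (metis add_le_mono mult_eq_0_iff size_union subset_mset.add_diff_inverse d(1))
  next
    fix \<sigma> :: "nat \<Rightarrow> nat" and m assume s: "bij \<sigma>"
    hence i: "image_mset \<sigma> a = image_mset \<sigma> b \<longleftrightarrow> a = b" for a b
      by (meson bij_is_inj inj_eq multiset.inj_map)
    show "mcoeff (f * g) (image_mset \<sigma> m) = mcoeff (f * g) m"
      unfolding times_mps.rep_eq
    proof (rule sum.reindex_cong[of "image_mset \<sigma>"])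
      show "inj_on (image_mset \<sigma>) {a. a \<subseteq># m}" using i by (auto intro: inj_onI)
      show "{a. a \<subseteq># image_mset \<sigma> m} = image_mset \<sigma> ` {a. a \<subseteq># m}"
        by (auto dest: image_mset_subset_inv intro: image_mset_subseteq_mono)
      fix a assume "a \<in> {a. a \<subseteq># m}"
      thus "mcoeff f (image_mset \<sigma> a) * mcoeff g (image_mset \<sigma> m - image_mset \<sigma> a) = mcoeff f a * mcoeff g (m - a)"
        using s by (simp add: sym_funD[OF f] sym_funD[OF g] flip: image_mset_Diff)
    qed
  qed
qed

lemma uminus_sym_fun [intro]: "f \<in> sym_fun \<Longrightarrow> - f \<in> sym_fun"
  using mult_sym_fun[OF scalar_sym_fun[of "-1"], of f] by (simp add: scalar_minus)

lemma diff_sym_fun [intro]: "f \<in> sym_fun \<Longrightarrow> g \<in> sym_fun \<Longrightarrow> f - g \<in> sym_fun"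
  using add_sym_fun[of f "- g"] by auto

lemma sum_sym_fun [intro]: "(\<And>x. x \<in> A \<Longrightarrow> f x \<in> sym_fun) \<Longrightarrow> sum f A \<in> sym_fun"
  by (induction A rule: infinite_finite_induct) auto

lemma power_sum_sym_fun [simp, intro]: "power_sum k \<in> sym_fun"
proof (rule sym_funI[of _ k])
  fix \<sigma> :: "nat \<Rightarrow> nat" and m assume "bij \<sigma>"
  hence "(\<exists>i. image_mset \<sigma> m = replicate_mset k i) \<longleftrightarrow> (\<exists>i. m = replicate_mset k i)"
    by (metis (no_types) bij_pointE image_replicate_mset inj_eq multiset.inj_map bij_is_inj)
  thus "mcoeff (power_sum k) (image_mset \<sigma> m) = mcoeff (power_sum k) m"
    by (simp add: power_sum.rep_eq)
qed (auto simp: power_sum.rep_eq split: if_splits)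

section \<open>Monomials up to permutation of the variables\<close>

definition shape :: "'v multiset \<Rightarrow> nat multiset" where
  "shape m = image_mset (count m) (mset_set (set_mset m))"

lemma zero_notin_shape [simp]: "0 \<notin># shape m"
  by (auto simp: shape_def count_eq_zero_iff)

lemma size_shape: "size (shape m) = card (set_mset m)"
  by (simp add: shape_def)

lemma sum_shape: "sum_mset (shape m) = size m"
  by (simp add: shape_def size_multiset_overloaded_eq sum_unfold_sum_mset)

lemma count_image_mset_inj: "inj f \<Longrightarrow> count (image_mset f m) (f x) = count m x"
  by (induction m) (auto simp: inj_eq)

lemma count_image_mset_set: "finite A \<Longrightarrow> count (image_mset f (mset_set A)) c = card {x \<in> A. f x = c}"
proof (induction A rule: finite_induct)
  case (insert a A)
  have "{x \<in> insert a A. f x = c} = (if f a = c then insert a {x \<in> A. f x = c} else {x \<in> A. f x = c})" by auto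
  thus ?case using insert by auto
qed simp

text \<open>Equality of the two label multisets says that corresponding fibres have the same size; a
  bijection is chosen for every label and these are glued.\<close>

lemma fiber_bij:
  assumes "finite A" "finite B" "image_mset f (mset_set A) = image_mset g (mset_set B)"
  shows "\<exists>h. bij_betw h A B \<and> (\<forall>x\<in>A. g (h x) = f x)"
proof -
  have "card {x \<in> A. f x = c} = card {y \<in> B. g y = c}" for c
    using arg_cong[OF assms(3), of "\<lambda>M. count M c"] assms(1,2) by (simp add: count_image_mset_set)
  hence "\<forall>c. \<exists>h. bij_betw h {x \<in> A. f x = c} {y \<in> B. g y = c}"
    using assms(1,2) by (intro allI finite_same_card_bij) auto
  then obtain h where h: "\<And>c. bij_betw (h c) {x \<in> A. f x = c} {y \<in> B. g y = c}" by metis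
  have "bij_betw (\<lambda>x. h (f x) x) A B"
  proof (rule bij_betw_imageI)
    show "inj_on (\<lambda>x. h (f x) x) A"
    proof
      fix x y assume xy: "x \<in> A" "y \<in> A" "h (f x) x = h (f y) y"
      have "g (h (f x) x) = f x" "g (h (f y) y) = f y" using bij_betwE[OF h] xy by blast+
      hence "f x = f y" using xy by simp
      thus "x = y" using h[of "f x"] xy by (auto simp: bij_betw_def inj_on_def)
    qed
    show "(\<lambda>x. h (f x) x) ` A = B"
    proof safe
      fix x assume "x \<in> A" thus "h (f x) x \<in> B" using bij_betwE[OF h[of "f x"]] by auto
    next
      fix y assume "y \<in> B"
      hence "y \<in> h (g y) ` {x \<in> A. f x = g y}"
        unfolding bij_betw_imp_surj_on[OF h[of "g y"]] by simp
      then obtain x where "x \<in> A" "f x = g y" "h (g y) x = y" by auto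
      have "y = h (f x) x" using \<open>f x = g y\<close> \<open>h (g y) x = y\<close> by simp
      thus "y \<in> (\<lambda>x. h (f x) x) ` A" using \<open>x \<in> A\<close> by (rule image_eqI)
    qed
  qed
  moreover have "\<forall>x\<in>A. g (h (f x) x) = f x" using bij_betwE[OF h] by auto
  ultimately show ?thesis by blast
qed

text \<open>The complements are infinite sets of naturals, so their enumerations match them up. The
  extension is needed because symmetry in \<open>sym_fun\<close> refers to bijections of all
  variables.\<close>

lemma bij_betw_extend_nat:
  fixes A B :: "nat set"
  assumes "finite A" "finite B" "bij_betw h A B"
  shows "\<exists>\<sigma>. bij \<sigma> \<and> (\<forall>x\<in>A. \<sigma> x = h x)"
proof -
  have "bij_betw (enumerate (- A)) UNIV (- A)" "bij_betw (enumerate (- B)) UNIV (- B)"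
    using assms by (auto intro!: bij_enumerate)
  then obtain e where e: "bij_betw e (- A) (- B)" using bij_betw_inv bij_betw_trans by blast
  let ?s = "\<lambda>x. if x \<in> A then h x else e x"
  have "bij_betw ?s A B" using assms(3) by (rule bij_betw_cong[THEN iffD1, rotated]) auto
  moreover have "bij_betw ?s (- A) (- B)" using e by (rule bij_betw_cong[THEN iffD1, rotated]) auto
  ultimately have "bij_betw ?s (A \<union> - A) (B \<union> - B)" by (rule bij_betw_combine) auto
  thus ?thesis by (intro exI[of _ ?s]) auto
qed

text \<open>Exponents serve as labels in \<open>fiber_bij\<close>: variables of equal exponent are
  matched, and the bijection of supports is extended. Hence a symmetric function is determined by
  one coefficient per shape.\<close>

lemma shape_eq_imp_bij:
  fixes m m' :: "nat multiset"
  assumes "shape m = shape m'"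
  shows "\<exists>\<sigma>. bij \<sigma> \<and> image_mset \<sigma> m = m'"
proof -
  obtain h where h: "bij_betw h (set_mset m) (set_mset m')" "\<forall>x\<in>set_mset m. count m' (h x) = count m x"
    using fiber_bij[of "set_mset m" "set_mset m'" "count m" "count m'"] assms by (auto simp: shape_def)
  obtain \<sigma> where s: "bij \<sigma>" "\<forall>x\<in>set_mset m. \<sigma> x = h x" using bij_betw_extend_nat[OF _ _ h(1)] by auto
  have "count (image_mset \<sigma> m) y = count m' y" for y
  proof -
    obtain x where y: "y = \<sigma> x" using s(1) by (metis bij_pointE)
    have c: "count (image_mset \<sigma> m) y = count m x"
      unfolding y using s(1) by (simp add: bij_is_inj count_image_mset_inj)
    show ?thesis
    proof (cases "x \<in># m")
      case True thus ?thesis using c h s y by auto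
    next
      case False
      have "y \<notin># m'"
      proof
        assume "y \<in># m'"
        then obtain x' where "x' \<in># m" "y = \<sigma> x'" using h(1) s(2) by (auto simp: bij_betw_def image_iff)
        thus False using False y s(1) by (metis bij_is_inj injD)
      qed
      thus ?thesis using c False by (simp add: not_in_iff)
    qed
  qed
  thus ?thesis using s(1) by (metis multiset_eqI)
qed

lemma shape_image:
  assumes "inj \<sigma>" shows "shape (image_mset \<sigma> m) = shape m"
proof -
  have "mset_set (\<sigma> ` set_mset m) = image_mset \<sigma> (mset_set (set_mset m))"
    using assms by (simp add: image_mset_mset_set inj_on_subset)
  thus ?thesis using assms by (simp add: shape_def count_image_mset_inj multiset.map_comp comp_def)
qed

lemma sym_fun_shape: "f \<in> sym_fun \<Longrightarrow> shape m = shape m' \<Longrightarrow> mcoeff f m = mcoeff f m'"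
  by (metis shape_eq_imp_bij sym_funD)

lemma shape_add_fresh:
  assumes "i \<notin># m" "k \<ge> 1"
  shows "shape (m + replicate_mset k i) = add_mset k (shape m)"
proof -
  have "set_mset (m + replicate_mset k i) = insert i (set_mset m)" using assms by auto
  moreover have "image_mset (count (m + replicate_mset k i)) (mset_set (set_mset m)) = shape m"
    unfolding shape_def using assms by (intro image_mset_cong) auto
  ultimately show ?thesis using assms by (simp add: shape_def not_in_iff)
qed

lemma shape_surj:
  assumes "0 \<notin># s" shows "\<exists>m :: nat multiset. shape m = s"
  using assms
proof (induction s)
  case empty show ?case by (intro exI[of _ "{#}"]) (simp add: shape_def)
next
  case (add k s)
  then obtain m :: "nat multiset" where m: "shape m = s" by auto
  obtain i where "i \<notin># m" using ex_new_if_finite[OF infinite_UNIV_nat, of "set_mset m"] by auto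
  hence "shape (m + replicate_mset k i) = add_mset k s" using add m by (intro trans[OF shape_add_fresh]) auto
  thus ?case by blast
qed

section \<open>Products of power sums as a basis of the symmetric functions\<close>

lift_definition monomial_sym :: "nat multiset \<Rightarrow> nat mps" is "\<lambda>s m. if shape m = s then 1 else 0" .

definition psum :: "nat multiset \<Rightarrow> nat mps" where "psum s = prod_mset (image_mset power_sum s)"

lemma psum_simps [simp]: "psum {#} = 1" "psum (add_mset k s) = power_sum k * psum s"
  "psum (s + s') = psum s * psum s'"
  by (auto simp: psum_def)

lemma psum_sym_fun [simp, intro]: "psum s \<in> sym_fun"
  by (induction s) auto

lemma monomial_sym_sym_fun [simp, intro]: "monomial_sym s \<in> sym_fun"
  by (rule sym_funI[of _ "sum_mset s"])
     (auto simp: monomial_sym.rep_eq shape_image bij_is_inj sum_shape split: if_splits)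

text \<open>For k = 0 the monomials \<open>replicate_mset k i\<close> would all coincide and the
  index set on the right would be infinite; hence the hypothesis.\<close>

lemma mcoeff_power_sum_mult:
  assumes "k \<ge> 1"
  shows "mcoeff (power_sum k * g) m = (\<Sum>i | k \<le> count m i. mcoeff g (m - replicate_mset k i))"
proof -
  have fin: "finite {i. k \<le> count m i}"
    by (rule finite_subset[of _ "set_mset m"]) (use assms in \<open>auto simp flip: count_greater_zero_iff\<close>)
  have "mcoeff (power_sum k * g) m = (\<Sum>a\<in>replicate_mset k ` {i. k \<le> count m i}. mcoeff (power_sum k) a * mcoeff g (m - a))"
    by (rule mcoeff_mult_support)
       (use fin in \<open>auto simp: power_sum.rep_eq count_le_replicate_mset_subset_eq split: if_splits\<close>)
  also have "\<dots> = (\<Sum>i | k \<le> count m i. mcoeff g (m - replicate_mset k i))"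
  proof (rule sum.reindex_cong[of "replicate_mset k"])
    show "inj_on (replicate_mset k) {i. k \<le> count m i}"
      using assms by (intro inj_onI) (metis in_replicate_mset not_one_le_zero neq0_conv)
    fix i
    have "mcoeff (power_sum k) (replicate_mset k i) = 1" by (auto simp: power_sum.rep_eq)
    thus "mcoeff (power_sum k) (replicate_mset k i) * mcoeff g (m - replicate_mset k i) =
      mcoeff g (m - replicate_mset k i)" by simp
  qed simp
  finally show ?thesis .
qed

lemma finite_shapes: "finite {s :: nat multiset. 0 \<notin># s \<and> sum_mset s \<le> d}"
proof (rule finite_subset)
  show "{s :: nat multiset. 0 \<notin># s \<and> sum_mset s \<le> d} \<subseteq> mset ` {xs. set xs \<subseteq> {0..d} \<and> length xs \<le> d}"
  proof
    fix s :: "nat multiset" assume s: "s \<in> {s. 0 \<notin># s \<and> sum_mset s \<le> d}"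
    obtain xs where xs: "s = mset xs" by (metis ex_mset)
    have "size s \<le> sum_mset s" if "0 \<notin># s" for s :: "nat multiset"
      using that by (induction s) auto
    moreover have "set xs \<subseteq> {0..d}"
      using s xs by (auto dest: member_le_sum_list simp: sum_mset_sum_list)
    ultimately have "length xs \<le> d" "set xs \<subseteq> {0..d}" using s xs by (metis (no_types, lifting) le_trans mem_Collect_eq size_mset, simp)
    thus "s \<in> mset ` {xs. set xs \<subseteq> {0..d} \<and> length xs \<le> d}" using xs by blast
  qed
qed (simp add: finite_lists_length_le)

lemma mcoeff_psum_nonneg: "0 \<notin># s \<Longrightarrow> Re (mcoeff (psum s) m) \<ge> 0"
  by (induction s arbitrary: m) (auto simp: mcoeff_power_sum_mult Suc_le_eq intro!: sum_nonneg)

text \<open>All coefficients are nonnegative, so nothing cancels and one positive contribution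
  suffices: peel off a variable whose exponent is exactly k.\<close>

lemma mcoeff_psum_pos: "0 \<notin># s \<Longrightarrow> shape m = s \<Longrightarrow> Re (mcoeff (psum s) m) > 0"
proof (induction s arbitrary: m)
  case empty
  hence "m = {#}" by (simp add: shape_def mset_set_empty_iff)
  thus ?case by simp
next
  case (add k s)
  have k: "k \<ge> 1" using add.prems by auto
  have "k \<in># shape m" using add.prems by simp
  then obtain i where i: "count m i = k" "i \<in># m" by (auto simp: shape_def)
  let ?m = "m - replicate_mset k i"
  have "replicate_mset k i \<subseteq># m" using i by (simp flip: count_le_replicate_mset_subset_eq)
  hence "m = ?m + replicate_mset k i" by simp
  moreover have ni: "i \<notin># ?m" using i by (simp add: not_in_iff)
  ultimately have "shape ?m = s" using shape_add_fresh[OF ni k] add.prems by simp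
  hence pos: "Re (mcoeff (psum s) ?m) > 0" using add by auto
  have fin: "finite {i. k \<le> count m i}"
    by (rule finite_subset[of _ "set_mset m"]) (use k in \<open>auto simp flip: count_greater_zero_iff\<close>)
  show ?case
    unfolding psum_simps mcoeff_power_sum_mult[OF k] Re_sum
    by (rule sum_pos2[OF fin, of i]) (use i pos add.prems in \<open>auto intro: mcoeff_psum_nonneg\<close>)
qed

text \<open>Multiplication by p_k either raises the exponent of a variable already present or brings
  in one new variable with exponent k. So \<open>psum s\<close> is triangular with respect to the
  monomial symmetric functions, ordered by the number of parts.\<close>

lemma mcoeff_psum_nonzeroD:
  assumes "0 \<notin># s" "mcoeff (psum s) m \<noteq> 0"
  shows "size (shape m) \<le> size s \<and> (size (shape m) = size s \<longrightarrow> shape m = s)"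
  using assms
proof (induction s arbitrary: m)
  case empty thus ?case by (auto simp: shape_def split: if_splits)
next
  case (add k s)
  have k: "k \<ge> 1" using add.prems by auto
  from add.prems obtain i where i: "k \<le> count m i" "mcoeff (psum s) (m - replicate_mset k i) \<noteq> 0"
    unfolding psum_simps mcoeff_power_sum_mult[OF k] by (metis (mono_tags, lifting) mem_Collect_eq sum.neutral)
  let ?m = "m - replicate_mset k i"
  have "replicate_mset k i \<subseteq># m" using i by (simp flip: count_le_replicate_mset_subset_eq)
  hence m: "m = ?m + replicate_mset k i" by simp
  have IH: "size (shape ?m) \<le> size s \<and> (size (shape ?m) = size s \<longrightarrow> shape ?m = s)"
    using add i(2) by auto
  show ?case
  proof (cases "i \<in># ?m")
    case True
    hence "set_mset (?m + replicate_mset k i) = set_mset ?m" using k by auto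
    hence "set_mset m = set_mset ?m" unfolding m[symmetric] .
    thus ?thesis using IH by (simp add: size_shape)
  next
    case False
    thus ?thesis using IH shape_add_fresh[OF False k] m by auto
  qed
qed

global_interpretation mps: vector_space "\<lambda>c (f :: 'v mps). scalar c * f"
  by unfold_locales (auto simp: algebra_simps scalar_add scalar_mult)

global_interpretation mps_pair: vector_space_pair
    "\<lambda>c (f :: 'v mps). scalar c * f" "\<lambda>c (f :: 'w mps). scalar c * f"
  by unfold_locales

lemma sym_fun_expand:
  assumes "f \<in> sym_fun" "\<And>m. mcoeff f m \<noteq> 0 \<Longrightarrow> size m \<le> d"
  shows "f = (\<Sum>s | 0 \<notin># s \<and> sum_mset s \<le> d. scalar (mcoeff f (SOME m. shape m = s)) * monomial_sym s)"
proof (rule mps_eqI)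
  fix m
  have "mcoeff (\<Sum>s | 0 \<notin># s \<and> sum_mset s \<le> d. scalar (mcoeff f (SOME m. shape m = s)) * monomial_sym s) m
     = (\<Sum>s | 0 \<notin># s \<and> sum_mset s \<le> d. if shape m = s then mcoeff f (SOME m. shape m = s) else 0)"
    unfolding mcoeff_sum by (rule sum.cong) (auto simp: monomial_sym.rep_eq)
  also have "\<dots> = (if size m \<le> d then mcoeff f (SOME m'. shape m' = shape m) else 0)"
    using finite_shapes[of d] by (simp add: sum_shape)
  also have "\<dots> = mcoeff f m"
  proof (cases "size m \<le> d")
    case True
    have "shape (SOME m' :: nat multiset. shape m' = shape m) = shape m" by (rule someI_ex) blast
    hence "mcoeff f (SOME m'. shape m' = shape m) = mcoeff f m" by (rule sym_fun_shape[OF assms(1)])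
    thus ?thesis using True by simp
  qed (use assms(2) in auto)
  finally show "mcoeff f m = mcoeff (\<Sum>s | 0 \<notin># s \<and> sum_mset s \<le> d. scalar (mcoeff f (SOME m. shape m = s)) * monomial_sym s) m" ..
qed

lemma size_psum_support: "mcoeff (psum s) m \<noteq> 0 \<Longrightarrow> 0 \<notin># s \<Longrightarrow> size m = sum_mset s"
proof (induction s arbitrary: m)
  case (add k s)
  have k: "k \<ge> 1" using add.prems by auto
  from add.prems obtain i where i: "k \<le> count m i" "mcoeff (psum s) (m - replicate_mset k i) \<noteq> 0"
    unfolding psum_simps mcoeff_power_sum_mult[OF k] by (metis (mono_tags, lifting) mem_Collect_eq sum.neutral)
  have "size (m - replicate_mset k i) = sum_mset s" using add i by auto
  moreover have "replicate_mset k i \<subseteq># m" using i by (simp add: count_le_replicate_mset_subset_eq)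
  ultimately show ?case by (simp add: size_Diff_submset) (metis add.commute size_mset_mono size_replicate_mset le_add_diff_inverse)
qed (auto split: if_splits)

text \<open>Solves the triangular system for its leading term, whose coefficient is nonzero by
  \<open>mcoeff_psum_pos\<close>; the remaining terms have fewer parts and are covered by the
  induction.\<close>

lemma monomial_sym_in_span: "0 \<notin># s \<Longrightarrow> monomial_sym s \<in> mps.span (psum ` {s. 0 \<notin># s})"
proof (induction "size s" arbitrary: s rule: less_induct)
  case less
  let ?S = "{s'. 0 \<notin># s' \<and> sum_mset s' \<le> sum_mset s}"
  let ?c = "\<lambda>s'. mcoeff (psum s) (SOME m. shape m = s')"
  let ?V = "mps.span (psum ` {s. 0 \<notin># s})"
  have some: "shape (SOME m :: nat multiset. shape m = s') = s'" if "0 \<notin># s'" for s'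
    using someI_ex[OF shape_surj[OF that]] .
  have "psum s = (\<Sum>s'\<in>?S. scalar (?c s') * monomial_sym s')"
    using less.prems by (intro sym_fun_expand) (auto dest: size_psum_support)
  also have "\<dots> = scalar (?c s) * monomial_sym s + (\<Sum>s'\<in>?S - {s}. scalar (?c s') * monomial_sym s')"
    using less.prems by (intro sum.remove finite_shapes) auto
  finally have "scalar (?c s) * monomial_sym s = psum s - (\<Sum>s'\<in>?S - {s}. scalar (?c s') * monomial_sym s')"
    by (rule eq_diff_eq[THEN iffD2, OF sym])
  moreover have "scalar (?c s') * monomial_sym s' \<in> ?V" if "s' \<in> ?S - {s}" for s'
  proof (cases "?c s' = 0")
    case False
    from mcoeff_psum_nonzeroD[OF less.prems this] some[of s'] that have "size s' < size s" by auto
    thus ?thesis using less.hyps that by (auto intro: mps.span_scale)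
  qed (simp add: mps.span_zero)
  ultimately have "scalar (?c s) * monomial_sym s \<in> ?V"
    using less.prems by (auto intro!: mps.span_diff mps.span_sum intro: mps.span_base)
  hence "scalar (inverse (?c s)) * (scalar (?c s) * monomial_sym s) \<in> ?V" by (rule mps.span_scale)
  moreover have "?c s \<noteq> 0" using mcoeff_psum_pos[OF less.prems some[OF less.prems]] by force
  ultimately show ?case by (simp flip: mult.assoc scalar_mult)
qed

lemma span_psum: "mps.span (psum ` {s. 0 \<notin># s}) = sym_fun"
proof
  have "mps.subspace sym_fun" by (auto simp: mps.subspace_def)
  thus "mps.span (psum ` {s. 0 \<notin># s}) \<subseteq> sym_fun" by (intro mps.span_minimal) auto
  show "sym_fun \<subseteq> mps.span (psum ` {s. 0 \<notin># s})"
  proof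
    fix f assume f: "f \<in> sym_fun"
    then obtain d where "\<And>m. mcoeff f m \<noteq> 0 \<Longrightarrow> size m \<le> d" by (auto simp: sym_fun_def)
    from sym_fun_expand[OF f this] show "f \<in> mps.span (psum ` {s. 0 \<notin># s})"
      by (rule ssubst) (auto intro!: mps.span_sum mps.span_scale monomial_sym_in_span)
  qed
qed

lemma sym_fun_induct [consumes 1, case_names scalar power_sum add mult]:
  assumes "f \<in> sym_fun"
    and "\<And>c. P (scalar c)" "\<And>k. k \<ge> 1 \<Longrightarrow> P (power_sum k)"
    and "\<And>f g. f \<in> sym_fun \<Longrightarrow> g \<in> sym_fun \<Longrightarrow> P f \<Longrightarrow> P g \<Longrightarrow> P (f + g)"
    and "\<And>f g. f \<in> sym_fun \<Longrightarrow> g \<in> sym_fun \<Longrightarrow> P f \<Longrightarrow> P g \<Longrightarrow> P (f * g)"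
  shows "P f"
proof -
  have ps: "P (psum s)" if "0 \<notin># s" for s
    using that
  proof (induction s)
    case empty show ?case using assms(2)[of 1] by simp
  next
    case (add k s) thus ?case by (auto intro!: assms(3,5))
  qed
  have "f \<in> mps.span (psum ` {s. 0 \<notin># s})" using assms(1) span_psum by simp
  hence "f \<in> sym_fun \<and> P f"
  proof (induction rule: mps.span_induct_alt)
    case base show ?case using assms(2)[of 0] by simp
  next
    case (step c x y) thus ?case using assms(2)[of c] by (auto intro!: assms(4,5) ps)
  qed
  thus ?thesis ..
qed

text \<open>Among the terms with nonzero coefficient take one with the most parts, of shape s'. By
  triangularity no other term contributes to a monomial of shape s'.\<close>

lemma psum_lin_indep:
  assumes "finite T" "\<And>s. s \<in> T \<Longrightarrow> 0 \<notin># s" "(\<Sum>s\<in>T. scalar (c s) * psum s) = 0" "s \<in> T"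
  shows "c s = 0"
proof (rule ccontr)
  assume "c s \<noteq> 0"
  let ?T = "{s \<in> T. c s \<noteq> 0}"
  have T: "finite ?T" "?T \<noteq> {}" using assms \<open>c s \<noteq> 0\<close> by auto
  obtain s' where s': "s' \<in> ?T" "size s' = Max (size ` ?T)"
    using Max_in[of "size ` ?T"] T by fastforce
  hence max: "size s'' \<le> size s'" if "s'' \<in> ?T" for s'' using that T by simp
  obtain m :: "nat multiset" where m: "shape m = s'" using shape_surj assms(2) s' by blast
  have "0 = mcoeff (\<Sum>s\<in>T. scalar (c s) * psum s) m" using assms(3) by simp
  also have "\<dots> = (\<Sum>s\<in>T. c s * mcoeff (psum s) m)" by (simp add: mcoeff_sum)
  also have "\<dots> = (\<Sum>s\<in>{s'}. c s * mcoeff (psum s) m)"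
  proof (rule sum.mono_neutral_right)
    show "\<forall>i\<in>T - {s'}. c i * mcoeff (psum i) m = 0"
      using max mcoeff_psum_nonzeroD[OF assms(2), of _ m] m by fastforce
  qed (use assms s' in auto)
  finally have "mcoeff (psum s') m = 0" using s' by simp
  thus False using mcoeff_psum_pos[OF assms(2) m] s' by auto
qed

lemma inj_on_psum: "inj_on psum {s. 0 \<notin># s}"
proof (rule inj_onI, rule ccontr)
  fix s s' assume a: "s \<in> {s. 0 \<notin># s}" "s' \<in> {s. 0 \<notin># s}" "psum s = psum s'" "s \<noteq> s'"
  have "(if s = s then 1 else -1 :: complex) = 0"
    by (rule psum_lin_indep[of "{s, s'}" "\<lambda>x. if x = s then 1 else -1"])
       (use a in \<open>auto simp: scalar_minus\<close>)
  thus False by simp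
qed

lemma independent_psum: "mps.independent (psum ` {s. 0 \<notin># s})"
proof
  assume "mps.dependent (psum ` {s. 0 \<notin># s})"
  then obtain S u v where S: "finite S" "S \<subseteq> psum ` {s. 0 \<notin># s}" "(\<Sum>v\<in>S. scalar (u v) * v) = 0" "v \<in> S" "u v \<noteq> 0"
    unfolding mps.dependent_explicit by auto
  then obtain T where T: "T \<subseteq> {s. 0 \<notin># s}" "S = psum ` T" by (meson subset_imageE)
  have inj: "inj_on psum T" using inj_on_psum T(1) inj_on_subset by blast
  obtain s where s: "s \<in> T" "v = psum s" using S T by auto
  have "u (psum s) = 0"
    by (rule psum_lin_indep[of T "\<lambda>s. u (psum s)"])
       (use S T s inj in \<open>auto simp: sum.reindex finite_image_iff\<close>)
  thus False using S s by simp
qed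

lemma alg_hom_on_mult_span:
  assumes "\<And>x y. F (x + y) = F x + F y" "\<And>c x. F (scalar c * x) = scalar c * F x"
    and "\<And>x y. x \<in> B \<Longrightarrow> y \<in> B \<Longrightarrow> F (x * y) = F x * F y"
    and "x \<in> mps.span B" "y \<in> mps.span B"
  shows "F (x * y) = F x * F y"
proof -
  have F0: "F 0 = 0" using assms(2)[of 0 0] by simp
  have "F (x * y) = F x * F y" if "x \<in> B" for x
    using assms(5)
  proof (induction rule: mps.span_induct_alt)
    case (step c z y)
    have "F (x * (scalar c * z + y)) = F (scalar c * (x * z) + x * y)" by (simp add: algebra_simps)
    moreover have "F (x * z) = F x * F z" by (rule assms(3)) fact+
    ultimately show ?case using step(2) by (simp only: assms(1,2) distrib_left mult.left_commute[of "F x"])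
  qed (simp add: F0)
  with assms(4) show ?thesis
  proof (induction rule: mps.span_induct_alt)
    case (step c z x)
    have "F ((scalar c * z + x) * y) = F (scalar c * (z * y) + x * y)" by (simp add: algebra_simps)
    thus ?case using step assms(1,2) by (simp add: distrib_right mult.assoc)
  qed (simp add: F0)
qed

text \<open>A linear map may be prescribed on the basis of the \<open>psum s\<close>. This basis is
  closed under multiplication, with \<open>psum s * psum s' = psum (s + s')\<close>, so prescribing
  products of the given values makes the map multiplicative.\<close>

theorem alg_hom_exists:
  fixes v :: "nat \<Rightarrow> 'w mps"
  shows "\<exists>F. alg_hom_on sym_fun F \<and> (\<forall>k\<ge>1. F (power_sum k) = v k)"
proof -
  let ?B = "psum ` {s. 0 \<notin># s}"
  let ?g = "\<lambda>b. prod_mset (image_mset v (inv_into {s. 0 \<notin># s} psum b))"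
  let ?F = "mps_pair.construct ?B ?g"
  have lin: "?F (x + y) = ?F x + ?F y" "?F (scalar c * x) = scalar c * ?F x" for x y c
    using mps_pair.linear_add[OF mps_pair.linear_construct[OF independent_psum, of ?g]]
      mps_pair.linear_scale[OF mps_pair.linear_construct[OF independent_psum, of ?g]] by blast+
  have b: "?F (psum s) = prod_mset (image_mset v s)" if "0 \<notin># s" for s
    by (simp add: mps_pair.construct_basis independent_psum that inj_on_psum inv_into_f_f)
  have "alg_hom_on sym_fun ?F"
    unfolding alg_hom_on_def linear_on_mps_def
  proof (intro conjI ballI allI)
    show "?F 1 = 1" using b[of "{#}"] by simp
    fix f g assume "f \<in> sym_fun" "g \<in> sym_fun"
    thus "?F (f * g) = ?F f * ?F g"
      unfolding span_psum[symmetric]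
    proof (rule alg_hom_on_mult_span[OF lin, rotated -2])
      fix x y assume "x \<in> ?B" "y \<in> ?B"
      then obtain s s' where s: "x = psum s" "y = psum s'" "0 \<notin># s" "0 \<notin># s'" by auto
      have "?F (psum (s + s')) = prod_mset (image_mset v (s + s'))" by (rule b) (use s in auto)
      thus "?F (x * y) = ?F x * ?F y" using s b by simp
    qed
  qed (auto simp: lin)
  moreover have "?F (power_sum k) = v k" if "k \<ge> 1" for k
    using b[of "{#k#}"] that by simp
  ultimately show ?thesis by blast
qed

lemma alg_hom_unique:
  assumes "alg_hom_on sym_fun F" "alg_hom_on sym_fun G" "\<And>k. k \<ge> 1 \<Longrightarrow> F (power_sum k) = G (power_sum k)"
    and "f \<in> sym_fun"
  shows "F f = G f"
  using assms(4)
proof (induction rule: sym_fun_induct)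
  case (scalar c) thus ?case using assms(1,2) by (simp add: alg_hom_on_scalar)
qed (use assms in \<open>auto simp: alg_hom_onD\<close>)

lemma alg_hom_on_sum:
  assumes "alg_hom_on A F" "0 \<in> A" "\<And>f g. f \<in> A \<Longrightarrow> g \<in> A \<Longrightarrow> f + g \<in> A" "\<And>x. x \<in> I \<Longrightarrow> f x \<in> A"
  shows "F (\<Sum>x\<in>I. f x) = (\<Sum>x\<in>I. F (f x))"
proof -
  have F0: "F 0 = 0" using alg_hom_onD(2)[OF assms(1,2), of 0] by simp
  have "F (\<Sum>x\<in>I. f x) = (\<Sum>x\<in>I. F (f x)) \<and> (\<Sum>x\<in>I. f x) \<in> A"
    using assms(4)
    by (induction I rule: infinite_finite_induct) (auto simp: F0 assms(2,3) alg_hom_onD(1)[OF assms(1)])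
  thus ?thesis ..
qed

subsection \<open>Newton's identities\<close>

lemma mcoeff_of_nat_mult [simp]: "mcoeff (of_nat n * f) m = of_nat n * mcoeff f m"
  by (simp flip: scalar_of_nat)

lemma of_nat_mps_cancel: "n > 0 \<Longrightarrow> of_nat n * f = of_nat n * (g :: 'v mps) \<longleftrightarrow> f = g"
  using scalar_cancel[of "of_nat n" f g] by (simp add: scalar_of_nat)

lemma complete_h_eq_pleth: "complete_h a = complete_pleth a 1"
  by (rule mps_eqI) (simp add: complete_h.rep_eq complete_pleth.rep_eq)

lemma complete_pleth_0 [simp]: "complete_pleth 0 b = 1"
  by (rule mps_eqI) (simp add: complete_pleth.rep_eq)

lemma complete_h_sym_fun [simp, intro]: "complete_h a \<in> sym_fun"
  by (rule sym_funI[of _ a]) (auto simp: complete_h.rep_eq split: if_splits)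

lemma repeat_mset_inj: "b \<ge> 1 \<Longrightarrow> repeat_mset b m = repeat_mset b m' \<longleftrightarrow> m = m'"
  by (auto simp: multiset_eq_iff)

lemma repeat_mset_replicate: "repeat_mset b (replicate_mset i v) = replicate_mset (i * b) v"
  by (auto simp: multiset_eq_iff)

text \<open>Double counting: a monomial \<open>repeat_mset b n\<close> with
  \<open>size n = a\<close> is reached once for every variable v and every i between 1 and
  \<open>count n v\<close>, which is a times in all. The case b = 1 is Newton's identity for the
  complete functions.\<close>

lemma newton_pleth:
  assumes b: "b \<ge> 1"
  shows "of_nat a * complete_pleth a b = (\<Sum>i=1..a. power_sum (i * b) * complete_pleth (a - i) b)"
proof (rule mps_eqI)
  fix m :: "nat multiset"
  let ?cond = "\<lambda>i v. \<exists>m'. size m' = a - i \<and> m - replicate_mset (i * b) v = repeat_mset b m'"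
  have "mcoeff (\<Sum>i=1..a. power_sum (i * b) * complete_pleth (a - i) b) m =
      (\<Sum>i=1..a. \<Sum>v | i * b \<le> count m v. if ?cond i v then 1 else 0)"
    unfolding mcoeff_sum using b
    by (intro sum.cong refl, subst mcoeff_power_sum_mult) (auto simp: complete_pleth.rep_eq)
  also have "\<dots> = (if \<exists>m'. size m' = a \<and> m = repeat_mset b m' then of_nat a else 0)"
  proof (cases "\<exists>m''. m = repeat_mset b m''")
    case False
    have "\<not> ?cond i v" if "i * b \<le> count m v" for i v
    proof
      assume "?cond i v"
      then obtain m' where m': "m - replicate_mset (i * b) v = repeat_mset b m'" by blast
      have "replicate_mset (i * b) v \<subseteq># m" using that by (simp flip: count_le_replicate_mset_subset_eq)
      hence "m = repeat_mset b m' + repeat_mset b (replicate_mset i v)"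
        unfolding m'[symmetric] repeat_mset_replicate by simp
      hence "m = repeat_mset b (m' + replicate_mset i v)" by (simp add: repeat_mset_distrib2)
      thus False using False by blast
    qed
    hence "(\<Sum>i=1..a. \<Sum>v | i * b \<le> count m v. if ?cond i v then 1 else 0) = (0 :: complex)"
      by (intro sum.neutral ballI) auto
    thus ?thesis using False by auto
  next
    case True
    then obtain n where n: "m = repeat_mset b n" by blast
    have *: "?cond i v \<longleftrightarrow> size n = a" if "i \<in> {1..a}" "i \<le> count n v" for i v
    proof -
      have sub: "replicate_mset i v \<subseteq># n" using that by (simp flip: count_le_replicate_mset_subset_eq)
      have "m - replicate_mset (i * b) v = repeat_mset b (n - replicate_mset i v)"
        unfolding n by (auto simp: multiset_eq_iff algebra_simps)
      moreover have "size (n - replicate_mset i v) = size n - i" "i \<le> size n"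
        using sub size_mset_mono[OF sub] by (auto simp: size_Diff_submset)
      ultimately show ?thesis using that b by (auto simp: repeat_mset_inj)
    qed
    have "(\<Sum>i=1..a. \<Sum>v | i * b \<le> count m v. if ?cond i v then 1 else 0) =
        (\<Sum>i=1..a. \<Sum>v\<in>set_mset n. if i \<le> count n v then if size n = a then 1 else 0 else (0 :: complex))"
    proof (rule sum.cong[OF refl])
      fix i assume i: "i \<in> {1..a}"
      have "{v. i * b \<le> count m v} = {v \<in> set_mset n. i \<le> count n v}"
        using i b by (auto simp: n mult.commute simp flip: count_greater_zero_iff)
      thus "(\<Sum>v | i * b \<le> count m v. if ?cond i v then 1 else 0) =
        (\<Sum>v\<in>set_mset n. if i \<le> count n v then if size n = a then 1 else 0 else (0 :: complex))"
        unfolding sum.inter_filter[OF finite_set_mset, symmetric] by (intro sum.cong) (use i * in auto)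
    qed
    also have "\<dots> = (\<Sum>v\<in>set_mset n. \<Sum>i=1..a. if i \<le> count n v then if size n = a then 1 else 0 else 0)"
      by (rule sum.swap)
    also have "\<dots> = (\<Sum>v\<in>set_mset n. if size n = a then of_nat (count n v) else 0)"
    proof (rule sum.cong[OF refl])
      fix v
      have "count n v \<le> size n" by (rule count_le_size)
      hence "size n = a \<Longrightarrow> {i \<in> {1..a}. i \<le> count n v} = {1..count n v}" by auto
      thus "(\<Sum>i=1..a. if i \<le> count n v then if size n = a then 1 else 0 else 0) =
        (if size n = a then of_nat (count n v) else (0 :: complex))"
        by (simp flip: sum.inter_filter)
    qed
    also have "\<dots> = (if size n = a then of_nat a else 0)"
      by (auto simp: size_multiset_overloaded_eq)
    finally show ?thesis using b by (auto simp: n repeat_mset_inj)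
  qed
  finally show "mcoeff (of_nat a * complete_pleth a b) m = mcoeff (\<Sum>i=1..a. power_sum (i * b) * complete_pleth (a - i) b) m"
    by (auto simp: complete_pleth.rep_eq)
qed

lemma alg_hom_complete_h_recursion:
  assumes "alg_hom_on sym_fun G"
  shows "of_nat a * G (complete_h a) = (\<Sum>i=1..a. G (power_sum i) * G (complete_h (a - i)))"
proof -
  have "G (of_nat a * complete_h a) = (\<Sum>i=1..a. G (power_sum i * complete_h (a - i)))"
    using newton_pleth[of 1 a] assms
    by (simp add: complete_h_eq_pleth[symmetric, simplified] alg_hom_on_sum[OF assms] add_sym_fun mult_sym_fun)
  moreover have "G (of_nat a * complete_h a) = of_nat a * G (complete_h a)"
    using alg_hom_onD(2)[OF assms, of "complete_h a" "of_nat a"] by (simp add: scalar_of_nat)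
  ultimately show ?thesis using assms by (simp add: alg_hom_onD(3))
qed

lemma alg_hom_complete_h:
  assumes "alg_hom_on sym_fun G" "b \<ge> 1" "\<And>k. k \<ge> 1 \<Longrightarrow> G (power_sum k) = power_sum (k * b)"
  shows "G (complete_h a) = complete_pleth a b"
proof (induction a rule: less_induct)
  case (less a)
  show ?case
  proof (cases "a = 0")
    case True thus ?thesis using assms(1) by (simp add: complete_h_eq_pleth alg_hom_onD(4))
  next
    case False
    have "of_nat a * G (complete_h a) = of_nat a * complete_pleth a b"
      unfolding alg_hom_complete_h_recursion[OF assms(1)] newton_pleth[OF assms(2)]
      by (rule sum.cong) (use assms(3) less in auto)
    thus ?thesis using False by (simp add: of_nat_mps_cancel)
  qed
qed

text \<open>In Newton's identity the last term is the k-th power sum times 1, so the power sums can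
  be recovered recursively from the complete functions.\<close>

lemma alg_hom_power_sum_of_complete_h:
  assumes "alg_hom_on sym_fun G" "b \<ge> 1" "\<And>a. G (complete_h a) = complete_pleth a b" "k \<ge> 1"
  shows "G (power_sum k) = power_sum (k * b)"
  using assms(4)
proof (induction k rule: less_induct)
  case (less k)
  have "(\<Sum>i=1..k. G (power_sum i) * complete_pleth (k - i) b) = (\<Sum>i=1..k. power_sum (i * b) * complete_pleth (k - i) b)"
    using alg_hom_complete_h_recursion[OF assms(1), of k] newton_pleth[OF assms(2), of k] assms(3) by simp
  moreover have "{1..k} = insert k {1..<k}" using less.prems by auto
  moreover have "(\<Sum>i=1..<k. G (power_sum i) * complete_pleth (k - i) b) = (\<Sum>i=1..<k. power_sum (i * b) * complete_pleth (k - i) b)"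
    by (rule sum.cong) (use less in auto)
  ultimately show ?case by simp
qed

section \<open>Elementary symmetric functions\<close>

lift_definition elem_e :: "nat \<Rightarrow> nat mps" is "\<lambda>n m. if size m = n \<and> (\<forall>i. count m i \<le> 1) then 1 else 0" .

lemma elem_e_0 [simp]: "elem_e 0 = 1"
  by (rule mps_eqI) (auto simp: elem_e.rep_eq)

lemma elem_e_sym_fun [simp, intro]: "elem_e n \<in> sym_fun"
proof (rule sym_funI[of _ n])
  fix \<sigma> :: "nat \<Rightarrow> nat" and m assume s: "bij \<sigma>"
  have "(\<forall>i. count (image_mset \<sigma> m) i \<le> 1) \<longleftrightarrow> (\<forall>i. count (image_mset \<sigma> m) (\<sigma> i) \<le> 1)"
    using s by (metis bij_pointE)
  thus "mcoeff (elem_e n) (image_mset \<sigma> m) = mcoeff (elem_e n) m"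
    using s by (simp add: elem_e.rep_eq count_image_mset_inj bij_is_inj)
qed (auto simp: elem_e.rep_eq split: if_splits)

text \<open>For c \<ge> 2 exactly the terms j = c - 1 and j = c survive, with opposite signs; for c
  = 1 the first of them is outside the range.\<close>

lemma alternating_tail:
  assumes "c \<ge> 1"
  shows "(\<Sum>j=1..c. if c - j \<le> 1 then (-1) ^ (j - 1) else 0 :: complex) = (if c = 1 then 1 else 0)"
proof (cases "c = 1")
  case False
  then obtain d where d: "c = Suc (Suc d)" using assms by (metis One_nat_def Suc_le_D not_less_eq_eq le_zero_eq old.nat.exhaust)
  have "(\<Sum>j=1..d. if c - j \<le> 1 then (-1) ^ (j - 1) else 0 :: complex) = 0"
    by (rule sum.neutral) (auto simp: d)
  thus ?thesis by (simp add: d)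
qed simp

text \<open>Removing j copies of v leaves a square-free monomial only if all other exponents are at
  most 1 and that of v is at most j + 1. By \<open>alternating_tail\<close> the sum over j vanishes
  unless v itself has exponent 1, and then each of the n variables contributes 1.\<close>

lemma newton_elem:
  "of_nat n * elem_e n = (\<Sum>j=1..n. (-1) ^ (j - 1) * power_sum j * elem_e (n - j))"
proof (rule mps_eqI)
  fix m :: "nat multiset"
  let ?sq = "\<lambda>m :: nat multiset. \<forall>i. count m i \<le> 1"
  have "mcoeff (\<Sum>j=1..n. (-1) ^ (j - 1) * power_sum j * elem_e (n - j)) m =
      (\<Sum>j=1..n. \<Sum>v | j \<le> count m v. (-1) ^ (j - 1) * mcoeff (elem_e (n - j)) (m - replicate_mset j v))"
    unfolding mcoeff_sum mult.assoc scalar_neg1 mcoeff_scalar_mult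
    by (intro sum.cong refl) (simp add: mcoeff_power_sum_mult sum_distrib_left)
  also have "\<dots> = (if size m = n \<and> ?sq m then of_nat n else 0)"
  proof (cases "size m = n")
    case False
    have "mcoeff (elem_e (n - j)) (m - replicate_mset j v) = 0" if "j \<in> {1..n}" "j \<le> count m v" for j v
    proof -
      have sub: "replicate_mset j v \<subseteq># m" using that by (simp flip: count_le_replicate_mset_subset_eq)
      have "size (m - replicate_mset j v) = size m - j" "j \<le> size m"
        using sub size_mset_mono[OF sub] by (auto simp: size_Diff_submset)
      thus ?thesis using False that by (auto simp: elem_e.rep_eq)
    qed
    hence "(\<Sum>j=1..n. \<Sum>v | j \<le> count m v. (-1) ^ (j - 1) * mcoeff (elem_e (n - j)) (m - replicate_mset j v)) = 0"
      by (intro sum.neutral ballI) auto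
    thus ?thesis using False by simp
  next
    case True
    let ?R = "\<lambda>v. \<forall>i. i \<noteq> v \<longrightarrow> count m i \<le> 1"
    have "(\<Sum>j=1..n. \<Sum>v | j \<le> count m v. (-1) ^ (j - 1) * mcoeff (elem_e (n - j)) (m - replicate_mset j v))
        = (\<Sum>j=1..n. \<Sum>v\<in>set_mset m. if j \<le> count m v then if ?R v \<and> count m v - j \<le> 1 then (-1) ^ (j - 1) else 0 else 0)"
    proof (rule sum.cong[OF refl])
      fix j assume j: "j \<in> {1..n}"
      have s: "{v. j \<le> count m v} = {v \<in> set_mset m. j \<le> count m v}"
        using j by (auto simp flip: count_greater_zero_iff)
      have "mcoeff (elem_e (n - j)) (m - replicate_mset j v) = (if ?R v \<and> count m v - j \<le> 1 then 1 else 0)"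
        if "j \<le> count m v" for v
      proof -
        have sub: "replicate_mset j v \<subseteq># m" using that by (simp flip: count_le_replicate_mset_subset_eq)
        have "size (m - replicate_mset j v) = n - j" using sub True by (auto simp: size_Diff_submset)
        moreover have "?sq (m - replicate_mset j v) \<longleftrightarrow> ?R v \<and> count m v - j \<le> 1"
          by (auto split: if_splits)
        ultimately show ?thesis by (simp add: elem_e.rep_eq)
      qed
      thus "(\<Sum>v | j \<le> count m v. (-1) ^ (j - 1) * mcoeff (elem_e (n - j)) (m - replicate_mset j v)) =
          (\<Sum>v\<in>set_mset m. if j \<le> count m v then if ?R v \<and> count m v - j \<le> 1 then (-1) ^ (j - 1) else 0 else 0)"
        unfolding s by (subst sum.inter_filter) (auto intro!: sum.cong)
    qed
    also have "\<dots> = (\<Sum>v\<in>set_mset m. \<Sum>j=1..n. if j \<le> count m v then if ?R v \<and> count m v - j \<le> 1 then (-1) ^ (j - 1) else 0 else 0)"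
      by (rule sum.swap)
    also have "\<dots> = (\<Sum>v\<in>set_mset m. if ?R v \<and> count m v = 1 then 1 else 0)"
    proof (rule sum.cong[OF refl])
      fix v assume v: "v \<in># m"
      have "count m v \<le> n" using True count_le_size[of m v] by simp
      hence "{j \<in> {1..n}. j \<le> count m v} = {1..count m v}" by auto
      hence "(\<Sum>j=1..n. if j \<le> count m v then if ?R v \<and> count m v - j \<le> 1 then (-1) ^ (j - 1) else 0 else 0 :: complex)
          = (\<Sum>j=1..count m v. if ?R v \<and> count m v - j \<le> 1 then (-1) ^ (j - 1) else 0)"
        by (simp flip: sum.inter_filter)
      also have "\<dots> = (if ?R v then \<Sum>j=1..count m v. if count m v - j \<le> 1 then (-1) ^ (j - 1) else 0 else 0)"
      proof -
        have "(\<Sum>j\<in>J. if P \<and> Q j then f j else 0) = (if P then \<Sum>j\<in>J. if Q j then f j else 0 else (0 :: complex))"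
          for J P Q and f :: "nat \<Rightarrow> complex" by (cases P) simp_all
        thus ?thesis .
      qed
      also have "\<dots> = (if ?R v \<and> count m v = 1 then 1 else 0)"
        using v by (subst alternating_tail) (auto simp: Suc_le_eq)
      finally show "(\<Sum>j=1..n. if j \<le> count m v then if ?R v \<and> count m v - j \<le> 1 then (-1) ^ (j - 1) else 0 else 0 :: complex)
        = (if ?R v \<and> count m v = 1 then 1 else 0)" .
    qed
    also have "\<dots> = (if ?sq m then of_nat n else 0)"
    proof (cases "?sq m")
      case sq: True
      have one: "count m v = 1" if "v \<in># m" for v
        using that sq by (metis Suc_le_eq One_nat_def count_greater_zero_iff le_antisym)
      hence "size m = card (set_mset m)" by (simp add: size_multiset_overloaded_eq)
      thus ?thesis using sq one True by simp
    next
      case False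
      hence "\<not> (?R v \<and> count m v = 1)" for v by (metis order_refl)
      thus ?thesis by (simp only: False if_False sum.neutral_const)
    qed
    finally show ?thesis using True by simp
  qed
  finally show "mcoeff (of_nat n * elem_e n) m = mcoeff (\<Sum>j=1..n. (-1) ^ (j - 1) * power_sum j * elem_e (n - j)) m"
    by (simp add: elem_e.rep_eq)
qed

subsection \<open>The involution exchanging complete and elementary functions\<close>

definition omega :: "nat mps \<Rightarrow> nat mps" where
  "omega = (SOME F. alg_hom_on sym_fun F \<and> (\<forall>k\<ge>1. F (power_sum k) = scalar ((-1) ^ (k - 1)) * power_sum k))"

lemma alg_hom_omega: "alg_hom_on sym_fun omega"
  and omega_power_sum: "k \<ge> 1 \<Longrightarrow> omega (power_sum k) = scalar ((-1) ^ (k - 1)) * power_sum k"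
  using someI_ex[OF alg_hom_exists[of "\<lambda>k. scalar ((-1) ^ (k - 1)) * power_sum k"], folded omega_def] by auto

lemma alg_hom_on_image_sym_fun:
  assumes "alg_hom_on sym_fun F" "\<And>c. scalar c \<in> B" "\<And>x y. x \<in> B \<Longrightarrow> y \<in> B \<Longrightarrow> x + y \<in> B"
    "\<And>x y. x \<in> B \<Longrightarrow> y \<in> B \<Longrightarrow> x * y \<in> B" "\<And>k. k \<ge> 1 \<Longrightarrow> F (power_sum k) \<in> B" "f \<in> sym_fun"
  shows "F f \<in> B"
  using assms(6)
  by (induction rule: sym_fun_induct) (use assms(1-5) in \<open>auto simp: alg_hom_on_scalar alg_hom_onD\<close>)

lemma omega_sym_fun: "f \<in> sym_fun \<Longrightarrow> omega f \<in> sym_fun"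
  by (rule alg_hom_on_image_sym_fun[OF alg_hom_omega]) (auto simp: omega_power_sum)

lemma alg_hom_on_comp:
  assumes "alg_hom_on A F" "alg_hom_on B G" "\<And>x. x \<in> A \<Longrightarrow> F x \<in> B"
  shows "alg_hom_on A (\<lambda>x. G (F x))"
  using assms by (auto simp: alg_hom_on_def linear_on_mps_def)

lemma omega_omega: "f \<in> sym_fun \<Longrightarrow> omega (omega f) = f"
proof (rule alg_hom_unique[of "\<lambda>x. omega (omega x)" "\<lambda>x. x"])
  show "alg_hom_on sym_fun (\<lambda>x. omega (omega x))"
    by (rule alg_hom_on_comp[OF alg_hom_omega alg_hom_omega omega_sym_fun])
  fix k :: nat assume "k \<ge> 1"
  thus "omega (omega (power_sum k)) = power_sum k"
    by (simp add: omega_power_sum alg_hom_onD(2)[OF alg_hom_omega] flip: mult.assoc scalar_mult power_mult_distrib)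
qed (auto simp: alg_hom_on_def linear_on_mps_def)

section \<open>Hall-Littlewood functions\<close>

subsection \<open>Homogeneous polynomials in finitely many variables\<close>

definition hpoly :: "nat \<Rightarrow> nat \<Rightarrow> nat mps \<Rightarrow> bool" where
  "hpoly N d f \<longleftrightarrow> (\<forall>m. mcoeff f m \<noteq> 0 \<longrightarrow> set_mset m \<subseteq> {..<N} \<and> size m = d)"

lemma hpoly_0 [simp]: "hpoly N d 0" by (simp add: hpoly_def)

lemma hpoly_1 [simp]: "hpoly N 0 1" by (simp add: hpoly_def)

lemma hpoly_add: "hpoly N d f \<Longrightarrow> hpoly N d g \<Longrightarrow> hpoly N d (f + g)"
  by (auto simp: hpoly_def) (metis add.left_neutral subsetD lessThan_iff, metis add.left_neutral)

lemma hpoly_scalar: "hpoly N d f \<Longrightarrow> hpoly N d (scalar c * f)"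
  by (auto simp: hpoly_def)

lemma hpoly_diff: "hpoly N d f \<Longrightarrow> hpoly N d g \<Longrightarrow> hpoly N d (f - g)"
  using hpoly_add[of N d f "scalar (-1) * g"] hpoly_scalar[of N d g "-1"] by (simp add: scalar_minus)

lemma hpoly_sum: "(\<And>x. x \<in> A \<Longrightarrow> hpoly N d (f x)) \<Longrightarrow> hpoly N d (sum f A)"
  by (induction A rule: infinite_finite_induct) (auto intro: hpoly_add)

lemma hpoly_mult:
  assumes "hpoly N d f" "hpoly N d' g"
  shows "hpoly N (d + d') (f * g)"
  unfolding hpoly_def
proof (intro allI impI)
  fix m assume "mcoeff (f * g) m \<noteq> 0"
  then obtain a where a: "a \<subseteq># m" "mcoeff f a \<noteq> 0" "mcoeff g (m - a) \<noteq> 0"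
    unfolding times_mps.rep_eq by (metis (no_types, lifting) mem_Collect_eq mult_eq_0_iff sum.neutral)
  hence m: "m = a + (m - a)" by simp
  show "set_mset m \<subseteq> {..<N} \<and> size m = d + d'"
    using assms a(2,3) unfolding hpoly_def by (subst (1 2) m) (auto simp del: subset_mset.add_diff_inverse)
qed

lemma hpoly_prod: "(\<And>x. x \<in> A \<Longrightarrow> hpoly N (d x) (f x)) \<Longrightarrow> hpoly N (sum d A) (prod f A)"
  by (induction A rule: infinite_finite_induct) (auto intro: hpoly_mult)

lemma hpoly_var: "i < N \<Longrightarrow> hpoly N (Suc 0) (var i)"
  by (auto simp: hpoly_def var.rep_eq split: if_splits)

lift_definition monom_mps :: "'v multiset \<Rightarrow> 'v mps" is "\<lambda>m m'. if m' = m then 1 else 0" .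

lemma monom_mps_mult: "monom_mps m * monom_mps m' = monom_mps (m + m')"
proof (rule mps_eqI)
  fix u
  have "mcoeff (monom_mps m * monom_mps m') u = (\<Sum>a\<in>(if m \<subseteq># u then {m} else {}). mcoeff (monom_mps m) a * mcoeff (monom_mps m') (u - a))"
    by (rule mcoeff_mult_support) (auto simp: monom_mps.rep_eq split: if_splits)
  also have "\<dots> = mcoeff (monom_mps (m + m')) u" by (auto simp: monom_mps.rep_eq)
  finally show "mcoeff (monom_mps m * monom_mps m') u = mcoeff (monom_mps (m + m')) u" .
qed

lemma var_eq_monom: "var i = monom_mps {#i#}"
  by (rule mps_eqI) (simp add: var.rep_eq monom_mps.rep_eq)

section \<open>Evaluation of polynomials at a point\<close>

definition fin_supp :: "'v mps \<Rightarrow> bool" where "fin_supp f \<longleftrightarrow> finite {m. mcoeff f m \<noteq> 0}"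

definition eval_mps :: "('v \<Rightarrow> complex) \<Rightarrow> 'v mps \<Rightarrow> complex" where
  "eval_mps a f = (\<Sum>m | mcoeff f m \<noteq> 0. mcoeff f m * prod_mset (image_mset a m))"

lemma eval_mps_superset:
  assumes "finite S" "{m. mcoeff f m \<noteq> 0} \<subseteq> S"
  shows "eval_mps a f = (\<Sum>m\<in>S. mcoeff f m * prod_mset (image_mset a m))"
  unfolding eval_mps_def by (rule sum.mono_neutral_left) (use assms in auto)

lemma eval_mps_add:
  assumes "fin_supp f" "fin_supp g"
  shows "fin_supp (f + g)" "eval_mps a (f + g) = eval_mps a f + eval_mps a g"
proof -
  let ?S = "{m. mcoeff f m \<noteq> 0} \<union> {m. mcoeff g m \<noteq> 0}"
  have S: "finite ?S" "{m. mcoeff (f + g) m \<noteq> 0} \<subseteq> ?S" using assms by (auto simp: fin_supp_def)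
  thus "fin_supp (f + g)" by (auto simp: fin_supp_def intro: finite_subset)
  have "eval_mps a (f + g) = (\<Sum>m\<in>?S. mcoeff (f + g) m * prod_mset (image_mset a m))"
    using S by (rule eval_mps_superset)
  also have "\<dots> = (\<Sum>m\<in>?S. mcoeff f m * prod_mset (image_mset a m)) + (\<Sum>m\<in>?S. mcoeff g m * prod_mset (image_mset a m))"
    by (simp add: algebra_simps sum.distrib)
  also have "\<dots> = eval_mps a f + eval_mps a g"
    using S(1) by (subst (1 2) eval_mps_superset[of ?S]) auto
  finally show "eval_mps a (f + g) = eval_mps a f + eval_mps a g" .
qed

lemma eval_mps_scalar_mult:
  assumes "fin_supp f"
  shows "fin_supp (scalar c * f)" "eval_mps a (scalar c * f) = c * eval_mps a f"
proof -
  show "fin_supp (scalar c * f)"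
    using assms unfolding fin_supp_def by (rule rev_finite_subset) auto
  have "eval_mps a (scalar c * f) = (\<Sum>m | mcoeff f m \<noteq> 0. mcoeff (scalar c * f) m * prod_mset (image_mset a m))"
    using assms by (intro eval_mps_superset) (auto simp: fin_supp_def)
  thus "eval_mps a (scalar c * f) = c * eval_mps a f"
    by (simp add: eval_mps_def sum_distrib_left mult.assoc)
qed

lemma eval_mps_monom: "fin_supp (monom_mps m)" "eval_mps a (monom_mps m) = prod_mset (image_mset a m)"
  by (auto simp: monom_mps.rep_eq fin_supp_def eval_mps_def)

lemma eval_mps_0 [simp]: "fin_supp 0" "eval_mps a 0 = 0"
  by (auto simp: fin_supp_def eval_mps_def)

lemma eval_mps_sum:
  assumes "\<And>x. x \<in> A \<Longrightarrow> fin_supp (f x)"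
  shows "fin_supp (sum f A) \<and> eval_mps a (sum f A) = (\<Sum>x\<in>A. eval_mps a (f x))"
  using assms by (induction A rule: infinite_finite_induct) (auto simp: eval_mps_add)

lemma fin_supp_expand:
  assumes "fin_supp f"
  shows "f = (\<Sum>m | mcoeff f m \<noteq> 0. scalar (mcoeff f m) * monom_mps m)"
proof (rule mps_eqI)
  fix u
  have "mcoeff (\<Sum>m | mcoeff f m \<noteq> 0. scalar (mcoeff f m) * monom_mps m) u = (\<Sum>m | mcoeff f m \<noteq> 0. if m = u then mcoeff f u else 0)"
    unfolding mcoeff_sum by (rule sum.cong) (auto simp: monom_mps.rep_eq)
  thus "mcoeff f u = mcoeff (\<Sum>m | mcoeff f m \<noteq> 0. scalar (mcoeff f m) * monom_mps m) u"
    using assms by (simp add: fin_supp_def)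
qed

lemma eval_mps_mult:
  assumes "fin_supp f" "fin_supp g"
  shows "fin_supp (f * g)" "eval_mps a (f * g) = eval_mps a f * eval_mps a g"
proof -
  let ?F = "{m. mcoeff f m \<noteq> 0}" and ?G = "{m. mcoeff g m \<noteq> 0}"
  have "f * g = (\<Sum>m\<in>?F. scalar (mcoeff f m) * monom_mps m) * (\<Sum>m\<in>?G. scalar (mcoeff g m) * monom_mps m)"
    using fin_supp_expand[OF assms(1)] fin_supp_expand[OF assms(2)] by simp
  also have "\<dots> = (\<Sum>m\<in>?F. \<Sum>m'\<in>?G. scalar (mcoeff f m * mcoeff g m') * monom_mps (m + m'))"
    by (simp add: sum_product scalar_mult mult_ac flip: monom_mps_mult)
  finally have e: "f * g = (\<Sum>m\<in>?F. \<Sum>m'\<in>?G. scalar (mcoeff f m * mcoeff g m') * monom_mps (m + m'))" .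
  have i: "fin_supp (\<Sum>m'\<in>?G. scalar (mcoeff f m * mcoeff g m') * monom_mps (m + m')) \<and>
     eval_mps a (\<Sum>m'\<in>?G. scalar (mcoeff f m * mcoeff g m') * monom_mps (m + m')) =
      (\<Sum>m'\<in>?G. mcoeff f m * mcoeff g m' * prod_mset (image_mset a (m + m')))" for m
    using eval_mps_sum[of ?G "\<lambda>m'. scalar (mcoeff f m * mcoeff g m') * monom_mps (m + m')" a]
    by (simp add: eval_mps_scalar_mult eval_mps_monom)
  note s = eval_mps_sum[where A = ?F and a = a, OF i[THEN conjunct1]]
  show "fin_supp (f * g)" unfolding e by (rule s[THEN conjunct1])
  have "eval_mps a (f * g) = (\<Sum>m\<in>?F. \<Sum>m'\<in>?G. mcoeff f m * mcoeff g m' * prod_mset (image_mset a (m + m')))"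
    unfolding e using s i by simp
  also have "\<dots> = eval_mps a f * eval_mps a g"
    by (simp add: eval_mps_def sum_product mult_ac)
  finally show "eval_mps a (f * g) = eval_mps a f * eval_mps a g" .
qed

lemma eval_mps_1 [simp]: "fin_supp (1 :: 'v mps)" "eval_mps a (1 :: 'v mps) = 1"
proof -
  have "(1 :: 'v mps) = monom_mps {#}" by (rule mps_eqI) (simp add: monom_mps.rep_eq)
  thus "fin_supp (1 :: 'v mps)" "eval_mps a (1 :: 'v mps) = 1" using eval_mps_monom[where m = "{#} :: 'v multiset"] by auto
qed

lemma eval_mps_prod:
  assumes "\<And>x. x \<in> A \<Longrightarrow> fin_supp (f x)"
  shows "fin_supp (prod f A) \<and> eval_mps a (prod f A) = (\<Prod>x\<in>A. eval_mps a (f x))"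
  using assms by (induction A rule: infinite_finite_induct) (auto simp: eval_mps_mult)

lemma eval_mps_linear_form:
  "fin_supp (var i - scalar t * var j)" "eval_mps a (var i - scalar t * var j) = a i - t * a j"
proof -
  have "fin_supp (var i + scalar s * var j) \<and> eval_mps a (var i + scalar s * var j) = a i + s * a j" for s
    unfolding var_eq_monom by (simp add: eval_mps_scalar_mult eval_mps_monom eval_mps_add)
  from this[of "- t"] show "fin_supp (var i - scalar t * var j)" "eval_mps a (var i - scalar t * var j) = a i - t * a j"
    by auto
qed

subsection \<open>Renaming variables\<close>

text \<open>The inverse appears because coefficients pull back: with it, the variable i is sent to
  the variable \<sigma> i.\<close>

lift_definition rename_vars :: "('v \<Rightarrow> 'v) \<Rightarrow> 'v mps \<Rightarrow> 'v mps" is "\<lambda>\<sigma> f m. f (image_mset (inv_into UNIV \<sigma>) m)" .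

lemma mcoeff_rename: "bij \<sigma> \<Longrightarrow> mcoeff (rename_vars \<sigma> f) (image_mset \<sigma> m) = mcoeff f m"
  by (simp add: rename_vars.rep_eq multiset.map_comp comp_def bij_is_inj)

lemma image_mset_bij_cancel: "bij \<sigma> \<Longrightarrow> image_mset \<sigma> (image_mset (inv_into UNIV \<sigma>) m) = m"
  by (simp add: multiset.map_comp comp_def bij_is_surj surj_f_inv_f)

lemma rename_vars_add: "rename_vars \<sigma> (f + g) = rename_vars \<sigma> f + rename_vars \<sigma> g"
  and rename_vars_diff: "rename_vars \<sigma> (f - g) = rename_vars \<sigma> f - rename_vars \<sigma> g"
  and rename_vars_0 [simp]: "rename_vars \<sigma> 0 = 0"
  and rename_vars_1 [simp]: "rename_vars \<sigma> 1 = 1"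
  and rename_vars_scalar: "rename_vars \<sigma> (scalar c * f) = scalar c * rename_vars \<sigma> f"
  by (rule mps_eqI, simp add: rename_vars.rep_eq)+

lemma rename_vars_sum: "rename_vars \<sigma> (sum f A) = (\<Sum>x\<in>A. rename_vars \<sigma> (f x))"
  by (induction A rule: infinite_finite_induct) (auto simp: rename_vars_add)

lemma rename_vars_mult:
  assumes s: "bij \<sigma>"
  shows "rename_vars \<sigma> (f * g) = rename_vars \<sigma> f * rename_vars \<sigma> g"
proof (rule mps_eqI)
  fix m
  let ?i = "image_mset (inv_into UNIV \<sigma>)"
  have b: "bij (inv_into UNIV \<sigma>)" using s by (rule bij_imp_bij_inv)
  hence i: "?i a = ?i b \<longleftrightarrow> a = b" for a b by (meson bij_is_inj inj_eq multiset.inj_map)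
  have "mcoeff (f * g) (?i m) = (\<Sum>a | a \<subseteq># m. mcoeff f (?i a) * mcoeff g (?i (m - a)))"
    unfolding times_mps.rep_eq
  proof (rule sum.reindex_cong[of ?i])
    show "inj_on ?i {a. a \<subseteq># m}" using i by (auto intro: inj_onI)
    show "{a. a \<subseteq># ?i m} = ?i ` {a. a \<subseteq># m}"
      by (auto dest: image_mset_subset_inv intro: image_mset_subseteq_mono)
  qed (use b in \<open>auto simp: image_mset_Diff\<close>)
  thus "mcoeff (rename_vars \<sigma> (f * g)) m = mcoeff (rename_vars \<sigma> f * rename_vars \<sigma> g) m"
    by (simp add: rename_vars.rep_eq times_mps.rep_eq)
qed

lemma rename_vars_prod: "bij \<sigma> \<Longrightarrow> rename_vars \<sigma> (prod f A) = (\<Prod>x\<in>A. rename_vars \<sigma> (f x))"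
  by (induction A rule: infinite_finite_induct) (auto simp: rename_vars_mult)

lemma rename_vars_var: "bij \<sigma> \<Longrightarrow> rename_vars \<sigma> (var i) = var (\<sigma> i)"
proof (rule mps_eqI)
  fix m assume s: "bij \<sigma>"
  have "image_mset (inv_into UNIV \<sigma>) m = {#i#} \<longleftrightarrow> m = {#\<sigma> i#}"
    using image_mset_bij_cancel[OF s, of m] s by (auto simp: bij_is_inj)
  thus "mcoeff (rename_vars \<sigma> (var i)) m = mcoeff (var (\<sigma> i)) m" by (simp add: rename_vars.rep_eq var.rep_eq)
qed

subsection \<open>Antisymmetric polynomials of the degree of the Vandermonde product\<close>

definition alternating :: "nat \<Rightarrow> nat mps \<Rightarrow> bool" where
  "alternating N f \<longleftrightarrow> (\<forall>\<sigma>. \<sigma> permutes {..<N} \<longrightarrow> rename_vars \<sigma> f = of_int (sign \<sigma>) * f)"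

lemma of_int_mps: "of_int z = (scalar (of_int z) :: 'v mps)"
  by (simp add: scalar_of_int)

lemma alternating_coeff:
  assumes "alternating N f" "\<sigma> permutes {..<N}"
  shows "mcoeff f m = of_int (sign \<sigma>) * mcoeff f (image_mset \<sigma> m)"
  using assms mcoeff_rename[OF permutes_bij[OF assms(2)], of f m]
  unfolding alternating_def of_int_mps by simp

text \<open>The largest of N + 1 distinct naturals is at least N; removing it leads to the induction
  hypothesis, and equality of the sums forces equality in both places.\<close>

lemma finite_set_sum_lessThan:
  "finite S \<Longrightarrow> card S = N \<Longrightarrow> \<Sum>S \<ge> \<Sum>{..<N} \<and> (\<Sum>S = \<Sum>{..<N} \<longrightarrow> S = {..<N :: nat})"
proof (induction N arbitrary: S)
  case (Suc N)
  have S: "S \<noteq> {}" using Suc.prems by auto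
  let ?M = "Max S"
  have M: "?M \<in> S" using S Suc.prems by simp
  have "S \<subseteq> {..?M}" using Suc.prems by auto
  hence M': "Suc N \<le> Suc ?M" using card_mono[of "{..?M}" S] Suc.prems by simp
  have IH: "\<Sum>(S - {?M}) \<ge> \<Sum>{..<N} \<and> (\<Sum>(S - {?M}) = \<Sum>{..<N} \<longrightarrow> S - {?M} = {..<N})"
    using Suc.prems M by (intro Suc.IH) auto
  moreover have "\<Sum>S = ?M + \<Sum>(S - {?M})" using M Suc.prems by (simp add: sum.remove)
  moreover have "S = insert ?M (S - {?M})" using M by auto
  ultimately have f: "N \<le> ?M" "\<Sum>S = ?M + \<Sum>(S - {?M})" "S = insert ?M (S - {?M})" using M' by auto
  show ?case
    using f(1,2) IH lessThan_Suc f(3) by auto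
qed simp

text \<open>In an antisymmetric polynomial the exponents of each occurring monomial are distinct. N
  distinct exponents with sum 0 + ... + (N - 1) are 0, ..., N - 1 in some order, so every
  coefficient is up to sign the one at \<delta>. The conclusion is cross-multiplied, so neither
  coefficient has to be known to be nonzero.\<close>

lemma alternating_unique:
  assumes "hpoly N (\<Sum>{..<N}) f" "hpoly N (\<Sum>{..<N}) g" "alternating N f" "alternating N g"
  shows "\<exists>\<delta>. scalar (mcoeff g \<delta>) * f = scalar (mcoeff f \<delta>) * g \<and> (mcoeff g \<delta> = 0 \<longrightarrow> g = 0)"
proof -
  define \<delta> where "\<delta> = (\<Sum>j<N. replicate_mset j j)"
  have cd: "count \<delta> j = (if j < N then j else 0)" for j
    by (simp add: \<delta>_def count_sum)
  have zero: "mcoeff h m = 0 \<or> (\<exists>\<sigma>. \<sigma> permutes {..<N} \<and> image_mset \<sigma> m = \<delta>)"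
    if h: "hpoly N (\<Sum>{..<N}) h" "alternating N h" for h m
  proof (cases "mcoeff h m = 0")
    case nz: False
    hence m: "set_mset m \<subseteq> {..<N}" "size m = \<Sum>{..<N}" using h by (auto simp: hpoly_def)
    have inj: "inj_on (count m) {..<N}"
    proof (rule inj_onI, rule ccontr)
      fix a b assume ab: "a \<in> {..<N}" "b \<in> {..<N}" "count m a = count m b" "a \<noteq> b"
      \<comment> \<open>With equal exponents at a and b the transposition fixes the monomial, but
        its sign is -1, so the coefficient is its own negative.\<close>
      let ?s = "Transposition.transpose a b"
      have "image_mset ?s m = m"
      proof (rule multiset_eqI)
        fix x
        have "count (image_mset ?s m) (?s (?s x)) = count m (?s x)"
          by (rule count_image_mset_inj) (simp add: bij_is_inj)
        moreover have "count m (?s x) = count m x" using ab by (auto simp: Transposition.transpose_def)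
        ultimately show "count (image_mset ?s m) x = count m x" by simp
      qed
      moreover have "?s permutes {..<N}" using ab by (intro permutes_swap_id)
      moreover have "sign ?s = -1" using ab by (simp add: sign_swap_id)
      ultimately have "mcoeff h m = - mcoeff h m" using alternating_coeff[OF h(2), of ?s m] by simp
      thus False using nz by simp
    qed
    have "sum (count m) (set_mset m) = sum (count m) {..<N}"
      by (rule sum.mono_neutral_left) (use m in \<open>auto simp: count_eq_zero_iff\<close>)
    hence "\<Sum>(count m ` {..<N}) = size m"
      using inj by (simp add: sum.reindex size_multiset_overloaded_eq)
    hence im: "count m ` {..<N} = {..<N}"
      using finite_set_sum_lessThan[of "count m ` {..<N}" N] m inj by (simp add: card_image)
    \<comment> \<open>Renaming every variable by its exponent turns m into \<delta>.\<close>
    define \<sigma> where "\<sigma> x = (if x < N then count m x else x)" for x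
    have "bij_betw \<sigma> {..<N} {..<N}"
      using inj im by (auto simp: bij_betw_def \<sigma>_def inj_on_def image_iff)
    hence p: "\<sigma> permutes {..<N}" by (rule bij_imp_permutes) (simp add: \<sigma>_def)
    have "image_mset \<sigma> m = \<delta>"
    proof (rule multiset_eqI)
      fix y
      obtain x where x: "y = \<sigma> x" using permutes_bij[OF p] by (metis bij_pointE)
      have "count (image_mset \<sigma> m) y = count m x"
        unfolding x by (rule count_image_mset_inj) (use p in \<open>auto dest: permutes_inj\<close>)
      moreover have "count m x = 0" if "x \<ge> N" using m(1) that by (meson not_in_iff lessThan_iff not_less subsetD)
      ultimately show "count (image_mset \<sigma> m) y = count \<delta> y"
        using permutes_in_image[OF p, of x] by (auto simp: cd x \<sigma>_def)
    qed
    thus ?thesis using p by blast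
  qed auto
  have "mcoeff g \<delta> * mcoeff f m = mcoeff f \<delta> * mcoeff g m" for m
  proof (cases "\<exists>\<sigma>. \<sigma> permutes {..<N} \<and> image_mset \<sigma> m = \<delta>")
    case True
    then obtain \<sigma> where "\<sigma> permutes {..<N}" "image_mset \<sigma> m = \<delta>" by blast
    thus ?thesis using alternating_coeff[OF assms(3), of \<sigma> m] alternating_coeff[OF assms(4), of \<sigma> m] by simp
  next
    case False thus ?thesis using zero[OF assms(1,3), of m] zero[OF assms(2,4), of m] by auto
  qed
  moreover have "g = 0" if "mcoeff g \<delta> = 0"
  proof (rule mps_eqI)
    fix m show "mcoeff g m = mcoeff 0 m"
      using zero[OF assms(2,4), of m] that alternating_coeff[OF assms(4), of _ m] by fastforce
  qed
  ultimately show ?thesis by (intro exI[of _ \<delta>] conjI mps_eqI) auto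
qed

subsection \<open>Symmetrised monomials\<close>

definition pairs :: "nat \<Rightarrow> (nat \<times> nat) set" where "pairs N = {(i, j). i < j \<and> j < N}"

lemma finite_pairs [simp]: "finite (pairs N)"
  by (rule finite_subset[of _ "{..<N} \<times> {..<N}"]) (auto simp: pairs_def)

lemma prod_pairs: "(\<Prod>j<N. \<Prod>i<j. g i j) = (\<Prod>(i, j)\<in>pairs N. g i j)"
proof -
  have "(\<Prod>j<N. \<Prod>i<j. g i j) = (\<Prod>(j, i)\<in>Sigma {..<N} (\<lambda>j. {..<j}). g i j)"
    by (rule prod.Sigma) auto
  also have "\<dots> = (\<Prod>(i, j)\<in>pairs N. g i j)"
    by (rule prod.reindex_bij_witness[of _ "\<lambda>(i, j). (j, i)" "\<lambda>(j, i). (i, j)"]) (auto simp: pairs_def)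
  finally show ?thesis .
qed

definition hl_kernel :: "complex \<Rightarrow> nat \<Rightarrow> (nat \<Rightarrow> nat) \<Rightarrow> nat mps" where
  "hl_kernel t N w = (\<Prod>(i, j)\<in>pairs N. var (w i) - scalar t * var (w j))"

abbreviation adj :: "nat \<Rightarrow> nat \<Rightarrow> nat" where "adj p \<equiv> Transposition.transpose p (Suc p)"

lemma adj_apply: "adj p i = (if i = p then Suc p else if i = Suc p then p else i)"
  by (simp add: Transposition.transpose_def)

text \<open>Composition with \<open>adj p\<close> permutes the pairs i < j other than (p, p + 1)
  among themselves, so only the factor of that pair changes.\<close>

lemma kernel_adjacent:
  assumes "Suc p < N"
  obtains R where "hl_kernel t N w = (var (w p) - scalar t * var (w (Suc p))) * R"
    "hl_kernel t N (w \<circ> adj p) = (var (w (Suc p)) - scalar t * var (w p)) * R"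
proof -
  let ?P = "pairs N - {(p, Suc p)}"
  define R where "R w = (\<Prod>(i, j)\<in>?P. var (w i) - scalar t * var (w j))" for w :: "nat \<Rightarrow> nat"
  have mem: "(p, Suc p) \<in> pairs N" using assms by (simp add: pairs_def)
  have k: "hl_kernel t N w = (var (w p) - scalar t * var (w (Suc p))) * R w" for w
    unfolding hl_kernel_def R_def by (subst prod.remove[OF finite_pairs mem]) simp
  have "R (w \<circ> adj p) = R w"
    unfolding R_def
    by (rule prod.reindex_bij_witness[of _ "\<lambda>(i, j). (adj p i, adj p j)" "\<lambda>(i, j). (adj p i, adj p j)"])
       (use assms in \<open>auto simp: pairs_def adj_apply split: if_splits\<close>)
  with k[of w] k[of "w \<circ> adj p"] show ?thesis by (intro that[of "R w"]) (simp_all add: adj_apply)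
qed

lemma adj_permutes: "Suc p < N \<Longrightarrow> adj p permutes {..<N}"
  by (rule permutes_swap_id) auto

lemma sign_adj: "sign (adj p) = -1"
  by (simp add: sign_swap_id)

lemma sign_comp_permutes: "w permutes {..<N :: nat} \<Longrightarrow> s permutes {..<N} \<Longrightarrow> sign (w \<circ> s) = sign w * sign s"
  by (meson finite_lessThan permutation_permutes sign_compose)

lemma kernel_1_adj:
  assumes "Suc p < N" shows "hl_kernel 1 N (w \<circ> adj p) = - hl_kernel 1 N w"
proof -
  obtain R where "hl_kernel 1 N w = (var (w p) - scalar 1 * var (w (Suc p))) * R"
    "hl_kernel 1 N (w \<circ> adj p) = (var (w (Suc p)) - scalar 1 * var (w p)) * R"
    using kernel_adjacent[OF assms] by blast
  thus ?thesis by (metis minus_diff_eq mult_minus_left scalar_1 mult_1_left)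
qed

text \<open>A transposition of distant indices is a conjugate of a shorter one by an adjacent
  transposition, hence a product of three maps that each change the sign.\<close>

lemma kernel_1_transpose:
  "a < b \<Longrightarrow> b < N \<Longrightarrow> hl_kernel 1 N (w \<circ> Transposition.transpose a b) = - hl_kernel 1 N w"
proof (induction "b - a" arbitrary: b w)
  case (Suc d)
  show ?case
  proof (cases "b = Suc a")
    case True thus ?thesis using kernel_1_adj[of a N w] Suc.prems by simp
  next
    case False
    then obtain b' where b': "b = Suc b'" "a < b'" using Suc.prems by (cases b) auto
    have e: "Transposition.transpose a b = adj b' \<circ> Transposition.transpose a b' \<circ> adj b'"
      using b' by (auto simp: fun_eq_iff Transposition.transpose_def)
    have "hl_kernel 1 N (w \<circ> Transposition.transpose a b) = hl_kernel 1 N ((w \<circ> adj b') \<circ> Transposition.transpose a b' \<circ> adj b')"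
      unfolding e by (simp add: comp_assoc)
    also have "\<dots> = - hl_kernel 1 N ((w \<circ> adj b') \<circ> Transposition.transpose a b')"
      by (rule kernel_1_adj) (use Suc.prems b' in auto)
    also have "\<dots> = - hl_kernel 1 N w"
      using Suc.hyps(1)[of b' "w \<circ> adj b'"] Suc b' kernel_1_adj[of b' N w] by simp
    finally show ?thesis .
  qed
qed simp

lemma kernel_1_permute:
  assumes "s permutes {..<N}"
  shows "hl_kernel 1 N (w \<circ> s) = of_int (sign s) * hl_kernel 1 N w"
  using assms finite_lessThan[of N]
proof (induction s arbitrary: w rule: permutes_induct)
  case id show ?case by simp
next
  case (swap a b p)
  show ?case
  proof (cases "a = b")
    case True thus ?thesis using swap by simp
  next
    case False
    have "hl_kernel 1 N (w \<circ> (Transposition.transpose a b \<circ> p)) = hl_kernel 1 N ((w \<circ> Transposition.transpose a b) \<circ> p)"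
      by (simp add: comp_assoc)
    also have "\<dots> = of_int (sign p) * hl_kernel 1 N (w \<circ> Transposition.transpose a b)" by (rule swap.IH)
    also have "hl_kernel 1 N (w \<circ> Transposition.transpose a b) = - hl_kernel 1 N w"
      using kernel_1_transpose[of a b N w] kernel_1_transpose[of b a N w] False swap.hyps
      by (cases "a < b") (auto simp: transpose_commute)
    also have "of_int (sign p) * - hl_kernel 1 N w = of_int (sign (Transposition.transpose a b \<circ> p)) * hl_kernel 1 N w"
      using swap.hyps False by (subst sign_comp_permutes[of _ N]) (auto simp: sign_swap_id intro: permutes_swap_id)
    finally show ?thesis .
  qed
qed

lemma vandermonde_eq_kernel: "vandermonde N = hl_kernel 1 N id"
  by (simp add: vandermonde_def hl_kernel_def prod_pairs)

lemma rename_kernel: "bij s \<Longrightarrow> rename_vars s (hl_kernel t N w) = hl_kernel t N (s \<circ> w)"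
  unfolding hl_kernel_def
  by (subst rename_vars_prod)
     (auto intro!: prod.cong simp: rename_vars_diff rename_vars_scalar rename_vars_var)

lemma alternating_vandermonde: "alternating N (vandermonde N)"
  unfolding alternating_def vandermonde_eq_kernel
proof (intro allI impI)
  fix s assume s: "s permutes {..<N}"
  show "rename_vars s (hl_kernel 1 N id) = of_int (sign s) * hl_kernel 1 N id"
    using kernel_1_permute[OF s, of id] by (simp add: rename_kernel[OF permutes_bij[OF s]])
qed

lemma sum_pairs_1: "(\<Sum>x\<in>pairs N. 1) = \<Sum>{..<N}"
proof -
  have "(\<Sum>x\<in>pairs N. 1) = (\<Sum>x\<in>Sigma {..<N} (\<lambda>j. {..<j}). 1 :: nat)"
    by (rule sum.reindex_bij_witness[of _ "\<lambda>(j, i). (i, j)" "\<lambda>(i, j). (j, i)"]) (auto simp: pairs_def)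
  also have "\<dots> = \<Sum>{..<N}" by simp
  finally show ?thesis .
qed

lemma hpoly_kernel:
  assumes "w permutes {..<N}" shows "hpoly N (\<Sum>{..<N}) (hl_kernel t N w)"
proof -
  have "w i < N" if "i < N" for i using permutes_in_image[OF assms, of i] that by auto
  hence "hpoly N (\<Sum>x\<in>pairs N. 1) (hl_kernel t N w)"
    unfolding hl_kernel_def
    by (intro hpoly_prod) (auto simp: pairs_def intro!: hpoly_diff hpoly_scalar hpoly_var)
  thus ?thesis unfolding sum_pairs_1 .
qed

definition hl_num :: "complex \<Rightarrow> nat list \<Rightarrow> nat mps" where
  "hl_num t xs = (\<Sum>w | w permutes {..<length xs}.
     of_int (sign w) * (\<Prod>i<length xs. var (w i) ^ (xs ! i)) * hl_kernel t (length xs) w)"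

lemma HL_numerator_eq_hl_num:
  assumes "n \<ge> length l"
  shows "HL_numerator n l t = hl_num t (l @ replicate (n - length l) 0)"
proof -
  have len: "length (l @ replicate (n - length l) 0) = n" using assms by simp
  have "(\<Prod>i<n. var (w i) ^ ((l @ replicate (n - length l) 0) ! i)) = (\<Prod>i<length l. var (w i) ^ (l ! i))" for w :: "nat \<Rightarrow> nat"
  proof -
    have "(\<Prod>i<n. var (w i) ^ ((l @ replicate (n - length l) 0) ! i)) =
      (\<Prod>i<length l. var (w i) ^ ((l @ replicate (n - length l) 0) ! i))"
      by (rule prod.mono_neutral_right) (use assms in \<open>auto simp: nth_append\<close>)
    thus ?thesis by (simp add: nth_append)
  qed
  thus ?thesis unfolding HL_numerator_def hl_num_def len hl_kernel_def prod_pairs by simp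
qed

text \<open>Write x, y for the variables at positions p and p + 1, and add the terms of w and w o
  adj p. On the right this gives x^a y^a (x^2 - y^2) times factors common to both sides, on the left
  t times the same.\<close>

lemma hl_num_straighten: "hl_num t (ys @ a # Suc a # zs) = scalar t * hl_num t (ys @ Suc a # a # zs)"
proof -
  let ?xs = "ys @ a # Suc a # zs" and ?xs' = "ys @ Suc a # a # zs"
  define N p where "N = length ?xs" and "p = length ys"
  have N: "length ?xs = N" "length ?xs' = N" "Suc p < N" by (auto simp: N_def p_def)
  have nth: "?xs ! p = a" "?xs ! Suc p = Suc a" "?xs' ! p = Suc a" "?xs' ! Suc p = a"
    by (auto simp: p_def nth_append)
  have nth': "?xs' ! i = ?xs ! i" if "i \<notin> {p, Suc p}" for i
    using that by (auto simp: p_def nth_append nth_Cons split: nat.splits)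
  define f where "f l w = of_int (sign w) * (\<Prod>i<N. var (w i) ^ (l ! i)) * hl_kernel t N w" for l :: "nat list" and w
  \<comment> \<open>Summing over all w the pairs {w, w o adj p} meets every pair twice; the factor 2
    is cancelled at the end.\<close>
  have double: "(\<Sum>w | w permutes {..<N}. f l w) + (\<Sum>w | w permutes {..<N}. f l w) =
      (\<Sum>w | w permutes {..<N}. f l w + f l (w \<circ> adj p))" for l
    unfolding sum.distrib
    using sum_permutations_compose_right[OF adj_permutes[OF N(3)], of "f l"] by simp
  have "scalar 2 = (1 + 1 :: nat mps)" using scalar_add[of 1 1] by simp
  hence two: "scalar 2 * z = z + z" for z :: "nat mps" by (simp only: distrib_right mult_1_left)
  have "f ?xs w + f ?xs (w \<circ> adj p) = scalar t * (f ?xs' w + f ?xs' (w \<circ> adj p))"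
    if w: "w permutes {..<N}" for w
  proof -
    obtain R where R: "hl_kernel t N w = (var (w p) - scalar t * var (w (Suc p))) * R"
      "hl_kernel t N (w \<circ> adj p) = (var (w (Suc p)) - scalar t * var (w p)) * R"
      using kernel_adjacent[OF N(3)] by blast
    define M where "M = (\<Prod>i\<in>{..<N} - {p, Suc p}. var (w i) ^ (?xs ! i))"
    have split: "(\<Prod>i<N. g i) = g p * g (Suc p) * (\<Prod>i\<in>{..<N} - {p, Suc p}. g i)" for g :: "nat \<Rightarrow> nat mps"
      using N(3) by (subst prod.subset_diff[of "{p, Suc p}"]) (auto simp: mult.commute)
    have "(\<Prod>i\<in>{..<N} - {p, Suc p}. var (w i) ^ (?xs' ! i)) = M"
      "(\<Prod>i\<in>{..<N} - {p, Suc p}. var ((w \<circ> adj p) i) ^ (?xs ! i)) = M"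
      "(\<Prod>i\<in>{..<N} - {p, Suc p}. var ((w \<circ> adj p) i) ^ (?xs' ! i)) = M"
      unfolding M_def by (intro prod.cong refl; use nth' in \<open>simp add: adj_apply\<close>)+
    note f = f_def split this M_def[symmetric] nth R
    have s: "of_int (sign (w \<circ> adj p)) = - (of_int (sign w) :: nat mps)"
      using w adj_permutes[OF N(3)] by (simp add: sign_comp_permutes sign_adj)
    show ?thesis unfolding f s by (simp add: adj_apply algebra_simps)
  qed
  hence "(\<Sum>w | w permutes {..<N}. f ?xs w) + (\<Sum>w | w permutes {..<N}. f ?xs w) =
    scalar t * ((\<Sum>w | w permutes {..<N}. f ?xs' w) + (\<Sum>w | w permutes {..<N}. f ?xs' w))"
    unfolding double sum_distrib_left by (intro sum.cong) auto
  hence "scalar 2 * hl_num t ?xs = scalar 2 * (scalar t * hl_num t ?xs')"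
    unfolding hl_num_def N f_def two by (simp only: distrib_left)
  thus ?thesis by (subst (asm) scalar_cancel) simp_all
qed

text \<open>Excluding zero and the roots of unity keeps the normalising factors
  \<open>HL_v m t\<close> and the Gaussian binomials invertible. The parameter is later 1/q.\<close>

locale hl_parameter =
  fixes t :: complex
  assumes t_nz: "t \<noteq> 0" and t_pow: "j \<ge> 1 \<Longrightarrow> t ^ j \<noteq> 1"
begin

lemma t_ne_1: "t \<noteq> 1"
  using t_pow[of 1] by simp

lemma HL_v_0 [simp]: "HL_v 0 t = 1"
  by (simp add: HL_v_def)

lemma HL_v_Suc: "HL_v (Suc m) t = HL_v m t * ((1 - t ^ Suc m) / (1 - t))"
  by (simp add: HL_v_def)

lemma HL_v_nz [simp]: "HL_v m t \<noteq> 0"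
  unfolding HL_v_def using t_pow t_ne_1 by (auto simp: prod_zero_iff)

lemma prod_ratio:
  "(\<Prod>i<m. (1 - t ^ Suc (Suc i)) / (1 - t ^ Suc i)) = (1 - t ^ Suc m) / (1 - t)"
proof (induction m)
  case 0 thus ?case using t_ne_1 by simp
next
  case (Suc m)
  have "1 - t ^ Suc m \<noteq> 0" using t_pow[of "Suc m"] by simp
  thus ?case unfolding prod.lessThan_Suc Suc by (simp add: divide_simps)
qed

text \<open>If w is not the identity, some value a + 1 is taken before the value a. The kernel then
  contains the factor x_{a+1} - t x_a, which vanishes at x_i = t^i.\<close>

lemma eval_kernel_zero:
  assumes "w permutes {..<N}" "w \<noteq> id"
  shows "eval_mps (\<lambda>i. t ^ i) (hl_kernel t N w) = 0"
proof -
  have "\<exists>a. Suc a < N \<and> inv_into UNIV w (Suc a) < inv_into UNIV w a"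
  proof (rule ccontr)
    let ?u = "inv_into UNIV w"
    assume "\<not> ?thesis"
    hence *: "?u a \<le> ?u (Suc a)" if "Suc a < N" for a using that by (meson not_less)
    have p: "?u permutes {..<N}" using assms(1) by (rule permutes_inv)
    have lt: "?u a < ?u (Suc a)" if "Suc a < N" for a
      using *[OF that] permutes_inj[OF p] by (metis injD le_neq_implies_less n_not_Suc_n)
    have ge: "a < N \<Longrightarrow> a \<le> ?u a" for a
    proof (induction a)
      case (Suc a) thus ?case using lt[of a] by auto
    qed simp
    \<comment> \<open>A strictly increasing map of {0, ..., N - 1} into itself satisfies a \<le> u a
      and must leave room for N - 1 - a larger values, so it is the identity.\<close>
    have "?u a = a" for a
    proof (cases "a < N")
      case True
      have "?u a + (N - 1 - a) \<le> N - 1"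
      proof -
        have "?u a + d \<le> ?u (a + d)" if "a + d < N" for d
          using that
        proof (induction d)
          case (Suc d) thus ?case using lt[of "a + d"] by auto
        qed simp
        from this[of "N - 1 - a"] True have "?u a + (N - 1 - a) \<le> ?u (N - 1)" by simp
        moreover have "?u (N - 1) < N" using permutes_in_image[OF p, of "N - 1"] True by simp
        ultimately show ?thesis by simp
      qed
      thus ?thesis using ge[OF True] True by simp
    next
      case False thus ?thesis using permutes_not_in[OF p] by simp
    qed
    hence "?u = id" by auto
    hence "w = id" using permutes_inv_inv[OF assms(1)] by (metis inv_id)
    thus False using assms(2) by simp
  qed
  then obtain a where a: "Suc a < N" "inv_into UNIV w (Suc a) < inv_into UNIV w a" by blast
  let ?i = "inv_into UNIV w (Suc a)" and ?j = "inv_into UNIV w a"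
  have w: "w ?i = Suc a" "w ?j = a" using permutes_inverses(1)[OF assms(1)] by auto
  have "?j < N" using permutes_in_image[OF permutes_inv[OF assms(1)], of a] a by simp
  hence "(?i, ?j) \<in> pairs N" using a by (simp add: pairs_def)
  moreover have "eval_mps (\<lambda>i. t ^ i) (var (w ?i) - scalar t * var (w ?j)) = 0"
    unfolding eval_mps_linear_form w by simp
  ultimately have "(\<Prod>x\<in>pairs N. eval_mps (\<lambda>i. t ^ i) (case x of (i, j) \<Rightarrow> var (w i) - scalar t * var (w j))) = 0"
    by (intro prod_zero bexI[of _ "(?i, ?j)"]) auto
  moreover have "eval_mps (\<lambda>i. t ^ i) (hl_kernel t N w) =
      (\<Prod>x\<in>pairs N. eval_mps (\<lambda>i. t ^ i) (case x of (i, j) \<Rightarrow> var (w i) - scalar t * var (w j)))"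
    unfolding hl_kernel_def
    by (rule eval_mps_prod[THEN conjunct2]) (auto simp: eval_mps_linear_form)
  ultimately show ?thesis by simp
qed

lemma eval_kernel_id:
  "eval_mps (\<lambda>i. t ^ i) (hl_kernel s N id) = (\<Prod>j<N. \<Prod>i<j. t ^ i - s * t ^ j)" "fin_supp (hl_kernel s N w)"
proof -
  have "eval_mps (\<lambda>i. t ^ i) (hl_kernel s N id) = (\<Prod>x\<in>pairs N. case x of (i, j) \<Rightarrow> t ^ i - s * t ^ j)"
    unfolding hl_kernel_def
    by (subst eval_mps_prod[THEN conjunct2]) (auto simp: eval_mps_linear_form intro!: prod.cong)
  thus "eval_mps (\<lambda>i. t ^ i) (hl_kernel s N id) = (\<Prod>j<N. \<Prod>i<j. t ^ i - s * t ^ j)" by (simp add: prod_pairs)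
  show "fin_supp (hl_kernel s N w)"
    unfolding hl_kernel_def by (rule eval_mps_prod[THEN conjunct1]) (auto simp: eval_mps_linear_form)
qed

lemma eval_vandermonde_nz: "(\<Prod>j<N. \<Prod>i<j. t ^ i - t ^ j) \<noteq> 0"
proof -
  have "t ^ i - t ^ j \<noteq> 0" if "i < j" for i j
  proof
    assume "t ^ i - t ^ j = 0"
    moreover have "t ^ j = t ^ i * t ^ (j - i)" using that by (simp flip: power_add)
    ultimately have "t ^ (j - i) = 1" using t_nz by simp
    thus False using t_pow[of "j - i"] that by simp
  qed
  thus ?thesis by (auto simp: prod_zero_iff)
qed

text \<open>For the new index j = N the quotients of corresponding factors telescope to (1 -
  t^(N+1)) / (1 - t), once t^i has been taken out of each.\<close>

lemma prod_kernel_ratio: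
  "(\<Prod>j<N. \<Prod>i<j. t ^ i - t * t ^ j) = HL_v N t * (\<Prod>j<N. \<Prod>i<j. t ^ i - t ^ j)"
proof (induction N)
  case (Suc N)
  have "(\<Prod>i<N. t ^ i - t * t ^ N) = (1 - t ^ Suc N) / (1 - t) * (\<Prod>i<N. t ^ i - t ^ N)"
  proof -
    have e: "t ^ i - t ^ N = t ^ i * (1 - t ^ Suc (N - Suc i))" "t ^ i - t * t ^ N = t ^ i * (1 - t ^ Suc (Suc (N - Suc i)))"
      if "i < N" for i
    proof -
      have "t ^ N = t ^ i * t ^ Suc (N - Suc i)" using that power_add[of t i "Suc (N - Suc i)"] by simp
      thus "t ^ i - t ^ N = t ^ i * (1 - t ^ Suc (N - Suc i))" "t ^ i - t * t ^ N = t ^ i * (1 - t ^ Suc (Suc (N - Suc i)))"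
        by (simp_all add: algebra_simps)
    qed
    have nz: "1 - t ^ Suc i \<noteq> 0" for i using t_pow[of "Suc i"] by simp
    have "(\<Prod>i<N. t ^ i - t * t ^ N) = (\<Prod>i<N. (1 - t ^ Suc (Suc (N - Suc i))) / (1 - t ^ Suc (N - Suc i)) * (t ^ i - t ^ N))"
    proof (rule prod.cong[OF refl])
      fix i assume "i \<in> {..<N}"
      thus "t ^ i - t * t ^ N = (1 - t ^ Suc (Suc (N - Suc i))) / (1 - t ^ Suc (N - Suc i)) * (t ^ i - t ^ N)"
        using nz[of "N - Suc i"] e[of i] by simp
    qed
    also have "\<dots> = (\<Prod>i<N. (1 - t ^ Suc (Suc (N - Suc i))) / (1 - t ^ Suc (N - Suc i))) * (\<Prod>i<N. t ^ i - t ^ N)"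
      by (rule prod.distrib)
    also have "(\<Prod>i<N. (1 - t ^ Suc (Suc (N - Suc i))) / (1 - t ^ Suc (N - Suc i))) = (1 - t ^ Suc N) / (1 - t)"
      by (subst prod.nat_diff_reindex[of "\<lambda>i. (1 - t ^ Suc (Suc i)) / (1 - t ^ Suc i)"]) (rule prod_ratio)
    finally show ?thesis .
  qed
  thus ?case by (simp add: Suc HL_v_Suc mult_ac del: power_Suc)
qed simp

text \<open>The sum is antisymmetric of the degree of the Vandermonde product, hence a multiple of
  it. The factor is found by evaluation at x_i = t^i, where only the term of the identity
  survives.\<close>

lemma sum_kernel:
  "(\<Sum>w | w permutes {..<N}. of_int (sign w) * hl_kernel t N w) = scalar (HL_v N t) * vandermonde N"
proof -
  let ?f = "\<Sum>w | w permutes {..<N}. of_int (sign w) * hl_kernel t N w"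
  let ?a = "\<lambda>i. t ^ i"
  have "rename_vars s ?f = of_int (sign s) * ?f" if s: "s permutes {..<N}" for s
  proof -
    have "rename_vars s ?f = (\<Sum>w | w permutes {..<N}. of_int (sign w) * hl_kernel t N (s \<circ> w))"
      using permutes_bij[OF s] by (simp add: rename_vars_sum of_int_mps rename_vars_scalar rename_kernel)
    also have "\<dots> = (\<Sum>w | w permutes {..<N}. of_int (sign s) * (of_int (sign (s \<circ> w)) * hl_kernel t N (s \<circ> w)))"
      by (rule sum.cong) (use s in \<open>auto simp: sign_comp_permutes sign_idempotent simp flip: mult.assoc of_int_mult\<close>)
    also have "\<dots> = of_int (sign s) * ?f"
      unfolding sum_distrib_left
      by (rule sum.reindex_bij_witness[of _ "\<lambda>w. inv_into UNIV s \<circ> w" "\<lambda>w. s \<circ> w"])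
         (use s in \<open>auto simp: permutes_compose permutes_inv permutes_inv_o comp_assoc[symmetric]\<close>)
    finally show ?thesis .
  qed
  hence alt: "alternating N ?f" by (simp add: alternating_def)
  have hp: "hpoly N (\<Sum>{..<N}) ?f"
    unfolding of_int_mps by (intro hpoly_sum hpoly_scalar hpoly_kernel) auto
  have hv: "hpoly N (\<Sum>{..<N}) (vandermonde N)"
    unfolding vandermonde_eq_kernel by (rule hpoly_kernel) (rule permutes_id)
  obtain \<delta> where d: "scalar (mcoeff (vandermonde N) \<delta>) * ?f = scalar (mcoeff ?f \<delta>) * vandermonde N"
    "mcoeff (vandermonde N) \<delta> = 0 \<longrightarrow> vandermonde N = 0"
    using alternating_unique[OF hp hv alt alternating_vandermonde] by blast
  have ev: "fin_supp (vandermonde N)" "eval_mps ?a (vandermonde N) = (\<Prod>j<N. \<Prod>i<j. t ^ i - t ^ j)"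
    unfolding vandermonde_eq_kernel using eval_kernel_id[of 1 N] by auto
  have g: "mcoeff (vandermonde N) \<delta> \<noteq> 0"
    using d(2) ev(2) eval_vandermonde_nz[of N] by auto
  have ff: "fin_supp ?f" "eval_mps ?a ?f = (\<Prod>j<N. \<Prod>i<j. t ^ i - t * t ^ j)"
  proof -
    have fs: "fin_supp (of_int (sign w) * hl_kernel t N w)" for w :: "nat \<Rightarrow> nat"
      unfolding of_int_mps by (intro eval_mps_scalar_mult eval_kernel_id)
    thus "fin_supp ?f" by (intro eval_mps_sum[THEN conjunct1])
    have "eval_mps ?a ?f = (\<Sum>w | w permutes {..<N}. eval_mps ?a (of_int (sign w) * hl_kernel t N w))"
      using fs by (intro eval_mps_sum[THEN conjunct2])
    also have "\<dots> = (\<Sum>w\<in>{id}. eval_mps ?a (of_int (sign w) * hl_kernel t N w))"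
      by (rule sum.mono_neutral_right)
         (auto simp: permutes_id finite_permutations of_int_mps eval_mps_scalar_mult eval_kernel_id eval_kernel_zero)
    also have "\<dots> = (\<Prod>j<N. \<Prod>i<j. t ^ i - t * t ^ j)" by (simp add: eval_kernel_id sign_id)
    finally show "eval_mps ?a ?f = (\<Prod>j<N. \<Prod>i<j. t ^ i - t * t ^ j)" .
  qed
  have "mcoeff (vandermonde N) \<delta> * eval_mps ?a ?f = mcoeff ?f \<delta> * eval_mps ?a (vandermonde N)"
    using arg_cong[OF d(1), of "eval_mps ?a"] ff ev by (simp add: eval_mps_scalar_mult)
  hence "mcoeff ?f \<delta> = mcoeff (vandermonde N) \<delta> * HL_v N t"
    unfolding ff ev prod_kernel_ratio using eval_vandermonde_nz[of N] by (simp add: mult_ac)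
  hence "scalar (mcoeff (vandermonde N) \<delta>) * ?f = scalar (mcoeff (vandermonde N) \<delta>) * (scalar (HL_v N t) * vandermonde N)"
    using d(1) by (simp only: scalar_mult mult.assoc)
  thus ?thesis by (simp only: scalar_cancel[OF g])
qed

lemma hl_num_zeros: "hl_num t (replicate N 0) = scalar (HL_v N t) * vandermonde N"
  using sum_kernel[of N] by (simp add: hl_num_def)

subsection \<open>Multiplication by elementary symmetric functions\<close>

text \<open>The Gaussian binomial coefficient in t: \<open>HL_v m t\<close> is the t-analogue of the
  factorial of m.\<close>

definition gbin :: "nat \<Rightarrow> nat \<Rightarrow> complex" where
  "gbin m k = (if k \<le> m then HL_v m t / (HL_v k t * HL_v (m - k) t) else 0)"

lemma gbin_0 [simp]: "gbin m 0 = 1" and gbin_self [simp]: "gbin m m = 1"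
  by (auto simp: gbin_def)

lemma gbin_nz: "k \<le> m \<Longrightarrow> gbin m k \<noteq> 0"
  by (simp add: gbin_def)

text \<open>The t-analogue of Pascal's rule. With m = k + d + 1 it comes from 1 - t^(m+1) = (1 -
  t^(k+1)) + t^(k+1) (1 - t^(d+1)).\<close>

lemma gbin_Suc_Suc: "gbin (Suc m) (Suc k) = gbin m k + t ^ Suc k * gbin m (Suc k)"
proof -
  consider "k > m" | "k = m" | "Suc k \<le> m" by linarith
  thus ?thesis
  proof cases
    case 3
    define d where "d = m - Suc k"
    have m: "m = Suc (k + d)" using 3 by (simp add: d_def)
    have nz: "1 - t ^ Suc i \<noteq> 0" "1 - t \<noteq> 0" for i using t_pow[of "Suc i"] t_ne_1 by auto
    have e: "m - k = Suc d" "m - Suc k = d" "Suc m - Suc k = Suc d" using m by auto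
    have "1 - t ^ Suc m = (1 - t ^ Suc k) + t ^ Suc k * (1 - t ^ Suc d)"
      unfolding m by (simp add: algebra_simps power_add)
    note split = this
    have "A * (M / u) / (a * (x / u) * (b * (y / u))) = A / (a * (b * (y / u))) + p * (A / (a * (x / u) * b))"
      if "M = x + p * y" "u \<noteq> 0" "a \<noteq> 0" "b \<noteq> 0" "x \<noteq> 0" "y \<noteq> 0" for A M u a b x y p :: complex
      by (simp add: that(2-) mult_ac that(1) distrib_left add_divide_distrib)
    note gen = this
    have "HL_v m t * ((1 - t ^ Suc m) / (1 - t)) / (HL_v k t * ((1 - t ^ Suc k) / (1 - t)) * (HL_v d t * ((1 - t ^ Suc d) / (1 - t))))
      = HL_v m t / (HL_v k t * (HL_v d t * ((1 - t ^ Suc d) / (1 - t)))) + t ^ Suc k * (HL_v m t / (HL_v k t * ((1 - t ^ Suc k) / (1 - t)) * HL_v d t))"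
      by (rule gen[OF split nz(2) HL_v_nz HL_v_nz nz(1)[of k] nz(1)[of d]])
    moreover have "k \<le> m" using 3 by simp
    ultimately show ?thesis
      using 3 by (simp only: gbin_def e HL_v_Suc[of m] HL_v_Suc[of k] HL_v_Suc[of d] if_True Suc_le_mono)
  qed (auto simp: gbin_def)
qed

text \<open>Every entry of the second list is either kept or raised by one, and a choice that raises
  r entries has weight W r. The first list holds the entries already decided. This is the product of
  \<open>hl_num\<close> with a weighted sum of elementary functions, see
  \<open>addsum_pieri\<close>.\<close>

fun addsum :: "(nat \<Rightarrow> complex) \<Rightarrow> nat list \<Rightarrow> nat list \<Rightarrow> nat mps" where
  "addsum W ys [] = scalar (W 0) * hl_num t ys"
| "addsum W ys (x # xs) = addsum W (ys @ [x]) xs + addsum (\<lambda>r. W (Suc r)) (ys @ [Suc x]) xs"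

lemma addsum_scale:
  "(\<And>us. hl_num t (A @ us) = scalar s * hl_num t (B @ us)) \<Longrightarrow> addsum W A xs = scalar s * addsum W B xs"
proof (induction xs arbitrary: W A B)
  case Nil thus ?case using Nil[of "[]"] by (simp add: mult.left_commute)
next
  case (Cons x xs)
  have "addsum W (A @ [y]) xs = scalar s * addsum W (B @ [y]) xs" for W y
    by (rule Cons.IH) (use Cons.prems[of "y # us" for us] in simp)
  thus ?case by (simp add: distrib_left)
qed

lemma hl_num_move: "hl_num t (ys @ c # replicate k (Suc c) @ zs) = scalar (t ^ k) * hl_num t (ys @ replicate k (Suc c) @ c # zs)"
proof (induction k arbitrary: ys)
  case (Suc k)
  have "hl_num t (ys @ c # replicate (Suc k) (Suc c) @ zs) = scalar t * hl_num t ((ys @ [Suc c]) @ c # replicate k (Suc c) @ zs)"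
    using hl_num_straighten[of t ys c] by simp
  also have "\<dots> = scalar t * (scalar (t ^ k) * hl_num t ((ys @ [Suc c]) @ replicate k (Suc c) @ c # zs))"
    by (simp only: Suc)
  finally show ?case by (simp only: power_Suc scalar_mult mult.assoc replicate_Suc append.simps append_assoc)
qed simp

text \<open>Inside a block of equal entries, straightening moves the raised entries to the front at
  the cost of a power of t. The rule \<open>gbin_Suc_Suc\<close> collects these powers into a
  Gaussian binomial.\<close>

lemma addsum_block:
  "addsum W ys (replicate m c @ xs) =
    (\<Sum>k\<le>m. scalar (gbin m k) * addsum (\<lambda>r. W (k + r)) (ys @ replicate k (Suc c) @ replicate (m - k) c) xs)"
proof (induction m arbitrary: W ys)
  case (Suc m)
  let ?A = "\<lambda>k. addsum (\<lambda>r. W (k + r)) (ys @ replicate k (Suc c) @ replicate (Suc m - k) c) xs"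
  have "addsum W (ys @ [c]) (replicate m c @ xs) = (\<Sum>k\<le>m. scalar (t ^ k * gbin m k) * ?A k)"
    unfolding Suc
  proof (rule sum.cong[OF refl])
    fix k assume k: "k \<in> {..m}"
    have "addsum (\<lambda>r. W (k + r)) ((ys @ [c]) @ replicate k (Suc c) @ replicate (m - k) c) xs = scalar (t ^ k) * ?A k"
      by (rule addsum_scale) (use k hl_num_move[of ys c k] in \<open>simp add: Suc_diff_le\<close>)
    thus "scalar (gbin m k) * addsum (\<lambda>r. W (k + r)) ((ys @ [c]) @ replicate k (Suc c) @ replicate (m - k) c) xs =
      scalar (t ^ k * gbin m k) * ?A k" by (simp only: scalar_mult mult_ac)
  qed
  also have "\<dots> = (\<Sum>k\<le>Suc m. scalar (t ^ k * gbin m k) * ?A k)" by (simp add: gbin_def)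
  also have "\<dots> = ?A 0 + (\<Sum>k\<le>m. scalar (t ^ Suc k * gbin m (Suc k)) * ?A (Suc k))"
    by (subst sum.atMost_Suc_shift) simp
  finally have 1: "addsum W (ys @ [c]) (replicate m c @ xs) = \<dots>" .
  have 2: "addsum (\<lambda>r. W (Suc r)) (ys @ [Suc c]) (replicate m c @ xs) = (\<Sum>k\<le>m. scalar (gbin m k) * ?A (Suc k))"
    unfolding Suc by simp
  have "addsum W ys (replicate (Suc m) c @ xs) = ?A 0 + (\<Sum>k\<le>m. scalar (gbin (Suc m) (Suc k)) * ?A (Suc k))"
    using 1 2 by (simp add: gbin_Suc_Suc scalar_add distrib_right sum.distrib)
  also have "\<dots> = (\<Sum>k\<le>Suc m. scalar (gbin (Suc m) k) * ?A k)" by (subst sum.atMost_Suc_shift) simp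
  finally show ?case .
qed simp

end

section \<open>Restriction to finitely many variables, and elementary functions as sums over
  subsets\<close>

lemma truncate_vars_add: "truncate_vars n (f + g) = truncate_vars n f + truncate_vars n g"
  and truncate_vars_diff: "truncate_vars n (f - g) = truncate_vars n f - truncate_vars n g"
  and truncate_vars_0 [simp]: "truncate_vars n 0 = 0"
  and truncate_vars_1 [simp]: "truncate_vars n 1 = 1"
  and truncate_vars_scalar: "truncate_vars n (scalar c * f) = scalar c * truncate_vars n f"
  by (rule mps_eqI, simp add: truncate_vars.rep_eq)+

lemma truncate_vars_sum: "truncate_vars n (sum f A) = (\<Sum>x\<in>A. truncate_vars n (f x))"
  by (induction A rule: infinite_finite_induct) (auto simp: truncate_vars_add)

lemma truncate_vars_mult: "truncate_vars n (f * g) = truncate_vars n f * truncate_vars n g"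
proof (rule mps_eqI)
  fix m
  show "mcoeff (truncate_vars n (f * g)) m = mcoeff (truncate_vars n f * truncate_vars n g) m"
  proof (cases "set_mset m \<subseteq> {..<n}")
    case True
    have "set_mset a \<subseteq> {..<n}" "set_mset (m - a) \<subseteq> {..<n}" if "a \<subseteq># m" for a
      using True that by (auto dest: mset_subset_eqD in_diffD)
    thus ?thesis using True by (auto simp: truncate_vars.rep_eq times_mps.rep_eq intro!: sum.cong)
  next
    case False
    have "\<not> set_mset a \<subseteq> {..<n} \<or> \<not> set_mset (m - a) \<subseteq> {..<n}" if "a \<subseteq># m" for a
      using False that by (metis Un_subset_iff set_mset_union subset_mset.add_diff_inverse)
    hence "mcoeff (truncate_vars n f * truncate_vars n g) m = 0"
      unfolding times_mps.rep_eq by (intro sum.neutral) (auto simp: truncate_vars.rep_eq)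
    thus ?thesis using False by (simp add: truncate_vars.rep_eq)
  qed
qed

text \<open>The generating combination of elementary functions of the variables in S; an indicator
  weight W selects one degree.\<close>

definition esum :: "(nat \<Rightarrow> complex) \<Rightarrow> nat set \<Rightarrow> nat mps" where
  "esum W S = (\<Sum>I\<in>Pow S. scalar (W (card I)) * (\<Prod>i\<in>I. var i))"

lemma esum_insert:
  assumes "finite S" "a \<notin> S"
  shows "esum W (insert a S) = esum W S + var a * esum (\<lambda>r. W (Suc r)) S"
proof -
  have "esum W (insert a S) = esum W S + (\<Sum>I\<in>insert a ` Pow S. scalar (W (card I)) * (\<Prod>i\<in>I. var i))"
    unfolding esum_def Pow_insert using assms by (intro sum.union_disjoint) auto
  also have "(\<Sum>I\<in>insert a ` Pow S. scalar (W (card I)) * (\<Prod>i\<in>I. var i)) =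
      (\<Sum>I\<in>Pow S. var a * (scalar (W (Suc (card I))) * (\<Prod>i\<in>I. var i)))"
  proof (rule sum.reindex_cong[of "insert a"])
    show "inj_on (insert a) (Pow S)" using assms(2) by (intro inj_onI) (metis Pow_iff insert_ident subsetD)
    fix I assume "I \<in> Pow S"
    hence "a \<notin> I" "finite I" using assms by (auto intro: finite_subset)
    thus "scalar (W (card (insert a I))) * (\<Prod>i\<in>insert a I. var i) = var a * (scalar (W (Suc (card I))) * (\<Prod>i\<in>I. var i))"
      by (simp add: mult.left_commute)
  qed simp
  finally show ?thesis by (simp only: esum_def sum_distrib_left)
qed

lemma prod_var: "finite I \<Longrightarrow> (\<Prod>i\<in>I. var i) = monom_mps (mset_set I)"
proof (induction I rule: finite_induct)
  case empty show ?case by (rule mps_eqI) (simp add: monom_mps.rep_eq)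
qed (simp add: var_eq_monom monom_mps_mult)

lemma esum_elem_e: "esum (\<lambda>r. if r = m then 1 else 0) {..<n} = truncate_vars n (elem_e m)"
proof (rule mps_eqI)
  fix u :: "nat multiset"
  have delta: "(\<Sum>I\<in>Pow {..<n}. if I = s \<and> b then 1 else 0) = (if s \<subseteq> {..<n} \<and> b then 1 else 0 :: complex)" for s b
    by (cases b) simp_all
  have "mcoeff (esum (\<lambda>r. if r = m then 1 else 0) {..<n}) u =
      (\<Sum>I\<in>Pow {..<n}. if I = set_mset u \<and> u = mset_set (set_mset u) \<and> size u = m then 1 else 0)"
    unfolding esum_def mcoeff_sum mcoeff_scalar_mult
  proof (rule sum.cong[OF refl])
    fix I assume "I \<in> Pow {..<n}"
    hence I: "finite I" by (auto intro: finite_subset)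
    have "mset_set I = u \<longleftrightarrow> I = set_mset u \<and> u = mset_set (set_mset u)" using I by auto
    thus "(if card I = m then 1 else 0) * mcoeff (\<Prod>i\<in>I. var i) u =
      (if I = set_mset u \<and> u = mset_set (set_mset u) \<and> size u = m then 1 else 0)"
      using I by (auto simp: prod_var monom_mps.rep_eq)
  qed
  also have "\<dots> = (if set_mset u \<subseteq> {..<n} \<and> u = mset_set (set_mset u) \<and> size u = m then 1 else 0)"
    by (rule delta)
  also have "u = mset_set (set_mset u) \<longleftrightarrow> (\<forall>i. count u i \<le> 1)"
  proof
    assume "u = mset_set (set_mset u)"
    thus "\<forall>i. count u i \<le> 1" by (metis count_mset_set(1,3) finite_set_mset le_numeral_extra(4) zero_le)
  next
    assume a: "\<forall>i. count u i \<le> 1"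
    show "u = mset_set (set_mset u)"
    proof (rule multiset_eqI)
      fix i show "count u i = count (mset_set (set_mset u)) i"
      proof (cases "i \<in># u")
        case True
        hence "count u i = 1" using spec[OF a, of i] by (metis count_greater_eq_one_iff le_antisym)
        thus ?thesis using True by simp
      qed (simp add: not_in_iff)
    qed
  qed
  finally show "mcoeff (esum (\<lambda>r. if r = m then 1 else 0) {..<n}) u = mcoeff (truncate_vars n (elem_e m)) u"
    by (simp add: truncate_vars.rep_eq elem_e.rep_eq conj_commute)
qed

context hl_parameter
begin

text \<open>Raising the entry at position i multiplies the term of w by \<open>var (w i)\<close>. So
  the choices still open contribute a sum over the subsets of the variables w i with i beyond the
  processed prefix.\<close>

lemma addsum_terms:
  assumes "N = length ys + length xs"
  shows "addsum W ys xs = (\<Sum>w | w permutes {..<N}. of_int (sign w) * (\<Prod>i<N. var (w i) ^ ((ys @ xs) ! i)) *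
    hl_kernel t N w * esum W (w ` {length ys..<N}))"
  using assms
proof (induction xs arbitrary: W ys)
  case Nil
  thus ?case by (simp add: hl_num_def esum_def sum_distrib_left sum_distrib_right mult_ac)
next
  case (Cons x xs)
  let ?l = "length ys"
  let ?P = "\<lambda>zs w. \<Prod>i<N. var (w i) ^ (zs ! i) :: nat mps"
  have l: "?l < N" using Cons.prems by simp
  note IH = Cons.IH[of "ys @ [x]" W] Cons.IH[of "ys @ [Suc x]" "\<lambda>r. W (Suc r)"]
  have len: "N = length (ys @ [y]) + length xs" for y using Cons.prems by simp
  have P: "?P ((ys @ [Suc x]) @ xs) w = var (w ?l) * ?P (ys @ x # xs) w" for w :: "nat \<Rightarrow> nat"
  proof -
    have r: "?P zs w = var (w ?l) ^ (zs ! ?l) * (\<Prod>i\<in>{..<N} - {?l}. var (w i) ^ (zs ! i))" for zs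
      using l by (intro prod.remove) auto
    have "(\<Prod>i\<in>{..<N} - {?l}. var (w i) ^ (((ys @ [Suc x]) @ xs) ! i)) = (\<Prod>i\<in>{..<N} - {?l}. var (w i) ^ ((ys @ x # xs) ! i) :: nat mps)"
      by (rule prod.cong) (auto simp: nth_append nth_Cons split: nat.splits)
    thus ?thesis unfolding r[of "(ys @ [Suc x]) @ xs"] r[of "ys @ x # xs"] by (simp add: nth_append mult.assoc)
  qed
  have E: "esum W (w ` {?l..<N}) = esum W (w ` {Suc ?l..<N}) + var (w ?l) * esum (\<lambda>r. W (Suc r)) (w ` {Suc ?l..<N})"
    if "w permutes {..<N}" for w
  proof -
    have "{?l..<N} = insert ?l {Suc ?l..<N}" using l by auto
    hence "w ` {?l..<N} = insert (w ?l) (w ` {Suc ?l..<N})" by simp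
    moreover have "w ?l \<notin> w ` {Suc ?l..<N}" using permutes_inj[OF that] by (simp add: inj_image_mem_iff)
    ultimately show ?thesis by (simp add: esum_insert)
  qed
  show ?case
    unfolding addsum.simps IH(1)[OF len] IH(2)[OF len] P sum.distrib[symmetric]
    by (rule sum.cong[OF refl]) (simp add: E algebra_simps)
qed

text \<open>With an empty prefix the subsets range over all variables, whatever w is, and the factor
  can be taken out of the sum over w.\<close>

lemma addsum_pieri: "addsum W [] xs = hl_num t xs * esum W {..<length xs}"
proof -
  have "w ` {0..<length xs} = {..<length xs}" if "w permutes {..<length xs}" for w
    using permutes_image[OF that] by (simp add: lessThan_atLeast0)
  thus ?thesis
    by (subst addsum_terms[OF refl]) (auto simp: hl_num_def sum_distrib_right intro!: sum.cong)
qed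

end

text \<open>
  A partition with parts at most \<open>C\<close> is encoded by the multiplicities \<open>m i\<close> of its parts \<open>i\<close>;
  \<open>blocks C m\<close> also has \<open>m 0\<close> zeros. Adding a vertical strip raises \<open>k i\<close> of the parts \<open>i\<close> by one.
\<close>

primrec parts :: "nat \<Rightarrow> (nat \<Rightarrow> nat) \<Rightarrow> nat list" where
  "parts 0 m = []"
| "parts (Suc C) m = replicate (m (Suc C)) (Suc C) @ parts C m"

definition blocks :: "nat \<Rightarrow> (nat \<Rightarrow> nat) \<Rightarrow> nat list" where
  "blocks C m = parts C m @ replicate (m 0) 0"

primrec raised :: "nat \<Rightarrow> (nat \<Rightarrow> nat) \<Rightarrow> (nat \<Rightarrow> nat) \<Rightarrow> nat list" where
  "raised 0 m k = replicate (k 0) 1 @ replicate (m 0 - k 0) 0"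
| "raised (Suc C) m k = replicate (k (Suc C)) (Suc (Suc C)) @ replicate (m (Suc C) - k (Suc C)) (Suc C) @ raised C m k"

definition raise :: "nat \<Rightarrow> (nat \<Rightarrow> nat) \<Rightarrow> (nat \<Rightarrow> nat) \<Rightarrow> nat \<Rightarrow> nat" where
  "raise C m k i = (if i \<le> C then m i - k i else 0) + (if 1 \<le> i \<and> i \<le> Suc C then k (i - 1) else 0)"

lemma parts_cong: "(\<And>i. 1 \<le> i \<Longrightarrow> i \<le> C \<Longrightarrow> m i = m' i) \<Longrightarrow> parts C m = parts C m'"
  by (induction C) auto

lemma raised_cong: "(\<And>i. i \<le> C \<Longrightarrow> m i = m' i \<and> k i = k' i) \<Longrightarrow> raised C m k = raised C m' k'"
  by (induction C) auto

lemma raised_eq_blocks: "raised C m k = blocks (Suc C) (raise C m k)"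
proof (induction C)
  case 0 show ?case by (simp add: blocks_def raise_def)
next
  case (Suc C)
  have "parts C (raise (Suc C) m k) = parts C (raise C m k)" by (rule parts_cong) (auto simp: raise_def)
  moreover have "raise (Suc C) m k 0 = raise C m k 0" "raise (Suc C) m k (Suc C) = m (Suc C) - k (Suc C) + k C"
    "raise C m k (Suc C) = k C" "raise (Suc C) m k (Suc (Suc C)) = k (Suc C)" by (auto simp: raise_def)
  ultimately show ?case unfolding raised.simps Suc by (simp add: blocks_def replicate_add)
qed

lemma length_parts: "length (parts C m) = (\<Sum>i=1..C. m i)"
  by (induction C) (auto simp: add.commute)

lemma blocks_Suc: "blocks (Suc C) m = replicate (m (Suc C)) (Suc C) @ blocks C m"
  by (simp add: blocks_def)

lemma blocks_0: "blocks 0 m = replicate (m 0) 0"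
  by (simp add: blocks_def)

lemma sum_PiE_insert:
  assumes "finite S" "a \<notin> S"
  shows "(\<Sum>k\<in>PiE (insert a S) T. f k) = (\<Sum>x\<in>T a. \<Sum>k\<in>PiE S T. f (k(a := x)))"
proof -
  have "(\<Sum>k\<in>PiE (insert a S) T. f k) = (\<Sum>(x, k)\<in>T a \<times> PiE S T. f (k(a := x)))"
    unfolding PiE_insert_eq
    by (subst sum.reindex) (use inj_combinator[OF assms(2), of T] in \<open>auto simp: case_prod_unfold intro!: sum.cong\<close>)
  thus ?thesis by (simp add: sum.cartesian_product)
qed

context hl_parameter
begin

lemma addsum_blocks:
  "addsum W ys (blocks C m) = (\<Sum>k\<in>PiE {..C} (\<lambda>i. {..m i}).
     scalar (W (\<Sum>i\<le>C. k i) * (\<Prod>i\<le>C. gbin (m i) (k i))) * hl_num t (ys @ raised C m k))"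
proof (induction C arbitrary: W ys)
  case 0
  have e: "(\<Sum>k\<in>PiE {..0} T. f k) = (\<Sum>x\<in>T 0. f ((\<lambda>_. undefined)(0 := x)))"
    for T :: "nat \<Rightarrow> nat set" and f :: "(nat \<Rightarrow> nat) \<Rightarrow> nat mps"
    using sum_PiE_insert[of "{}" 0 f T] by (simp add: fun_upd_def)
  have s: "(\<Sum>i\<le>0. g i) = g (0 :: nat)" "(\<Prod>i\<le>0. h i) = h (0 :: nat)" for g :: "nat \<Rightarrow> nat" and h :: "nat \<Rightarrow> complex"
    by simp_all
  have "addsum W ys (blocks 0 m) = addsum W ys (replicate (m 0) 0 @ [])" by (simp add: blocks_0)
  thus ?case unfolding addsum_block e
    by (simp only: addsum.simps s raised.simps fun_upd_same scalar_mult mult_ac add_0_right One_nat_def)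
next
  case (Suc C)
  have "addsum W ys (blocks (Suc C) m) = (\<Sum>x\<le>m (Suc C). \<Sum>k\<in>PiE {..C} (\<lambda>i. {..m i}).
     scalar (gbin (m (Suc C)) x) * (scalar (W (x + (\<Sum>i\<le>C. k i)) * (\<Prod>i\<le>C. gbin (m i) (k i))) *
        hl_num t (ys @ replicate x (Suc (Suc C)) @ replicate (m (Suc C) - x) (Suc C) @ raised C m k)))"
    unfolding blocks_Suc addsum_block Suc sum_distrib_left by simp
  also have "\<dots> = (\<Sum>x\<le>m (Suc C). \<Sum>k\<in>PiE {..C} (\<lambda>i. {..m i}).
     scalar (W (\<Sum>i\<le>Suc C. (k(Suc C := x)) i) * (\<Prod>i\<le>Suc C. gbin (m i) ((k(Suc C := x)) i))) *
        hl_num t (ys @ raised (Suc C) m (k(Suc C := x))))"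
  proof (intro sum.cong refl)
    fix x k
    have r: "raised C m (k(Suc C := x)) = raised C m k" by (rule raised_cong) auto
    have "(\<Sum>i\<le>C. (k(Suc C := x)) i) = (\<Sum>i\<le>C. k i)"
      "(\<Prod>i\<le>C. gbin (m i) ((k(Suc C := x)) i)) = (\<Prod>i\<le>C. gbin (m i) (k i))"
      by (auto intro!: sum.cong prod.cong)
    hence a: "(\<Sum>i\<le>Suc C. (k(Suc C := x)) i) = x + (\<Sum>i\<le>C. k i)"
      "(\<Prod>i\<le>Suc C. gbin (m i) ((k(Suc C := x)) i)) = gbin (m (Suc C)) x * (\<Prod>i\<le>C. gbin (m i) (k i))"
      by simp_all
    have b: "raised (Suc C) m (k(Suc C := x)) = replicate x (Suc (Suc C)) @ replicate (m (Suc C) - x) (Suc C) @ raised C m k"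
      using r by simp
    show "scalar (gbin (m (Suc C)) x) * (scalar (W (x + (\<Sum>i\<le>C. k i)) * (\<Prod>i\<le>C. gbin (m i) (k i))) *
        hl_num t (ys @ replicate x (Suc (Suc C)) @ replicate (m (Suc C) - x) (Suc C) @ raised C m k)) =
      scalar (W (\<Sum>i\<le>Suc C. (k(Suc C := x)) i) * (\<Prod>i\<le>Suc C. gbin (m i) ((k(Suc C := x)) i))) *
        hl_num t (ys @ raised (Suc C) m (k(Suc C := x)))"
      unfolding a b scalar_mult by (simp only: mult_ac)
  qed
  also have "\<dots> = (\<Sum>k\<in>PiE (insert (Suc C) {..C}) (\<lambda>i. {..m i}).
     scalar (W (\<Sum>i\<le>Suc C. k i) * (\<Prod>i\<le>Suc C. gbin (m i) (k i))) * hl_num t (ys @ raised (Suc C) m k))"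
    by (subst sum_PiE_insert) auto
  finally show ?case by (simp add: atMost_Suc)
qed

theorem hl_num_pieri:
  assumes "n = (\<Sum>i\<le>C. m i)"
  shows "hl_num t (blocks C m) * truncate_vars n (elem_e r) =
    (\<Sum>k | k \<in> PiE {..C} (\<lambda>i. {..m i}) \<and> (\<Sum>i\<le>C. k i) = r.
       scalar (\<Prod>i\<le>C. gbin (m i) (k i)) * hl_num t (blocks (Suc C) (raise C m k)))"
proof -
  have "length (blocks C m) = n"
    using assms by (simp add: blocks_def length_parts atMost_atLeast0 sum.atLeast_Suc_atMost)
  hence "hl_num t (blocks C m) * truncate_vars n (elem_e r) = addsum (\<lambda>s. if s = r then 1 else 0) [] (blocks C m)"
    by (simp add: addsum_pieri esum_elem_e)
  also have "\<dots> = (\<Sum>k\<in>PiE {..C} (\<lambda>i. {..m i}). if (\<Sum>i\<le>C. k i) = r then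
       scalar (\<Prod>i\<le>C. gbin (m i) (k i)) * hl_num t (blocks (Suc C) (raise C m k)) else 0)"
    unfolding addsum_blocks by (rule sum.cong) (auto simp: raised_eq_blocks)
  also have "\<dots> = (\<Sum>k | k \<in> PiE {..C} (\<lambda>i. {..m i}) \<and> (\<Sum>i\<le>C. k i) = r.
       scalar (\<Prod>i\<le>C. gbin (m i) (k i)) * hl_num t (blocks (Suc C) (raise C m k)))"
    by (subst sum.inter_filter[symmetric]) (auto intro!: finite_PiE)
  finally show ?thesis .
qed

end

subsection \<open>Existence and the Pieri formula\<close>

lemma mcoeff_var_mult: "mcoeff (var i * f) m = (if i \<in># m then mcoeff f (m - {#i#}) else 0)"
proof -
  have "mcoeff (var i * f) m = (\<Sum>a\<in>(if i \<in># m then {{#i#}} else {}). mcoeff (var i) a * mcoeff f (m - a))"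
    by (rule mcoeff_mult_support) (auto simp: var.rep_eq split: if_splits)
  thus ?thesis by (simp add: var.rep_eq)
qed

text \<open>The equation says that a coefficient of f does not change when one x_j in the monomial
  is replaced by x_i. After all x_j are used up, one more comparison gives zero.\<close>

lemma var_diff_cancel:
  assumes "i \<noteq> j" "(var i - var j) * f = 0"
  shows "f = 0"
proof (rule mps_eqI)
  fix m
  have *: "(if i \<in># m then mcoeff f (m - {#i#}) else 0) = (if j \<in># m then mcoeff f (m - {#j#}) else 0)" for m
    using arg_cong[OF assms(2), of "\<lambda>f. mcoeff f m"] by (simp add: left_diff_distrib mcoeff_var_mult)
  show "mcoeff f m = mcoeff 0 m"
  proof (induction "count m j" arbitrary: m)
    case 0
    hence "j \<notin># m" by (simp add: not_in_iff)
    thus ?case using *[of "add_mset i m"] assms(1) by auto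
  next
    case (Suc k)
    have "j \<in># m" using Suc.hyps(2) by (simp flip: count_greater_zero_iff)
    hence "mcoeff f m = mcoeff f (add_mset i m - {#j#})" using *[of "add_mset i m"] by auto
    also have "\<dots> = 0" using Suc.hyps(1)[of "add_mset i m - {#j#}"] Suc.hyps(2) assms(1) by simp
    finally show ?case by simp
  qed
qed

lemma vandermonde_cancel:
  assumes "vandermonde n * f = 0" shows "f = 0"
proof -
  have "finite A \<Longrightarrow> A \<subseteq> pairs n \<Longrightarrow> (\<Prod>(i, j)\<in>A. var i - var j) * f = 0 \<Longrightarrow> f = 0" for A
  proof (induction A rule: finite_induct)
    case (insert x A)
    obtain i j where x: "x = (i, j)" by (cases x)
    have "(var i - var j) * ((\<Prod>(i, j)\<in>A. var i - var j) * f) = 0"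
      using insert.prems insert.hyps by (simp add: x mult.assoc)
    moreover have "i \<noteq> j" using insert.prems by (auto simp: x pairs_def)
    ultimately have "(\<Prod>(i, j)\<in>A. var i - var j) * f = 0" by (rule var_diff_cancel[rotated])
    thus ?case using insert by auto
  qed simp
  from this[of "pairs n"] assms show ?thesis by (simp add: vandermonde_def prod_pairs)
qed

lemma truncate_vars_eqI:
  assumes "\<And>n. n \<ge> N \<Longrightarrow> truncate_vars n f = truncate_vars n g"
  shows "f = g"
proof (rule mps_eqI)
  fix m :: "nat multiset"
  obtain b where b: "set_mset m \<subseteq> {..<b}" by (metis finite_nat_iff_bounded finite_set_mset)
  have "mcoeff (truncate_vars (max N b) f) m = mcoeff (truncate_vars (max N b) g) m"
    using assms[of "max N b"] by simp
  moreover have "set_mset m \<subseteq> {..<max N b}" using b by auto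
  ultimately show "mcoeff f m = mcoeff g m" by (simp add: truncate_vars.rep_eq)
qed

lemma count_parts: "count (mset (parts C m)) i = (if 1 \<le> i \<and> i \<le> C then m i else 0)"
  by (induction C) auto

lemma set_parts: "set (parts C m) = {i. 1 \<le> i \<and> i \<le> C \<and> m i > 0}"
proof -
  have *: "i \<in> set (parts C m) \<longleftrightarrow> count (mset (parts C m)) i > 0" for i by simp
  show ?thesis
  proof (rule Set.set_eqI)
    fix i show "i \<in> set (parts C m) \<longleftrightarrow> i \<in> {i. 1 \<le> i \<and> i \<le> C \<and> m i > 0}"
      using *[of i] unfolding count_parts by (auto split: if_splits)
  qed
qed

lemma sorted_parts: "sorted_wrt (\<ge>) (parts C m)"
proof (induction C)
  case (Suc C)
  have "sorted_wrt (\<ge>) (replicate k (c :: nat))" for k c by (induction k) auto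
  thus ?case using Suc by (auto simp: sorted_wrt_append set_parts)
qed simp

lemma is_partition_parts [simp]: "is_partition (parts C m)"
  by (auto simp: is_partition_def sorted_parts set_parts)

lemma partition_eqI:
  assumes "is_partition l" "is_partition l'" "mset l = mset l'"
  shows "l = l'"
proof -
  have s: "sorted (rev l)" "sorted (rev l')"
    using assms by (simp_all add: is_partition_def sorted_wrt_rev)
  have "sort (rev l) = rev l" by (rule sorted_sort_id[OF s(1)])
  moreover have "sort (rev l) = rev l'" by (rule properties_for_sort) (use s assms in auto)
  ultimately show ?thesis by simp
qed

lemma partition_eq_parts:
  assumes "is_partition l" "\<And>x. x \<in> set l \<Longrightarrow> x \<le> C"
  shows "l = parts C (count (mset l))"
proof (rule partition_eqI[OF assms(1) is_partition_parts], rule multiset_eqI)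
  fix i
  show "count (mset l) i = count (mset (parts C (count (mset l)))) i"
    unfolding count_parts using assms by (cases "i \<in> set l") (auto simp: is_partition_def Suc_le_eq intro!: gr0I)
qed

context hl_parameter
begin

text \<open>The last clause goes beyond the description in \<open>hall_littlewood\<close>. It
  controls the terms of the Pieri formula that have more parts than there are variables.\<close>

definition is_HL :: "nat list \<Rightarrow> nat mps \<Rightarrow> bool" where
  "is_HL l P \<longleftrightarrow> P \<in> sym_fun \<and>
     (\<forall>n\<ge>length l. scalar (HL_norm n l t) * vandermonde n * truncate_vars n P = HL_numerator n l t) \<and>
     (\<forall>n<length l. truncate_vars n P = 0)"

lemma HL_norm_nz: "HL_norm n l t \<noteq> 0"
  by (auto simp: HL_norm_def prod_zero_iff)

lemma HL_norm_parts:
  "HL_norm n (parts C m) t = HL_v (n - length (parts C m)) t * (\<Prod>i=1..C. HL_v (m i) t)"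
proof -
  have "(\<Prod>k\<in>set (parts C m). HL_v (count (mset (parts C m)) k) t) = (\<Prod>i=1..C. HL_v (m i) t)"
    by (rule prod.mono_neutral_cong_left) (auto simp: set_parts count_parts)
  thus ?thesis by (simp add: HL_norm_def)
qed

lemma HL_unique:
  assumes "\<And>n. n \<ge> length l \<Longrightarrow> scalar (HL_norm n l t) * vandermonde n * truncate_vars n P = HL_numerator n l t"
    and "\<And>n. n \<ge> length l \<Longrightarrow> scalar (HL_norm n l t) * vandermonde n * truncate_vars n P' = HL_numerator n l t"
  shows "P = P'"
proof (rule truncate_vars_eqI[of "length l"])
  fix n assume n: "n \<ge> length l"
  have "scalar (HL_norm n l t) * (vandermonde n * truncate_vars n P) = scalar (HL_norm n l t) * (vandermonde n * truncate_vars n P')"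
    using assms[OF n] by (simp only: mult.assoc)
  hence "vandermonde n * truncate_vars n P = vandermonde n * truncate_vars n P'"
    by (simp only: scalar_cancel[OF HL_norm_nz])
  hence "vandermonde n * (truncate_vars n P - truncate_vars n P') = 0" by (simp only: right_diff_distrib diff_self)
  thus "truncate_vars n P = truncate_vars n P'" using vandermonde_cancel by (metis eq_iff_diff_eq_0)
qed

lemma is_HL_unique:
  assumes "is_HL l P" "is_HL l P'" shows "P = P'"
  by (metis HL_unique assms(1) is_HL_def assms(2))

lemma is_HL_Nil: "is_HL [] 1"
  unfolding is_HL_def using hl_num_zeros by (simp add: HL_norm_def HL_numerator_eq_hl_num)

text \<open>The vertical strips of size r. Here k 0 counts the new parts equal to 1; it is bounded
  by r alone because infinitely many variables leave an unlimited supply of zeros.\<close>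

definition strips :: "nat \<Rightarrow> (nat \<Rightarrow> nat) \<Rightarrow> nat \<Rightarrow> (nat \<Rightarrow> nat) set" where
  "strips C m r = {k \<in> PiE {..C} (\<lambda>i. {..if i = 0 then r else m i}). (\<Sum>i\<le>C. k i) = r}"

text \<open>Macdonald's coefficient in e_r P_\<mu>: of the parts equal to i + 1 in the resulting
  partition, k i have just been raised.\<close>

definition strip_coeff :: "nat \<Rightarrow> (nat \<Rightarrow> nat) \<Rightarrow> (nat \<Rightarrow> nat) \<Rightarrow> complex" where
  "strip_coeff C m k = (\<Prod>i\<le>C. gbin (raise C m k (Suc i)) (k i))"

lemma finite_strips [simp]: "finite (strips C m r)"
  by (simp add: finite_PiE strips_def)

lemma strip_coeff_nz: "strip_coeff C m k \<noteq> 0"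
  unfolding strip_coeff_def by (auto simp: prod_zero_iff raise_def intro!: gbin_nz)

text \<open>Passing from numerators to the functions P divides by products of t-factorials of
  multiplicities. This change of normalisation turns binomials in the old multiplicities into
  binomials in the new ones; the factors m_i - k_i occur in both and cancel.\<close>

lemma strip_coeff_norm:
  assumes "\<And>i. i \<le> C \<Longrightarrow> k i \<le> m i"
  shows "(\<Prod>i\<le>C. gbin (m i) (k i)) * (\<Prod>i\<le>Suc C. HL_v (raise C m k i) t) = (\<Prod>i\<le>C. HL_v (m i) t) * strip_coeff C m k"
proof -
  define B K R where "B = (\<Prod>i\<le>C. HL_v (m i - k i) t)" and "K = (\<Prod>i\<le>C. HL_v (k i) t)"
    and "R = (\<Prod>i<C. HL_v (m (Suc i) - k (Suc i)) t)"
  have 1: "(\<Prod>i\<le>C. gbin (m i) (k i)) * B * K = (\<Prod>i\<le>C. HL_v (m i) t)"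
    unfolding B_def K_def prod.distrib[symmetric] using assms by (intro prod.cong) (auto simp: gbin_def)
  have "(\<Prod>i\<le>C. HL_v (raise C m k (Suc i)) t) =
      (\<Prod>i\<le>C. gbin (raise C m k (Suc i)) (k i) * HL_v (k i) t * HL_v (raise C m k (Suc i) - k i) t)"
    by (intro prod.cong) (auto simp: gbin_def raise_def)
  also have "\<dots> = strip_coeff C m k * K * (\<Prod>i\<le>C. HL_v (raise C m k (Suc i) - k i) t)"
    by (simp add: prod.distrib strip_coeff_def K_def)
  also have "(\<Prod>i\<le>C. HL_v (raise C m k (Suc i) - k i) t) = R"
    unfolding R_def lessThan_Suc_atMost[symmetric] by (simp add: raise_def)
  finally have 2: "(\<Prod>i\<le>C. HL_v (raise C m k (Suc i)) t) = strip_coeff C m k * K * R" .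
  have 3: "B = HL_v (m 0 - k 0) t * R" unfolding B_def R_def lessThan_Suc_atMost[symmetric] prod.lessThan_Suc_shift by simp
  have 4: "(\<Prod>i\<le>Suc C. HL_v (raise C m k i) t) = HL_v (m 0 - k 0) t * (strip_coeff C m k * K * R)"
    unfolding prod.atMost_Suc_shift 2 by (simp add: raise_def)
  show ?thesis unfolding 4 1[symmetric] 3 by (simp add: mult_ac)
qed

lemma length_raise:
  assumes "k \<in> strips C m r"
  shows "length (parts (Suc C) (raise C m k)) = length (parts C m) + k 0"
proof -
  have k: "k i \<le> m i" if "1 \<le> i" "i \<le> C" for i using assms that by (auto simp: strips_def PiE_iff dest!: bspec[of _ _ i])
  have "(\<Sum>i=1..Suc C. raise C m k i) = (\<Sum>i=1..Suc C. if i \<le> C then m i - k i else 0) + (\<Sum>i=1..Suc C. k (i - 1))"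
    unfolding sum.distrib[symmetric] by (rule sum.cong) (auto simp: raise_def)
  also have "(\<Sum>i=1..Suc C. k (i - 1)) = (\<Sum>i\<le>C. k i)"
    by (rule sum.reindex_bij_witness[of _ Suc "\<lambda>i. i - 1"]) auto
  also have "(\<Sum>i\<le>C. k i) = k 0 + (\<Sum>i=1..C. k i)" by (simp add: atMost_atLeast0 sum.atLeast_Suc_atMost)
  also have "(\<Sum>i=1..Suc C. if i \<le> C then m i - k i else 0) = (\<Sum>i=1..C. m i - k i)" by simp
  also have "(\<Sum>i=1..C. m i - k i) + (k 0 + (\<Sum>i=1..C. k i)) = (\<Sum>i=1..C. m i) + k 0"
    using k by (simp add: sum.distrib[symmetric])
  finally show ?thesis by (simp only: length_parts)
qed

text \<open>If all terms of the Pieri formula but one are known to be Hall-Littlewood functions, the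
  remaining one is obtained by solving for it. The result is checked separately for every number n
  of variables, where \<open>hl_num_pieri\<close> applies.\<close>

lemma is_HL_step:
  assumes P: "is_HL (parts C m) P" and k0: "k0 \<in> strips C m r"
    and Q: "\<And>k. k \<in> strips C m r - {k0} \<Longrightarrow> is_HL (parts (Suc C) (raise C m k)) (Q k)"
  shows "is_HL (parts (Suc C) (raise C m k0)) (scalar (inverse (strip_coeff C m k0)) *
     (elem_e r * P - (\<Sum>k\<in>strips C m r - {k0}. scalar (strip_coeff C m k) * Q k)))" (is "is_HL _ ?R")
proof -
  let ?K = "strips C m r" and ?l = "length (parts C m)"
  let ?G = "strip_coeff C m"
  have sym: "?R \<in> sym_fun" using P Q by (auto simp: is_HL_def intro!: mult_sym_fun diff_sym_fun sum_sym_fun)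
  have "scalar (?G k0) * ?R = elem_e r * P - (\<Sum>k\<in>?K - {k0}. scalar (?G k) * Q k)"
    using strip_coeff_nz[of C m k0] by (simp flip: mult.assoc scalar_mult)
  hence R: "scalar (?G k0) * truncate_vars n ?R = truncate_vars n (elem_e r) * truncate_vars n P
      - (\<Sum>k\<in>?K - {k0}. scalar (?G k) * truncate_vars n (Q k))" for n
    by (metis (no_types, lifting) sum.cong truncate_vars_scalar truncate_vars_diff truncate_vars_mult truncate_vars_sum)
  have main: "if ?l + k0 0 \<le> n then scalar (HL_norm n (parts (Suc C) (raise C m k0)) t) * vandermonde n * truncate_vars n ?R =
       HL_numerator n (parts (Suc C) (raise C m k0)) t else truncate_vars n ?R = 0" for n
  proof (cases "?l \<le> n")
    \<comment> \<open>With fewer variables than parts of the smaller partition, P and all the Q k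
      vanish, hence also the solution.\<close>
    case False
    have "truncate_vars n P = 0" using P False by (simp add: is_HL_def)
    moreover have "truncate_vars n (Q k) = 0" if "k \<in> ?K - {k0}" for k
      using Q[OF that] False length_raise[of k C m r] that by (auto simp: is_HL_def)
    ultimately have "scalar (?G k0) * truncate_vars n ?R = scalar (?G k0) * 0" unfolding R by simp
    hence "truncate_vars n ?R = 0" using scalar_cancel[OF strip_coeff_nz] by blast
    thus ?thesis using False by simp
  next
    case True
    \<comment> \<open>Zeros are appended until the partition has one entry for each of the n
      variables.\<close>
    define m' where "m' = m(0 := n - ?l)"
    \<comment> \<open>The strips whose new parts fit into n variables; for the others the truncation
      of Q k is zero.\<close>
    define B where "B = {k \<in> ?K. k 0 \<le> n - ?l}"
    let ?M = "\<Prod>i\<le>C. HL_v (m' i) t"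
    let ?H = "\<lambda>k. hl_num t (blocks (Suc C) (raise C m' k))"
    let ?b = "\<lambda>k. \<Prod>i\<le>C. gbin (m' i) (k i)"
    have parts_m': "parts C m' = parts C m" by (rule parts_cong) (auto simp: m'_def)
    have parts_r: "parts (Suc C) (raise C m' k) = parts (Suc C) (raise C m k)" for k
      by (rule parts_cong) (auto simp: raise_def m'_def)
    have G: "strip_coeff C m' k = ?G k" for k
      unfolding strip_coeff_def by (rule prod.cong) (auto simp: raise_def m'_def)
    have sum_m': "n = (\<Sum>i\<le>C. m' i)"
      using True by (simp add: atMost_atLeast0 sum.atLeast_Suc_atMost length_parts m'_def)
    have norm: "HL_norm n (parts C m) t = ?M"
      unfolding HL_norm_parts by (simp add: atMost_atLeast0 prod.atLeast_Suc_atMost m'_def)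
    have num: "HL_numerator n (parts C m) t = hl_num t (blocks C m')"
      using True by (simp add: HL_numerator_eq_hl_num blocks_def parts_m') (simp add: m'_def)
    \<comment> \<open>The supply m' 0 of zeros is the bound on k 0 in B, and the bound by r from
      \<open>strips\<close> follows from the total.\<close>
    have B: "{k. k \<in> PiE {..C} (\<lambda>i. {..m' i}) \<and> (\<Sum>i\<le>C. k i) = r} = B"
    proof -
      have "k 0 \<le> r" if "(\<Sum>i\<le>C. k i) = r" for k :: "nat \<Rightarrow> nat"
        using that member_le_sum[of 0 "{..C}" k] by simp
      thus ?thesis by (auto simp: B_def strips_def m'_def PiE_iff split: if_splits)
    qed
    have finB: "finite B" by (simp add: B_def)
    have coeff: "?b k * (\<Prod>i\<le>Suc C. HL_v (raise C m' k i) t) = ?M * ?G k" if "k \<in> B" for k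
      using strip_coeff_norm[of C k m'] that unfolding B[symmetric] G by (auto simp: PiE_iff)
    have nk: "HL_norm n (parts (Suc C) (raise C m k)) t = (\<Prod>i\<le>Suc C. HL_v (raise C m' k i) t)"
      and numk: "HL_numerator n (parts (Suc C) (raise C m k)) t = ?H k"
      and lenk: "length (parts (Suc C) (raise C m k)) \<le> n" if "k \<in> B" for k
    proof -
      have k: "k \<in> ?K" "k 0 \<le> n - ?l" using that by (auto simp: B_def)
      have l: "length (parts (Suc C) (raise C m k)) = ?l + k 0" by (rule length_raise[OF k(1)])
      thus "length (parts (Suc C) (raise C m k)) \<le> n" using k(2) True by simp
      have r0: "raise C m' k 0 = n - (?l + k 0)" by (simp add: raise_def m'_def)
      have "(\<Prod>i=1..Suc C. HL_v (raise C m k i) t) = (\<Prod>i=1..Suc C. HL_v (raise C m' k i) t)"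
        by (rule prod.cong) (auto simp: raise_def m'_def)
      thus "HL_norm n (parts (Suc C) (raise C m k)) t = (\<Prod>i\<le>Suc C. HL_v (raise C m' k i) t)"
        unfolding HL_norm_parts l by (simp add: atMost_atLeast0 prod.atLeast_Suc_atMost[of 0] r0 del: prod.cl_ivl_Suc)
      show "HL_numerator n (parts (Suc C) (raise C m k)) t = ?H k"
        using \<open>length (parts (Suc C) (raise C m k)) \<le> n\<close>
        by (simp add: HL_numerator_eq_hl_num blocks_def parts_r r0 l del: parts.simps)
    qed
    have QB: "scalar (?M * ?G k) * (vandermonde n * truncate_vars n (Q k)) = scalar (?b k) * ?H k" if "k \<in> B - {k0}" for k
    proof -
      have k: "k \<in> B" "k \<in> ?K - {k0}" using that by (auto simp: B_def)
      have "scalar (HL_norm n (parts (Suc C) (raise C m k)) t) * vandermonde n * truncate_vars n (Q k) = ?H k"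
        using Q[OF k(2)] lenk[OF k(1)] numk[OF k(1)] by (simp add: is_HL_def del: parts.simps)
      hence "?H k = scalar (\<Prod>i\<le>Suc C. HL_v (raise C m' k i) t) * (vandermonde n * truncate_vars n (Q k))"
        unfolding nk[OF k(1)] by (simp only: mult.assoc)
      hence "scalar (?b k) * ?H k = scalar (?b k * (\<Prod>i\<le>Suc C. HL_v (raise C m' k i) t)) * (vandermonde n * truncate_vars n (Q k))"
        by (simp only: scalar_mult mult.assoc)
      thus ?thesis unfolding coeff[OF k(1)] ..
    qed
    have Qz: "truncate_vars n (Q k) = 0" if "k \<in> ?K - {k0}" "k \<notin> B" for k
      using Q[OF that(1)] length_raise[of k C m r] that True by (auto simp: is_HL_def B_def simp del: parts.simps)
    have "scalar ?M * (vandermonde n * (truncate_vars n (elem_e r) * truncate_vars n P)) =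
        (\<Sum>k\<in>B. scalar (?b k) * ?H k)"
    proof -
      have "scalar (HL_norm n (parts C m) t) * vandermonde n * truncate_vars n P = HL_numerator n (parts C m) t"
        using P True by (simp add: is_HL_def)
      hence "scalar ?M * vandermonde n * truncate_vars n P = hl_num t (blocks C m')" unfolding norm num .
      hence "scalar ?M * vandermonde n * truncate_vars n P * truncate_vars n (elem_e r) = (\<Sum>k\<in>B. scalar (?b k) * ?H k)"
        using hl_num_pieri[OF sum_m', of r] unfolding B by simp
      thus ?thesis by (simp only: mult_ac)
    qed
    moreover have "scalar ?M * (vandermonde n * (truncate_vars n (elem_e r) * truncate_vars n P)) =
        scalar (?M * ?G k0) * (vandermonde n * truncate_vars n ?R) + (\<Sum>k\<in>B - {k0}. scalar (?b k) * ?H k)"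
    proof -
      have "truncate_vars n (elem_e r) * truncate_vars n P =
          scalar (?G k0) * truncate_vars n ?R + (\<Sum>k\<in>?K - {k0}. scalar (?G k) * truncate_vars n (Q k))"
        unfolding R by simp
      also have "(\<Sum>k\<in>?K - {k0}. scalar (?G k) * truncate_vars n (Q k)) = (\<Sum>k\<in>B - {k0}. scalar (?G k) * truncate_vars n (Q k))"
      proof (rule sum.mono_neutral_right)
        show "\<forall>k\<in>?K - {k0} - (B - {k0}). scalar (?G k) * truncate_vars n (Q k) = 0" using Qz by auto
      qed (auto simp: B_def)
      finally have "scalar ?M * (vandermonde n * (truncate_vars n (elem_e r) * truncate_vars n P)) =
        scalar (?M * ?G k0) * (vandermonde n * truncate_vars n ?R) +
          (\<Sum>k\<in>B - {k0}. scalar (?M * ?G k) * (vandermonde n * truncate_vars n (Q k)))"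
        by (simp only: distrib_left sum_distrib_left scalar_mult mult_ac)
      thus ?thesis using QB by simp
    qed
    ultimately have eq: "scalar (?M * ?G k0) * (vandermonde n * truncate_vars n ?R) + (\<Sum>k\<in>B - {k0}. scalar (?b k) * ?H k) =
      (\<Sum>k\<in>B. scalar (?b k) * ?H k)" by simp
    have Mnz: "?M \<noteq> 0" by (simp add: prod_zero_iff)
    hence nz: "?M * ?G k0 \<noteq> 0" using strip_coeff_nz[of C m k0] by simp
    show ?thesis
    proof (cases "k0 \<in> B")
      case in_B: True
      hence "scalar (?M * ?G k0) * (vandermonde n * truncate_vars n ?R) = scalar (?b k0) * ?H k0"
        using eq by (simp add: sum.remove[OF finB in_B])
      hence "scalar (?b k0) * (scalar (\<Prod>i\<le>Suc C. HL_v (raise C m' k0 i) t) * vandermonde n * truncate_vars n ?R) = scalar (?b k0) * ?H k0"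
        unfolding coeff[OF in_B, symmetric] by (simp only: scalar_mult mult.assoc)
      moreover have "?b k0 \<noteq> 0" using coeff[OF in_B] Mnz strip_coeff_nz[of C m k0] by (metis mult_zero_left no_zero_divisors)
      ultimately have "scalar (\<Prod>i\<le>Suc C. HL_v (raise C m' k0 i) t) * vandermonde n * truncate_vars n ?R = ?H k0"
        using scalar_cancel by blast
      moreover have "?l + k0 0 \<le> n" using in_B True by (auto simp: B_def)
      ultimately show ?thesis using nk[OF in_B] numk[OF in_B] by (simp del: parts.simps)
    next
      case False
      hence "scalar (?M * ?G k0) * (vandermonde n * truncate_vars n ?R) = scalar (?M * ?G k0) * 0" using eq by simp
      hence "vandermonde n * truncate_vars n ?R = 0"
        by (simp only: scalar_cancel[OF nz])
      hence "truncate_vars n ?R = 0" by (rule vandermonde_cancel)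
      moreover have "\<not> ?l + k0 0 \<le> n" using False k0 True by (auto simp: B_def)
      ultimately show ?thesis by simp
    qed
  qed
  show ?thesis
    unfolding is_HL_def length_raise[OF k0]
  proof (intro conjI allI impI)
    show "?R \<in> sym_fun" by (rule sym)
    fix n assume "?l + k0 0 \<le> n"
    thus "scalar (HL_norm n (parts (Suc C) (raise C m k0)) t) * vandermonde n * truncate_vars n ?R =
       HL_numerator n (parts (Suc C) (raise C m k0)) t" using main[of n] by (simp only: if_True)
  next
    fix n assume "n < ?l + k0 0"
    hence "\<not> ?l + k0 0 \<le> n" by simp
    thus "truncate_vars n ?R = 0" using main[of n] by (simp only: if_False)
  qed
qed

end

section \<open>Existence of all Hall-Littlewood functions, and the Pieri formula\<close>

context hl_parameter
begin

text \<open>Raising a part from i to i + 1 adds (i + 1)^2 - i^2 = 2 i + 1 to the sum of the squares,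
  which is the measure of the induction in \<open>is_HL_exists\<close>.\<close>

lemma sum_squares_raise:
  assumes "\<And>i. 1 \<le> i \<Longrightarrow> i \<le> C \<Longrightarrow> k i \<le> m i"
  shows "(\<Sum>i=1..Suc C. i\<^sup>2 * raise C m k i) = (\<Sum>i=1..C. i\<^sup>2 * m i) + (\<Sum>i\<le>C. (2 * i + 1) * k i)"
proof -
  have "(\<Sum>i=1..Suc C. i\<^sup>2 * raise C m k i) =
      (\<Sum>i=1..Suc C. i\<^sup>2 * (if i \<le> C then m i - k i else 0)) + (\<Sum>i=1..Suc C. i\<^sup>2 * k (i - 1))"
    unfolding sum.distrib[symmetric] by (rule sum.cong) (auto simp: raise_def algebra_simps)
  also have "(\<Sum>i=1..Suc C. i\<^sup>2 * k (i - 1)) = (\<Sum>i\<le>C. (Suc i)\<^sup>2 * k i)"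
    by (rule sum.reindex_bij_witness[of _ Suc "\<lambda>i. i - 1"]) auto
  also have "(\<Sum>i\<le>C. (Suc i)\<^sup>2 * k i) = (\<Sum>i\<le>C. i\<^sup>2 * k i) + (\<Sum>i\<le>C. (2 * i + 1) * k i)"
    unfolding sum.distrib[symmetric] by (rule sum.cong) (auto simp: power2_eq_square algebra_simps)
  also have "(\<Sum>i\<le>C. i\<^sup>2 * k i) = (\<Sum>i=1..C. i\<^sup>2 * k i)" by (simp add: atMost_atLeast0 sum.atLeast_Suc_atMost)
  also have "(\<Sum>i=1..Suc C. i\<^sup>2 * (if i \<le> C then m i - k i else 0)) = (\<Sum>i=1..C. i\<^sup>2 * (m i - k i))" by simp
  also have "(\<Sum>i=1..C. i\<^sup>2 * (m i - k i)) + ((\<Sum>i=1..C. i\<^sup>2 * k i) + (\<Sum>i\<le>C. (2 * i + 1) * k i)) =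
      (\<Sum>i=1..C. i\<^sup>2 * m i) + (\<Sum>i\<le>C. (2 * i + 1) * k i)"
    unfolding add.assoc[symmetric] sum.distrib[symmetric] using assms by (simp add: algebra_simps flip: distrib_left)
  finally show ?thesis .
qed

lemma strip_top_maximal:
  fixes k :: "nat \<Rightarrow> nat"
  assumes "k \<in> extensional {..C}" "(\<Sum>i\<le>C. k i) = M" "k \<noteq> (\<lambda>i\<in>{..C}. if i = C then M else 0)"
  shows "(\<Sum>i\<le>C. (2 * i + 1) * k i) < (2 * C + 1) * M"
proof -
  have "\<exists>i<C. k i > 0"
  proof (rule ccontr)
    assume "\<not> ?thesis"
    hence z: "k i = 0" if "i < C" for i using that by auto
    have "(\<Sum>i\<le>C. k i) = (\<Sum>i\<in>{C}. k i)" by (rule sum.mono_neutral_right) (use z in auto)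
    hence "k C = M" using assms(2) by simp
    hence "k = (\<lambda>i\<in>{..C}. if i = C then M else 0)"
      using z assms(1) by (intro ext) (auto simp: extensional_def restrict_def)
    thus False using assms(3) by simp
  qed
  then obtain i where i: "i < C" "k i > 0" by blast
  have "(\<Sum>i\<le>C. (2 * i + 1) * k i) < (\<Sum>i\<le>C. (2 * C + 1) * k i)"
    by (rule sum_strict_mono_ex1) (use i in \<open>auto intro!: bexI[of _ i]\<close>)
  thus ?thesis by (simp only: assms(2) sum_distrib_left[symmetric])
qed

lemma strips_le: "k \<in> strips C m r \<Longrightarrow> 1 \<le> i \<Longrightarrow> i \<le> C \<Longrightarrow> k i \<le> m i"
  by (auto simp: strips_def PiE_iff dest!: bspec[of _ _ i])

text \<open>Lower each of the M largest parts by one. The given partition comes back by raising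
  exactly these parts. Any other strip of size M raises some smaller part, so it adds less to the
  sum of squares, and its term is known by induction; so is the function of the lowered partition.
  Then \<open>is_HL_step\<close> applies.\<close>

lemma is_HL_exists: "\<exists>P. is_HL (parts C m) P"
proof (induction "\<Sum>i=1..C. i\<^sup>2 * m i" arbitrary: C m rule: less_induct)
  case less
  show ?case
  proof (cases "\<exists>i\<in>{1..C}. m i > 0")
    case False
    hence "set (parts C m) = {}" unfolding set_parts by auto
    hence "parts C m = []" by simp
    thus ?thesis using is_HL_Nil by metis
  next
    case True
    let ?I = "{i \<in> {1..C}. m i > 0}"
    define c where "c = Max ?I"
    have "finite ?I" "?I \<noteq> {}" using True by auto
    hence c: "c \<in> ?I" "\<And>i. i \<in> ?I \<Longrightarrow> i \<le> c" unfolding c_def using Max_in Max_ge by blast+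
    obtain C' where C': "c = Suc C'" using c(1) by (cases c) auto
    let ?M = "m c"
    \<comment> \<open>The parts c become parts C' = c - 1, and k0 raises them again. The entries of
      m' above C' are ignored by \<open>parts C'\<close>.\<close>
    define m' where "m' i = (if i = C' then m i + ?M else m i)" for i
    define k0 where "k0 = (\<lambda>i\<in>{..C'}. if i = C' then ?M else 0)"
    have k0_sum: "(\<Sum>i\<le>C'. k0 i) = ?M"
      by (subst sum.mono_neutral_right[where S = "{C'}"]) (auto simp: k0_def)
    have k0: "k0 \<in> strips C' m' ?M"
      using k0_sum by (auto simp: strips_def k0_def m'_def PiE_iff)
    have r: "raise C' m' k0 i = m i" if "1 \<le> i" "i \<le> c" for i
      using that by (auto simp: raise_def k0_def m'_def C')
    have parts_m: "parts (Suc C') (raise C' m' k0) = parts C m"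
    proof (rule partition_eqI)
      show "mset (parts (Suc C') (raise C' m' k0)) = mset (parts C m)"
        by (rule multiset_eqI) (use r c C' in \<open>fastforce simp: count_parts simp del: parts.simps\<close>)
    qed (auto simp del: parts.simps)
    have sq: "(\<Sum>i=1..C. i\<^sup>2 * m i) = (\<Sum>i=1..Suc C'. i\<^sup>2 * raise C' m' k0 i)"
    proof -
      have "(\<Sum>i=1..C. i\<^sup>2 * m i) = (\<Sum>i=1..c. i\<^sup>2 * m i)"
      proof (rule sum.mono_neutral_right)
        have "m i = 0" if "i \<in> {1..C}" "i \<notin> {1..c}" for i using c(2)[of i] that by (cases "m i") auto
        thus "\<forall>i\<in>{1..C} - {1..c}. i\<^sup>2 * m i = 0" by simp
      qed (use c(1) in auto)
      also have "\<dots> = (\<Sum>i=1..Suc C'. i\<^sup>2 * raise C' m' k0 i)"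
        unfolding C'[symmetric] by (rule sum.cong) (use r in auto)
      finally show ?thesis .
    qed
    have sq_m: "(\<Sum>i=1..C. i\<^sup>2 * m i) = (\<Sum>i=1..C'. i\<^sup>2 * m' i) + (2 * C' + 1) * ?M"
    proof -
      have "(\<Sum>i\<le>C'. (2 * i + 1) * k0 i) = (\<Sum>i\<in>{C'}. (2 * i + 1) * k0 i)"
        by (rule sum.mono_neutral_right) (auto simp: k0_def)
      thus ?thesis unfolding sq by (subst sum_squares_raise) (use strips_le[OF k0] in \<open>auto simp: k0_def\<close>)
    qed
    have "?M > 0" using c by auto
    hence "\<exists>P. is_HL (parts C' m') P" by (intro less) (use sq_m in simp)
    then obtain P where P: "is_HL (parts C' m') P" by blast
    have "\<exists>Q. is_HL (parts (Suc C') (raise C' m' k)) Q" if k: "k \<in> strips C' m' ?M - {k0}" for k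
    proof (rule less)
      have "(\<Sum>i=1..Suc C'. i\<^sup>2 * raise C' m' k i) = (\<Sum>i=1..C'. i\<^sup>2 * m' i) + (\<Sum>i\<le>C'. (2 * i + 1) * k i)"
        by (rule sum_squares_raise) (use strips_le k in auto)
      moreover have "(\<Sum>i\<le>C'. (2 * i + 1) * k i) < (2 * C' + 1) * ?M"
        by (rule strip_top_maximal) (use k in \<open>auto simp: strips_def PiE_iff k0_def\<close>)
      ultimately show "(\<Sum>i=1..Suc C'. i\<^sup>2 * raise C' m' k i) < (\<Sum>i=1..C. i\<^sup>2 * m i)"
        unfolding sq_m by simp
    qed
    then obtain Q where "\<And>k. k \<in> strips C' m' ?M - {k0} \<Longrightarrow> is_HL (parts (Suc C') (raise C' m' k)) (Q k)"
      by metis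
    from is_HL_step[OF P k0 this] show ?thesis unfolding parts_m by blast
  qed
qed

abbreviation HL :: "nat list \<Rightarrow> nat mps" where "HL l \<equiv> hall_littlewood l t"

lemma is_HL_hall_littlewood:
  assumes "is_partition l" shows "is_HL l (HL l)"
proof -
  have "l = parts (Max (insert 0 (set l))) (count (mset l))" by (rule partition_eq_parts[OF assms]) auto
  then obtain P where P: "is_HL l P" using is_HL_exists by metis
  have "HL l = P"
    unfolding hall_littlewood_def
  proof (rule the_equality)
    show "P \<in> sym_fun \<and> (\<forall>n\<ge>length l. scalar (HL_norm n l t) * vandermonde n * truncate_vars n P = HL_numerator n l t)"
      using P by (simp add: is_HL_def)
    fix P' assume "P' \<in> sym_fun \<and> (\<forall>n\<ge>length l. scalar (HL_norm n l t) * vandermonde n * truncate_vars n P' = HL_numerator n l t)"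
    hence "scalar (HL_norm n l t) * vandermonde n * truncate_vars n P' = HL_numerator n l t" if "length l \<le> n" for n
      using that by blast
    moreover have "scalar (HL_norm n l t) * vandermonde n * truncate_vars n P = HL_numerator n l t" if "length l \<le> n" for n
      using that P unfolding is_HL_def by blast
    ultimately show "P' = P" by (rule HL_unique)
  qed
  thus ?thesis using P by simp
qed

lemma HL_sym_fun: "is_partition l \<Longrightarrow> HL l \<in> sym_fun"
  using is_HL_hall_littlewood by (simp add: is_HL_def)

text \<open>Applied to the functions P themselves, \<open>is_HL_step\<close> yields a
  Hall-Littlewood function, which by uniqueness is the omitted term; rearranging gives the formula.
  As the omitted term serves the strip of new parts only, which always exists.\<close>

theorem HL_pieri:
  "elem_e r * HL (parts C m) = (\<Sum>k\<in>strips C m r. scalar (strip_coeff C m k) * HL (parts (Suc C) (raise C m k)))"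
proof -
  define k0 where "k0 = (\<lambda>i\<in>{..C}. if i = 0 then r else 0 :: nat)"
  have "(\<Sum>i\<le>C. k0 i) = (\<Sum>i\<in>{0}. k0 i)" by (rule sum.mono_neutral_right) (auto simp: k0_def)
  hence k0: "k0 \<in> strips C m r" by (auto simp: strips_def k0_def PiE_iff)
  let ?c = "strip_coeff C m" and ?Q = "\<lambda>k. HL (parts (Suc C) (raise C m k))"
  let ?R = "scalar (inverse (?c k0)) * (elem_e r * HL (parts C m) - (\<Sum>k\<in>strips C m r - {k0}. scalar (?c k) * ?Q k))"
  have "is_HL (parts (Suc C) (raise C m k0)) ?R"
    by (rule is_HL_step[OF _ k0]) (intro is_HL_hall_littlewood is_partition_parts)+
  hence "?Q k0 = ?R"
    by (rule is_HL_unique[OF is_HL_hall_littlewood[OF is_partition_parts]])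
  hence "scalar (?c k0) * ?Q k0 = elem_e r * HL (parts C m) - (\<Sum>k\<in>strips C m r - {k0}. scalar (?c k) * ?Q k)"
    using strip_coeff_nz[of C m k0] by (simp only: mult.assoc[symmetric] scalar_mult[symmetric]) simp
  thus ?thesis by (simp only: sum.remove[OF finite_strips k0] eq_diff_eq)
qed

end

subsection \<open>The Hall-Littlewood expansion of the Gelfand-Graev generating function\<close>

text \<open>For i \<ge> 1 this is the i-th part of the conjugate partition.\<close>

definition tail_sum :: "nat \<Rightarrow> (nat \<Rightarrow> nat) \<Rightarrow> nat \<Rightarrow> nat" where
  "tail_sum C m i = (\<Sum>j=i..C. m j)"

definition mult_funs :: "nat \<Rightarrow> nat \<Rightarrow> (nat \<Rightarrow> nat) set" where
  "mult_funs C n = {m. (\<forall>i. i = 0 \<or> i > C \<longrightarrow> m i = 0) \<and> (\<Sum>i=1..C. i * m i) = n}"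

definition partitions :: "nat \<Rightarrow> nat list set" where
  "partitions n = {l. is_partition l \<and> sum_list l = n}"

lemma tail_sum_Suc: "i \<le> Suc C \<Longrightarrow> tail_sum (Suc C) m i = tail_sum C m i + m (Suc C)"
  by (simp add: tail_sum_def)

lemma sum_list_parts: "sum_list (parts C m) = (\<Sum>i=1..C. i * m i)"
  by (induction C) (auto simp: sum_list_replicate)

lemma sum_tail_sum: "(\<Sum>i=1..C. tail_sum C m i) = (\<Sum>i=1..C. i * m i)"
proof (induction C)
  case (Suc C)
  have "(\<Sum>i=1..Suc C. tail_sum (Suc C) m i) = (\<Sum>i=1..C. tail_sum C m i + m (Suc C)) + tail_sum (Suc C) m (Suc C)"
    by (simp add: tail_sum_Suc)
  also have "tail_sum (Suc C) m (Suc C) = m (Suc C)" by (simp add: tail_sum_def)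
  finally show ?case using Suc by (simp add: sum.distrib)
qed simp

lemma n_stat_append: "n_stat (xs @ ys) = n_stat xs + length xs * sum_list ys + n_stat ys"
proof -
  have "n_stat (xs @ ys) = (\<Sum>i\<in>{0..<length xs + length ys}. i * (xs @ ys) ! i)"
    by (simp add: n_stat_def atLeast0LessThan)
  also have "\<dots> = (\<Sum>i\<in>{0..<length xs}. i * (xs @ ys) ! i) + (\<Sum>i\<in>{length xs..<length xs + length ys}. i * (xs @ ys) ! i)"
    by (rule sum.atLeastLessThan_concat[symmetric]) auto
  also have "(\<Sum>i\<in>{0..<length xs}. i * (xs @ ys) ! i) = n_stat xs"
    unfolding n_stat_def atLeast0LessThan by (rule sum.cong) (auto simp: nth_append)
  also have "(\<Sum>i\<in>{length xs..<length xs + length ys}. i * (xs @ ys) ! i) = (\<Sum>i<length ys. (length xs + i) * ys ! i)"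
    by (rule sum.reindex_bij_witness[of _ "\<lambda>i. length xs + i" "\<lambda>i. i - length xs"]) (auto simp: nth_append)
  also have "\<dots> = length xs * sum_list ys + n_stat ys"
    by (simp add: n_stat_def distrib_right sum.distrib sum_list_sum_nth atLeast0LessThan flip: sum_distrib_left)
  finally show ?thesis by simp
qed

lemma n_stat_replicate: "n_stat (replicate a c) = c * (a choose 2)"
proof -
  have "n_stat (replicate a c) = c * (\<Sum>i<a. i)"
    unfolding n_stat_def sum_distrib_left by (rule sum.cong) auto
  also have "(\<Sum>i<a. i) = a choose 2"
    by (induction a) (auto simp: numeral_2_eq_2)
  finally show ?thesis .
qed

lemma choose_2_add: "((a + b) choose 2) = (a choose 2) + a * b + (b choose 2)"
proof (induction b)
  case (Suc b)
  have "Suc x choose 2 = x + (x choose 2)" for x by (simp add: numeral_2_eq_2)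
  thus ?case using Suc by simp
qed simp

text \<open>The formula for n(\<lambda>) by columns. The new largest parts lengthen each of the
  first C + 1 columns by their number, and \<open>choose_2_add\<close> separates the mixed
  term.\<close>

lemma n_stat_parts: "n_stat (parts C m) = (\<Sum>i=1..C. tail_sum C m i choose 2)"
proof (induction C)
  case 0 show ?case by (simp add: n_stat_def)
next
  case (Suc C)
  let ?a = "m (Suc C)"
  have "(\<Sum>i=1..Suc C. tail_sum (Suc C) m i choose 2) = (\<Sum>i=1..C. tail_sum C m i + ?a choose 2) + (?a choose 2)"
    by (simp add: tail_sum_Suc) (simp add: tail_sum_def)
  also have "\<dots> = (\<Sum>i=1..C. tail_sum C m i choose 2) + ?a * (\<Sum>i=1..C. tail_sum C m i) + Suc C * (?a choose 2)"
    by (simp add: choose_2_add sum.distrib sum_distrib_left mult.commute)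
  finally show ?case
    using Suc sum_tail_sum[of C m] by (simp add: n_stat_append n_stat_replicate sum_list_parts)
qed

lemma bij_parts:
  assumes "n \<le> C" shows "bij_betw (parts C) (mult_funs C n) (partitions n)"
proof (rule bij_betwI[where g = "\<lambda>l. count (mset l)"])
  show "parts C \<in> mult_funs C n \<rightarrow> partitions n"
    by (auto simp: mult_funs_def partitions_def sum_list_parts)
  have le: "x \<le> C" if "l \<in> partitions n" "x \<in> set l" for l x
    using that assms member_le_sum_list[of x l] by (auto simp: partitions_def)
  have e: "parts C (count (mset l)) = l" if "l \<in> partitions n" for l
    using partition_eq_parts[of l C] le[OF that] that by (auto simp: partitions_def)
  show "(\<lambda>l. count (mset l)) \<in> partitions n \<rightarrow> mult_funs C n"
  proof
    fix l assume l: "l \<in> partitions n"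
    have "(\<Sum>i=1..C. i * count (mset l) i) = n"
      using sum_list_parts[of C "count (mset l)"] l unfolding e[OF l] by (simp add: partitions_def)
    moreover have "count (mset l) i = 0" if "i = 0 \<or> i > C" for i
      using that l le[OF l, of i] by (auto simp: partitions_def is_partition_def count_eq_zero_iff)
    ultimately show "count (mset l) \<in> mult_funs C n" by (auto simp: mult_funs_def)
  qed
  show "parts C (count (mset l)) = l" if "l \<in> partitions n" for l by (rule e[OF that])
  show "count (mset (parts C m)) = m" if "m \<in> mult_funs C n" for m
    using that by (auto simp: count_parts mult_funs_def fun_eq_iff Suc_le_eq)
qed

lemma finite_partitions: "finite (partitions n)"
proof (rule finite_subset)
  show "partitions n \<subseteq> {l. set l \<subseteq> {0..n} \<and> length l \<le> n}"
  proof
    fix l assume l: "l \<in> partitions n"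
    have "length l \<le> sum_list l" if "0 \<notin> set l" for l :: "nat list"
      using that by (induction l) auto
    thus "l \<in> {l. set l \<subseteq> {0..n} \<and> length l \<le> n}"
      using l by (auto simp: partitions_def is_partition_def dest: member_le_sum_list)
  qed
qed (simp add: finite_lists_length_le)

lemma finite_mult_funs: "n \<le> C \<Longrightarrow> finite (mult_funs C n)"
  using bij_betw_finite[OF bij_parts] finite_partitions by blast

context hl_parameter
begin

text \<open>For t = 1/q the factors are 1 - q^j, so this is the Gelfand-Graev value at l Jordan
  blocks up to the sign (-1)^n.\<close>

definition beta :: "nat \<Rightarrow> complex" where "beta l = (\<Prod>j=1..l. 1 - inverse t ^ j)"

text \<open>A case of the q-binomial theorem: Pascal's rule gives S (m + 1) = (t^m - 1) S m, and the
  factor at m = 0 is zero.\<close>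

lemma qbinomial_zero: "m \<ge> 1 \<Longrightarrow> (\<Sum>k\<le>m. (-1) ^ k * gbin m k * t ^ (m - k choose 2)) = 0"
proof -
  define S where "S m = (\<Sum>k\<le>m. (-1) ^ k * gbin m k * t ^ (m - k choose 2))" for m
  have step: "S (Suc m) = (t ^ m - 1) * S m" for m
  proof -
    have c: "Suc x choose 2 = x + (x choose 2)" for x by (simp add: numeral_2_eq_2)
    have "S (Suc m) = t ^ (Suc m choose 2) + (\<Sum>k\<le>m. (-1) ^ Suc k * (gbin m k + t ^ Suc k * gbin m (Suc k)) * t ^ (m - k choose 2))"
      unfolding S_def by (subst sum.atMost_Suc_shift) (simp only: gbin_Suc_Suc diff_Suc_Suc gbin_0 power_0 mult_1_left minus_nat.diff_0)
    also have "\<dots> = - S m + (t ^ (Suc m choose 2) + (\<Sum>k\<le>m. (-1) ^ Suc k * t ^ Suc k * gbin m (Suc k) * t ^ (m - k choose 2)))"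
      by (simp add: S_def algebra_simps sum.distrib sum_negf sum_subtractf)
    also have "t ^ (Suc m choose 2) + (\<Sum>k\<le>m. (-1) ^ Suc k * t ^ Suc k * gbin m (Suc k) * t ^ (m - k choose 2)) =
        (\<Sum>j\<le>Suc m. (-1) ^ j * t ^ j * gbin m j * t ^ (Suc m - j choose 2))"
      by (subst sum.atMost_Suc_shift) simp
    also have "\<dots> = (\<Sum>j\<le>m. (-1) ^ j * t ^ j * gbin m j * t ^ (Suc m - j choose 2))"
      by (simp add: gbin_def)
    also have "\<dots> = t ^ m * S m"
      unfolding S_def sum_distrib_left
    proof (rule sum.cong[OF refl])
      fix j assume j: "j \<in> {..m}"
      have "t ^ j * t ^ (Suc m - j choose 2) = t ^ m * t ^ (m - j choose 2)"
        using j by (simp add: Suc_diff_le c flip: power_add)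
      thus "(-1) ^ j * t ^ j * gbin m j * t ^ (Suc m - j choose 2) = t ^ m * ((-1) ^ j * gbin m j * t ^ (m - j choose 2))"
        by (simp add: mult_ac)
    qed
    finally show ?thesis by (simp add: algebra_simps)
  qed
  have "S (Suc m) = 0" for m
  proof (induction m)
    case 0 show ?case using step[of 0] by simp
  next
    case (Suc m) show ?case using step[of "Suc m"] Suc by simp
  qed
  thus "m \<ge> 1 \<Longrightarrow> (\<Sum>k\<le>m. (-1) ^ k * gbin m k * t ^ (m - k choose 2)) = 0"
    unfolding S_def by (cases m) auto
qed

text \<open>After reversal the summands satisfy u (n+1) (l+1) = (1 - t^(n+1)) / t * u n l. Hence D
  (n+1) = 1 + (1 - t^(n+1)) / t * D n, which t^(-n) solves.\<close>

lemma column_sum: "(-1) ^ n * (\<Sum>k\<le>n. (-1) ^ k * gbin n k * t ^ (n - k choose 2) * beta (n - k)) = inverse t ^ n"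
proof -
  define u where "u n l = (-1) ^ l * gbin n l * t ^ (l choose 2) * beta l" for n l
  define D where "D n = (\<Sum>l\<le>n. u n l)" for n
  have step: "u (Suc n) (Suc l) = (1 - t ^ Suc n) / t * u n l" if l: "l \<le> n" for n l
  proof -
    have nz: "1 - t ^ Suc l \<noteq> 0" "1 - t \<noteq> 0" using t_pow[of "Suc l"] t_ne_1 by auto
    have g: "gbin (Suc n) (Suc l) = gbin n l * ((1 - t ^ Suc n) / (1 - t ^ Suc l))"
      using l nz unfolding gbin_def HL_v_Suc by simp
    have c: "Suc l choose 2 = l + (l choose 2)" by (simp add: numeral_2_eq_2)
    have b: "beta (Suc l) = beta l * (1 - inverse t ^ Suc l)" by (simp add: beta_def)
    have f: "(1 - inverse t ^ Suc l) * t ^ l = - ((1 - t ^ Suc l) / t)"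
      using t_nz by (simp add: field_simps)
    have "u (Suc n) (Suc l) = - ((-1) ^ l * gbin n l * t ^ (l choose 2) * beta l * ((1 - t ^ Suc n) / (1 - t ^ Suc l)) *
        ((1 - inverse t ^ Suc l) * t ^ l))"
      unfolding u_def g c b power_add by (simp del: power_Suc add: power_Suc[of "-1"] mult_ac)
    also have "\<dots> = u n l * ((1 - t ^ Suc n) / (1 - t ^ Suc l)) * ((1 - t ^ Suc l) / t)"
      unfolding f u_def by simp
    also have "\<dots> = (1 - t ^ Suc n) / t * u n l" using nz(1) by simp
    finally show ?thesis .
  qed
  have "D n = inverse t ^ n"
  proof (induction n)
    case 0 show ?case by (simp add: D_def u_def beta_def binomial_eq_0)
  next
    case (Suc n)
    have "D (Suc n) = u (Suc n) 0 + (\<Sum>l\<le>n. u (Suc n) (Suc l))" unfolding D_def by (rule sum.atMost_Suc_shift)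
    also have "(\<Sum>l\<le>n. u (Suc n) (Suc l)) = (1 - t ^ Suc n) / t * D n"
      unfolding D_def sum_distrib_left by (rule sum.cong) (auto simp: step)
    also have "u (Suc n) 0 = 1" by (simp add: u_def beta_def binomial_eq_0)
    finally show ?case unfolding Suc using t_nz by (simp add: field_simps)
  qed
  moreover have "(\<Sum>k\<le>n. (-1) ^ k * gbin n k * t ^ (n - k choose 2) * beta (n - k)) = (-1) ^ n * D n"
    unfolding D_def sum_distrib_left
  proof (rule sum.reindex_bij_witness[of _ "\<lambda>l. n - l" "\<lambda>k. n - k"])
    fix k assume k: "k \<in> {..n}"
    have "gbin n (n - k) = gbin n k" using k by (simp add: gbin_def mult.commute)
    moreover have "(-1) ^ n * (-1 :: complex) ^ (n - k) = (-1) ^ k"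
      using k by (simp flip: power_add) (simp add: minus_one_power_iff)
    ultimately show "(-1) ^ n * u n (n - k) = (-1) ^ k * gbin n k * t ^ (n - k choose 2) * beta (n - k)"
      unfolding u_def by (simp add: mult.assoc[symmetric])
  qed auto
  ultimately show ?thesis by (simp flip: power_mult_distrib mult.assoc)
qed

text \<open>The function Gamma_n by its values on unipotent classes: t^n(\<lambda>) times
  P_\<lambda> is the modified function \<open>HL_tilde\<close> when t = 1/q.\<close>

definition gg_sym :: "nat \<Rightarrow> nat mps" where
  "gg_sym n = (\<Sum>l\<in>partitions n. scalar ((-1) ^ n * beta (length l) * t ^ n_stat l) * HL l)"

lemma gg_sym_sym_fun: "gg_sym n \<in> sym_fun"
  unfolding gg_sym_def by (intro sum_sym_fun mult_sym_fun) (auto simp: partitions_def HL_sym_fun)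

lemma gg_sym_mult_funs:
  assumes "n \<le> C"
  shows "gg_sym n = (\<Sum>m\<in>mult_funs C n. scalar ((-1) ^ n * beta (tail_sum C m 1) *
     (\<Prod>i=1..C. t ^ (tail_sum C m i choose 2))) * HL (parts C m))"
  unfolding gg_sym_def
  by (subst sum.reindex_bij_betw[OF bij_parts[OF assms], symmetric])
     (simp add: n_stat_parts length_parts power_sum tail_sum_def)

lemma HL_Nil: "HL [] = 1"
  by (rule is_HL_unique[OF is_HL_hall_littlewood is_HL_Nil]) (simp add: is_partition_def)

lemma HL_column: "HL (replicate n 1) = elem_e n"
proof -
  let ?k = "\<lambda>i\<in>{..0 :: nat}. n"
  have "strips 0 (\<lambda>_. 0) n = {?k}"
    unfolding strips_def by (auto simp: PiE_iff extensional_def restrict_def fun_eq_iff)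
  moreover have "strip_coeff 0 (\<lambda>_. 0) ?k = 1" by (simp add: strip_coeff_def raise_def)
  ultimately show ?thesis using HL_pieri[of n 0 "\<lambda>_. 0"] by (simp add: HL_Nil raise_def)
qed

definition unraise :: "nat \<Rightarrow> (nat \<Rightarrow> nat) \<Rightarrow> (nat \<Rightarrow> nat) \<Rightarrow> nat \<Rightarrow> nat" where
  "unraise C M k i = (if 1 \<le> i \<and> i \<le> C then M i - k (i - 1) + k i else 0)"

text \<open>The strip has k (i - 1) boxes in column i, and removing it shortens that column by as
  much.\<close>

lemma tail_sum_unraise:
  assumes "\<And>i. 1 \<le> i \<Longrightarrow> i \<le> C \<Longrightarrow> k (i - 1) \<le> M i" "k C = 0" "1 \<le> i" "i \<le> C"
  shows "tail_sum C (unraise C M k) i + k (i - 1) = tail_sum C M i"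
  using assms(4,3)
proof (induction rule: inc_induct)
  case base thus ?case using assms(1)[of C] assms(2) by (simp add: tail_sum_def unraise_def)
next
  case (step j)
  have "tail_sum C f j = f j + tail_sum C f (Suc j)" for f
    unfolding tail_sum_def using step by (intro sum.atLeast_Suc_atMost) auto
  thus ?case using step assms(1)[of j] by (simp add: unraise_def)
qed

lemma sum_weight_raise:
  assumes "k \<in> strips C m r"
  shows "(\<Sum>i=1..Suc C. i * raise C m k i) = (\<Sum>i=1..C. i * m i) + r"
proof -
  have "(\<Sum>i=1..Suc C. i * raise C m k i) =
      (\<Sum>i=1..Suc C. i * (if i \<le> C then m i - k i else 0)) + (\<Sum>i=1..Suc C. i * k (i - 1))"
    unfolding sum.distrib[symmetric] by (rule sum.cong) (auto simp: raise_def algebra_simps)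
  also have "(\<Sum>i=1..Suc C. i * k (i - 1)) = (\<Sum>i\<le>C. Suc i * k i)"
    by (rule sum.reindex_bij_witness[of _ Suc "\<lambda>i. i - 1"]) auto
  also have "(\<Sum>i\<le>C. Suc i * k i) = (\<Sum>i\<le>C. i * k i) + r"
    using assms by (simp add: sum.distrib strips_def)
  also have "(\<Sum>i\<le>C. i * k i) = (\<Sum>i=1..C. i * k i)" by (simp add: atMost_atLeast0 sum.atLeast_Suc_atMost)
  also have "(\<Sum>i=1..Suc C. i * (if i \<le> C then m i - k i else 0)) = (\<Sum>i=1..C. i * (m i - k i))" by simp
  also have "(\<Sum>i=1..C. i * (m i - k i)) + ((\<Sum>i=1..C. i * k i) + r) = (\<Sum>i=1..C. i * m i) + r"
    unfolding add.assoc[symmetric] sum.distrib[symmetric] using strips_le[OF assms] by (simp flip: distrib_left)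
  finally show ?thesis .
qed

text \<open>Coefficientwise this is E(u) Gamma(u) = E(u / t). The left side is expanded by the Pieri
  formula and regrouped by the larger partition. Its coefficient factors over the part sizes; the
  factor of the largest part vanishes by \<open>qbinomial_zero\<close> as soon as that part exceeds
  1. Only the column 1^n remains, and \<open>column_sum\<close> evaluates its coefficient.\<close>

theorem gg_sym_recursion: "(\<Sum>r\<le>n. elem_e r * gg_sym (n - r)) = scalar (inverse t ^ n) * elem_e n"
proof -
  define C where "C = n"
  let ?b = "\<lambda>m r. (-1) ^ (n - r) * beta (tail_sum C m 1) * (\<Prod>i=1..C. t ^ (tail_sum C m i choose 2))"
  let ?T = "SIGMA x : (SIGMA r : {..n}. mult_funs C (n - r)). strips C (snd x) (fst x)"
  let ?M = "mult_funs (Suc C) n"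
  let ?K = "\<lambda>M. PiE {..C} (\<lambda>i. {..M (Suc i)})"
  \<comment> \<open>The contribution when k of the parts i + 1 of the larger partition come from
    parts i: the sign, the Pieri coefficient, and the power of t for column i + 1 of the smaller
    partition. The number of parts of the smaller partition enters only through column 1, that is at
    i = 0.\<close>
  let ?phi = "\<lambda>M i k. (-1) ^ k * gbin (M (Suc i)) k * t ^ (tail_sum C M (Suc i) - k choose 2) *
     (if i = 0 then beta (tail_sum C M 1 - k) else 1)"
  define bwd where "bwd = (\<lambda>(M, k). (((\<Sum>i\<le>C. k i), unraise C M k), k))"
  define fwd where "fwd = (\<lambda>((r :: nat, m), k). (raise C m k, k))"
  have finK: "finite (?K M)" for M :: "nat \<Rightarrow> nat" by (rule finite_PiE) auto
  have "(\<Sum>r\<le>n. elem_e r * gg_sym (n - r)) =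
    (\<Sum>r\<le>n. \<Sum>m\<in>mult_funs C (n - r). \<Sum>k\<in>strips C m r. scalar (?b m r * strip_coeff C m k) * HL (parts (Suc C) (raise C m k)))"
  proof (rule sum.cong[OF refl])
    fix r assume "r \<in> {..n}"
    have "elem_e r * gg_sym (n - r) = (\<Sum>m\<in>mult_funs C (n - r). scalar (?b m r) * (elem_e r * HL (parts C m)))"
      by (subst gg_sym_mult_funs[of "n - r" C]) (simp_all add: C_def sum_distrib_left mult.left_commute)
    also have "\<dots> = (\<Sum>m\<in>mult_funs C (n - r). \<Sum>k\<in>strips C m r. scalar (?b m r * strip_coeff C m k) * HL (parts (Suc C) (raise C m k)))"
      by (simp only: HL_pieri sum_distrib_left scalar_mult mult.assoc)
    finally show "elem_e r * gg_sym (n - r) = (\<Sum>m\<in>mult_funs C (n - r). \<Sum>k\<in>strips C m r. scalar (?b m r * strip_coeff C m k) * HL (parts (Suc C) (raise C m k)))" .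
  qed
  also have "\<dots> = (\<Sum>y\<in>?T. scalar (?b (snd (fst y)) (fst (fst y)) * strip_coeff C (snd (fst y)) (snd y)) *
      HL (parts (Suc C) (raise C (snd (fst y)) (snd y))))"
  proof -
    let ?g = "\<lambda>r m k. scalar (?b m r * strip_coeff C m k) * HL (parts (Suc C) (raise C m k))"
    have "(\<Sum>r\<le>n. \<Sum>m\<in>mult_funs C (n - r). \<Sum>k\<in>strips C m r. ?g r m k) =
        (\<Sum>x\<in>(SIGMA r : {..n}. mult_funs C (n - r)). \<Sum>k\<in>strips C (snd x) (fst x). ?g (fst x) (snd x) k)"
      by (subst sum.Sigma) (simp_all add: finite_mult_funs C_def case_prod_unfold)
    also have "\<dots> = (\<Sum>y\<in>?T. ?g (fst (fst y)) (snd (fst y)) (snd y))"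
      by (subst sum.Sigma) (simp_all add: finite_mult_funs C_def case_prod_unfold)
    finally show ?thesis .
  qed
  \<comment> \<open>For a fixed result M the strips leading to it are all k with k i \<le> M (i +
    1), conditions that are independent for different i.\<close>
  also have "\<dots> = (\<Sum>(M, k)\<in>Sigma ?M ?K. scalar ((-1) ^ n * (\<Prod>i\<le>C. ?phi M i (k i))) * HL (parts (Suc C) M))"
  proof (rule sum.reindex_bij_witness[of _ bwd fwd])
    fix x assume "x \<in> ?T"
    then obtain r m k where x: "x = ((r, m), k)" and r: "r \<le> n" and m: "m \<in> mult_funs C (n - r)" and k: "k \<in> strips C m r"
      by auto
    have m0: "m 0 = 0" "m i = 0" if "i > C" for i using m that by (auto simp: mult_funs_def)
    have km: "k i \<le> m i" if "1 \<le> i" "i \<le> C" for i using strips_le[OF k that] .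
    have sumk: "(\<Sum>i\<le>C. k i) = r" using k by (simp add: strips_def)
    have "raise C m k \<in> ?M"
      using sum_weight_raise[OF k] m r by (auto simp: mult_funs_def raise_def simp del: sum.cl_ivl_Suc)
    moreover have "k \<in> ?K (raise C m k)" using k by (auto simp: strips_def PiE_iff raise_def)
    ultimately show "fwd x \<in> Sigma ?M ?K" by (simp add: x fwd_def)
    have un: "unraise C (raise C m k) k = m"
      using km m by (auto simp: fun_eq_iff unraise_def raise_def mult_funs_def Suc_le_eq)
    show "bwd (fwd x) = x"
      using un sumk by (simp add: x fwd_def bwd_def)
    \<comment> \<open>A part of size C = n cannot occur in a partition of n - r when r \<ge>
      1.\<close>
    have kC: "k C = 0"
    proof (cases "C = 0")
      case False
      have "C * m C \<le> (\<Sum>i=1..C. i * m i)" using False by (intro member_le_sum[of C "{1..C}" "\<lambda>i. i * m i"]) auto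
      also have "\<dots> = n - r" using m by (simp add: mult_funs_def)
      finally have "C * m C \<le> n - r" .
      hence "m C = 0 \<or> r = 0" using False C_def by (cases "m C") auto
      thus ?thesis using km[of C] False sumk by auto
    qed (use r sumk C_def in auto)
    have ts: "tail_sum C m i = tail_sum C (raise C m k) i - k (i - 1)" if "1 \<le> i" "i \<le> C" for i
      using tail_sum_unraise[of C k "raise C m k" i] kC that unfolding un by (auto simp: raise_def)
    have "(-1) ^ n * (\<Prod>i\<le>C. ?phi (raise C m k) i (k i)) = ?b m r * strip_coeff C m k"
    proof -
      let ?R = "raise C m k"
      have "(\<Prod>i\<le>C. ?phi ?R i (k i)) = (\<Prod>i\<le>C. (-1) ^ k i) * (\<Prod>i\<le>C. gbin (?R (Suc i)) (k i)) *
         (\<Prod>i\<le>C. t ^ (tail_sum C ?R (Suc i) - k i choose 2)) * (\<Prod>i\<le>C. if i = 0 then beta (tail_sum C ?R 1 - k i) else 1)"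
        by (simp add: prod.distrib)
      also have "(\<Prod>i\<le>C. (-1 :: complex) ^ k i) = (-1) ^ r" by (simp add: sumk flip: power_sum)
      also have "(\<Prod>i\<le>C. gbin (?R (Suc i)) (k i)) = strip_coeff C m k" by (simp add: strip_coeff_def)
      also have "(\<Prod>i\<le>C. t ^ (tail_sum C ?R (Suc i) - k i choose 2)) = (\<Prod>i=1..C. t ^ (tail_sum C m i choose 2))"
      proof -
        have "(\<Prod>i\<le>C. t ^ (tail_sum C ?R (Suc i) - k i choose 2)) = (\<Prod>i<C. t ^ (tail_sum C ?R (Suc i) - k i choose 2))"
          by (simp add: lessThan_Suc_atMost[symmetric] tail_sum_def numeral_2_eq_2)
        also have "\<dots> = (\<Prod>i=1..C. t ^ (tail_sum C m i choose 2))"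
          by (rule prod.reindex_bij_witness[of _ "\<lambda>i. i - 1" Suc]) (auto simp: ts)
        finally show ?thesis .
      qed
      also have "(\<Prod>i\<le>C. if i = 0 then beta (tail_sum C ?R 1 - k i) else 1) = beta (tail_sum C ?R 1 - k 0)"
        by (subst prod.mono_neutral_right[where S = "{0}"]) auto
      also have "tail_sum C ?R 1 - k 0 = tail_sum C m 1"
        by (cases "C = 0") (auto simp: ts, simp add: tail_sum_def)
      finally have "(-1) ^ n * (\<Prod>i\<le>C. ?phi ?R i (k i)) = ((-1) ^ n * (-1) ^ r) * beta (tail_sum C m 1) *
          (\<Prod>i=1..C. t ^ (tail_sum C m i choose 2)) * strip_coeff C m k" by (simp only: mult_ac)
      also have "(-1) ^ n * (-1) ^ r = (-1 :: complex) ^ (n - r)"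
        using r by (simp flip: power_add) (simp add: minus_one_power_iff)
      finally show ?thesis .
    qed
    thus "(case fwd x of (M, k) \<Rightarrow>
        scalar ((-1) ^ n * (\<Prod>i\<le>C. ?phi M i (k i))) * HL (parts (Suc C) M)) =
      scalar (?b (snd (fst x)) (fst (fst x)) * strip_coeff C (snd (fst x)) (snd x)) *
        HL (parts (Suc C) (raise C (snd (fst x)) (snd x)))"
      by (simp add: x fwd_def del: parts.simps)
  next
    fix y assume "y \<in> Sigma ?M ?K"
    then obtain M k where y: "y = (M, k)" and M: "M \<in> ?M" and k: "k \<in> ?K M" by auto
    have kM: "k i \<le> M (Suc i)" if "i \<le> C" for i using k that by auto
    have MC: "M (Suc C) = 0"
    proof -
      have "Suc C * M (Suc C) \<le> (\<Sum>i=1..Suc C. i * M i)"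
        by (intro member_le_sum[of "Suc C" "{1..Suc C}" "\<lambda>i. i * M i"]) auto
      also have "\<dots> = C" using M by (simp add: mult_funs_def C_def del: sum.cl_ivl_Suc)
      finally show ?thesis by (cases "M (Suc C)") auto
    qed
    let ?m = "unraise C M k" and ?r = "\<Sum>i\<le>C. k i"
    have ra: "raise C ?m k = M"
    proof
      fix i
      consider "i = 0" | j where "i = Suc j" "j < C" | "i = Suc C" | "i > Suc C"
        by (metis not_less_less_Suc_eq not0_implies_Suc Suc_lessI Suc_less_eq linorder_neqE_nat)
      thus "raise C ?m k i = M i"
      proof cases
        case 2 thus ?thesis using kM[of j] by (simp add: raise_def unraise_def)
      next
        case 3 thus ?thesis using kM[of C] MC by (simp add: raise_def)
      qed (use M in \<open>auto simp: raise_def unraise_def mult_funs_def\<close>)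
    qed
    have st: "k \<in> strips C ?m ?r"
      using k member_le_sum[of 0 "{..C}" k] by (auto simp: strips_def PiE_iff unraise_def)
    have "(\<Sum>i=1..C. i * ?m i) + ?r = n"
      using sum_weight_raise[OF st] M unfolding ra by (simp add: mult_funs_def del: sum.cl_ivl_Suc)
    hence "?m \<in> mult_funs C (n - ?r)" "?r \<le> n" by (auto simp: mult_funs_def unraise_def)
    thus "bwd y \<in> ?T" using st by (simp add: y bwd_def)
    show "fwd (bwd y) = y"
      using ra by (simp add: y fwd_def bwd_def)
  qed
  \<comment> \<open>Since the k i are independent, the sum over strips is a product of sums over a
    single k.\<close>
  also have "\<dots> = (\<Sum>M\<in>?M. scalar ((-1) ^ n * (\<Prod>i\<le>C. \<Sum>k\<le>M (Suc i). ?phi M i k)) * HL (parts (Suc C) M))"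
  proof -
    have "(\<Prod>i\<le>C. \<Sum>k\<le>M (Suc i). ?phi M i k) = (\<Sum>k\<in>?K M. \<Prod>i\<le>C. ?phi M i (k i))" for M
      by (rule prod_sum_PiE) auto
    thus ?thesis
      by (subst sum.Sigma[symmetric]) (simp_all only: finK scalar_sum sum_distrib_left sum_distrib_right ballI, auto simp: finite_mult_funs C_def)
  qed
  also have "\<dots> = (\<Sum>M\<in>{\<lambda>i. if i = 1 then n else 0}. scalar ((-1) ^ n * (\<Prod>i\<le>C. \<Sum>k\<le>M (Suc i). ?phi M i k)) * HL (parts (Suc C) M))"
  proof (rule sum.mono_neutral_right)
    show "finite ?M" by (simp add: finite_mult_funs C_def)
    have "(\<Sum>i=1..Suc C. i * (if i = 1 then n else 0)) = (\<Sum>i\<in>{1}. i * (if i = 1 then n else 0))"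
      by (rule sum.mono_neutral_right) auto
    thus "{\<lambda>i. if i = 1 then n else 0} \<subseteq> ?M" by (auto simp: mult_funs_def simp del: sum.cl_ivl_Suc)
    show "\<forall>M\<in>?M - {\<lambda>i. if i = 1 then n else 0}. scalar ((-1) ^ n * (\<Prod>i\<le>C. \<Sum>k\<le>M (Suc i). ?phi M i k)) * HL (parts (Suc C) M) = 0"
    proof
      fix M assume M: "M \<in> ?M - {\<lambda>i. if i = 1 then n else 0}"
      let ?I = "{i. i > 1 \<and> M i > 0}"
      have sub: "?I \<subseteq> {..Suc C}"
      proof
        fix i assume "i \<in> ?I"
        moreover have "M i = 0" if "i > Suc C" using M that by (simp add: mult_funs_def)
        ultimately show "i \<in> {..Suc C}" by (cases "i > Suc C") auto
      qed
      have "?I \<noteq> {}"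
      proof
        assume "?I = {}"
        hence z: "M i = 0" if "i > 1" for i using that by auto
        have "(\<Sum>i=1..Suc C. i * M i) = (\<Sum>i\<in>{1}. i * M i)"
          by (rule sum.mono_neutral_right) (use z in auto)
        hence "M 1 = n" using M by (simp add: mult_funs_def del: sum.cl_ivl_Suc)
        moreover have "M 0 = 0" using M by (simp add: mult_funs_def)
        ultimately have "M = (\<lambda>i. if i = 1 then n else 0)" using z
          by (intro ext) (metis less_one linorder_neqE_nat)
        thus False using M by simp
      qed
      moreover have finI: "finite ?I" using sub by (rule finite_subset) simp
      ultimately have c: "Max ?I \<in> ?I" "\<And>i. i \<in> ?I \<Longrightarrow> i \<le> Max ?I" by (auto simp: Max_in simp del: mem_Collect_eq)
      \<comment> \<open>The largest part is c' + 1, so its column has length M (c' + 1) and the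
        factor at i = c' is the sum in \<open>qbinomial_zero\<close>. As c' \<ge> 1, that factor
        contains no \<open>beta\<close>.\<close>
      define c' where "c' = Max ?I - 1"
      have c': "Max ?I = Suc c'" "c' \<ge> 1" using c(1) by (auto simp: c'_def)
      have "Suc c' \<le> Suc C" "M (Suc c') \<ge> 1" using c(1) sub c'(1) by auto
      have ts: "tail_sum C M (Suc c') = M (Suc c') \<or> C < Suc c'"
      proof (cases "C < Suc c'")
        case False
        have "tail_sum C M (Suc c') = (\<Sum>j\<in>{Suc c'}. M j)"
          unfolding tail_sum_def
        proof (rule sum.mono_neutral_right)
          have "M i = 0" if "Suc c' < i" for i
            using c(2)[of i] that unfolding c'(1) by (cases "M i") auto
          thus "\<forall>i\<in>{Suc c'..C} - {Suc c'}. M i = 0" by auto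
        qed (use False in auto)
        thus ?thesis by simp
      qed simp
      have cC: "\<not> C < Suc c'"
      proof
        assume "C < Suc c'"
        hence "Suc c' = Suc C" using \<open>Suc c' \<le> Suc C\<close> by simp
        moreover have "Suc C * M (Suc C) \<le> (\<Sum>i=1..Suc C. i * M i)"
          by (intro member_le_sum[of "Suc C" "{1..Suc C}" "\<lambda>i. i * M i"]) auto
        moreover have "(\<Sum>i=1..Suc C. i * M i) = C" using M by (simp add: mult_funs_def C_def del: sum.cl_ivl_Suc)
        ultimately show False using \<open>M (Suc c') \<ge> 1\<close> by (cases "M (Suc C)") auto
      qed
      have "(\<Sum>k\<le>M (Suc c'). ?phi M c' k) = 0"
        using qbinomial_zero[OF \<open>M (Suc c') \<ge> 1\<close>] ts cC c'(2) by simp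
      hence "(\<Prod>i\<le>C. \<Sum>k\<le>M (Suc i). ?phi M i k) = 0"
        using cC by (intro prod_zero bexI[of _ c']) auto
      thus "scalar ((-1) ^ n * (\<Prod>i\<le>C. \<Sum>k\<le>M (Suc i). ?phi M i k)) * HL (parts (Suc C) M) = 0" by simp
    qed
  qed
  also have "\<dots> = scalar (inverse t ^ n) * elem_e n"
  proof -
    define M1 where "M1 = (\<lambda>i :: nat. if i = 1 then n else 0)"
    have M1: "M1 (Suc i) = (if i = 0 then n else 0)" for i by (simp add: M1_def)
    have p: "parts (Suc C) M1 = replicate n 1"
    proof -
      have "parts c M1 = (if c = 0 then [] else replicate n 1)" for c by (induction c) (auto simp: M1)
      thus ?thesis by simp
    qed
    have ts: "tail_sum C M1 (Suc i) = (if i = 0 then n else 0)" for i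
      by (auto simp: tail_sum_def M1_def C_def)
    have "(\<Prod>i\<le>C. \<Sum>k\<le>M1 (Suc i). ?phi M1 i k) = (\<Prod>i\<in>{0}. \<Sum>k\<le>M1 (Suc i). ?phi M1 i k)"
      by (rule prod.mono_neutral_right) (auto simp: ts M1 binomial_eq_0)
    also have "\<dots> = (\<Sum>k\<le>n. (-1) ^ k * gbin n k * t ^ (n - k choose 2) * beta (n - k))"
      using ts[of 0] by (simp add: M1)
    finally show ?thesis using column_sum[of n] p HL_column[of n] unfolding M1_def[symmetric] by (simp del: parts.simps)
  qed
  finally show ?thesis .
qed

end

section \<open>Finite fields and their characters\<close>

lemma prime_CHAR_finite_field: "prime CHAR('a :: {field, finite})"
  by (rule prime_CHAR_semidom) (rule finite_imp_CHAR_pos, simp)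

text \<open>Sylow's theorem in the additive group gives a subgroup of order r, and a nonzero element
  of it is annihilated by r.\<close>

lemma prime_dvd_CARD_eq_CHAR:
  assumes "prime r" "r dvd CARD('a :: {field, finite})"
  shows "r = CHAR('a)"
proof -
  define G where "G = \<lparr>carrier = (UNIV :: 'a set), monoid.mult = (\<lambda>x y :: 'a. x + y), one = (0 :: 'a)\<rparr>"
  have "group G"
    by (rule groupI) (auto simp: G_def add.assoc intro: exI[of _ "- x" for x])
  then interpret G: group G .
  have pow: "x [^]\<^bsub>G\<^esub> n = of_nat n * x" for x and n :: nat
    by (induction n) (auto simp: G_def algebra_simps)
  obtain m where "CARD('a) = r ^ 1 * m" using assms(2) by auto
  hence "\<exists>H. subgroup H G \<and> card H = r ^ 1"
    by (intro sylow_thm[OF assms(1)] \<open>group G\<close>) (auto simp: Coset.order_def G_def)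
  then obtain H where H: "subgroup H G" "card H = r" by auto
  have "H \<noteq> {0}" using H(2) assms(1) by auto
  moreover have "0 \<in> H" using subgroup.one_closed[OF H(1)] by (simp add: G_def)
  ultimately obtain x where x: "x \<in> H" "x \<noteq> 0" by blast
  have "x [^]\<^bsub>G\<^esub> card H = \<one>\<^bsub>G\<^esub>"
  proof -
    interpret H: group "G\<lparr>carrier := H\<rparr>" by (rule subgroup.subgroup_is_group[OF H(1) \<open>group G\<close>])
    have "x [^]\<^bsub>G\<lparr>carrier := H\<rparr>\<^esub> Coset.order (G\<lparr>carrier := H\<rparr>) = \<one>\<^bsub>G\<lparr>carrier := H\<rparr>\<^esub>"
      by (rule H.pow_order_eq_1) (use x in simp)
    thus ?thesis by (simp add: Coset.order_def nat_pow_def)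
  qed
  hence "of_nat r * x = 0" unfolding pow H(2) by (simp add: G_def)
  hence "of_nat r = (0 :: 'a)" using x(2) by simp
  hence "CHAR('a) dvd r" by (simp add: of_nat_eq_0_iff_char_dvd)
  thus ?thesis using assms(1) prime_CHAR_finite_field[where 'a = 'a] primes_dvd_imp_eq by metis
qed

lemma CARD_prime_power: "\<exists>e. CARD('a :: {field, finite}) = CHAR('a) ^ e"
proof -
  let ?p = "CHAR('a)"
  have "CARD('a) \<noteq> 0" by simp
  moreover have "\<not> is_unit ?p" using prime_CHAR_finite_field[where 'a = 'a] by (metis not_prime_unit)
  ultimately obtain m where m: "CARD('a) = ?p ^ multiplicity ?p CARD('a) * m" "\<not> ?p dvd m"
    using multiplicity_decompose' by metis
  have "m = 1"
    by (metis ccontr prime_factor_nat m(1) dvd_mult prime_dvd_CARD_eq_CHAR m(2))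
  thus ?thesis using m(1) by (metis mult.right_neutral)
qed

lemma CARD_gt_1: "CARD('a :: {field, finite}) \<ge> 2"
proof -
  have "card {0, 1 :: 'a} \<le> CARD('a)" by (rule card_mono) auto
  thus ?thesis by simp
qed

section \<open>The Frobenius map, its fixed points, and the groups of units\<close>

lemma power_sum_frob:
  fixes f :: "'b \<Rightarrow> ('a :: {field, finite}) alg_closure"
  shows "sum f A ^ (CARD('a) ^ n) = (\<Sum>x\<in>A. f x ^ (CARD('a) ^ n))"
proof -
  obtain e where "CARD('a) = CHAR('a) ^ e" using CARD_prime_power by blast
  hence "CARD('a) ^ n = CHAR('a alg_closure) ^ (e * n)" by (simp add: power_mult)
  thus ?thesis using prime_CHAR_finite_field[where 'a = 'a] by (intro freshmans_dream_sum') auto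
qed

lemma frob_add: "(x + y :: ('a :: {field, finite}) alg_closure) ^ (CARD('a) ^ n) = x ^ (CARD('a) ^ n) + y ^ (CARD('a) ^ n)"
proof -
  obtain e where "CARD('a) = CHAR('a) ^ e" using CARD_prime_power by blast
  hence "CARD('a) ^ n = CHAR('a alg_closure) ^ (e * n)" by (simp add: power_mult)
  thus ?thesis using prime_CHAR_finite_field[where 'a = 'a] by (intro freshmans_dream') auto
qed

lemma CARD_pow_pos: "CARD('a :: {field, finite}) ^ n > 0"
  by simp

lemma frob_minus: "(- x :: ('a :: {field, finite}) alg_closure) ^ (CARD('a) ^ n) = - (x ^ (CARD('a) ^ n))"
proof -
  have "(- x) ^ (CARD('a) ^ n) + x ^ (CARD('a) ^ n) = 0"
    using frob_add[of "- x" x n] by (simp add: power_0_left)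
  thus ?thesis by (simp add: eq_neg_iff_add_eq_0)
qed

lemma frob_diff: "(x - y :: ('a :: {field, finite}) alg_closure) ^ (CARD('a) ^ n) = x ^ (CARD('a) ^ n) - y ^ (CARD('a) ^ n)"
  using frob_add[of x "- y" n] by (simp add: frob_minus)

lemma frob_inj: "x ^ (CARD('a) ^ n) = y ^ (CARD('a) ^ n) \<longleftrightarrow> x = (y :: ('a :: {field, finite}) alg_closure)"
  using frob_diff[of x y n] by auto

text \<open>Multiplication by x permutes the nonzero elements, so their product is unchanged when
  multiplied by x^(q - 1).\<close>

lemma power_CARD: "x ^ CARD('a) = (x :: 'a :: {field, finite})"
proof (cases "x = 0")
  case False
  let ?U = "UNIV - {0 :: 'a}"
  have "(\<Prod>y\<in>?U. y) = (\<Prod>y\<in>?U. x * y)"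
    by (rule prod.reindex_bij_witness[of _ "\<lambda>y. x * y" "\<lambda>y. y / x"]) (use False in auto)
  also have "\<dots> = x ^ (CARD('a) - 1) * (\<Prod>y\<in>?U. y)" by (simp add: prod.distrib card_Diff_singleton)
  finally have "x ^ (CARD('a) - 1) = 1" by (auto simp: prod_zero_iff)
  hence "x ^ Suc (CARD('a) - 1) = x" by (simp only: power_Suc mult_1_right)
  moreover have "Suc (CARD('a) - 1) = CARD('a)" using CARD_gt_1[where 'a = 'a] by linarith
  ultimately show ?thesis by metis
qed (simp add: power_0_left)

lemma power_CARD_pow: "x ^ (CARD('a) ^ n) = (x :: 'a :: {field, finite})"
  by (induction n) (simp_all add: power_mult power_CARD mult.commute)

lemma poly_frob_root:
  assumes "poly (map_poly to_ac p) z = 0"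
  shows "poly (map_poly to_ac p) (z ^ (CARD('a :: {field, finite}) ^ k)) = (0 :: 'a alg_closure)"
proof -
  let ?d = "Polynomial.degree (map_poly to_ac p :: 'a alg_closure poly)" and ?q = "CARD('a) ^ k"
  have "poly (map_poly to_ac p) (z ^ ?q) = (\<Sum>i\<le>?d. (to_ac (Polynomial.coeff p i) * z ^ i) ^ ?q)"
    unfolding poly_altdef
    by (rule sum.cong) (simp_all add: coeff_map_poly power_mult_distrib power_CARD_pow power_mult[symmetric] mult.commute flip: to_ac_power)
  also have "\<dots> = poly (map_poly to_ac p) z ^ ?q"
    unfolding power_sum_frob[symmetric] poly_altdef by (simp add: coeff_map_poly)
  finally show ?thesis using assms by (simp add: power_0_left)
qed

text \<open>All the z^(q^k) are roots of one polynomial over the finite field, so two of them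
  coincide; injectivity of the Frobenius map cancels the smaller exponent.\<close>

lemma frob_periodic: "\<exists>n\<ge>1. z ^ (CARD('a) ^ n) = (z :: ('a :: {field, finite}) alg_closure)"
proof -
  obtain p :: "'a poly" where p: "p \<noteq> 0" "poly (map_poly to_ac p) z = 0" by (rule alg_closure_algebraic)
  have nz: "map_poly to_ac p \<noteq> (0 :: 'a alg_closure poly)"
    using p(1) by (auto simp: poly_eq_iff coeff_map_poly)
  have "range (\<lambda>k. z ^ (CARD('a) ^ k)) \<subseteq> {x. poly (map_poly to_ac p) x = 0}"
    using poly_frob_root[OF p(2)] by auto
  hence "finite (range (\<lambda>k. z ^ (CARD('a) ^ k)))" using poly_roots_finite[OF nz] finite_subset by blast
  hence "\<not> inj (\<lambda>k. z ^ (CARD('a) ^ k))" using finite_imageD by blast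
  then obtain i j where ij: "i < j" "z ^ (CARD('a) ^ i) = z ^ (CARD('a) ^ j)"
    unfolding inj_on_def by (metis linorder_neqE_nat)
  have "z ^ (CARD('a) ^ j) = (z ^ (CARD('a) ^ (j - i))) ^ (CARD('a) ^ i)"
    using ij(1) by (simp flip: power_mult power_add)
  hence "z ^ (CARD('a) ^ (j - i)) = z" using ij(2) frob_inj by metis
  thus ?thesis using ij(1) by (intro exI[of _ "j - i"]) auto
qed

text \<open>The polynomial x^(q^n) - x has derivative -1, hence only simple roots, and it splits
  over the closure.\<close>

lemma finite_card_frob_fixed:
  assumes "n \<ge> 1"
  shows "finite {z :: ('a :: {field, finite}) alg_closure. z ^ (CARD('a) ^ n) = z}"
    "card {z :: 'a alg_closure. z ^ (CARD('a) ^ n) = z} = CARD('a) ^ n"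
proof -
  let ?N = "CARD('a) ^ n"
  define p where "p = Polynomial.monom 1 ?N - (Polynomial.monom 1 1 :: 'a alg_closure poly)"
  have N: "?N > 1" using CARD_gt_1[where 'a = 'a] assms by (metis One_nat_def Suc_1 Suc_le_lessD one_less_power zero_less_one_class.zero_le_one order_less_le_trans)
  have deg: "Polynomial.degree p = ?N" unfolding p_def using N
    unfolding diff_conv_add_uminus by (subst degree_add_eq_left) (auto simp: degree_monom_eq)
  have nz: "p \<noteq> 0" using deg N by auto
  have roots: "{z. poly p z = 0} = {z. z ^ ?N = z}"
    by (auto simp: p_def poly_monom)
  have "\<not> [:- a, 1:] ^ 2 dvd p" for a
  proof
    assume "[:- a, 1:] ^ 2 dvd p"
    then obtain r where "p = [:- a, 1:] ^ 2 * r" by (rule dvdE)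
    hence r: "p = [:- a, 1:] * ([:- a, 1:] * r)" by (simp only: power2_eq_square mult.assoc)
    have "of_nat ?N = (0 :: 'a alg_closure)"
    proof -
      obtain e where e: "CARD('a) = CHAR('a) ^ e" using CARD_prime_power by blast
      hence "e \<noteq> 0" using CARD_gt_1[where 'a = 'a] by (intro notI) simp
      hence "CHAR('a) dvd CARD('a)" using e by (metis dvd_power neq0_conv)
      moreover have "CARD('a) dvd ?N" using assms by (intro dvd_power) auto
      ultimately have "CHAR('a) dvd ?N" by (rule dvd_trans)
      thus ?thesis unfolding of_nat_eq_0_iff_char_dvd CHAR_alg_closure .
    qed
    hence "pderiv (Polynomial.monom 1 ?N) = (0 :: 'a alg_closure poly)" unfolding pderiv_monom by (simp del: of_nat_power)
    hence "pderiv p = - pderiv (Polynomial.monom 1 1)" by (simp only: p_def pderiv_diff diff_0)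
    hence "pderiv p = -1" by (simp add: pderiv_monom monom_0 one_pCons)
    moreover have "poly (pderiv p) a = 0"
      unfolding r pderiv_mult[of "[:- a, 1:]"] poly_add poly_mult by simp
    ultimately show False by simp
  qed
  hence order: "order a p = 1" if "poly p a = 0" for a
    using that nz order_root[of p a] order_divides[of a 2 p] by (metis One_nat_def less_2_cases linorder_not_less numeral_2_eq_2)
  show fin: "finite {z :: 'a alg_closure. z ^ ?N = z}" using poly_roots_finite[OF nz] roots by simp
  obtain A where A: "size A = Polynomial.degree p" "p = Polynomial.smult (lead_coeff p) (\<Prod>x\<in>#A. [:- x, 1:])"
    using alg_closed_imp_factorization[OF nz] by blast
  have lc: "lead_coeff p \<noteq> 0" using nz by simp
  have "count A a = order a p" for a
  proof -
    have "order a p = order a (\<Prod>x\<in>#A. [:- x, 1:])" by (subst A(2)) (use lc in \<open>simp add: order_smult\<close>)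
    also have "\<dots> = count A a"
    proof (induction A)
      case (add x A)
      have nz: "(\<Prod>x\<in>#A. [:- x, 1:]) \<noteq> 0" by (auto simp: prod_mset_zero_iff)
      have "order a ([:- x, 1:] * (\<Prod>x\<in>#A. [:- x, 1:])) = order a [:- x, 1:] + order a (\<Prod>x\<in>#A. [:- x, 1:])"
        by (rule order_mult) (use nz in \<open>simp del: mult_pCons_left\<close>)
      moreover have "order a [:- x, 1:] = (if x = a then 1 else 0)"
        using order_power_n_n[of x 1] by (auto intro: order_0I)
      ultimately show ?case using add by auto
    qed simp
    finally show ?thesis ..
  qed
  hence count: "count A a = (if a \<in> {z. poly p z = 0} then 1 else 0)" for a
    using order[of a] order_0I[of p a] by auto
  hence "A = mset_set {z. poly p z = 0}"
    using fin roots by (intro multiset_eqI) (simp add: count_mset_set')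
  thus "card {z :: 'a alg_closure. z ^ ?N = z} = ?N" using A(1) deg roots by simp
qed

lemma field_units_card:
  assumes "n \<ge> 1"
  shows "finite (field_units n :: ('a :: {field, finite}) alg_closure set)"
    "card (field_units n :: 'a alg_closure set) = CARD('a) ^ n - 1"
proof -
  have e: "field_units n = {z :: 'a alg_closure. z ^ (CARD('a) ^ n) = z} - {0}" by (auto simp: field_units_def)
  show "finite (field_units n :: 'a alg_closure set)" unfolding e using finite_card_frob_fixed[OF assms] by auto
  show "card (field_units n :: 'a alg_closure set) = CARD('a) ^ n - 1"
    unfolding e using finite_card_frob_fixed[OF assms, where 'a = 'a] by (subst card_Diff_singleton) (auto simp: power_0_left)
qed

text \<open>The embedded field consists of fixed points, and both sets have q elements.\<close>

lemma range_to_ac: "z ^ CARD('a) = z \<longleftrightarrow> z \<in> range (to_ac :: 'a :: {field, finite} \<Rightarrow> _)"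
proof -
  have "range (to_ac :: 'a \<Rightarrow> _) \<subseteq> {z. z ^ CARD('a) = z}"
    by (auto simp: power_CARD simp flip: to_ac_power)
  moreover have "card (range (to_ac :: 'a \<Rightarrow> _)) = CARD('a)" by (rule card_image[OF inj_to_ac])
  ultimately have "range (to_ac :: 'a \<Rightarrow> _) = {z. z ^ CARD('a) = z}"
    using finite_card_frob_fixed[of 1, where 'a = 'a] by (intro card_subset_eq) auto
  thus ?thesis by auto
qed

lemma field_units_closed:
  fixes x y :: "('a :: {field, finite}) alg_closure"
  assumes "x \<in> field_units n" "y \<in> field_units n"
  shows "x * y \<in> field_units n" "inverse x \<in> field_units n" "x ^ k \<in> field_units n" "1 \<in> (field_units n :: 'a alg_closure set)"
proof -
  have "(x ^ k) ^ (CARD('a) ^ n) = (x ^ (CARD('a) ^ n)) ^ k" by (simp add: power_mult[symmetric] mult.commute)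
  thus "x * y \<in> field_units n" "inverse x \<in> field_units n" "x ^ k \<in> field_units n" "1 \<in> (field_units n :: 'a alg_closure set)"
    using assms by (auto simp: field_units_def power_mult_distrib power_inverse)
qed

text \<open>The points fixed by the n-th power of Frobenius are assembled into a finite field, whose
  multiplicative group has a generator. The last clause records that the order of g is exactly q^n -
  1.\<close>

lemma field_units_cyclic:
  assumes "n \<ge> 1"
  obtains g :: "('a :: {field, finite}) alg_closure"
    where "g \<in> field_units n" "field_units n = range (\<lambda>i. g ^ i)"
      "\<And>i j. g ^ i = g ^ j \<longleftrightarrow> i mod (CARD('a) ^ n - 1) = j mod (CARD('a) ^ n - 1)"
proof -
  let ?S = "{z :: 'a alg_closure. z ^ (CARD('a) ^ n) = z}"
  define R where "R = \<lparr>carrier = ?S, monoid.mult = (\<lambda>x y :: 'a alg_closure. x * y), one = (1 :: 'a alg_closure),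
    ring.zero = (0 :: 'a alg_closure), add = (\<lambda>x y :: 'a alg_closure. x + y)\<rparr>"
  have Units: "Units R = carrier R - {\<zero>\<^bsub>R\<^esub>}"
  proof (intro equalityI subsetI)
    fix x assume "x \<in> carrier R - {\<zero>\<^bsub>R\<^esub>}"
    hence "\<exists>y\<in>carrier R. y \<otimes>\<^bsub>R\<^esub> x = \<one>\<^bsub>R\<^esub> \<and> x \<otimes>\<^bsub>R\<^esub> y = \<one>\<^bsub>R\<^esub>"
      by (intro bexI[of _ "inverse x"]) (auto simp: R_def power_inverse)
    thus "x \<in> Units R" using \<open>x \<in> carrier R - {\<zero>\<^bsub>R\<^esub>}\<close> by (simp add: Units_def)
  qed (auto simp: Units_def R_def)
  have "cring R"
  proof (rule cringI)
    show "abelian_group R"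
    proof (rule abelian_groupI)
      fix x assume "x \<in> carrier R"
      thus "\<exists>y\<in>carrier R. y \<oplus>\<^bsub>R\<^esub> x = \<zero>\<^bsub>R\<^esub>"
        by (intro bexI[of _ "- x"]) (auto simp: R_def frob_minus)
    qed (auto simp: R_def frob_add power_0_left add_ac)
    show "comm_monoid R"
      by (rule comm_monoidI) (auto simp: R_def power_mult_distrib mult_ac)
  qed (auto simp: R_def algebra_simps)
  then interpret cring R .
  have "field R" by (rule cring_fieldI[OF Units])
  then interpret R: field R .
  have fin: "finite (carrier R)" using finite_card_frob_fixed(1)[OF assms, where 'a = 'a] by (simp add: R_def)
  obtain g where g: "g \<in> carrier (Multiplicative_Group.mult_of R)" "carrier (Multiplicative_Group.mult_of R) = {g [^]\<^bsub>R\<^esub> i | i :: nat. i \<in> UNIV}"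
    using R.finite_field_mult_group_has_gen[OF fin] by blast
  have car: "carrier (Multiplicative_Group.mult_of R) = field_units n"
    by (auto simp: R_def field_units_def Multiplicative_Group.carrier_mult_of)
  have pow: "g [^]\<^bsub>R\<^esub> i = g ^ i" for i :: nat
    by (induction i) (auto simp: R_def mult.commute)
  have rng: "field_units n = range (\<lambda>i. g ^ i)" using g(2) unfolding car pow by auto
  have gu: "g \<in> field_units n" using g(1) unfolding car .
  let ?Q = "CARD('a) ^ n - 1"
  have g0: "g \<noteq> 0" using gu by (simp add: field_units_def)
  have cQ: "card (range (\<lambda>i. g ^ i)) = ?Q" using field_units_card(2)[OF assms, where 'a = 'a] rng by simp
  have gQ: "g ^ ?Q = 1"
  proof -
    have "g ^ Suc ?Q = g" using gu CARD_pow_pos[of n, where 'a = 'a] by (simp add: field_units_def)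
    hence "g * g ^ ?Q = g * 1" by (simp only: power_Suc mult_1_right)
    thus ?thesis using g0 by (simp only: mult_cancel_left) simp
  qed
  have Qpos: "?Q > 0" using cQ field_units_card(1)[OF assms, where 'a = 'a] rng by (metis card_gt_0_iff empty_iff gu)
  have mod: "g ^ i = g ^ (i mod ?Q)" for i
  proof -
    have "g ^ i = g ^ (?Q * (i div ?Q) + i mod ?Q)" by simp
    also have "\<dots> = (g ^ ?Q) ^ (i div ?Q) * g ^ (i mod ?Q)" by (simp only: power_add power_mult)
    finally show ?thesis using gQ by simp
  qed
  have "range (\<lambda>i. g ^ i) = (\<lambda>i. g ^ i) ` {..<?Q}"
    using mod Qpos by fastforce
  hence "inj_on (\<lambda>i. g ^ i) {..<?Q}" using cQ by (intro eq_card_imp_inj_on) auto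
  hence "g ^ i = g ^ j \<longleftrightarrow> i mod ?Q = j mod ?Q" for i j
    using mod[of i] mod[of j] Qpos unfolding inj_on_def by (metis lessThan_iff mod_less_divisor)
  thus ?thesis using gu rng by (intro that)
qed

subsection \<open>Orbits\<close>

text \<open>Stated for an arbitrary map because it serves the Frobenius orbits both of field
  elements and of characters.\<close>

lemma orbit_of_periodic:
  assumes "(f ^^ m) x = x" "m \<ge> 1"
  defines "orb \<equiv> \<lambda>x. {(f ^^ k) x | k. True}"
  shows "finite (orb x)" "card (orb x) \<ge> 1" "(f ^^ j) x = x \<longleftrightarrow> card (orb x) dvd j" "y \<in> orb x \<Longrightarrow> orb y = orb x"
proof -
  define p where "p = (LEAST k. k \<ge> 1 \<and> (f ^^ k) x = x)"
  have p: "p \<ge> 1" "(f ^^ p) x = x" using LeastI[of "\<lambda>k. k \<ge> 1 \<and> (f ^^ k) x = x" m] assms(1,2) by (auto simp: p_def)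
  have least: "p \<le> k" if "k \<ge> 1" "(f ^^ k) x = x" for k unfolding p_def using that by (intro Least_le) auto
  have mult: "(f ^^ (p * a)) x = x" for a by (induction a) (simp_all add: funpow_add p(2))
  have mod: "(f ^^ k) x = (f ^^ (k mod p)) x" for k
  proof -
    have "(f ^^ k) x = (f ^^ (k mod p + p * (k div p))) x" by simp
    thus ?thesis by (simp only: funpow_add comp_apply mult)
  qed
  have orb: "orb x = (\<lambda>k. (f ^^ k) x) ` {..<p}"
  proof (intro equalityI subsetI)
    fix y assume "y \<in> orb x"
    then obtain k where "y = (f ^^ k) x" by (auto simp: orb_def)
    thus "y \<in> (\<lambda>k. (f ^^ k) x) ` {..<p}" using mod[of k] p(1) by (intro image_eqI[of _ _ "k mod p"]) auto
  qed (auto simp: orb_def)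
  have neq: "(f ^^ a) x \<noteq> (f ^^ b) x" if "a < b" "b < p" for a b
  proof
    assume "(f ^^ a) x = (f ^^ b) x"
    hence "(f ^^ (p - a)) ((f ^^ a) x) = (f ^^ (p - a)) ((f ^^ b) x)" by simp
    hence "(f ^^ (p - a + a)) x = (f ^^ (p - a + b)) x" by (simp only: funpow_add comp_apply)
    moreover have e: "p - a + a = p" "p - a + b = (b - a) + p" using that by auto
    ultimately have "(f ^^ p) x = (f ^^ ((b - a) + p)) x" by (simp only: e)
    hence "(f ^^ (b - a)) x = x" by (simp add: funpow_add p(2))
    hence "p \<le> b - a" using that by (intro least) auto
    thus False using that p(1) by linarith
  qed
  have inj: "inj_on (\<lambda>k. (f ^^ k) x) {..<p}"
    using neq by (intro inj_onI) (metis lessThan_iff linorder_neqE_nat)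
  have card: "card (orb x) = p" unfolding orb using inj by (simp add: card_image)
  show "finite (orb x)" unfolding orb by simp
  show "card (orb x) \<ge> 1" using card p(1) by simp
  show "(f ^^ j) x = x \<longleftrightarrow> card (orb x) dvd j"
  proof
    assume "(f ^^ j) x = x"
    hence "(f ^^ (j mod p)) x = x" using mod[of j] by simp
    moreover have "j mod p < p" using p(1) by simp
    ultimately have "\<not> j mod p \<ge> 1" using least[of "j mod p"] by linarith
    thus "card (orb x) dvd j" using card by (simp add: dvd_eq_mod_eq_0)
  next
    assume "card (orb x) dvd j"
    thus "(f ^^ j) x = x" using mult card by (auto elim: dvdE)
  qed
  show "orb y = orb x" if y0: "y \<in> orb x"
  proof -
    obtain k where y: "y = (f ^^ k) x" using y0 by (auto simp: orb_def)
    show ?thesis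
    proof (intro equalityI subsetI)
      fix z assume "z \<in> orb y"
      then obtain i where "z = (f ^^ i) y" by (auto simp: orb_def)
      hence "z = (f ^^ (i + k)) x" by (simp add: y funpow_add)
      thus "z \<in> orb x" by (auto simp: orb_def)
    next
      fix z assume "z \<in> orb x"
      then obtain i where z: "z = (f ^^ i) x" by (auto simp: orb_def)
      \<comment> \<open>Starting from the k-th iterate, p * k - k further steps complete k rounds of
        the cycle and return to x.\<close>
      have "p * k \<ge> k" using p(1) by (cases p) auto
      hence "i + (p * k - k) + k = i + p * k" by linarith
      hence "(f ^^ (i + (p * k - k))) y = (f ^^ (i + p * k)) x"
        unfolding y by (metis funpow_add comp_apply)
      also have "\<dots> = z" by (simp add: funpow_add mult z)
      finally show "z \<in> orb y" by (auto simp: orb_def)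
    qed
  qed
qed

lemma funpow_power: "((\<lambda>z. z ^ c) ^^ k) z = (z :: 'b :: monoid_mult) ^ (c ^ k)"
  by (induction k) (simp_all add: power_mult[symmetric] mult.commute)

lemma frob_orbit_alt: "frob_orbit z = {((\<lambda>z. z ^ CARD('a)) ^^ k) z | k. True}" for z :: "('a :: {field, finite}) alg_closure"
  by (simp add: frob_orbit_def funpow_power)

lemma frob_orbit_finite:
  fixes z :: "('a :: {field, finite}) alg_closure"
  shows "finite (frob_orbit z)" "card (frob_orbit z) \<ge> 1"
    "z ^ (CARD('a) ^ j) = z \<longleftrightarrow> card (frob_orbit z) dvd j" "w \<in> frob_orbit z \<Longrightarrow> frob_orbit w = frob_orbit z"
    "z \<in> frob_orbit z"
proof -
  obtain n where "n \<ge> 1" "z ^ (CARD('a) ^ n) = z" using frob_periodic by blast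
  hence n: "((\<lambda>z. z ^ CARD('a)) ^^ n) z = z" "n \<ge> 1" by (simp_all add: funpow_power)
  note o = orbit_of_periodic[OF n, folded frob_orbit_alt]
  show "finite (frob_orbit z)" "card (frob_orbit z) \<ge> 1" "w \<in> frob_orbit z \<Longrightarrow> frob_orbit w = frob_orbit z"
    using o by auto
  show "z ^ (CARD('a) ^ j) = z \<longleftrightarrow> card (frob_orbit z) dvd j" using o(3)[of j] by (simp add: funpow_power)
  show "z \<in> frob_orbit z" by (auto simp: frob_orbit_def intro: exI[of _ 0])
qed

lemma frob_orbit_frob: "frob_orbit (z ^ (CARD('a) ^ k)) = frob_orbit (z :: ('a :: {field, finite}) alg_closure)"
  by (rule frob_orbit_finite(4)) (auto simp: frob_orbit_def)

lemma frob_orbit_1: "frob_orbit (1 :: ('a :: {field, finite}) alg_closure) = {1}"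
  by (auto simp: frob_orbit_def)

lemma frob_orbit_eq_1: "frob_orbit z = {1} \<longleftrightarrow> z = (1 :: ('a :: {field, finite}) alg_closure)"
  using frob_orbit_finite(5)[of z] by (auto simp: frob_orbit_1)

lemma card_frob_orbit_le:
  assumes "z \<in> field_units n" "n \<ge> 1" shows "card (frob_orbit z) \<le> n"
  using assms frob_orbit_finite(3)[of z n] by (auto simp: field_units_def dest!: dvd_imp_le)

lemma Phi_D:
  assumes "f \<in> (Phi :: ('a :: {field, finite}) alg_closure set set)"
  shows "finite f" "card f \<ge> 1" "0 \<notin> f" "z \<in> f \<Longrightarrow> f = frob_orbit z"
proof -
  obtain z0 where z0: "f = frob_orbit z0" "z0 \<noteq> 0" using assms by (auto simp: Phi_def)
  show "finite f" "card f \<ge> 1" "0 \<notin> f" "z \<in> f \<Longrightarrow> f = frob_orbit z"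
    using frob_orbit_finite(1,2)[of z0] frob_orbit_finite(4)[of z z0] z0(2) unfolding z0(1)
    by (simp_all, auto simp: frob_orbit_def)
qed

lemma one_in_Phi [simp]: "{1} \<in> (Phi :: ('a :: {field, finite}) alg_closure set set)"
  unfolding Phi_def using frob_orbit_1[where 'a = 'a] by (auto intro: exI[of _ 1])

subsection \<open>Characters of the groups of units\<close>

lemma CARD_pow_gt_1: "n \<ge> 1 \<Longrightarrow> CARD('a :: {field, finite}) ^ n - 1 > 0"
proof -
  assume n: "n \<ge> 1"
  have "CARD('a) ^ n \<ge> 2 ^ n" using CARD_gt_1[where 'a = 'a] by (rule power_mono) simp
  moreover have "(2 :: nat) ^ n \<ge> 2 ^ 1" using n by (intro power_increasing) auto
  ultimately show ?thesis by simp
qed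

lemma field_units_iff:
  assumes "n \<ge> 1"
  shows "z \<in> field_units n \<longleftrightarrow> z ^ (CARD('a) ^ n - 1) = (1 :: ('a :: {field, finite}) alg_closure)"
proof -
  let ?N = "CARD('a) ^ n"
  have N: "?N = Suc (?N - 1)" using CARD_pow_pos[of n, where 'a = 'a] by simp
  have N1: "?N - 1 > 0" by (rule CARD_pow_gt_1[OF assms])
  have "z ^ ?N = z * z ^ (?N - 1)" by (subst N) (simp only: power_Suc)
  thus ?thesis using N1 by (cases "z = 0") (auto simp: field_units_def power_0_left)
qed

lemma field_charsD:
  assumes "\<xi> \<in> field_chars n" "n \<ge> 1"
  shows "z \<in> field_units n \<Longrightarrow> \<xi> z \<noteq> 0" "z \<notin> field_units n \<Longrightarrow> \<xi> z = 0"
    "z \<in> field_units n \<Longrightarrow> w \<in> field_units n \<Longrightarrow> \<xi> (z * w) = \<xi> z * \<xi> w"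
    "\<xi> 1 = 1" "z \<in> field_units n \<Longrightarrow> \<xi> (z ^ k) = \<xi> z ^ k"
    "z \<in> field_units n \<Longrightarrow> \<xi> z ^ (CARD('a) ^ n - 1) = 1"
    "\<xi> z ^ (CARD('a) ^ n) = \<xi> (z :: ('a :: {field, finite}) alg_closure)"
proof -
  have one: "1 \<in> (field_units n :: 'a alg_closure set)" by (simp add: field_units_def)
  show nz: "z \<in> field_units n \<Longrightarrow> \<xi> z \<noteq> 0" and z0: "z \<notin> field_units n \<Longrightarrow> \<xi> z = 0"
    and mul: "z \<in> field_units n \<Longrightarrow> w \<in> field_units n \<Longrightarrow> \<xi> (z * w) = \<xi> z * \<xi> w" for z w
    using assms by (auto simp: field_chars_def)
  show 1: "\<xi> 1 = 1" using mul[OF one one] nz[OF one] by simp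
  show pow: "\<xi> (z ^ k) = \<xi> z ^ k" if "z \<in> field_units n" for z k
    using that by (induction k) (auto simp: 1 mul field_units_closed)
  show Q: "\<xi> z ^ (CARD('a) ^ n - 1) = 1" if "z \<in> field_units n" for z
    using pow[OF that, of "CARD('a) ^ n - 1"] that 1 by (simp add: field_units_iff[OF assms(2)])
  have "\<xi> z ^ Suc (CARD('a) ^ n - 1) = \<xi> z"
    using Q[of z] z0[of z] by (cases "z \<in> field_units n") (simp_all only: power_Suc mult_1_right, simp)
  thus "\<xi> z ^ (CARD('a) ^ n) = \<xi> z" using CARD_pow_pos[of n, where 'a = 'a] by simp
qed

lemma field_chars_eqI:
  assumes "\<xi> \<in> field_chars n" "\<eta> \<in> field_chars n" "\<And>z. z \<in> field_units n \<Longrightarrow> \<xi> z = \<eta> z"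
  shows "\<xi> = \<eta>"
  using assms by (auto simp: field_chars_def fun_eq_iff) metis

lemma field_chars_bij:
  assumes n: "n \<ge> 1" and g: "g \<in> field_units n" "field_units n = range (\<lambda>i. g ^ i)"
    "\<And>i j. g ^ i = g ^ j \<longleftrightarrow> i mod (CARD('a) ^ n - 1) = j mod (CARD('a :: {field, finite}) ^ n - 1)"
  shows "bij_betw (\<lambda>\<xi>. \<xi> (g :: 'a alg_closure)) (field_chars n) {w. w ^ (CARD('a) ^ n - 1) = 1}"
proof (rule bij_betwI')
  fix \<xi> \<eta> :: "'a alg_closure \<Rightarrow> complex" assume xe: "\<xi> \<in> field_chars n" "\<eta> \<in> field_chars n"
  show "\<xi> g = \<eta> g \<longleftrightarrow> \<xi> = \<eta>"
  proof
    assume "\<xi> g = \<eta> g"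
    thus "\<xi> = \<eta>" using g field_charsD(5)[OF xe(1) n g(1)] field_charsD(5)[OF xe(2) n g(1)]
      by (intro field_chars_eqI[OF xe]) auto
  qed simp
next
  fix \<xi> :: "'a alg_closure \<Rightarrow> complex" assume "\<xi> \<in> field_chars n"
  thus "\<xi> g \<in> {w. w ^ (CARD('a) ^ n - 1) = 1}" using field_charsD(6)[OF _ n g(1)] by auto
next
  fix w :: complex assume w: "w \<in> {w. w ^ (CARD('a) ^ n - 1) = 1}"
  let ?Q = "CARD('a) ^ n - 1"
  define \<xi> where "\<xi> z = (if z \<in> field_units n then w ^ (SOME i. g ^ i = z) else 0)" for z :: "'a alg_closure"
  have wmod: "w ^ i = w ^ (i mod ?Q)" for i
  proof -
    have "w ^ i = w ^ (?Q * (i div ?Q) + i mod ?Q)" by simp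
    also have "\<dots> = (w ^ ?Q) ^ (i div ?Q) * w ^ (i mod ?Q)" by (simp only: power_add power_mult)
    finally show ?thesis using w by simp
  qed
  have val: "\<xi> (g ^ i) = w ^ i" for i
  proof -
    have "g ^ (SOME j. g ^ j = g ^ i) = g ^ i" by (rule someI[of "\<lambda>j. g ^ j = g ^ i"]) simp
    hence "(SOME j. g ^ j = g ^ i) mod ?Q = i mod ?Q" using g(3) by blast
    thus ?thesis using wmod[of i] wmod[of "SOME j. g ^ j = g ^ i"] g(2) by (auto simp: \<xi>_def)
  qed
  have "?Q > 0"
    using field_units_card[OF n, where 'a = 'a] g(1) by (metis card_gt_0_iff empty_iff)
  hence w0: "w \<noteq> 0" using w by (auto simp: power_0_left)
  have "\<xi> \<in> field_chars n"
    unfolding field_chars_def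
  proof (intro CollectI conjI ballI allI impI)
    fix z :: "'a alg_closure" assume "z \<in> field_units n"
    then obtain i where i: "z = g ^ i" using g(2) by auto
    show "\<xi> z \<noteq> 0" using val[of i] w0 i by simp
    fix z' :: "'a alg_closure" assume "z' \<in> field_units n"
    then obtain j where j: "z' = g ^ j" using g(2) by auto
    show "\<xi> (z * z') = \<xi> z * \<xi> z'" using val[of "i + j"] val[of i] val[of j] i j by (simp add: power_add)
  qed (auto simp: \<xi>_def)
  moreover have "w = \<xi> g" using val[of 1] by simp
  ultimately show "\<exists>\<xi>\<in>field_chars n. w = \<xi> g" by blast
qed

lemma field_chars_card:
  assumes "n \<ge> 1"
  shows "finite (field_chars n :: (('a :: {field, finite}) alg_closure \<Rightarrow> complex) set)"
    "card (field_chars n :: ('a alg_closure \<Rightarrow> complex) set) = CARD('a) ^ n - 1"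
proof -
  obtain g :: "'a alg_closure" where g: "g \<in> field_units n" "field_units n = range (\<lambda>i. g ^ i)"
    "\<And>i j. g ^ i = g ^ j \<longleftrightarrow> i mod (CARD('a) ^ n - 1) = j mod (CARD('a) ^ n - 1)" using field_units_cyclic[OF assms] by blast
  have Q: "CARD('a) ^ n - 1 > 0"
    using field_units_card[OF assms, where 'a = 'a] g(1) by (metis card_gt_0_iff empty_iff)
  note b = field_chars_bij[OF assms g]
  have f: "finite {w :: complex. w ^ (CARD('a) ^ n - 1) = 1}" "card {w :: complex. w ^ (CARD('a) ^ n - 1) = 1} = CARD('a) ^ n - 1"
    using finite_roots_unity[OF Suc_leI[OF Q, folded One_nat_def]] card_roots_unity_eq[OF Q] by auto
  show "finite (field_chars n :: ('a alg_closure \<Rightarrow> complex) set)" using bij_betw_finite[OF b] f by simp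
  show "card (field_chars n :: ('a alg_closure \<Rightarrow> complex) set) = CARD('a) ^ n - 1" using bij_betw_same_card[OF b] f by simp
qed

lemma field_chars_mult: "\<xi> \<in> field_chars n \<Longrightarrow> \<eta> \<in> field_chars n \<Longrightarrow> (\<lambda>z. \<xi> z * \<eta> z) \<in> field_chars n"
  by (auto simp: field_chars_def)

lemma field_chars_inverse: "\<xi> \<in> field_chars n \<Longrightarrow> (\<lambda>z. inverse (\<xi> z)) \<in> field_chars n"
  by (auto simp: field_chars_def)

text \<open>For z \<noteq> 1 there is a character \<xi> with \<xi> z \<noteq> 1. Multiplication by
  \<xi> permutes the characters and multiplies the sum by \<xi> z, so the sum is zero.\<close>

lemma field_chars_orthogonality:
  assumes n: "n \<ge> 1" and z: "z \<in> field_units n"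
  shows "(\<Sum>\<xi>\<in>field_chars n. \<xi> z) = (if z = (1 :: ('a :: {field, finite}) alg_closure) then of_nat (CARD('a) ^ n - 1) else 0)"
proof (cases "z = 1")
  case True
  have "(\<Sum>\<xi>\<in>field_chars n. \<xi> z) = (\<Sum>\<xi>\<in>(field_chars n :: ('a alg_closure \<Rightarrow> complex) set). 1)"
    by (rule sum.cong) (use True field_charsD(4)[OF _ n] in auto)
  thus ?thesis using True field_chars_card(2)[OF n, where 'a = 'a] by simp
next
  case False
  obtain g :: "'a alg_closure" where g: "g \<in> field_units n" "field_units n = range (\<lambda>i. g ^ i)"
    "\<And>i j. g ^ i = g ^ j \<longleftrightarrow> i mod (CARD('a) ^ n - 1) = j mod (CARD('a) ^ n - 1)" using field_units_cyclic[OF n] by blast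
  define N where "N = CARD('a) ^ n - 1"
  have Q: "N > 0" unfolding N_def using field_units_card[OF n, where 'a = 'a] g(1) by (metis card_gt_0_iff empty_iff)
  obtain i where i: "z = g ^ i" using z g(2) by auto
  \<comment> \<open>A primitive root of unity as value at the generator yields a faithful character,
    which separates z = g^i from 1.\<close>
  define w where "w = cis (2 * pi / real N)"
  have wk: "w ^ k = cis (2 * pi * real k / real N)" for k by (simp add: w_def DeMoivre mult_ac)
  have "w ^ N = 1" using Q by (simp add: wk)
  hence "w \<in> (\<lambda>\<xi>. \<xi> g) ` field_chars n"
    unfolding bij_betw_imp_surj_on[OF field_chars_bij[OF n g]] N_def by simp
  then obtain \<xi> where x: "\<xi> \<in> field_chars n" "\<xi> g = w" by auto
  have "\<xi> z \<noteq> 1"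
  proof
    assume "\<xi> z = 1"
    hence "w ^ i = 1" using field_charsD(5)[OF x(1) n g(1)] i x(2) by simp
    hence "cos (2 * pi * real i / real N) = 1" unfolding wk by (simp add: complex_eq_iff)
    then obtain k :: int where k: "2 * pi * real i / real N = of_int k * 2 * pi" unfolding cos_one_2pi_int by blast
    hence "real i = of_int k * real N" using Q by (simp add: field_simps)
    hence "of_int (int i) = (of_int (k * int N) :: real)" by simp
    hence "int i = k * int N" by (simp only: of_int_eq_iff)
    hence "int N dvd int i" by simp
    hence "N dvd i" by (simp only: int_dvd_int_iff)
    hence "g ^ i = g ^ 0" unfolding g(3) by (simp add: N_def)
    thus False using False i by simp
  qed
  let ?S = "\<Sum>\<xi>\<in>field_chars n. \<xi> z"
  have nz: "\<eta> \<in> field_chars n \<Longrightarrow> u \<in> field_units n \<Longrightarrow> \<eta> u \<noteq> 0" for \<eta> and u :: "'a alg_closure" using field_charsD(1)[OF _ n] by blast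
  have c: "(\<lambda>u. inverse (\<xi> u) * (\<xi> u * \<eta> u)) = \<eta>" "(\<lambda>u. \<xi> u * (inverse (\<xi> u) * \<eta> u)) = \<eta>" if "\<eta> \<in> field_chars n" for \<eta>
  proof -
    have "inverse (\<xi> u) * (\<xi> u * \<eta> u) = \<eta> u \<and> \<xi> u * (inverse (\<xi> u) * \<eta> u) = \<eta> u" for u
      using nz[OF x(1), of u] field_charsD(2)[OF that n, of u] by (cases "u \<in> field_units n") auto
    thus "(\<lambda>u. inverse (\<xi> u) * (\<xi> u * \<eta> u)) = \<eta>" "(\<lambda>u. \<xi> u * (inverse (\<xi> u) * \<eta> u)) = \<eta>" by auto
  qed
  have "?S = (\<Sum>\<eta>\<in>field_chars n. \<xi> z * \<eta> z)"
  proof (rule sum.reindex_bij_witness[of _ "\<lambda>\<eta> u. \<xi> u * \<eta> u" "\<lambda>\<eta> u. inverse (\<xi> u) * \<eta> u"])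
    fix \<eta> :: "'a alg_closure \<Rightarrow> complex" assume e: "\<eta> \<in> field_chars n"
    show "(\<lambda>u. \<xi> u * (inverse (\<xi> u) * \<eta> u)) = \<eta>" "(\<lambda>u. inverse (\<xi> u) * (\<xi> u * \<eta> u)) = \<eta>" using c[OF e] by auto
    show "(\<lambda>u. inverse (\<xi> u) * \<eta> u) \<in> field_chars n" "(\<lambda>u. \<xi> u * \<eta> u) \<in> field_chars n"
      using field_chars_mult[OF field_chars_inverse[OF x(1)] e] field_chars_mult[OF x(1) e] .
    show "\<xi> z * (inverse (\<xi> z) * \<eta> z) = \<eta> z" using nz[OF x(1) z] by simp
  qed
  also have "\<dots> = \<xi> z * ?S" by (simp add: sum_distrib_left)
  finally have "(1 - \<xi> z) * ?S = 0" by (simp add: algebra_simps)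
  thus ?thesis using \<open>\<xi> z \<noteq> 1\<close> False by simp
qed

subsection \<open>Norms and the direct limit of the character groups\<close>

lemma field_norm_eq: "field_norm m n z = z ^ (\<Sum>i<n div m. CARD('a) ^ (m * i))" for z :: "('a :: {field, finite}) alg_closure"
  by (simp add: field_norm_def power_sum)

text \<open>A geometric series: the norm from M_n to M_m is the power map with exponent (q^n - 1) /
  (q^m - 1).\<close>

lemma norm_exponent:
  assumes "m dvd n" "m \<ge> 1"
  shows "(\<Sum>i<n div m. q ^ (m * i)) * (q ^ m - 1) = q ^ n - (1 :: nat)"
proof (cases "q = 0")
  case True
  show ?thesis
  proof (cases "n = 0")
    case False
    thus ?thesis using True assms by (auto simp: power_0_left elim!: dvdE)
  qed simp
next
  case False
  have "(\<Sum>i<k. q ^ (m * i)) * (q ^ m - 1) + 1 = q ^ (m * k)" for k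
  proof (induction k)
    case (Suc k)
    have q: "q ^ m \<ge> 1" using False by simp
    have "(\<Sum>i<Suc k. q ^ (m * i)) * (q ^ m - 1) + 1 = q ^ (m * k) + q ^ (m * k) * (q ^ m - 1)"
      using Suc by (simp add: distrib_right)
    also have "\<dots> = q ^ (m * k) * (1 + (q ^ m - 1))" by (simp only: distrib_left mult_1_right)
    also have "1 + (q ^ m - 1) = q ^ m" using q by simp
    finally show ?case by (simp add: power_add)
  qed simp
  from this[of "n div m"] show ?thesis using assms by simp
qed

lemma field_units_mono:
  assumes "m dvd n"
  shows "field_units m \<subseteq> (field_units n :: ('a :: {field, finite}) alg_closure set)"
  by (auto simp: frob_orbit_finite(3) field_units_def assms dvd_trans)

context
  fixes m n :: nat
  assumes mn: "m dvd n" "m \<ge> 1" "n \<ge> 1"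
begin

lemma field_norm_in: "z \<in> field_units n \<Longrightarrow> field_norm m n z \<in> (field_units m :: ('a :: {field, finite}) alg_closure set)"
  unfolding field_units_iff[OF mn(2)] field_units_iff[OF mn(3)] field_norm_eq power_mult[symmetric] norm_exponent[OF mn(1,2)] .

lemma field_norm_mult: "field_norm m n (z * w) = field_norm m n z * field_norm m n (w :: ('a :: {field, finite}) alg_closure)"
  by (simp add: field_norm_eq power_mult_distrib)

text \<open>Write w = g^i with a generator g of M_n. Since w^(q^m - 1) = 1, the exponent i is a
  multiple of (q^n - 1) / (q^m - 1), the exponent of the norm.\<close>

lemma field_norm_surj:
  assumes "w \<in> (field_units m :: ('a :: {field, finite}) alg_closure set)"
  shows "\<exists>z\<in>field_units n. field_norm m n z = w"
proof -
  obtain g :: "'a alg_closure" where g: "g \<in> field_units n" "field_units n = range (\<lambda>i. g ^ i)"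
    "\<And>i j. g ^ i = g ^ j \<longleftrightarrow> i mod (CARD('a) ^ n - 1) = j mod (CARD('a) ^ n - 1)" using field_units_cyclic[OF mn(3)] by blast
  let ?E = "\<Sum>i<n div m. CARD('a) ^ (m * i)"
  let ?Q = "CARD('a) ^ m - 1"
  have Q: "?Q > 0" using field_units_card[OF mn(2), where 'a = 'a] assms by (metis card_gt_0_iff empty_iff)
  obtain i where i: "w = g ^ i" using assms field_units_mono[OF mn(1)] g(2) by blast
  have "g ^ (i * ?Q) = g ^ 0" using assms unfolding i field_units_iff[OF mn(2)] by (simp add: power_mult)
  hence "CARD('a) ^ n - 1 dvd i * ?Q" unfolding g(3) by (simp add: dvd_eq_mod_eq_0)
  hence "?E * ?Q dvd i * ?Q" unfolding norm_exponent[OF mn(1,2)] .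
  hence "?E dvd i" using Q by simp
  then obtain k where "i = k * ?E" by (metis dvdE mult.commute)
  hence "field_norm m n (g ^ k) = w" by (simp add: field_norm_eq i power_mult)
  thus ?thesis using g(2) by blast
qed

lemma char_embed_in:
  assumes "\<xi> \<in> field_chars m"
  shows "char_embed m n \<xi> \<in> (field_chars n :: (('a :: {field, finite}) alg_closure \<Rightarrow> complex) set)"
  using field_charsD(1,3)[OF assms mn(2)]
  by (auto simp: field_chars_def char_embed_def field_norm_in field_norm_mult field_units_closed)

lemma char_embed_inj:
  assumes "\<xi> \<in> field_chars m" "\<eta> \<in> field_chars m" "char_embed m n \<xi> = char_embed m n (\<eta> :: ('a :: {field, finite}) alg_closure \<Rightarrow> complex)"
  shows "\<xi> = \<eta>"
proof (rule field_chars_eqI[OF assms(1,2)])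
  fix w :: "'a alg_closure" assume "w \<in> field_units m"
  then obtain z where "z \<in> field_units n" "field_norm m n z = w" using field_norm_surj by blast
  thus "\<xi> w = \<eta> w" using fun_cong[OF assms(3), of z] by (simp add: char_embed_def)
qed

text \<open>An element of the norm kernel is g^i with i a multiple of q^m - 1, and the hypothesis
  makes \<xi> trivial on it. So \<xi> factors through the surjective norm.\<close>

lemma char_descent:
  assumes x: "\<xi> \<in> field_chars n" and fixed: "\<And>z. z \<in> field_units n \<Longrightarrow> \<xi> z ^ (CARD('a) ^ m) = \<xi> z"
  shows "\<exists>\<eta>\<in>field_chars m. char_embed m n \<eta> = (\<xi> :: ('a :: {field, finite}) alg_closure \<Rightarrow> complex)"
proof -
  obtain g :: "'a alg_closure" where g: "g \<in> field_units n" "field_units n = range (\<lambda>i. g ^ i)"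
    "\<And>i j. g ^ i = g ^ j \<longleftrightarrow> i mod (CARD('a) ^ n - 1) = j mod (CARD('a) ^ n - 1)" using field_units_cyclic[OF mn(3)] by blast
  let ?E = "\<Sum>i<n div m. CARD('a) ^ (m * i)"
  let ?Q = "CARD('a) ^ m - 1"
  have Q: "Suc ?Q = CARD('a) ^ m" using CARD_pow_pos[of m, where 'a = 'a] by simp
  have E0: "?E > 0"
    using norm_exponent[OF mn(1,2), of "CARD('a)"] CARD_pow_gt_1[OF mn(3), where 'a = 'a] by (metis nat_0_less_mult_iff)
  have nz: "\<xi> g \<noteq> 0" using field_charsD(1)[OF x mn(3) g(1)] .
  have "\<xi> g ^ Suc ?Q = \<xi> g" unfolding Q by (rule fixed[OF g(1)])
  hence "\<xi> g * \<xi> g ^ ?Q = \<xi> g * 1" by (simp only: power_Suc mult_1_right)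
  hence Q1: "\<xi> g ^ ?Q = 1" using nz by (simp only: mult_cancel_left) simp
  have ker: "\<xi> u = 1" if u: "u \<in> field_units n" "field_norm m n u = 1" for u
  proof -
    obtain i where i: "u = g ^ i" using u(1) g(2) by auto
    have "g ^ (i * ?E) = g ^ 0" using u(2) by (simp add: i field_norm_eq power_mult)
    hence "CARD('a) ^ n - 1 dvd i * ?E" unfolding g(3) by (simp add: dvd_eq_mod_eq_0)
    hence "?E * ?Q dvd ?E * i" unfolding norm_exponent[OF mn(1,2)] by (simp only: mult.commute)
    hence "?Q dvd i" by (simp only: nat_mult_dvd_cancel1[OF E0])
    then obtain k where "i = ?Q * k" by (rule dvdE)
    hence "\<xi> g ^ i = 1" by (simp only: power_mult Q1 power_one)
    thus ?thesis unfolding i field_charsD(5)[OF x mn(3) g(1)] .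
  qed
  have wd: "\<xi> z = \<xi> z'" if "z \<in> field_units n" "z' \<in> field_units n" "field_norm m n z = field_norm m n z'" for z z'
  proof -
    have z0: "z' \<noteq> 0" using that(2) by (simp add: field_units_def)
    have "field_norm m n (z * inverse z') = 1"
      using that z0 by (simp add: field_norm_eq power_mult_distrib power_inverse)
    hence "\<xi> (z * inverse z') = 1" using that by (intro ker) (auto intro: field_units_closed)
    moreover have "\<xi> (z * inverse z' * z') = \<xi> (z * inverse z') * \<xi> z'"
      using that by (intro field_charsD(3)[OF x mn(3)]) (auto intro: field_units_closed)
    ultimately show ?thesis using z0 by (simp add: mult.assoc)
  qed
  define \<eta> where "\<eta> w = (if w \<in> field_units m then \<xi> (SOME z. z \<in> field_units n \<and> field_norm m n z = w) else 0)" for w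
  have val: "\<eta> (field_norm m n z) = \<xi> z" if "z \<in> field_units n" for z
  proof -
    have "(SOME z'. z' \<in> field_units n \<and> field_norm m n z' = field_norm m n z) \<in> field_units n \<and>
      field_norm m n (SOME z'. z' \<in> field_units n \<and> field_norm m n z' = field_norm m n z) = field_norm m n z"
      using that by (intro someI[of "\<lambda>z'. z' \<in> field_units n \<and> field_norm m n z' = field_norm m n z" z]) simp
    thus ?thesis using wd[OF _ that] field_norm_in[OF that] by (simp add: \<eta>_def)
  qed
  have "\<eta> \<in> field_chars m"
    unfolding field_chars_def
  proof (intro CollectI conjI ballI allI impI)
    fix w :: "'a alg_closure" assume "w \<in> field_units m"
    then obtain z where z: "z \<in> field_units n" "field_norm m n z = w" using field_norm_surj by blast
    show "\<eta> w \<noteq> 0" using val[OF z(1)] z field_charsD(1)[OF x mn(3)] by simp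
    fix w' :: "'a alg_closure" assume "w' \<in> field_units m"
    then obtain z' where z': "z' \<in> field_units n" "field_norm m n z' = w'" using field_norm_surj by blast
    have "\<eta> (field_norm m n (z * z')) = \<xi> (z * z')" by (rule val) (use z z' in \<open>auto intro: field_units_closed\<close>)
    thus "\<eta> (w * w') = \<eta> w * \<eta> w'"
      using val[OF z(1)] val[OF z'(1)] field_charsD(3)[OF x mn(3) z(1) z'(1)] z z' by (simp add: field_norm_mult)
  qed (auto simp: \<eta>_def)
  moreover have "char_embed m n \<eta> = \<xi>"
    using val field_charsD(2)[OF x mn(3)] by (auto simp: char_embed_def)
  ultimately show ?thesis by blast
qed

end

text \<open>The exponents (q^k - 1) / (q^n - 1) and (q^n - 1) / (q^m - 1) multiply to that of the
  norm from M_k to M_m.\<close>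

lemma char_embed_trans:
  assumes "m dvd n" "n dvd k" "m \<ge> 1" "n \<ge> 1" "k \<ge> 1"
  shows "char_embed n k (char_embed m n \<xi>) = char_embed m k (\<xi> :: ('a :: {field, finite}) alg_closure \<Rightarrow> complex)"
proof
  fix z :: "'a alg_closure"
  let ?q = "CARD('a)"
  have "(\<Sum>i<k div n. ?q ^ (n * i)) * (\<Sum>i<n div m. ?q ^ (m * i)) * (?q ^ m - 1) = (\<Sum>i<k div n. ?q ^ (n * i)) * (?q ^ n - 1)"
    by (simp only: mult.assoc norm_exponent[OF assms(1,3)])
  also have "\<dots> = ?q ^ k - 1" by (rule norm_exponent[OF assms(2,4)])
  also have "\<dots> = (\<Sum>i<k div m. ?q ^ (m * i)) * (?q ^ m - 1)"
    by (rule norm_exponent[OF dvd_trans[OF assms(1,2)] assms(3), symmetric])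
  finally have "(\<Sum>i<k div n. ?q ^ (n * i)) * (\<Sum>i<n div m. ?q ^ (m * i)) = (\<Sum>i<k div m. ?q ^ (m * i))"
    using CARD_pow_gt_1[OF assms(3), where 'a = 'a] by (metis mult_right_cancel not_gr_zero)
  hence "field_norm m n (field_norm n k z) = field_norm m k z" by (simp add: field_norm_eq flip: power_mult)
  thus "char_embed n k (char_embed m n \<xi>) z = char_embed m k \<xi> z"
    using field_norm_in[OF assms(2,4,5)] by (auto simp: char_embed_def)
qed

definition char_class :: "nat \<Rightarrow> (('a :: {field, finite}) alg_closure \<Rightarrow> complex) \<Rightarrow> 'a limit_char" where
  "char_class n \<xi> = limit_rel `` {(n, \<xi>)}"

text \<open>\<open>limit_rel\<close> compares two characters at level m * n. Agreement at any common
  multiple k is enough, because both levels embed into level m * n * k and embeddings are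
  injective.\<close>

lemma limit_relI:
  assumes "\<xi> \<in> field_chars m" "\<eta> \<in> field_chars n" "m \<ge> 1" "n \<ge> 1" "k \<ge> 1" "m dvd k" "n dvd k"
    and "char_embed m k \<xi> = char_embed n k (\<eta> :: ('a :: {field, finite}) alg_closure \<Rightarrow> complex)"
  shows "((m, \<xi>), (n, \<eta>)) \<in> limit_rel"
proof -
  have mn: "m * n \<ge> 1" "m dvd m * n" "n dvd m * n" "m * n dvd m * n * k" "m * n * k \<ge> 1" "k dvd m * n * k" using assms(3-5) by auto
  have "char_embed (m * n) (m * n * k) (char_embed m (m * n) \<xi>) = char_embed k (m * n * k) (char_embed m k \<xi>)"
    using mn assms(3-7) by (simp add: char_embed_trans)
  also have "\<dots> = char_embed (m * n) (m * n * k) (char_embed n (m * n) \<eta>)"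
    using mn assms(3-8) by (simp add: char_embed_trans)
  finally have "char_embed m (m * n) \<xi> = char_embed n (m * n) \<eta>"
    by (rule char_embed_inj[OF mn(4) mn(1) mn(5) char_embed_in[OF mn(2) assms(3) mn(1) assms(1)]
        char_embed_in[OF mn(3) assms(4) mn(1) assms(2)]])
  thus ?thesis using assms by (auto simp: limit_rel_def)
qed

lemma limit_relD:
  assumes "((m, \<xi>), (n, \<eta>)) \<in> limit_rel"
  shows "\<xi> \<in> field_chars m" "\<eta> \<in> field_chars n" "m \<ge> 1" "n \<ge> 1"
    "char_embed m (m * n) \<xi> = char_embed n (m * n) (\<eta> :: ('a :: {field, finite}) alg_closure \<Rightarrow> complex)"
  using assms by (auto simp: limit_rel_def)

lemma equiv_limit_rel: "equiv (SIGMA n : {1..}. (field_chars n :: (('a :: {field, finite}) alg_closure \<Rightarrow> complex) set)) limit_rel"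
proof (rule equivI)
  show "refl_on (SIGMA n : {1..}. field_chars n) (limit_rel :: ((nat \<times> ('a alg_closure \<Rightarrow> complex)) \<times> (nat \<times> ('a alg_closure \<Rightarrow> complex))) set)"
    by (auto simp: refl_on_def limit_rel_def)
  show "sym (limit_rel :: ((nat \<times> ('a alg_closure \<Rightarrow> complex)) \<times> (nat \<times> ('a alg_closure \<Rightarrow> complex))) set)"
    by (auto simp: sym_def limit_rel_def mult.commute)
  show "trans (limit_rel :: ((nat \<times> ('a alg_closure \<Rightarrow> complex)) \<times> (nat \<times> ('a alg_closure \<Rightarrow> complex))) set)"
  proof (rule transI)
    fix x y w :: "nat \<times> ('a alg_closure \<Rightarrow> complex)"
    assume a: "(x, y) \<in> limit_rel" "(y, w) \<in> limit_rel"
    obtain m \<xi> n \<eta> k \<zeta> where e: "x = (m, \<xi>)" "y = (n, \<eta>)" "w = (k, \<zeta>)" by (metis surj_pair)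
    note d = limit_relD[OF a(1)[unfolded e]] limit_relD[OF a(2)[unfolded e]]
    let ?L = "m * n * k"
    have L: "?L \<ge> 1" "m * n \<ge> 1" "n * k \<ge> 1" "n * k dvd ?L" using d by auto
    have "char_embed m ?L \<xi> = char_embed (m * n) ?L (char_embed m (m * n) \<xi>)"
      by (rule char_embed_trans[symmetric]) (use L d(3,4,8) in auto)
    also have "\<dots> = char_embed (m * n) ?L (char_embed n (m * n) \<eta>)" by (simp only: d(5))
    also have "\<dots> = char_embed n ?L \<eta>" by (rule char_embed_trans) (use L d(3,4,8) in auto)
    also have "\<dots> = char_embed (n * k) ?L (char_embed n (n * k) \<eta>)"
      by (rule char_embed_trans[symmetric]) (use L d(3,4,8) in auto)
    also have "\<dots> = char_embed (n * k) ?L (char_embed k (n * k) \<zeta>)" by (simp only: d(10))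
    also have "\<dots> = char_embed k ?L \<zeta>" by (rule char_embed_trans) (use L d(3,4,8) in auto)
    finally show "(x, w) \<in> limit_rel" unfolding e using L d by (intro limit_relI[of _ _ _ _ ?L]) auto
  qed
qed (auto simp: limit_rel_def)

lemma char_class_in: "n \<ge> 1 \<Longrightarrow> \<xi> \<in> field_chars n \<Longrightarrow> char_class n \<xi> \<in> limit_chars"
  unfolding limit_chars_def char_class_def by (rule quotientI) auto

lemma limit_chars_cases:
  assumes "x \<in> limit_chars"
  obtains n \<xi> where "n \<ge> 1" "\<xi> \<in> field_chars n" "x = char_class n \<xi>"
  using assms unfolding limit_chars_def char_class_def by (auto elim!: quotientE)

lemma char_class_eq_iff:
  assumes "\<xi> \<in> field_chars m" "\<eta> \<in> field_chars n" "m \<ge> 1" "n \<ge> 1"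
  shows "char_class m \<xi> = char_class n (\<eta> :: ('a :: {field, finite}) alg_closure \<Rightarrow> complex) \<longleftrightarrow> ((m, \<xi>), (n, \<eta>)) \<in> limit_rel"
  unfolding char_class_def using assms by (intro eq_equiv_class_iff[OF equiv_limit_rel]) auto

lemma char_class_inj:
  assumes "\<xi> \<in> field_chars n" "\<eta> \<in> field_chars n" "n \<ge> 1" "char_class n \<xi> = char_class n (\<eta> :: ('a :: {field, finite}) alg_closure \<Rightarrow> complex)"
  shows "\<xi> = \<eta>"
proof -
  have "char_embed n (n * n) \<xi> = char_embed n (n * n) \<eta>"
    using assms limit_relD(5) by (simp add: char_class_eq_iff) blast
  thus ?thesis by (rule char_embed_inj[OF _ _ _ assms(1,2), rotated -1]) (use assms(3) in auto)
qed

lemma char_at_char_class: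
  assumes "\<xi> \<in> field_chars n" "n \<ge> 1"
  shows "char_at n (char_class n \<xi>) = (\<xi> :: ('a :: {field, finite}) alg_closure \<Rightarrow> complex)"
  unfolding char_at_def
proof (rule the_equality)
  show "(n, \<xi>) \<in> char_class n \<xi>" using assms by (auto simp: char_class_def limit_rel_def)
  fix \<eta> assume "(n, \<eta>) \<in> char_class n \<xi>"
  hence r: "((n, \<xi>), (n, \<eta>)) \<in> limit_rel" by (simp add: char_class_def)
  hence "char_class n \<xi> = char_class n \<eta>" using limit_relD[OF r] by (simp add: char_class_eq_iff)
  thus "\<eta> = \<xi>" using char_class_inj[of \<xi> n \<eta>] limit_relD[OF r] by simp
qed

lemma char_class_embed:
  assumes "\<xi> \<in> field_chars m" "m dvd n" "m \<ge> 1" "n \<ge> 1"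
  shows "char_class n (char_embed m n \<xi>) = char_class m (\<xi> :: ('a :: {field, finite}) alg_closure \<Rightarrow> complex)"
proof -
  have "char_embed n n (char_embed m n \<xi>) = char_embed m n \<xi>" using assms by (simp add: char_embed_trans)
  hence "((n, char_embed m n \<xi>), (m, \<xi>)) \<in> limit_rel"
    using assms by (intro limit_relI[of _ _ _ _ n] char_embed_in) auto
  thus ?thesis using assms by (subst char_class_eq_iff) (auto intro: char_embed_in)
qed

lemma char_power_in: "\<xi> \<in> field_chars n \<Longrightarrow> k \<ge> 1 \<Longrightarrow> (\<lambda>z. \<xi> z ^ k) \<in> field_chars n"
  by (auto simp: field_chars_def power_mult_distrib power_0_left)

lemma char_embed_power: "k \<ge> 1 \<Longrightarrow> char_embed m n (\<lambda>z. \<xi> z ^ k) = (\<lambda>z. char_embed m n \<xi> z ^ k)"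
  by (auto simp: char_embed_def power_0_left)

lemma limit_rel_power:
  assumes "((m, \<xi>), (n, \<eta>)) \<in> limit_rel" "k \<ge> 1"
  shows "((m, \<lambda>z. \<xi> z ^ k), (n, \<lambda>z. \<eta> z ^ k)) \<in> limit_rel"
  using limit_relD[OF assms(1)] assms(2) by (auto simp: limit_rel_def char_power_in char_embed_power)

lemma char_power_CARD_pow:
  assumes "\<xi> \<in> field_chars n" "n \<ge> 1"
  shows "\<xi> z ^ (CARD('a) ^ (n * k)) = \<xi> (z :: ('a :: {field, finite}) alg_closure)"
proof (induction k)
  case (Suc k)
  have "\<xi> z ^ (CARD('a) ^ (n * Suc k)) = (\<xi> z ^ (CARD('a) ^ n)) ^ (CARD('a) ^ (n * k))" by (simp add: power_add power_mult)
  thus ?case using Suc field_charsD(7)[OF assms] by simp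
qed simp

text \<open>\<open>frob_char\<close> is the image of a class under the q-th power on its members.
  That this image is a whole class again requires every member of the target to have a q-th root in
  the source.\<close>

lemma frob_char_class:
  assumes x: "\<xi> \<in> field_chars n" "n \<ge> 1"
  shows "frob_char (char_class n \<xi>) = char_class n (\<lambda>z :: ('a :: {field, finite}) alg_closure. \<xi> z ^ CARD('a))"
proof (intro equalityI subsetI)
  fix y assume "y \<in> frob_char (char_class n \<xi>)"
  then obtain k \<zeta> where y: "y = (k, \<lambda>z. \<zeta> z ^ CARD('a))" "((n, \<xi>), (k, \<zeta>)) \<in> limit_rel"
    by (auto simp: frob_char_def char_class_def)
  thus "y \<in> char_class n (\<lambda>z. \<xi> z ^ CARD('a))" using limit_rel_power[OF y(2), of "CARD('a)"] by (simp add: char_class_def)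
next
  fix y assume "y \<in> char_class n (\<lambda>z. \<xi> z ^ CARD('a))"
  then obtain k \<zeta> where y: "y = (k, \<zeta>)" and r: "((n, \<lambda>z. \<xi> z ^ CARD('a)), (k, \<zeta>)) \<in> limit_rel"
    unfolding char_class_def by (cases y) auto
  note d = limit_relD[OF r]
  \<comment> \<open>Values of characters of level n or k satisfy x^(q^(n k)) = x, so the power q^(n
    k - 1) inverts the q-th power.\<close>
  let ?e = "CARD('a) ^ (n * k - 1)"
  have nk: "n * k \<ge> 1" using d by simp
  have e1: "CARD('a) * ?e = CARD('a) ^ (n * k)" using nk by (simp flip: power_Suc)
  have e2: "?e * CARD('a) = CARD('a) ^ (k * n)" using e1 by (simp only: mult.commute)
  have xi: "(\<xi> z ^ CARD('a)) ^ ?e = \<xi> z" for z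
    unfolding power_mult[symmetric] e1 by (rule char_power_CARD_pow[OF x])
  have ze: "(\<zeta> z ^ ?e) ^ CARD('a) = \<zeta> z" for z
    unfolding power_mult[symmetric] e2 by (rule char_power_CARD_pow[OF d(2,4)])
  have "((n, \<xi>), (k, \<lambda>z. \<zeta> z ^ ?e)) \<in> limit_rel"
    using limit_rel_power[OF r, of ?e] by (simp only: xi) simp
  hence "(k, \<lambda>z. \<zeta> z ^ ?e) \<in> char_class n \<xi>" by (simp add: char_class_def)
  hence "(\<lambda>(n, \<xi>). (n, \<lambda>z. \<xi> z ^ CARD('a))) (k, \<lambda>z. \<zeta> z ^ ?e) \<in> frob_char (char_class n \<xi>)"
    unfolding frob_char_def by (rule imageI)
  thus "y \<in> frob_char (char_class n \<xi>)" by (simp only: y ze prod.case)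
qed

lemma frob_char_pow_class:
  assumes "\<xi> \<in> field_chars n" "n \<ge> 1"
  shows "(frob_char ^^ k) (char_class n \<xi>) = char_class n (\<lambda>z :: ('a :: {field, finite}) alg_closure. \<xi> z ^ (CARD('a) ^ k))"
proof (induction k)
  case (Suc k)
  have "(\<lambda>z. \<xi> z ^ (CARD('a) ^ k)) \<in> field_chars n" using assms by (intro char_power_in) auto
  thus ?case using Suc assms(2) by (simp add: frob_char_class power_mult[symmetric] mult.commute)
qed simp

lemma limit_char_periodic:
  assumes "x \<in> (limit_chars :: ('a :: {field, finite}) limit_char set)"
  shows "\<exists>n\<ge>1. (frob_char ^^ n) x = x"
proof -
  obtain n \<xi> where x: "n \<ge> 1" "\<xi> \<in> field_chars n" "x = char_class n \<xi>" using limit_chars_cases[OF assms] .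
  have "(frob_char ^^ n) x = x" unfolding x(3) frob_char_pow_class[OF x(2,1)] using field_charsD(7)[OF x(2,1)] by simp
  thus ?thesis using x(1) by blast
qed

text \<open>Being fixed by the j-th power of Frobenius is the hypothesis of
  \<open>char_descent\<close> at a level divisible by j. It follows that the size of an orbit
  divides exactly the levels at which its elements live.\<close>

lemma limit_char_fixed_iff:
  assumes "x \<in> (limit_chars :: ('a :: {field, finite}) limit_char set)" "j \<ge> 1"
  shows "(frob_char ^^ j) x = x \<longleftrightarrow> (\<exists>\<xi>\<in>field_chars j. x = char_class j \<xi>)"
proof
  assume "\<exists>\<xi>\<in>field_chars j. x = char_class j \<xi>"
  then obtain \<xi> where x: "\<xi> \<in> field_chars j" "x = char_class j \<xi>" by blast
  show "(frob_char ^^ j) x = x" unfolding x(2) frob_char_pow_class[OF x(1) assms(2)] using field_charsD(7)[OF x(1) assms(2)] by simp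
next
  assume fix_x: "(frob_char ^^ j) x = x"
  obtain m \<eta> where x: "m \<ge> 1" "\<eta> \<in> field_chars m" "x = char_class m \<eta>" using limit_chars_cases[OF assms(1)] .
  let ?n = "m * j"
  let ?\<xi> = "char_embed m ?n \<eta>"
  have n: "?n \<ge> 1" "m dvd ?n" "j dvd ?n" using x(1) assms(2) by auto
  have xi: "?\<xi> \<in> field_chars ?n" using n x by (intro char_embed_in) auto
  have xc: "x = char_class ?n ?\<xi>" using char_class_embed[OF x(2) n(2) x(1) n(1)] x(3) by simp
  have "char_class ?n (\<lambda>z. ?\<xi> z ^ (CARD('a) ^ j)) = char_class ?n ?\<xi>"
    using fix_x unfolding xc frob_char_pow_class[OF xi n(1)] .
  hence "(\<lambda>z. ?\<xi> z ^ (CARD('a) ^ j)) = ?\<xi>"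
    using xi n(1) by (intro char_class_inj[of _ ?n]) (auto intro: char_power_in)
  hence "\<exists>\<xi>\<in>field_chars j. char_embed j ?n \<xi> = ?\<xi>"
    using xi n assms(2) by (intro char_descent) (auto dest: fun_cong)
  then obtain \<xi> where "\<xi> \<in> field_chars j" "char_embed j ?n \<xi> = ?\<xi>" by blast
  thus "\<exists>\<xi>\<in>field_chars j. x = char_class j \<xi>"
    using char_class_embed[of \<xi> j ?n] n assms(2) xc by metis
qed

subsection \<open>Frobenius orbits of characters and the sums of the \<open>p\<^sub>k(Y\<^sup>\<phi>)\<close>\<close>

definition char_orbit :: "('a :: {field, finite}) limit_char \<Rightarrow> 'a limit_char set" where
  "char_orbit x = {(frob_char ^^ k) x | k. True}"

lemma Theta_eq: "Theta = char_orbit ` limit_chars"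
  by (auto simp: Theta_def char_orbit_def)

lemma frob_char_pow_in:
  assumes "x \<in> (limit_chars :: ('a :: {field, finite}) limit_char set)"
  shows "(frob_char ^^ k) x \<in> limit_chars"
proof -
  obtain n \<xi> where x: "n \<ge> 1" "\<xi> \<in> field_chars n" "x = char_class n \<xi>" using limit_chars_cases[OF assms] .
  show ?thesis unfolding x(3) frob_char_pow_class[OF x(2,1)] using x by (intro char_class_in char_power_in) auto
qed

lemma char_orbit_props:
  assumes "x \<in> (limit_chars :: ('a :: {field, finite}) limit_char set)"
  shows "finite (char_orbit x)" "card (char_orbit x) \<ge> 1" "(frob_char ^^ j) x = x \<longleftrightarrow> card (char_orbit x) dvd j"
    "y \<in> char_orbit x \<Longrightarrow> char_orbit y = char_orbit x" "x \<in> char_orbit x" "char_orbit x \<subseteq> limit_chars"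
proof -
  obtain n where n: "n \<ge> 1" "(frob_char ^^ n) x = x" using limit_char_periodic[OF assms] by blast
  show "finite (char_orbit x)" "card (char_orbit x) \<ge> 1" "(frob_char ^^ j) x = x \<longleftrightarrow> card (char_orbit x) dvd j"
    "y \<in> char_orbit x \<Longrightarrow> char_orbit y = char_orbit x"
    using orbit_of_periodic[OF n(2,1), folded char_orbit_def] by blast+
  show "x \<in> char_orbit x" by (auto simp: char_orbit_def intro: exI[of _ 0])
  show "char_orbit x \<subseteq> limit_chars" using frob_char_pow_in[OF assms] by (auto simp: char_orbit_def)
qed

lemma Theta_D:
  assumes "\<phi> \<in> (Theta :: ('a :: {field, finite}) limit_char set set)"
  shows "finite \<phi>" "card \<phi> \<ge> 1" "\<phi> \<subseteq> limit_chars" "\<phi> \<noteq> {}" "x \<in> \<phi> \<Longrightarrow> char_orbit x = \<phi>"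
proof -
  obtain y where y: "y \<in> limit_chars" "\<phi> = char_orbit y" using assms by (auto simp: Theta_eq)
  show "finite \<phi>" "card \<phi> \<ge> 1" "\<phi> \<subseteq> limit_chars" "\<phi> \<noteq> {}" "x \<in> \<phi> \<Longrightarrow> char_orbit x = \<phi>"
    unfolding y(2) using char_orbit_props[OF y(1)] by blast+
qed

lemma Theta_level:
  assumes "\<phi> \<in> (Theta :: ('a :: {field, finite}) limit_char set set)" "x \<in> \<phi>" "card \<phi> dvd j" "j \<ge> 1"
  shows "\<exists>\<xi>\<in>field_chars j. x = char_class j \<xi>"
proof -
  have x: "x \<in> limit_chars" "char_orbit x = \<phi>" using Theta_D[OF assms(1)] assms(2) by auto
  hence "(frob_char ^^ j) x = x" using char_orbit_props(3)[OF x(1), of j] assms(3) by simp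
  thus ?thesis using limit_char_fixed_iff[OF x(1) assms(4)] by simp
qed

lemma char_orbit_level:
  assumes "\<xi> \<in> field_chars j" "j \<ge> 1"
  shows "char_orbit (char_class j \<xi>) \<in> (Theta :: ('a :: {field, finite}) limit_char set set)"
    "card (char_orbit (char_class j \<xi>)) dvd j"
proof -
  have x: "char_class j \<xi> \<in> limit_chars" using assms by (intro char_class_in)
  thus "char_orbit (char_class j \<xi>) \<in> Theta" by (auto simp: Theta_eq)
  show "card (char_orbit (char_class j \<xi>)) dvd j"
    using char_orbit_props(3)[OF x, of j] limit_char_fixed_iff[OF x assms(2)] assms(1) by blast
qed

lemma finite_Theta_dvd:
  assumes "j \<ge> 1" shows "finite {\<phi> \<in> (Theta :: ('a :: {field, finite}) limit_char set set). card \<phi> dvd j}"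
proof (rule finite_subset)
  show "{\<phi> \<in> (Theta :: 'a limit_char set set). card \<phi> dvd j} \<subseteq> (\<lambda>\<xi>. char_orbit (char_class j \<xi>)) ` field_chars j"
  proof
    fix \<phi> assume p: "\<phi> \<in> {\<phi> \<in> (Theta :: 'a limit_char set set). card \<phi> dvd j}"
    then obtain x where x: "x \<in> \<phi>" using Theta_D(4) by blast
    then obtain \<xi> where "\<xi> \<in> field_chars j" "x = char_class j \<xi>" using Theta_level[of \<phi> x j] p assms by blast
    thus "\<phi> \<in> (\<lambda>\<xi>. char_orbit (char_class j \<xi>)) ` field_chars j" using Theta_D(5)[of \<phi> x] p x by auto
  qed
qed (simp add: field_chars_card[OF assms])

text \<open>This supplies the multiplicity |\<phi>| when a sum over the characters of M_j is sorted
  by orbits.\<close>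

lemma card_level_chars:
  assumes "\<phi> \<in> (Theta :: ('a :: {field, finite}) limit_char set set)" "card \<phi> dvd j" "j \<ge> 1"
  shows "bij_betw (char_class j) {\<xi> \<in> field_chars j. char_orbit (char_class j \<xi>) = \<phi>} \<phi>"
proof (rule bij_betw_imageI)
  show "inj_on (char_class j) {\<xi> \<in> field_chars j. char_orbit (char_class j \<xi>) = \<phi>}"
    using char_class_inj assms(3) by (auto intro!: inj_onI)
  show "char_class j ` {\<xi> \<in> field_chars j. char_orbit (char_class j \<xi>) = \<phi>} = \<phi>"
  proof (intro equalityI subsetI)
    fix x assume "x \<in> char_class j ` {\<xi> \<in> field_chars j. char_orbit (char_class j \<xi>) = \<phi>}"
    thus "x \<in> \<phi>" using char_orbit_props(5) char_class_in assms(3) by auto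
  next
    fix x assume x: "x \<in> \<phi>"
    then obtain \<xi> where "\<xi> \<in> field_chars j" "x = char_class j \<xi>" using Theta_level[OF assms(1) _ assms(2,3)] by blast
    thus "x \<in> char_class j ` {\<xi> \<in> field_chars j. char_orbit (char_class j \<xi>) = \<phi>}"
      using Theta_D(5)[OF assms(1) x] by auto
  qed
qed

lemma sum_level_chars:
  assumes "j \<ge> 1"
  shows "(\<Sum>\<phi> | \<phi> \<in> (Theta :: ('a :: {field, finite}) limit_char set set) \<and> card \<phi> dvd j.
      \<Sum>\<xi> | \<xi> \<in> field_chars j \<and> char_orbit (char_class j \<xi>) = \<phi>. g \<xi>) = (\<Sum>\<xi>\<in>field_chars j. g \<xi> :: 'b :: comm_monoid_add)"
proof -
  have "(\<Sum>\<xi>\<in>field_chars j. g \<xi>) = (\<Sum>\<phi>\<in>{\<phi> \<in> (Theta :: 'a limit_char set set). card \<phi> dvd j}. sum g {\<xi> \<in> field_chars j. char_orbit (char_class j \<xi>) = \<phi>})"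
    using char_orbit_level[OF _ assms]
    by (intro sum.group[symmetric] field_chars_card[OF assms] finite_Theta_dvd[OF assms]) auto
  thus ?thesis by simp
qed

lemma sum_card_Theta:
  assumes "j \<ge> 1"
  shows "(\<Sum>\<phi> | \<phi> \<in> (Theta :: ('a :: {field, finite}) limit_char set set) \<and> card \<phi> dvd j. card \<phi>) = CARD('a) ^ j - 1"
proof -
  have "(\<Sum>\<phi> | \<phi> \<in> (Theta :: 'a limit_char set set) \<and> card \<phi> dvd j. card \<phi>) =
    (\<Sum>\<phi> | \<phi> \<in> (Theta :: 'a limit_char set set) \<and> card \<phi> dvd j. \<Sum>\<xi> | \<xi> \<in> field_chars j \<and> char_orbit (char_class j \<xi>) = \<phi>. 1)"
    by (rule sum.cong) (simp_all add: bij_betw_same_card[OF card_level_chars[OF _ _ assms]])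
  also have "\<dots> = card (field_chars j :: ('a alg_closure \<Rightarrow> complex) set)" using sum_level_chars[OF assms, of "\<lambda>_. 1 :: nat"] by simp
  finally show ?thesis using field_chars_card[OF assms, where 'a = 'a] by simp
qed

lemma field_units_frob_bij:
  assumes "j \<ge> 1"
  shows "bij_betw (\<lambda>z. z ^ (CARD('a) ^ k)) (field_units j) (field_units j :: ('a :: {field, finite}) alg_closure set)"
proof -
  have fin: "finite (field_units j :: 'a alg_closure set)" by (rule field_units_card[OF assms])
  have inj: "inj_on (\<lambda>z. z ^ (CARD('a) ^ k)) (field_units j :: 'a alg_closure set)" by (auto simp: inj_on_def frob_inj)
  have "(\<lambda>z. z ^ (CARD('a) ^ k)) ` field_units j \<subseteq> (field_units j :: 'a alg_closure set)" by (auto intro: field_units_closed)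
  thus ?thesis using inj endo_inj_surj[OF fin _ inj] by (simp add: bij_betw_def)
qed

definition orbit_power_sum :: "nat \<Rightarrow> ('a :: {field, finite}) alg_closure \<Rightarrow> 'a xvar mps" where
  "orbit_power_sum j z = in_alphabet (frob_orbit z) (power_sum (j div card (frob_orbit z)))"

text \<open>Shows that the choice in \<open>power_sum_Y\<close> does not matter: replacing \<xi> by
  a Frobenius power amounts to applying Frobenius to z, which permutes M_j and preserves
  orbits.\<close>

lemma power_sum_Y_level:
  assumes "\<phi> \<in> (Theta :: ('a :: {field, finite}) limit_char set set)" "card \<phi> dvd j" "j \<ge> 1"
    "\<xi> \<in> field_chars j" "char_orbit (char_class j \<xi>) = \<phi>"
  shows "power_sum_Y \<phi> (j div card \<phi>) = (-1) ^ (j - 1) * (\<Sum>z\<in>field_units j. scalar (\<xi> z) * orbit_power_sum j z)"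
proof -
  let ?x = "SOME x. x \<in> \<phi>"
  have x: "?x \<in> \<phi>" using Theta_D(4)[OF assms(1)] by (simp add: some_in_eq)
  hence "?x \<in> char_orbit (char_class j \<xi>)" using assms(5) by simp
  then obtain k where "?x = (frob_char ^^ k) (char_class j \<xi>)" by (auto simp: char_orbit_def)
  hence xk: "?x = char_class j (\<lambda>z. \<xi> z ^ (CARD('a) ^ k))" using assms(3,4) by (simp add: frob_char_pow_class)
  have at: "char_at j ?x = (\<lambda>z. \<xi> z ^ (CARD('a) ^ k))"
    unfolding xk using assms(3,4) by (intro char_at_char_class char_power_in) auto
  have n: "j div card \<phi> * card \<phi> = j" using assms(2) by simp
  have "(\<Sum>z\<in>field_units j. scalar (\<xi> z ^ (CARD('a) ^ k)) * orbit_power_sum j z) =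
      (\<Sum>z\<in>field_units j. scalar (\<xi> (z ^ (CARD('a) ^ k))) * orbit_power_sum j (z ^ (CARD('a) ^ k)))"
    by (rule sum.cong) (simp_all add: field_charsD(5)[OF assms(4,3)] orbit_power_sum_def frob_orbit_frob)
  also have "\<dots> = (\<Sum>z\<in>field_units j. scalar (\<xi> z) * orbit_power_sum j z)"
    by (rule sum.reindex_bij_betw[OF field_units_frob_bij[OF assms(3)]])
  finally show ?thesis
    unfolding power_sum_Y_def Let_def n at orbit_power_sum_def[symmetric] by simp
qed

theorem sum_power_sum_Y:
  assumes "j \<ge> 1"
  shows "(\<Sum>\<phi> | \<phi> \<in> (Theta :: ('a :: {field, finite}) limit_char set set) \<and> card \<phi> dvd j.
      of_nat (card \<phi>) * power_sum_Y \<phi> (j div card \<phi>)) =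
    scalar ((-1) ^ (j - 1) * of_nat (CARD('a) ^ j - 1)) * in_alphabet {1} (power_sum j)"
proof -
  define c where "c z = orbit_power_sum j z" for z :: "'a alg_closure"
  let ?Th = "{\<phi>. \<phi> \<in> (Theta :: 'a limit_char set set) \<and> card \<phi> dvd j}"
  have "(\<Sum>\<phi>\<in>?Th. of_nat (card \<phi>) * power_sum_Y \<phi> (j div card \<phi>)) =
    (\<Sum>\<phi>\<in>?Th. \<Sum>\<xi> | \<xi> \<in> field_chars j \<and> char_orbit (char_class j \<xi>) = \<phi>. (-1) ^ (j - 1) * (\<Sum>z\<in>field_units j. scalar (\<xi> z) * c z))"
  proof (rule sum.cong[OF refl])
    fix \<phi> assume p: "\<phi> \<in> ?Th"
    have "(\<Sum>\<xi> | \<xi> \<in> field_chars j \<and> char_orbit (char_class j \<xi>) = \<phi>. (-1) ^ (j - 1) * (\<Sum>z\<in>field_units j. scalar (\<xi> z) * c z))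
       = (\<Sum>\<xi> | \<xi> \<in> field_chars j \<and> char_orbit (char_class j \<xi>) = \<phi>. power_sum_Y \<phi> (j div card \<phi>))"
      by (rule sum.cong[OF refl], subst power_sum_Y_level) (use p assms in \<open>auto simp: c_def\<close>)
    also have "\<dots> = of_nat (card \<phi>) * power_sum_Y \<phi> (j div card \<phi>)"
      using bij_betw_same_card[OF card_level_chars[of \<phi> j]] p assms by simp
    finally show "of_nat (card \<phi>) * power_sum_Y \<phi> (j div card \<phi>) =
      (\<Sum>\<xi> | \<xi> \<in> field_chars j \<and> char_orbit (char_class j \<xi>) = \<phi>. (-1) ^ (j - 1) * (\<Sum>z\<in>field_units j. scalar (\<xi> z) * c z))" ..
  qed
  also have "\<dots> = (\<Sum>\<xi>\<in>field_chars j. (-1) ^ (j - 1) * (\<Sum>z\<in>field_units j. scalar (\<xi> z) * c z))"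
    by (rule sum_level_chars[OF assms])
  also have "\<dots> = (-1) ^ (j - 1) * (\<Sum>z\<in>field_units j. scalar (\<Sum>\<xi>\<in>field_chars j. \<xi> z) * c z)"
    unfolding sum_distrib_left[symmetric] scalar_sum sum_distrib_right by (subst sum.swap) (rule refl)
  also have "(\<Sum>z\<in>field_units j. scalar (\<Sum>\<xi>\<in>field_chars j. \<xi> z) * c z) =
      (\<Sum>z\<in>(field_units j :: 'a alg_closure set). if z = 1 then scalar (of_nat (CARD('a) ^ j - 1)) * c 1 else 0)"
    by (rule sum.cong) (simp_all add: field_chars_orthogonality[OF assms])
  also have "\<dots> = scalar (of_nat (CARD('a) ^ j - 1)) * c 1"
    using field_units_card(1)[OF assms, where 'a = 'a] by (simp add: field_units_def)
  also have "c 1 = in_alphabet {1} (power_sum j)" by (simp add: c_def orbit_power_sum_def frob_orbit_1)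
  finally show ?thesis by (simp only: scalar_neg1 scalar_mult mult.assoc)
qed

section \<open>The characteristic of the Gelfand-Graev character in the alphabets \<open>Y\<^sup>\<phi>\<close>\<close>

lemma alphabet_mset:
  assumes "fst ` set_mset m \<subseteq> {f}"
  shows "image_mset (Pair f) (image_mset snd m) = m"
proof -
  have "image_mset (Pair f) (image_mset snd m) = image_mset (\<lambda>x. x) m"
    unfolding multiset.map_comp by (rule image_mset_cong) (use assms in auto)
  thus ?thesis by simp
qed

text \<open>The lifted definition reads f and m through \<open>Rep_alg_closure\<close>; injectivity
  of the representation gives back the condition on f and m themselves.\<close>

lemma mcoeff_in_alphabet:
  fixes f :: "'a :: {field, finite} alg_closure set"
  shows "mcoeff (in_alphabet f g) m = (if fst ` set_mset m \<subseteq> {f} then mcoeff g (image_mset snd m) else 0)"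
proof -
  have "inj ((`) Rep_alg_closure :: 'a alg_closure set \<Rightarrow> _)"
    by (rule injI) (metis Rep_alg_closure_inject injI inj_image_eq_iff)
  hence "fst ` map_prod ((`) Rep_alg_closure) id ` set_mset m \<subseteq> {Rep_alg_closure ` f} \<longleftrightarrow> fst ` set_mset m \<subseteq> {f}"
    by (auto simp: image_subset_iff inj_eq)
  moreover have "image_mset snd (image_mset (map_prod ((`) Rep_alg_closure) id) m) = image_mset snd m"
    by (simp add: multiset.map_comp comp_def)
  ultimately show ?thesis unfolding in_alphabet_def by (simp add: Abs_mps_inverse)
qed

lemma in_alphabet_add: "in_alphabet f (g + h) = in_alphabet f g + in_alphabet f h"
  and in_alphabet_scalar: "in_alphabet f (scalar c * g) = scalar c * in_alphabet f g"
  and in_alphabet_1 [simp]: "in_alphabet f 1 = 1"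
  and in_alphabet_0 [simp]: "in_alphabet f 0 = 0"
  by (rule mps_eqI; auto simp: mcoeff_in_alphabet)+

lemma in_alphabet_mult: "in_alphabet f (g * h) = in_alphabet f g * in_alphabet f h"
proof (rule mps_eqI)
  fix m
  show "mcoeff (in_alphabet f (g * h)) m = mcoeff (in_alphabet f g * in_alphabet f h) m"
  proof (cases "fst ` set_mset m \<subseteq> {f}")
    case True
    have sub: "fst ` set_mset a \<subseteq> {f}" "fst ` set_mset (m - a) \<subseteq> {f}" if "a \<subseteq># m" for a
      using True that by (auto dest!: mset_subset_eqD in_diffD)
    have "mcoeff (in_alphabet f g * in_alphabet f h) m =
        (\<Sum>a | a \<subseteq># m. mcoeff g (image_mset snd a) * mcoeff h (image_mset snd (m - a)))"
      unfolding times_mps.rep_eq by (rule sum.cong) (use sub in \<open>auto simp: mcoeff_in_alphabet\<close>)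
    also have "\<dots> = (\<Sum>b | b \<subseteq># image_mset snd m. mcoeff g b * mcoeff h (image_mset snd m - b))"
    proof (rule sum.reindex_bij_witness[of _ "image_mset (Pair f)" "image_mset snd"])
      fix a assume "a \<in> {a. a \<subseteq># m}"
      hence a: "a \<subseteq># m" by simp
      show "image_mset (Pair f) (image_mset snd a) = a" by (rule alphabet_mset[OF sub(1)[OF a]])
      show "image_mset snd a \<in> {b. b \<subseteq># image_mset snd m}" using a by (simp add: image_mset_subseteq_mono)
      show "mcoeff g (image_mset snd a) * mcoeff h (image_mset snd m - image_mset snd a) =
        mcoeff g (image_mset snd a) * mcoeff h (image_mset snd (m - a))" using a by (simp add: image_mset_Diff)
    next
      fix b assume "b \<in> {b. b \<subseteq># image_mset snd m}"
      hence "image_mset (Pair f) b \<subseteq># image_mset (Pair f) (image_mset snd m)" by (simp add: image_mset_subseteq_mono)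
      thus "image_mset (Pair f) b \<in> {a. a \<subseteq># m}" using alphabet_mset[OF True] by simp
    qed (simp add: multiset.map_comp comp_def)
    also have "\<dots> = mcoeff (in_alphabet f (g * h)) m" using True by (simp add: mcoeff_in_alphabet times_mps.rep_eq)
    finally show ?thesis ..
  next
    case False
    have "\<not> fst ` set_mset a \<subseteq> {f} \<or> \<not> fst ` set_mset (m - a) \<subseteq> {f}" if "a \<subseteq># m" for a
    proof -
      have "set_mset m = set_mset a \<union> set_mset (m - a)" using that by (metis set_mset_union subset_mset.add_diff_inverse)
      thus ?thesis using False by (metis Un_subset_iff image_Un)
    qed
    hence "mcoeff (in_alphabet f g * in_alphabet f h) m = 0"
      unfolding times_mps.rep_eq by (intro sum.neutral) (auto simp: mcoeff_in_alphabet)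
    thus ?thesis using False by (simp add: mcoeff_in_alphabet)
  qed
qed

lemma in_alphabet_const [simp]: "in_alphabet f (scalar c) = scalar c"
  using in_alphabet_scalar[of f c 1] by simp

lemma alg_hom_in_alphabet: "alg_hom_on A (in_alphabet f)"
  by (auto simp: alg_hom_on_def linear_on_mps_def in_alphabet_add in_alphabet_scalar in_alphabet_mult)

lemma in_alphabet_sum: "in_alphabet f (sum g A) = (\<Sum>x\<in>A. in_alphabet f (g x))"
  by (induction A rule: infinite_finite_induct) (auto simp: in_alphabet_add)

subsection \<open>The ring generated by the alphabets\<close>

lemma Lambda_ring_scalar [simp, intro]: "scalar c \<in> Lambda_ring"
  using Lambda_ring.base[OF one_in_Phi scalar_sym_fun[of c]] by simp

lemma Lambda_ring_0 [simp, intro]: "0 \<in> Lambda_ring" and Lambda_ring_1 [simp, intro]: "1 \<in> Lambda_ring"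
  using Lambda_ring_scalar[of 0] Lambda_ring_scalar[of 1] by simp_all

lemma Lambda_ring_sum [intro]: "(\<And>x. x \<in> A \<Longrightarrow> f x \<in> Lambda_ring) \<Longrightarrow> sum f A \<in> Lambda_ring"
  by (induction A rule: infinite_finite_induct) (auto intro: Lambda_ring.add)

lemma power_sum_Y_in: "power_sum_Y \<phi> k \<in> (Lambda_ring :: ('a :: {field, finite}) xvar mps set)"
proof -
  have "frob_orbit z \<in> Phi" if "z \<in> field_units n" for z :: "'a alg_closure" and n
    using that by (auto simp: Phi_def field_units_def)
  thus ?thesis
    unfolding power_sum_Y_def Let_def scalar_neg1
    by (intro Lambda_ring.mult Lambda_ring_scalar Lambda_ring_sum Lambda_ring.base power_sum_sym_fun) auto
qed

lemma alg_hom_in_Y: "alg_hom_on sym_fun (in_Y \<phi>)"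
  and in_Y_power_sum: "k \<ge> 1 \<Longrightarrow> in_Y \<phi> (power_sum k) = power_sum_Y \<phi> k"
  using someI_ex[OF alg_hom_exists[of "power_sum_Y \<phi>"], folded in_Y_def] by auto

lemma in_Y_in: "g \<in> sym_fun \<Longrightarrow> in_Y \<phi> g \<in> Lambda_ring"
  by (rule alg_hom_on_image_sym_fun[OF alg_hom_in_Y])
     (auto simp: in_Y_power_sum intro: Lambda_ring.add Lambda_ring.mult power_sum_Y_in)

subsection \<open>Schur functions of one row\<close>

text \<open>A one-row tableau is a weakly increasing word, and each multiset of size k has exactly
  one such arrangement.\<close>

lemma schur_single: "schur [k] = complete_h k"
proof (rule mps_eqI)
  fix m :: "nat multiset"
  let ?S = "{T. is_ssyt [k] T \<and> image_mset T (mset_set (cells [k])) = m}"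
  have cells: "cells [k] = Pair 0 ` {..<k}" by (auto simp: cells_def)
  have im: "image_mset T (mset_set (cells [k])) = mset (map (\<lambda>c. T (0, c)) [0..<k])" for T :: "nat \<times> nat \<Rightarrow> nat"
  proof -
    have "mset_set (cells [k]) = image_mset (Pair 0) (mset_set {..<k})"
      unfolding cells by (rule image_mset_mset_set[symmetric]) (simp add: inj_on_def)
    thus ?thesis by (simp add: multiset.map_comp comp_def lessThan_atLeast0)
  qed
  have "card ?S = (if size m = k then 1 else 0)"
  proof (cases "size m = k")
    case True
    define T where "T = (\<lambda>x. if x \<in> cells [k] then sorted_list_of_multiset m ! snd x else 0)"
    have len: "length (sorted_list_of_multiset m) = k" using True by (metis mset_sorted_list_of_multiset size_mset)
    have Tm: "map (\<lambda>c. T (0, c)) [0..<k] = sorted_list_of_multiset m"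
      by (rule nth_equalityI) (auto simp: len T_def cells)
    have "is_ssyt [k] T"
      unfolding is_ssyt_def
      by (auto simp: T_def cells_def len intro!: sorted_nth_mono)
    moreover have "T' = T" if T': "T' \<in> ?S" for T'
    proof
      fix x
      have mono: "T' (0, c) \<le> T' (0, c')" if "c \<le> c'" "c' < k" for c c'
        using that
      proof (induction rule: dec_induct)
        case (step i) thus ?case using T' unfolding is_ssyt_def by (auto simp: cells_def intro: le_trans)
      qed simp
      have "sorted (map (\<lambda>c. T' (0, c)) [0..<k])"
        unfolding sorted_iff_nth_mono by (auto intro: mono)
      moreover have "mset (map (\<lambda>c. T' (0, c)) [0..<k]) = m" using T' by (simp only: im mem_Collect_eq)
      ultimately have "map (\<lambda>c. T' (0, c)) [0..<k] = sorted_list_of_multiset m"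
        by (metis sorted_list_of_multiset_mset sorted_sort_id)
      hence e: "map (\<lambda>c. T' (0, c)) [0..<k] = map (\<lambda>c. T (0, c)) [0..<k]" using Tm by simp
      show "T' x = T x"
      proof (cases "x \<in> cells [k]")
        case True
        then obtain c where "x = (0, c)" "c < k" by (auto simp: cells)
        thus ?thesis using e by simp
      next
        case False
        moreover have "T' x = 0" using T' False unfolding is_ssyt_def by blast
        ultimately show ?thesis unfolding T_def by (simp only: if_False)
      qed
    qed
    moreover have "image_mset T (mset_set (cells [k])) = m" unfolding im Tm by simp
    ultimately have "?S = {T}" by blast
    thus ?thesis using True by simp
  next
    case False
    have "size (image_mset T (mset_set (cells [k]))) = k" for T :: "nat \<times> nat \<Rightarrow> nat" unfolding im by simp
    hence e: "?S = {}" using False by blast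
    show ?thesis unfolding e using False by simp
  qed
  thus "mcoeff (schur [k]) m = mcoeff (complete_h k) m" by (simp add: schur.rep_eq complete_h.rep_eq)
qed

subsection \<open>Generating functions\<close>

lemma fps_mult_cancel_unit:
  fixes E f :: "'r :: comm_ring_1 fps"
  assumes "fps_nth E 0 = 1" "E * f = 0"
  shows "f = 0"
proof (rule fps_ext)
  fix n show "fps_nth f n = fps_nth 0 n"
  proof (induction n rule: less_induct)
    case (less n)
    have "0 = fps_nth (E * f) n" using assms(2) by simp
    also have "\<dots> = (\<Sum>i=0..n. fps_nth E i * fps_nth f (n - i))" by (simp add: fps_mult_nth)
    also have "\<dots> = fps_nth f n + (\<Sum>i=1..n. fps_nth E i * fps_nth f (n - i))"
      using assms(1) by (simp add: sum.atLeast_Suc_atMost)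
    also have "(\<Sum>i=1..n. fps_nth E i * fps_nth f (n - i)) = 0" using less by (intro sum.neutral) auto
    finally show ?case by simp
  qed
qed

text \<open>The series sum_k h(k) u^(d k). For h(k) = h_k(Y^\<phi>) and d = |\<phi>| it collects the
  one-row contributions of the orbit \<phi>.\<close>

definition row_fps :: "nat \<Rightarrow> (nat \<Rightarrow> 'r) \<Rightarrow> 'r :: comm_ring_1 fps" where
  "row_fps d h = Abs_fps (\<lambda>n. if d dvd n then h (n div d) else 0)"

text \<open>The exponent functions vanish outside A so that there are finitely many of given weight;
  this finiteness is proved in the same induction because the sum depends on it.\<close>

lemma prod_row_fps:
  fixes h :: "'i \<Rightarrow> nat \<Rightarrow> 'r :: comm_ring_1"
  assumes "finite A" "\<And>a. a \<in> A \<Longrightarrow> d a \<ge> 1"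
  shows "finite {k. (\<forall>a. a \<notin> A \<longrightarrow> k a = 0) \<and> (\<Sum>a\<in>A. d a * k a) = n} \<and> fps_nth (\<Prod>a\<in>A. row_fps (d a) (h a)) n =
    (\<Sum>k | (\<forall>a. a \<notin> A \<longrightarrow> k a = 0) \<and> (\<Sum>a\<in>A. d a * k a) = n. \<Prod>a\<in>A. h a (k a))"
  using assms
proof (induction A arbitrary: n rule: finite_induct)
  case empty
  have "{k. \<forall>a :: 'i. k a = (0 :: nat)} = {\<lambda>_. 0}" by auto
  thus ?case by (auto simp: fps_one_nth)
next
  case (insert b A)
  let ?K = "\<lambda>A n. {k. (\<forall>a. a \<notin> A \<longrightarrow> k a = 0) \<and> (\<Sum>a\<in>A. d a * k a) = n}"
  have d: "d b \<ge> 1" using insert.prems by simp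
  have IH: "finite (?K A n)" "fps_nth (\<Prod>a\<in>A. row_fps (d a) (h a)) n = (\<Sum>k\<in>?K A n. \<Prod>a\<in>A. h a (k a))" for n
    using insert.IH[of n] insert.prems by auto
  let ?S = "SIGMA i : {i \<in> {0..n}. d b dvd i}. ?K A (n - i)"
  let ?f = "\<lambda>(i, k). k(b := i div d b)" and ?g = "\<lambda>k. (d b * k b, k(b := 0))"
  have upd: "(\<Sum>a\<in>A. d a * (k(b := x)) a) = (\<Sum>a\<in>A. d a * k a)" "(\<Prod>a\<in>A. h a ((k(b := x)) a)) = (\<Prod>a\<in>A. h a (k a))" for k x
    using insert.hyps(2) by (auto intro!: sum.cong prod.cong)
  have upd': "(\<Sum>a\<in>insert b A. d a * (k(b := x)) a) = d b * x + (\<Sum>a\<in>A. d a * k a)" for k x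
    using insert.hyps upd(1)[of k x] by simp
  have ins: "(\<Sum>a\<in>insert b A. d a * k a) = d b * k b + (\<Sum>a\<in>A. d a * k a)" for k
    using insert.hyps by simp
  have kb: "k b = 0" if "k \<in> ?K A m" for k m using that insert.hyps(2) by auto
  have bij: "bij_betw ?f ?S (?K (insert b A) n)"
  proof (rule bij_betwI[where g = ?g])
    show "?f \<in> ?S \<rightarrow> ?K (insert b A) n"
      using upd' by auto
    show "?g \<in> ?K (insert b A) n \<rightarrow> ?S"
    proof
      fix k assume k: "k \<in> ?K (insert b A) n"
      hence n: "d b * k b + (\<Sum>a\<in>A. d a * k a) = n" unfolding ins by simp
      have "(\<Sum>a\<in>A. d a * (k(b := 0)) a) = n - d b * k b" unfolding upd using n by simp
      moreover have "d b * k b \<le> n" using n by simp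
      ultimately show "?g k \<in> ?S" using k by auto
    qed
    show "?g (?f x) = x" if "x \<in> ?S" for x using that kb by (auto simp: fun_upd_idem)
    show "?f (?g k) = k" if "k \<in> ?K (insert b A) n" for k using d by simp
  qed
  have finS: "finite ?S" using IH(1) by (intro finite_SigmaI) auto
  have "fps_nth (\<Prod>a\<in>insert b A. row_fps (d a) (h a)) n =
      (\<Sum>i=0..n. (if d b dvd i then h b (i div d b) else 0) * (\<Sum>k\<in>?K A (n - i). \<Prod>a\<in>A. h a (k a)))"
    using insert.hyps by (simp add: fps_mult_nth IH(2)) (simp add: row_fps_def)
  also have "\<dots> = (\<Sum>i | i \<in> {0..n} \<and> d b dvd i. \<Sum>k\<in>?K A (n - i). h b (i div d b) * (\<Prod>a\<in>A. h a (k a)))"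
    unfolding sum_distrib_left[symmetric] by (subst sum.inter_filter) (auto intro!: sum.cong)
  also have "\<dots> = (\<Sum>x\<in>?S. h b (fst x div d b) * (\<Prod>a\<in>A. h a (snd x a)))"
    using IH(1) by (subst sum.Sigma) (auto simp: case_prod_unfold)
  also have "\<dots> = (\<Sum>k\<in>?K (insert b A) n. \<Prod>a\<in>insert b A. h a (k a))"
  proof -
    have p: "(\<Prod>a\<in>insert b A. h a ((k(b := x)) a)) = h b x * (\<Prod>a\<in>A. h a (k a))" for k x
      using insert.hyps upd(2)[of k x] by simp
    have "(\<Sum>k\<in>?K (insert b A) n. \<Prod>a\<in>insert b A. h a (k a)) = (\<Sum>x\<in>?S. \<Prod>a\<in>insert b A. h a (?f x a))"
      by (rule sum.reindex_bij_betw[OF bij, symmetric])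
    also have "\<dots> = (\<Sum>x\<in>?S. h b (fst x div d b) * (\<Prod>a\<in>A. h a (snd x a)))"
      by (rule sum.cong[OF refl]) (simp only: case_prod_unfold p)
    finally show ?thesis ..
  qed
  finally show ?case using bij_betw_finite[OF bij] finS by simp
qed

text \<open>The logarithmic derivative of a product, written without division.\<close>

lemma fps_prod_log_deriv:
  fixes H D :: "'i \<Rightarrow> 'r :: comm_ring_1 fps"
  assumes "finite A" "\<And>a. a \<in> A \<Longrightarrow> fps_X * fps_deriv (H a) = D a * H a"
  shows "fps_X * fps_deriv (\<Prod>a\<in>A. H a) = (\<Sum>a\<in>A. D a) * (\<Prod>a\<in>A. H a)"
  using assms
proof (induction A rule: finite_induct)
  case (insert b A)
  have "fps_X * fps_deriv (\<Prod>a\<in>insert b A. H a) = H b * (fps_X * fps_deriv (\<Prod>a\<in>A. H a)) + (fps_X * fps_deriv (H b)) * (\<Prod>a\<in>A. H a)"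
    using insert.hyps by (simp add: algebra_simps)
  also have "\<dots> = (\<Sum>a\<in>insert b A. D a) * (\<Prod>a\<in>insert b A. H a)"
    using insert by (simp add: algebra_simps)
  finally show ?case .
qed simp

lemma fps_X_deriv_nth: "fps_nth (fps_X * fps_deriv f) n = of_nat n * fps_nth (f :: 'r :: comm_ring_1 fps) n"
  by (cases n) (auto simp: fps_X_mult_nth simp del: of_nat_Suc)

text \<open>The recursion for h says that u H'(u) is H(u) times sum_i p_i u^i; replacing u by u^d
  brings in the factor d.\<close>

lemma row_fps_log_deriv:
  fixes h p :: "nat \<Rightarrow> 'r :: comm_ring_1"
  assumes "d \<ge> 1" "\<And>k. of_nat k * h k = (\<Sum>i=1..k. p i * h (k - i))"
  shows "fps_X * fps_deriv (row_fps d h) = row_fps d (\<lambda>i. if i = 0 then 0 else of_nat d * p i) * row_fps d h"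
proof (rule fps_ext)
  fix n
  let ?p = "\<lambda>i. if i = 0 then 0 else of_nat d * p i"
  show "fps_nth (fps_X * fps_deriv (row_fps d h)) n = fps_nth (row_fps d ?p * row_fps d h) n"
  proof (cases "d dvd n")
    case False
    have "(if d dvd i then ?p (i div d) else 0) * (if d dvd n - i then h ((n - i) div d) else 0) = 0" if "i \<in> {0..n}" for i
    proof (cases "d dvd i")
      case True
      hence "\<not> d dvd n - i" using False that by (metis atLeastAtMost_iff dvd_add le_add_diff_inverse)
      thus ?thesis by simp
    qed simp
    hence "fps_nth (row_fps d ?p * row_fps d h) n = 0"
      unfolding fps_mult_nth row_fps_def fps_nth_Abs_fps by (rule sum.neutral[OF ballI])
    thus ?thesis using False by (simp add: fps_X_deriv_nth row_fps_def)
  next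
    case True
    then obtain k where k: "n = d * k" by auto
    have "fps_nth (row_fps d ?p * row_fps d h) n = (\<Sum>i=0..n. (if d dvd i then ?p (i div d) else 0) * (if d dvd n - i then h ((n - i) div d) else 0))"
      by (simp add: fps_mult_nth row_fps_def)
    also have "\<dots> = (\<Sum>i\<in>(\<lambda>i. d * i) ` {1..k}. (if d dvd i then ?p (i div d) else 0) * (if d dvd n - i then h ((n - i) div d) else 0))"
    proof (rule sum.mono_neutral_right)
      show "\<forall>i\<in>{0..n} - (\<lambda>i. d * i) ` {1..k}. (if d dvd i then ?p (i div d) else 0) * (if d dvd n - i then h ((n - i) div d) else 0) = 0"
        using assms(1) k by auto
    qed (use assms(1) k in auto)
    also have "\<dots> = (\<Sum>i=1..k. of_nat d * (p i * h (k - i)))"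
    proof (rule sum.reindex_cong[of "\<lambda>i. d * i"])
      show "inj_on (\<lambda>i. d * i) {1..k}" using assms(1) by (auto intro: inj_onI)
      fix i assume i: "i \<in> {1..k}"
      have "n - d * i = d * (k - i)" by (simp add: k diff_mult_distrib2)
      thus "(if d dvd d * i then ?p (d * i div d) else 0) * (if d dvd n - d * i then h ((n - d * i) div d) else 0) = of_nat d * (p i * h (k - i))"
        using assms(1) i by (simp add: mult.assoc)
    qed simp
    also have "\<dots> = of_nat n * h k" unfolding sum_distrib_left[symmetric] assms(2)[symmetric] by (simp add: k mult.assoc)
    finally show ?thesis using assms(1) by (simp add: fps_X_deriv_nth row_fps_def k)
  qed
qed

lemma hl_parameter_CARD: "hl_parameter (inverse (of_nat CARD('a :: {field, finite})))"
proof
  show "inverse (of_nat CARD('a)) \<noteq> (0 :: complex)" by simp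
  fix j :: nat assume "j \<ge> 1"
  hence "CARD('a) ^ j \<ge> 2" using CARD_pow_gt_1[of j, where 'a = 'a] by simp
  hence "of_nat (CARD('a) ^ j) \<noteq> (1 :: complex)" by (metis of_nat_1 of_nat_eq_iff not_numeral_le_zero numeral_le_one_iff semiring_norm(69))
  thus "inverse (of_nat CARD('a)) ^ j \<noteq> (1 :: complex)" by (simp add: power_inverse inverse_eq_1_iff del: of_nat_power flip: of_nat_power)
qed

abbreviation gg :: "('a :: {field, finite}) itself \<Rightarrow> nat \<Rightarrow> nat mps" where
  "gg TYPE('a) \<equiv> hl_parameter.gg_sym (inverse (of_nat CARD('a)))"

lemma gg_elem: "(\<Sum>r\<le>n. elem_e r * gg TYPE('a :: {field, finite}) (n - r)) = scalar (of_nat (CARD('a) ^ n)) * elem_e n"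
  using hl_parameter.gg_sym_recursion[OF hl_parameter_CARD[where 'a = 'a], of n] by simp

lemma gg_0 [simp]: "gg TYPE('a :: {field, finite}) 0 = 1"
  using gg_elem[of 0, where 'a = 'a] by simp

text \<open>The logarithmic derivative of E(q u) / E(u) is the difference of those of E(q u) and
  E(u), whose j-th coefficients differ by the factor q^j; hence q^j - 1.\<close>

lemma gg_newton:
  "of_nat n * gg TYPE('a :: {field, finite}) n =
    (\<Sum>j=1..n. scalar ((-1) ^ (j - 1) * of_nat (CARD('a) ^ j - 1)) * power_sum j * gg TYPE('a) (n - j))"
proof -
  define E where "E = Abs_fps elem_e"
  define Eq where "Eq = Abs_fps (\<lambda>n. scalar (of_nat (CARD('a) ^ n)) * elem_e n)"
  define G where "G = Abs_fps (gg TYPE('a))"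
  define P where "P = Abs_fps (\<lambda>j. if j = 0 then 0 else scalar ((-1) ^ (j - 1)) * power_sum j)"
  define Pq where "Pq = Abs_fps (\<lambda>j. if j = 0 then 0 else scalar ((-1) ^ (j - 1) * of_nat (CARD('a) ^ j)) * power_sum j)"
  have EG: "E * G = Eq"
    by (rule fps_ext) (simp add: E_def G_def Eq_def fps_mult_nth gg_elem atLeast0AtMost)
  have first: "(\<Sum>i=0..n. f i) = (\<Sum>i=1..n. f i)" if "f 0 = 0" for f :: "nat \<Rightarrow> nat mps" and n
    using that by (simp add: sum.atLeast_Suc_atMost)
  have dE: "fps_X * fps_deriv E = P * E"
  proof (rule fps_ext)
    fix n
    have "fps_nth (P * E) n = (\<Sum>j=1..n. (-1) ^ (j - 1) * power_sum j * elem_e (n - j))"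
      by (simp add: fps_mult_nth P_def E_def first scalar_neg1)
    thus "fps_nth (fps_X * fps_deriv E) n = fps_nth (P * E) n"
      by (simp add: fps_X_deriv_nth E_def newton_elem)
  qed
  have dEq: "fps_X * fps_deriv Eq = Pq * Eq"
  proof (rule fps_ext)
    fix n
    have "fps_nth (Pq * Eq) n = (\<Sum>j=1..n. scalar (of_nat (CARD('a) ^ n)) * ((-1) ^ (j - 1) * power_sum j * elem_e (n - j)))"
      unfolding fps_mult_nth
    proof (subst first)
      show "(\<Sum>i=1..n. fps_nth Pq i * fps_nth Eq (n - i)) = (\<Sum>j=1..n. scalar (of_nat (CARD('a) ^ n)) * ((-1) ^ (j - 1) * power_sum j * elem_e (n - j)))"
      proof (rule sum.cong[OF refl])
        fix j assume j: "j \<in> {1..n}"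
    hence j0: "(j = 0) = False" by simp
        have "(of_nat (CARD('a) ^ n) :: complex) = of_nat (CARD('a) ^ j) * of_nat (CARD('a) ^ (n - j))"
          using j by (simp flip: of_nat_mult power_add)
        thus "fps_nth Pq j * fps_nth Eq (n - j) = scalar (of_nat (CARD('a) ^ n)) * ((-1) ^ (j - 1) * power_sum j * elem_e (n - j))"
          using j0 unfolding Pq_def Eq_def scalar_neg1 fps_nth_Abs_fps by (simp only: scalar_mult mult_ac if_False)
      qed
    qed (simp add: Pq_def)
    thus "fps_nth (fps_X * fps_deriv Eq) n = fps_nth (Pq * Eq) n"
      unfolding sum_distrib_left[symmetric] newton_elem[symmetric] by (simp add: fps_X_deriv_nth Eq_def mult.left_commute)
  qed
  have "fps_X * fps_deriv Eq = P * Eq + E * (fps_X * fps_deriv G)"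
  proof -
    have "fps_X * fps_deriv Eq = (fps_X * fps_deriv E) * G + E * (fps_X * fps_deriv G)"
      unfolding EG[symmetric] by (simp add: algebra_simps)
    thus ?thesis unfolding dE by (simp add: mult.assoc EG)
  qed
  hence "E * (fps_X * fps_deriv G - (Pq - P) * G) = 0"
    unfolding dEq by (simp add: algebra_simps EG[symmetric])
  hence "fps_X * fps_deriv G - (Pq - P) * G = 0"
    by (rule fps_mult_cancel_unit[rotated]) (simp add: E_def)
  hence "fps_nth (fps_X * fps_deriv G) n = fps_nth ((Pq - P) * G) n" by simp
  also have "fps_nth ((Pq - P) * G) n = (\<Sum>j=1..n. fps_nth (Pq - P) j * gg TYPE('a) (n - j))"
    unfolding fps_mult_nth by (subst first) (auto simp: Pq_def P_def G_def)
  also have "\<dots> = (\<Sum>j=1..n. scalar ((-1) ^ (j - 1) * of_nat (CARD('a) ^ j - 1)) * power_sum j * gg TYPE('a) (n - j))"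
  proof (rule sum.cong[OF refl])
    fix j assume j: "j \<in> {1..n}"
    hence j0: "(j = 0) = False" by simp
    have "(of_nat (CARD('a) ^ j - 1) :: complex) = of_nat (CARD('a) ^ j) - 1"
      using CARD_pow_pos[of j, where 'a = 'a] by (subst of_nat_diff) auto
    hence "scalar ((-1) ^ (j - 1) * of_nat (CARD('a) ^ j - 1)) = scalar ((-1) ^ (j - 1) * of_nat (CARD('a) ^ j)) - (scalar ((-1) ^ (j - 1)) :: nat mps)"
      by (simp only: right_diff_distrib scalar_diff mult_1_right)
    thus "fps_nth (Pq - P) j * gg TYPE('a) (n - j) = scalar ((-1) ^ (j - 1) * of_nat (CARD('a) ^ j - 1)) * power_sum j * gg TYPE('a) (n - j)"
      using j0 unfolding Pq_def P_def fps_sub_nth fps_nth_Abs_fps by (simp only: left_diff_distrib if_False)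
  qed
  finally show ?thesis unfolding fps_X_deriv_nth G_def fps_nth_Abs_fps .
qed

subsection \<open>Summing over the orbits of characters\<close>

lemma finite_Theta_le: "finite {\<phi> \<in> (Theta :: ('a :: {field, finite}) limit_char set set). card \<phi> \<le> N}"
proof (rule finite_subset)
  show "{\<phi> \<in> (Theta :: 'a limit_char set set). card \<phi> \<le> N} \<subseteq> (\<Union>j\<in>{1..N}. {\<phi> \<in> Theta. card \<phi> dvd j})"
    using Theta_D(2) by fastforce
qed (use finite_Theta_dvd in auto)

text \<open>By \<open>sum_power_sum_Y\<close> the logarithmic derivative of the product has, up to
  degree N, the coefficients that occur in \<open>gg_newton\<close>, so both sides satisfy the same
  recursion. Orbits with more than N elements do not affect these degrees, which allows a finite
  product.\<close>

lemma prod_rows_in_Y: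
  assumes "n \<le> N"
  shows "fps_nth (\<Prod>\<phi> | \<phi> \<in> (Theta :: ('a :: {field, finite}) limit_char set set) \<and> card \<phi> \<le> N.
    row_fps (card \<phi>) (\<lambda>k. in_Y \<phi> (complete_h k))) n = in_alphabet {1} (gg TYPE('a) n)"
proof -
  define A where "A = {\<phi> \<in> (Theta :: 'a limit_char set set). card \<phi> \<le> N}"
  define H where "H = (\<lambda>\<phi> :: 'a limit_char set. row_fps (card \<phi>) (\<lambda>k. in_Y \<phi> (complete_h k)))"
  define D where "D = (\<lambda>\<phi> :: 'a limit_char set. row_fps (card \<phi>) (\<lambda>i. if i = 0 then 0 else of_nat (card \<phi>) * power_sum_Y \<phi> i))"
  have fin: "finite A" unfolding A_def by (rule finite_Theta_le)
  have ld: "fps_X * fps_deriv (\<Prod>\<phi>\<in>A. H \<phi>) = (\<Sum>\<phi>\<in>A. D \<phi>) * (\<Prod>\<phi>\<in>A. H \<phi>)"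
  proof (rule fps_prod_log_deriv[OF fin])
    fix \<phi> assume "\<phi> \<in> A"
    hence c: "card \<phi> \<ge> 1" using Theta_D(2) by (auto simp: A_def)
    show "fps_X * fps_deriv (H \<phi>) = D \<phi> * H \<phi>"
      unfolding H_def D_def
    proof (rule row_fps_log_deriv[OF c])
      fix k show "of_nat k * in_Y \<phi> (complete_h k) = (\<Sum>i=1..k. power_sum_Y \<phi> i * in_Y \<phi> (complete_h (k - i)))"
        unfolding alg_hom_complete_h_recursion[OF alg_hom_in_Y] by (rule sum.cong) (auto simp: in_Y_power_sum)
    qed
  qed
  have D: "fps_nth (\<Sum>\<phi>\<in>A. D \<phi>) i = (if i = 0 then 0 else
      scalar ((-1) ^ (i - 1) * of_nat (CARD('a) ^ i - 1)) * in_alphabet {1} (power_sum i))" if "i \<le> N" for i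
  proof (cases "i = 0")
    case True thus ?thesis by (simp add: fps_sum_nth D_def row_fps_def)
  next
    case False
    have "fps_nth (\<Sum>\<phi>\<in>A. D \<phi>) i = (\<Sum>\<phi>\<in>A. if card \<phi> dvd i then of_nat (card \<phi>) * power_sum_Y \<phi> (i div card \<phi>) else 0)"
      unfolding fps_sum_nth
    proof (rule sum.cong[OF refl])
      fix \<phi> assume "\<phi> \<in> A"
      hence "card \<phi> \<ge> 1" using Theta_D(2) by (auto simp: A_def)
      thus "fps_nth (D \<phi>) i = (if card \<phi> dvd i then of_nat (card \<phi>) * power_sum_Y \<phi> (i div card \<phi>) else 0)"
        using False by (auto simp: D_def row_fps_def)
    qed
    also have "\<dots> = (\<Sum>\<phi> | \<phi> \<in> A \<and> card \<phi> dvd i. of_nat (card \<phi>) * power_sum_Y \<phi> (i div card \<phi>))"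
      by (rule sum.inter_filter[OF fin, symmetric])
    also have "{\<phi>. \<phi> \<in> A \<and> card \<phi> dvd i} = {\<phi> \<in> Theta. card \<phi> dvd i}"
      using False that dvd_imp_le[of _ i] by (fastforce simp: A_def)
    also have "(\<Sum>\<phi> | \<phi> \<in> (Theta :: 'a limit_char set set) \<and> card \<phi> dvd i. of_nat (card \<phi>) * power_sum_Y \<phi> (i div card \<phi>)) =
      scalar ((-1) ^ (i - 1) * of_nat (CARD('a) ^ i - 1)) * in_alphabet {1} (power_sum i)"
      by (rule sum_power_sum_Y) (use False in simp)
    finally show ?thesis by (simp only: False if_False)
  qed
  have "fps_nth (\<Prod>\<phi>\<in>A. H \<phi>) n = in_alphabet {1} (gg TYPE('a) n)" using assms
  proof (induction n rule: less_induct)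
    case (less n)
    show ?case
    proof (cases "n = 0")
      case True
      have "fps_nth (\<Prod>\<phi>\<in>A. H \<phi>) 0 = (\<Prod>\<phi>\<in>A. fps_nth (H \<phi>) 0)" by (induction A rule: infinite_finite_induct) auto
      also have "\<dots> = 1"
        by (rule prod.neutral) (auto simp: H_def row_fps_def complete_h_eq_pleth alg_hom_onD(4)[OF alg_hom_in_Y])
      finally show ?thesis using True by simp
    next
      case False
      have "of_nat n * fps_nth (\<Prod>\<phi>\<in>A. H \<phi>) n = (\<Sum>i=0..n. fps_nth (\<Sum>\<phi>\<in>A. D \<phi>) i * fps_nth (\<Prod>\<phi>\<in>A. H \<phi>) (n - i))"
        unfolding fps_X_deriv_nth[symmetric] ld by (simp only: fps_mult_nth)
      also have "\<dots> = (\<Sum>i=1..n. fps_nth (\<Sum>\<phi>\<in>A. D \<phi>) i * fps_nth (\<Prod>\<phi>\<in>A. H \<phi>) (n - i))"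
        by (rule sum.mono_neutral_right) (auto simp: D not_less_eq_eq)
      also have "\<dots> = (\<Sum>i=1..n. in_alphabet {1} (scalar ((-1) ^ (i - 1) * of_nat (CARD('a) ^ i - 1)) * power_sum i * gg TYPE('a) (n - i)))"
      proof (rule sum.cong[OF refl])
        fix i assume i: "i \<in> {1..n}"
        hence i': "i \<le> N" "(i = 0) = False" "n - i < n" "n - i \<le> N" using less.prems by auto
        show "fps_nth (\<Sum>\<phi>\<in>A. D \<phi>) i * fps_nth (\<Prod>\<phi>\<in>A. H \<phi>) (n - i) =
          in_alphabet {1} (scalar ((-1) ^ (i - 1) * of_nat (CARD('a) ^ i - 1)) * power_sum i * gg TYPE('a) (n - i))"
          by (simp only: D[OF i'(1)] less.IH[OF i'(3,4)] i'(2) if_False mult.assoc in_alphabet_const in_alphabet_mult)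
      qed
      also have "\<dots> = in_alphabet {1} (of_nat n * gg TYPE('a) n)" by (simp only: gg_newton in_alphabet_sum)
      also have "\<dots> = of_nat n * in_alphabet {1} (gg TYPE('a) n)" by (simp only: scalar_of_nat[symmetric] in_alphabet_scalar)
      finally show ?thesis using False of_nat_mps_cancel[of n] by blast
    qed
  qed
  thus ?thesis unfolding A_def H_def by simp
qed

text \<open>The maximum over all of \<open>Theta\<close> is that of a finite set of lengths, since
  almost all values are empty. The condition n \<ge> 1 provides a nonempty value, so the maximum is
  at least 1.\<close>

lemma height_eq_1_iff:
  assumes "\<nu> \<in> partition_funs (Theta :: ('a :: {field, finite}) limit_char set set) n" "n \<ge> 1"
  shows "height \<nu> = 1 \<longleftrightarrow> (\<forall>\<phi>. length (\<nu> \<phi>) \<le> 1)"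
proof -
  let ?L = "(\<lambda>\<phi>. length (\<nu> \<phi>)) ` Theta"
  have \<nu>: "\<And>\<phi>. \<phi> \<notin> Theta \<Longrightarrow> \<nu> \<phi> = []" "finite {\<phi>. \<nu> \<phi> \<noteq> []}" "(\<Sum>f | \<nu> f \<noteq> []. card f * sum_list (\<nu> f)) = n"
    using assms(1) by (auto simp: partition_funs_def)
  have "?L \<subseteq> insert 0 ((\<lambda>\<phi>. length (\<nu> \<phi>)) ` {\<phi>. \<nu> \<phi> \<noteq> []})"
    by auto
  hence fin: "finite ?L" by (rule finite_subset) (use \<nu>(2) in simp)
  have "{\<phi>. \<nu> \<phi> \<noteq> []} \<noteq> {}" using \<nu>(3) assms(2) by (intro notI) simp
  then obtain \<phi> where \<phi>: "\<nu> \<phi> \<noteq> []" by blast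
  hence mem: "length (\<nu> \<phi>) \<in> ?L" "length (\<nu> \<phi>) \<ge> 1" using \<nu>(1) by (auto simp: Suc_le_eq)
  show ?thesis
  proof
    assume "height \<nu> = 1"
    hence "x \<le> 1" if "x \<in> ?L" for x using Max_ge[OF fin that] by (simp add: height_def)
    thus "\<forall>\<phi>. length (\<nu> \<phi>) \<le> 1" using \<nu>(1) by (metis imageI le0 list.size(3))
  next
    assume *: "\<forall>\<phi>. length (\<nu> \<phi>) \<le> 1"
    show "height \<nu> = 1" unfolding height_def
    proof (rule Max_eqI[OF fin])
      show "1 \<in> ?L" using mem * by (metis le_antisym)
    qed (use * in auto)
  qed
qed

lemma sum_height_1:
  assumes "n \<ge> 1"
  shows "(\<Sum>\<nu> | \<nu> \<in> partition_funs Theta n \<and> height \<nu> = 1. S_fun \<nu>) =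
    in_alphabet ({1} :: ('a :: {field, finite}) alg_closure set) (gg TYPE('a) n)"
proof -
  define A where "A = {\<phi> \<in> (Theta :: 'a limit_char set set). card \<phi> \<le> n}"
  have fin: "finite A" unfolding A_def by (rule finite_Theta_le)
  have cA: "card \<phi> \<ge> 1" if "\<phi> \<in> A" for \<phi> using that Theta_D(2) by (auto simp: A_def)
  define K where "K = {k. (\<forall>a. a \<notin> A \<longrightarrow> k a = 0) \<and> (\<Sum>a\<in>A. card a * k a) = n}"
  define row where "row = (\<lambda>(k :: 'a limit_char set \<Rightarrow> nat) \<phi>. if k \<phi> = 0 then [] else [k \<phi>])"
  define tot where "tot = (\<lambda>(\<nu> :: 'a limit_char set \<Rightarrow> nat list) \<phi>. sum_list (\<nu> \<phi>))"
  have ne: "{\<phi>. row k \<phi> \<noteq> []} = {\<phi>. k \<phi> \<noteq> 0}" for k by (auto simp: row_def)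
  have "in_alphabet ({1} :: 'a alg_closure set) (gg TYPE('a) n) = (\<Sum>k\<in>K. \<Prod>\<phi>\<in>A. in_Y \<phi> (complete_h (k \<phi>)))"
    using prod_rows_in_Y[of n n, where 'a = 'a]
      prod_row_fps[OF fin cA, where h = "\<lambda>\<phi> k. in_Y \<phi> (complete_h k)" and n = n]
    by (simp add: A_def K_def)
  also have "\<dots> = (\<Sum>\<nu> | \<nu> \<in> partition_funs Theta n \<and> height \<nu> = 1. S_fun \<nu>)"
  proof (rule sum.reindex_bij_witness[of _ tot row])
    fix k assume k: "k \<in> K"
    show "tot (row k) = k" by (auto simp: tot_def row_def)
    have k0: "k \<phi> = 0" if "\<phi> \<notin> A" for \<phi> using k that by (auto simp: K_def)
    have sub: "{\<phi>. k \<phi> \<noteq> 0} \<subseteq> A" by (rule subsetI, rule ccontr) (use k0 in simp)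
    have "(\<Sum>f | row k f \<noteq> []. card f * sum_list (row k f)) = (\<Sum>f\<in>A. card f * k f)"
      unfolding ne by (rule sum.mono_neutral_cong_left[OF fin sub]) (auto simp: row_def)
    also have "\<dots> = n" using k by (simp only: K_def mem_Collect_eq)
    finally have tot: "(\<Sum>f | row k f \<noteq> []. card f * sum_list (row k f)) = n" .
    have row: "row k \<in> partition_funs Theta n"
      unfolding partition_funs_def mem_Collect_eq
    proof (intro conjI allI impI tot)
      show "finite {f. row k f \<noteq> []}" unfolding ne by (rule finite_subset[OF sub fin])
      fix f show "is_partition (row k f)" by (simp add: row_def is_partition_def)
      assume "f \<notin> Theta" thus "row k f = []" using k0[of f] by (simp add: row_def A_def)
    qed
    moreover have "height (row k) = 1"
      unfolding height_eq_1_iff[OF row assms] by (simp add: row_def)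
    ultimately show "row k \<in> {\<nu>. \<nu> \<in> partition_funs Theta n \<and> height \<nu> = 1}" by simp
    show "S_fun (row k) = (\<Prod>\<phi>\<in>A. in_Y \<phi> (complete_h (k \<phi>)))"
      unfolding S_fun_def ne
      by (rule prod.mono_neutral_cong_left[OF fin sub])
         (auto simp: row_def schur_single complete_h_eq_pleth alg_hom_onD(4)[OF alg_hom_in_Y])
  next
    fix \<nu> assume v: "\<nu> \<in> {\<nu>. \<nu> \<in> partition_funs (Theta :: 'a limit_char set set) n \<and> height \<nu> = 1}"
    hence len: "length (\<nu> \<phi>) \<le> 1" for \<phi> using height_eq_1_iff[OF _ assms] by blast
    have \<nu>: "\<And>\<phi>. is_partition (\<nu> \<phi>)" "\<And>\<phi>. \<phi> \<notin> Theta \<Longrightarrow> \<nu> \<phi> = []" "finite {\<phi>. \<nu> \<phi> \<noteq> []}"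
        "(\<Sum>f | \<nu> f \<noteq> []. card f * sum_list (\<nu> f)) = n"
      using v by (auto simp: partition_funs_def)
    have form: "\<nu> \<phi> = [] \<or> (\<exists>a>0. \<nu> \<phi> = [a])" for \<phi>
      using len[of \<phi>] \<nu>(1)[of \<phi>] by (cases "\<nu> \<phi>") (auto simp: is_partition_def)
    show "row (tot \<nu>) = \<nu>"
    proof
      fix \<phi> show "row (tot \<nu>) \<phi> = \<nu> \<phi>" using form[of \<phi>] by (auto simp: tot_def row_def)
    qed
    have nonA: "\<nu> \<phi> = []" if "\<phi> \<notin> A" for \<phi>
    proof (rule ccontr)
      assume ne': "\<nu> \<phi> \<noteq> []"
      hence "\<phi> \<in> Theta" using \<nu>(2) by blast
      hence "card \<phi> > n" using that by (auto simp: A_def)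
      moreover have "card \<phi> * sum_list (\<nu> \<phi>) \<le> n"
        unfolding \<nu>(4)[symmetric] by (rule member_le_sum) (use ne' \<nu>(3) in auto)
      moreover have "sum_list (\<nu> \<phi>) \<ge> 1" using form[of \<phi>] ne' by auto
      ultimately show False by (metis mult.right_neutral mult_le_mono2 not_less order_trans)
    qed
    have "(\<Sum>a\<in>A. card a * tot \<nu> a) = n"
      unfolding \<nu>(4)[symmetric] by (rule sum.mono_neutral_cong_right) (use nonA fin in \<open>auto simp: tot_def\<close>)
    thus "tot \<nu> \<in> K" using nonA by (auto simp: K_def tot_def)
  qed
  finally show ?thesis ..
qed

subsection \<open>The maps rho and rho-hat\<close>

text \<open>The specialisation that sets all variables outside X_1 to zero.\<close>

definition restrict_1 :: "('a :: {field, finite}) xvar mps \<Rightarrow> nat mps" where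
  "restrict_1 u = Abs_mps (\<lambda>m. mcoeff u (image_mset (Pair {1}) m))"

lemma mcoeff_restrict_1: "mcoeff (restrict_1 u) m = mcoeff u (image_mset (Pair {1}) m)"
  by (simp add: restrict_1_def Abs_mps_inverse)

lemma restrict_1_add: "restrict_1 (u + v) = restrict_1 u + restrict_1 v"
  and restrict_1_scalar: "restrict_1 (scalar c * u) = scalar c * restrict_1 u"
  and restrict_1_1 [simp]: "restrict_1 1 = 1"
  and restrict_1_0 [simp]: "restrict_1 0 = 0"
  by (rule mps_eqI; auto simp: mcoeff_restrict_1)+

lemma restrict_1_const [simp]: "restrict_1 (scalar c) = scalar c"
  using restrict_1_scalar[of c 1] by simp

lemma restrict_1_mult: "restrict_1 (u * v) = restrict_1 u * restrict_1 (v :: ('a :: {field, finite}) xvar mps)"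
proof (rule mps_eqI)
  fix m :: "nat multiset"
  let ?P = "image_mset (Pair ({1} :: 'a alg_closure set)) :: nat multiset \<Rightarrow> _"
  have "(\<Sum>a | a \<subseteq># ?P m. mcoeff u a * mcoeff v (?P m - a)) =
    (\<Sum>b | b \<subseteq># m. mcoeff u (?P b) * mcoeff v (?P (m - b)))"
  proof (rule sum.reindex_bij_witness[of _ ?P "image_mset snd"])
    fix a assume "a \<in> {a. a \<subseteq># ?P m}"
    hence a: "a \<subseteq># ?P m" by simp
    have "set_mset a \<subseteq> Pair {1} ` set_mset m" using set_mset_mono[OF a] by simp
    hence "fst ` set_mset a \<subseteq> {{1}}" by auto
    thus e: "?P (image_mset snd a) = a" by (rule alphabet_mset)
    have "image_mset snd a \<subseteq># image_mset snd (?P m)" using a by (rule image_mset_subseteq_mono)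
    thus s: "image_mset snd a \<in> {b. b \<subseteq># m}" by (simp add: multiset.map_comp comp_def)
    show "mcoeff u (?P (image_mset snd a)) * mcoeff v (?P (m - image_mset snd a)) = mcoeff u a * mcoeff v (?P m - a)"
      using s by (simp only: mem_Collect_eq image_mset_Diff e)
  qed (auto simp: multiset.map_comp comp_def image_mset_subseteq_mono)
  thus "mcoeff (restrict_1 (u * v)) m = mcoeff (restrict_1 u * restrict_1 v) m"
    by (simp add: mcoeff_restrict_1 times_mps.rep_eq)
qed

lemma restrict_1_in_alphabet_1 [simp]: "restrict_1 (in_alphabet ({1} :: ('a :: {field, finite}) alg_closure set) g) = g"
  by (rule mps_eqI) (auto simp: mcoeff_restrict_1 mcoeff_in_alphabet multiset.map_comp comp_def)

lemma restrict_1_in_alphabet: "f \<noteq> {1} \<Longrightarrow> restrict_1 (in_alphabet f g) = scalar (mcoeff g {#})"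
  by (simp add: mps_eqI mcoeff_restrict_1 mcoeff_in_alphabet image_image image_constant_conv)

lemma restrict_1_sym_fun: "u \<in> Lambda_ring \<Longrightarrow> restrict_1 u \<in> sym_fun"
proof (induction rule: Lambda_ring.induct)
  case (base f g) thus ?case by (cases "f = {1}") (auto simp: restrict_1_in_alphabet)
qed (auto simp: restrict_1_add restrict_1_mult)

lemma alg_hom_restrict_1: "alg_hom_on A restrict_1"
  by (auto simp: alg_hom_on_def linear_on_mps_def restrict_1_add restrict_1_scalar restrict_1_mult)

lemma restrict_1_sum: "restrict_1 (sum f A) = (\<Sum>x\<in>A. restrict_1 (f x))"
  by (induction A rule: infinite_finite_induct) (auto simp: restrict_1_add)

text \<open>Only z = 1 has the orbit {1}; its coefficient is \<xi>(1) = 1, and all other summands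
  vanish under the specialisation.\<close>

lemma restrict_1_power_sum_Y:
  assumes "\<phi> \<in> (Theta :: ('a :: {field, finite}) limit_char set set)" "k \<ge> 1"
  shows "restrict_1 (power_sum_Y \<phi> k) = scalar ((-1) ^ (k * card \<phi> - 1)) * power_sum (k * card \<phi>)"
proof -
  define n where "n = k * card \<phi>"
  have n: "n \<ge> 1" using assms(2) Theta_D(2)[OF assms(1)] by (simp add: n_def)
  obtain x where x: "x \<in> \<phi>" using Theta_D(4)[OF assms(1)] by blast
  obtain \<xi> where \<xi>: "\<xi> \<in> field_chars n" "x = char_class n \<xi>"
    using Theta_level[OF assms(1) x _ n] by (auto simp: n_def)
  have "power_sum_Y \<phi> (n div card \<phi>) = (-1) ^ (n - 1) * (\<Sum>z\<in>field_units n. scalar (\<xi> z) * orbit_power_sum n z)"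
    by (rule power_sum_Y_level[OF assms(1) _ n \<xi>(1)]) (use Theta_D(5)[OF assms(1) x] \<xi>(2) in \<open>auto simp: n_def\<close>)
  moreover have "n div card \<phi> = k" using Theta_D(2)[OF assms(1)] by (simp add: n_def)
  ultimately have "restrict_1 (power_sum_Y \<phi> k) = scalar ((-1) ^ (n - 1)) *
      (\<Sum>z\<in>field_units n. scalar (\<xi> z) * restrict_1 (orbit_power_sum n z))"
    by (simp only: scalar_neg1 restrict_1_scalar restrict_1_sum)
  also have "(\<Sum>z\<in>field_units n. scalar (\<xi> z) * restrict_1 (orbit_power_sum n z)) =
    (\<Sum>z\<in>{1 :: 'a alg_closure}. scalar (\<xi> z) * restrict_1 (orbit_power_sum n z))"
  proof (rule sum.mono_neutral_right)
    show "finite (field_units n :: 'a alg_closure set)" using field_units_card(1)[OF n] .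
    show "{1} \<subseteq> (field_units n :: 'a alg_closure set)" by (auto simp: field_units_def)
    show "\<forall>z\<in>field_units n - {1 :: 'a alg_closure}. scalar (\<xi> z) * restrict_1 (orbit_power_sum n z) = 0"
    proof
      fix z :: "'a alg_closure" assume z: "z \<in> field_units n - {1}"
      hence "frob_orbit z \<noteq> {1}" by (simp add: frob_orbit_eq_1)
      \<comment> \<open>The index has to be positive, because \<open>power_sum 0\<close> has
        constant term 1.\<close>
      moreover have "n div card (frob_orbit z) \<noteq> 0"
        using card_frob_orbit_le[of z n] frob_orbit_finite(2)[of z] z n by (auto simp: field_units_def div_eq_0_iff)
      ultimately have "restrict_1 (orbit_power_sum n z) = 0"
        unfolding orbit_power_sum_def by (subst restrict_1_in_alphabet) (auto simp: power_sum.rep_eq)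
      thus "scalar (\<xi> z) * restrict_1 (orbit_power_sum n z) = 0" by simp
    qed
  qed
  also have "\<dots> = power_sum n"
  proof -
    have "\<xi> 1 = 1" by (rule field_charsD(4)[OF \<xi>(1) n])
    thus ?thesis by (simp add: orbit_power_sum_def frob_orbit_1)
  qed
  finally show ?thesis unfolding n_def .
qed

definition rho_spec :: "(('a :: {field, finite}) xvar mps \<Rightarrow> nat mps) \<Rightarrow> bool" where
  "rho_spec F \<longleftrightarrow> alg_hom_on Lambda_ring F \<and>
     (\<forall>\<phi>\<in>Theta. \<forall>a. F (in_Y \<phi> (complete_h a)) = complete_pleth a (card \<phi>))"

text \<open>Restriction to X_1 and omega each produce the sign (-1)^(k |\<phi>| - 1). The signs
  cancel, p_k(Y^\<phi>) goes to p_{k |\<phi>|}, and Newton's identities translate this into the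
  prescription on complete functions.\<close>

lemma rho_spec_omega: "rho_spec (\<lambda>u :: ('a :: {field, finite}) xvar mps. omega (restrict_1 u))"
  unfolding rho_spec_def
proof (intro conjI ballI allI)
  show "alg_hom_on Lambda_ring (\<lambda>u :: 'a xvar mps. omega (restrict_1 u))"
    by (rule alg_hom_on_comp[OF alg_hom_restrict_1 alg_hom_omega restrict_1_sym_fun])
  fix \<phi> :: "'a limit_char set" and a
  assume \<phi>: "\<phi> \<in> Theta"
  have hom: "alg_hom_on sym_fun (\<lambda>g. omega (restrict_1 (in_Y \<phi> g)))"
    by (rule alg_hom_on_comp[OF alg_hom_in_Y alg_hom_on_comp[OF alg_hom_restrict_1 alg_hom_omega restrict_1_sym_fun] in_Y_in])
  show "omega (restrict_1 (in_Y \<phi> (complete_h a))) = complete_pleth a (card \<phi>)"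
  proof (rule alg_hom_complete_h[OF hom Theta_D(2)[OF \<phi>]])
    fix k :: nat assume k: "k \<ge> 1"
    hence n: "k * card \<phi> \<ge> 1" using Theta_D(2)[OF \<phi>] by simp
    show "omega (restrict_1 (in_Y \<phi> (power_sum k))) = power_sum (k * card \<phi>)"
      by (simp add: in_Y_power_sum[OF k] restrict_1_power_sum_Y[OF \<phi> k] alg_hom_onD(2)[OF alg_hom_omega]
        omega_power_sum[OF n, simplified] flip: mult.assoc scalar_mult power_mult_distrib)
  qed
qed

lemma rho_spec_rho: "rho_spec rho"
  unfolding rho_def rho_spec_def[symmetric] by (rule someI[of rho_spec, OF rho_spec_omega])

text \<open>The prescription on complete functions forces p_k(Y^\<phi>) to go to p_{k |\<phi>|}.
  Under \<open>sum_power_sum_Y\<close> every orbit then contributes |\<phi>| p_j; the total weight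
  q^j - 1 appears on both sides and is cancelled.\<close>

lemma rho_in_alphabet_1:
  assumes "g \<in> sym_fun"
  shows "rho (in_alphabet ({1} :: ('a :: {field, finite}) alg_closure set) g) = omega g"
proof (rule alg_hom_unique[OF _ alg_hom_omega _ assms])
  have rho: "alg_hom_on Lambda_ring (rho :: 'a xvar mps \<Rightarrow> _)" using rho_spec_rho by (auto simp: rho_spec_def)
  have mem: "in_alphabet ({1} :: 'a alg_closure set) g \<in> Lambda_ring" if "g \<in> sym_fun" for g
    using that by (rule Lambda_ring.base[OF one_in_Phi])
  show "alg_hom_on sym_fun (\<lambda>g. rho (in_alphabet ({1} :: 'a alg_closure set) g))"
    by (rule alg_hom_on_comp[OF alg_hom_in_alphabet rho mem])
  fix j :: nat assume j: "j \<ge> 1"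
  let ?T = "{\<phi> \<in> (Theta :: 'a limit_char set set). card \<phi> dvd j}"
  have rY: "rho (in_Y \<phi> (power_sum k)) = power_sum (k * card \<phi>)" if "\<phi> \<in> (Theta :: 'a limit_char set set)" "k \<ge> 1" for \<phi> k
  proof (rule alg_hom_power_sum_of_complete_h[OF _ Theta_D(2)[OF that(1)] _ that(2)])
    show "alg_hom_on sym_fun (\<lambda>g. rho (in_Y \<phi> g))" by (rule alg_hom_on_comp[OF alg_hom_in_Y rho in_Y_in])
  qed (use rho_spec_rho that(1) in \<open>auto simp: rho_spec_def\<close>)
  have eq: "scalar ((-1) ^ (j - 1) * of_nat (CARD('a) ^ j - 1)) * in_alphabet {1} (power_sum j) =
      (\<Sum>\<phi>\<in>?T. scalar (of_nat (card \<phi>)) * power_sum_Y \<phi> (j div card \<phi>))"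
    using sum_power_sum_Y[OF j, where 'a = 'a] by (simp only: scalar_of_nat)
  have "scalar ((-1) ^ (j - 1) * of_nat (CARD('a) ^ j - 1)) * rho (in_alphabet ({1} :: 'a alg_closure set) (power_sum j)) =
      rho (\<Sum>\<phi>\<in>?T. scalar (of_nat (card \<phi>)) * power_sum_Y \<phi> (j div card \<phi>))"
    unfolding eq[symmetric] by (rule alg_hom_onD(2)[OF rho mem, symmetric]) simp
  also have "\<dots> = (\<Sum>\<phi>\<in>?T. rho (scalar (of_nat (card \<phi>)) * power_sum_Y \<phi> (j div card \<phi>)))"
    by (rule alg_hom_on_sum[OF rho]) (auto intro: Lambda_ring.add Lambda_ring.mult power_sum_Y_in)
  also have "\<dots> = (\<Sum>\<phi>\<in>?T. scalar (of_nat (card \<phi>)) * power_sum j)"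
  proof (rule sum.cong[OF refl])
    fix \<phi> assume \<phi>: "\<phi> \<in> ?T"
    hence k: "j div card \<phi> \<ge> 1" "j div card \<phi> * card \<phi> = j"
      using Theta_D(2)[of \<phi>] j by (auto simp: Suc_le_eq div_greater_zero_iff dvd_imp_le)
    have "rho (scalar (of_nat (card \<phi>)) * power_sum_Y \<phi> (j div card \<phi>)) =
        scalar (of_nat (card \<phi>)) * rho (power_sum_Y \<phi> (j div card \<phi>))"
      by (rule alg_hom_onD(2)[OF rho power_sum_Y_in])
    thus "rho (scalar (of_nat (card \<phi>)) * power_sum_Y \<phi> (j div card \<phi>)) = scalar (of_nat (card \<phi>)) * power_sum j"
      using rY[of \<phi>, OF _ k(1)] \<phi> by (simp add: in_Y_power_sum[OF k(1)] k(2))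
  qed
  also have "\<dots> = scalar (of_nat (\<Sum>\<phi>\<in>?T. card \<phi>)) * power_sum j"
    by (simp only: sum_distrib_right[symmetric] scalar_sum[symmetric] of_nat_sum)
  also have "\<dots> = scalar ((-1) ^ (j - 1) * of_nat (CARD('a) ^ j - 1)) * (scalar ((-1) ^ (j - 1)) * power_sum j)"
  proof -
    have "(of_nat (CARD('a) ^ j - 1) :: complex) = (-1) ^ (j - 1) * of_nat (CARD('a) ^ j - 1) * (-1) ^ (j - 1)"
      by (metis (no_types) mult.commute mult.left_neutral mult.assoc mult_minus1 minus_one_mult_self power_mult_distrib)
    thus ?thesis unfolding sum_card_Theta[OF j] mult.assoc[symmetric] scalar_mult[symmetric] by simp
  qed
  finally have "scalar ((-1) ^ (j - 1) * of_nat (CARD('a) ^ j - 1)) * rho (in_alphabet ({1} :: 'a alg_closure set) (power_sum j)) =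
    scalar ((-1) ^ (j - 1) * of_nat (CARD('a) ^ j - 1)) * (scalar ((-1) ^ (j - 1)) * power_sum j)" .
  moreover have "(-1) ^ (j - 1) * of_nat (CARD('a) ^ j - 1) \<noteq> (0 :: complex)"
    using CARD_pow_gt_1[OF j, where 'a = 'a] by (simp del: of_nat_power of_nat_diff)
  ultimately show "rho (in_alphabet ({1} :: 'a alg_closure set) (power_sum j)) = omega (power_sum j)"
    unfolding omega_power_sum[OF j] using scalar_cancel by blast
qed

section \<open>The products of the Gamma_n span the symmetric functions\<close>

definition gg_span :: "('a :: {field, finite}) itself \<Rightarrow> nat mps set" where
  "gg_span _ = mps.span {prod_list (map (gg TYPE('a)) l) | l. is_partition l}"

lemma prod_list_gg_in_span:
  assumes "0 \<notin> set l" shows "prod_list (map (gg TYPE('a :: {field, finite})) l) \<in> gg_span TYPE('a)"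
proof -
  have "is_partition (rev (sort l))"
    using assms by (auto simp: is_partition_def sorted_wrt_rev)
  moreover have "prod_list (map (gg TYPE('a)) (rev (sort l))) = prod_list (map (gg TYPE('a)) l)"
    by (simp only: prod_mset_prod_list[symmetric] mset_map mset_rev mset_sort)
  ultimately show ?thesis unfolding gg_span_def by (metis (mono_tags, lifting) mem_Collect_eq mps.span_base)
qed

lemma gg_span_scalar: "u \<in> gg_span TYPE('a :: {field, finite}) \<Longrightarrow> scalar c * u \<in> gg_span TYPE('a)"
  unfolding gg_span_def by (rule mps.span_scale)

lemma gg_span_add: "u \<in> gg_span TYPE('a :: {field, finite}) \<Longrightarrow> v \<in> gg_span TYPE('a) \<Longrightarrow> u + v \<in> gg_span TYPE('a)"
  unfolding gg_span_def by (rule mps.span_add)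

lemma gg_span_sum: "(\<And>x. x \<in> A \<Longrightarrow> f x \<in> gg_span TYPE('a :: {field, finite})) \<Longrightarrow> sum f A \<in> gg_span TYPE('a)"
  unfolding gg_span_def by (rule mps.span_sum)

lemma gg_span_mult:
  assumes "u \<in> gg_span TYPE('a :: {field, finite})" "v \<in> gg_span TYPE('a)"
  shows "u * v \<in> gg_span TYPE('a)"
  using assms(1) unfolding gg_span_def
proof (induction rule: mps.span_induct_alt)
  case base show ?case by (simp add: mps.span_zero)
next
  case (step c x y)
  then obtain l where l: "x = prod_list (map (gg TYPE('a)) l)" "is_partition l" by blast
  have "x * v \<in> gg_span TYPE('a)" using assms(2) unfolding gg_span_def
  proof (induction rule: mps.span_induct_alt)
    case base show ?case by (simp add: mps.span_zero)
  next
    case (step c' x' y')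
    then obtain l' where l': "x' = prod_list (map (gg TYPE('a)) l')" "is_partition l'" by blast
    have "x * x' \<in> gg_span TYPE('a)"
      using prod_list_gg_in_span[of "l @ l'"] l l' by (simp add: is_partition_def)
    hence "scalar c' * (x * x') + x * y' \<in> gg_span TYPE('a)"
      using step(2) by (intro gg_span_add gg_span_scalar) (simp_all only: gg_span_def)
    thus ?case by (simp only: gg_span_def distrib_left mult.left_commute)
  qed
  hence "scalar c * (x * v) + y * v \<in> gg_span TYPE('a)"
    using step(2) by (intro gg_span_add gg_span_scalar) (simp_all only: gg_span_def)
  thus ?case by (simp only: gg_span_def distrib_right mult.assoc)
qed

lemma gg_span_1: "1 \<in> gg_span TYPE('a :: {field, finite})"
  using prod_list_gg_in_span[of "[]"] by simp

lemma gg_in_span: "gg TYPE('a :: {field, finite}) n \<in> gg_span TYPE('a)"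
  using prod_list_gg_in_span[of "[n]"] gg_span_1 by (cases "n = 0") auto

text \<open>In \<open>gg_newton\<close> the term j = k is p_k with a nonzero coefficient, and the
  other terms involve smaller power sums only.\<close>

lemma power_sum_in_gg_span: "k \<ge> 1 \<Longrightarrow> power_sum k \<in> gg_span TYPE('a :: {field, finite})"
proof (induction k rule: less_induct)
  case (less k)
  let ?c = "\<lambda>j. (-1) ^ (j - 1) * (of_nat (CARD('a) ^ j - 1) :: complex)"
  have k: "{1..k} = insert k {1..k - 1}" using less.prems by auto
  have "scalar (of_nat k) * gg TYPE('a) k = scalar (?c k) * power_sum k +
      (\<Sum>j=1..k - 1. scalar (?c j) * power_sum j * gg TYPE('a) (k - j))"
    unfolding scalar_of_nat gg_newton k using less.prems by (subst sum.insert) auto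
  hence "scalar (?c k) * power_sum k = scalar (of_nat k) * gg TYPE('a) k +
      scalar (-1) * (\<Sum>j=1..k - 1. scalar (?c j) * (power_sum j * gg TYPE('a) (k - j)))"
    by (simp only: scalar_minus scalar_1 mult_minus_left mult_1_left mult.assoc) simp
  moreover have "(\<Sum>j=1..k - 1. scalar (?c j) * (power_sum j * gg TYPE('a) (k - j))) \<in> gg_span TYPE('a)"
  proof (rule gg_span_sum)
    fix j assume "j \<in> {1..k - 1}"
    hence "power_sum j \<in> gg_span TYPE('a)" using less.IH[of j] less.prems by auto
    thus "scalar (?c j) * (power_sum j * gg TYPE('a) (k - j)) \<in> gg_span TYPE('a)"
      by (intro gg_span_scalar gg_span_mult gg_in_span)
  qed
  ultimately have "scalar (?c k) * power_sum k \<in> gg_span TYPE('a)"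
    by (simp only:) (intro gg_span_add gg_span_scalar gg_in_span)
  hence "scalar (inverse (?c k)) * (scalar (?c k) * power_sum k) \<in> gg_span TYPE('a)" by (rule gg_span_scalar)
  moreover have "inverse (?c k) * ?c k = 1"
    using CARD_pow_gt_1[OF less.prems, where 'a = 'a] by (intro field_class.field_inverse) (simp del: of_nat_power of_nat_diff)
  ultimately show ?case by (simp only: mult.assoc[symmetric] scalar_mult[symmetric] scalar_1 mult_1_left)
qed

lemma sym_fun_subset_gg_span: "g \<in> sym_fun \<Longrightarrow> g \<in> gg_span TYPE('a :: {field, finite})"
proof (induction rule: sym_fun_induct)
  case (scalar c)
  show ?case using gg_span_scalar[OF gg_span_1, of c] by simp
qed (auto intro: power_sum_in_gg_span gg_span_add gg_span_mult)

text \<open>Values of the Gelfand-Graev character enter here only through the assumption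
  \<open>ch_lin_char\<close>, which is later supplied by \<open>ch_induced_lin_char\<close>.\<close>

context
  fixes \<psi> :: "'a :: {field, finite} \<Rightarrow> complex" and c :: "nat \<Rightarrow> nat \<Rightarrow> 'a"
  assumes ch_lin_char: "\<And>n. ch n (induced (GL n) (UT n) (lin_char \<psi> c n)) = in_alphabet {1} (gg TYPE('a) n)"
begin

lemma gg_sym_fun: "gg TYPE('a) n \<in> sym_fun"
  by (rule hl_parameter.gg_sym_sym_fun[OF hl_parameter_CARD])

lemma rho_n_eq: "rho_n \<psi> c n = omega (gg TYPE('a) n)"
  unfolding rho_n_def ch_lin_char by (rule rho_in_alphabet_1[OF gg_sym_fun])

definition rho_hat_spec :: "(nat mps \<Rightarrow> 'a xvar mps) \<Rightarrow> bool" where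
  "rho_hat_spec R \<longleftrightarrow> linear_on_mps sym_fun R \<and>
        (\<forall>n\<ge>1. R (rho_n \<psi> c n) = (\<Sum>\<nu> | \<nu> \<in> partition_funs Theta n \<and> height \<nu> = 1. S_fun \<nu>)) \<and>
        (\<forall>l. is_partition l \<longrightarrow>
           R (prod_list (map (rho_n \<psi> c) l)) = prod_list (map (\<lambda>k. R (rho_n \<psi> c k)) l))"

lemma prod_list_rho_n: "prod_list (map (rho_n \<psi> c) l) = omega (prod_list (map (gg TYPE('a)) l))"
  and prod_list_gg_sym_fun: "prod_list (map (gg TYPE('a)) l) \<in> sym_fun"
proof -
  have "prod_list (map (rho_n \<psi> c) l) = omega (prod_list (map (gg TYPE('a)) l)) \<and> prod_list (map (gg TYPE('a)) l) \<in> sym_fun"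
    by (induction l) (auto simp: alg_hom_onD(3,4)[OF alg_hom_omega] rho_n_eq gg_sym_fun)
  thus "prod_list (map (rho_n \<psi> c) l) = omega (prod_list (map (gg TYPE('a)) l))"
    "prod_list (map (gg TYPE('a)) l) \<in> sym_fun" by auto
qed

lemma in_alphabet_prod_list: "in_alphabet f (prod_list (map g l)) = prod_list (map (\<lambda>k. in_alphabet f (g k)) l)"
  by (induction l) (auto simp: in_alphabet_mult)

lemma rho_hat_spec_omega: "rho_hat_spec (\<lambda>g. in_alphabet {1} (omega g))"
proof -
  have "alg_hom_on sym_fun (\<lambda>g. in_alphabet {1} (omega g) :: 'a xvar mps)"
    by (rule alg_hom_on_comp[OF alg_hom_omega alg_hom_in_alphabet omega_sym_fun])
  thus ?thesis unfolding rho_hat_spec_def prod_list_rho_n rho_n_eq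
    by (simp add: sum_height_1[simplified] omega_omega gg_sym_fun prod_list_gg_sym_fun in_alphabet_prod_list alg_hom_on_def)
qed

lemma rho_hat_spec_rho_hat: "rho_hat_spec (rho_hat \<psi> c)"
  unfolding rho_hat_def rho_hat_spec_def[symmetric] by (rule someI[of rho_hat_spec, OF rho_hat_spec_omega])

text \<open>\<open>rho_hat\<close> is known to be linear and to be multiplicative on the products
  \<rho>_\<lambda>. This is enough, since g is a combination of products of the Gamma_n and omega
  carries these products to the \<rho>_\<lambda>.\<close>

lemma rho_hat_omega:
  assumes "g \<in> sym_fun" shows "rho_hat \<psi> c (omega g) = in_alphabet {1} g"
proof -
  let ?R = "rho_hat \<psi> c"
  have lin: "linear_on_mps sym_fun ?R"
    and R: "\<And>n. n \<ge> 1 \<Longrightarrow> ?R (rho_n \<psi> c n) = in_alphabet {1} (gg TYPE('a) n)"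
    and prod: "\<And>l. is_partition l \<Longrightarrow> ?R (prod_list (map (rho_n \<psi> c) l)) = prod_list (map (\<lambda>k. ?R (rho_n \<psi> c k)) l)"
    using rho_hat_spec_rho_hat by (auto simp: rho_hat_spec_def sum_height_1[simplified])
  have "g \<in> mps.span {prod_list (map (gg TYPE('a)) l) | l. is_partition l}"
    using sym_fun_subset_gg_span[OF assms, where 'a = 'a] by (simp add: gg_span_def)
  hence "g \<in> sym_fun \<and> ?R (omega g) = in_alphabet {1} g"
  proof (induction rule: mps.span_induct_alt)
    case base
    have "omega 0 = 0" using alg_hom_onD(2)[OF alg_hom_omega, of 0 0] by simp
    moreover have "?R 0 = 0" using linear_on_mpsD(2)[OF lin, of 0 0] by simp
    ultimately show ?case by simp
  next
    case (step a x y)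
    then obtain l where l: "x = prod_list (map (gg TYPE('a)) l)" "is_partition l" by blast
    have "?R (omega x) = prod_list (map (\<lambda>k. ?R (rho_n \<psi> c k)) l)"
      using prod[OF l(2)] by (simp only: l(1) prod_list_rho_n)
    also have "map (\<lambda>k. ?R (rho_n \<psi> c k)) l = map (\<lambda>k. in_alphabet {1} (gg TYPE('a) k)) l"
    proof (rule map_cong[OF refl])
      fix k assume "k \<in> set l"
      hence "k \<ge> 1" using l(2) by (metis is_partition_def less_one not_le)
      thus "?R (rho_n \<psi> c k) = in_alphabet {1} (gg TYPE('a) k)" by (rule R)
    qed
    finally have Rx: "?R (omega x) = in_alphabet {1} x" by (simp only: l(1) in_alphabet_prod_list)
    have x: "x \<in> sym_fun" using prod_list_gg_sym_fun l(1) by simp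
    have ax: "scalar a * x \<in> sym_fun" using x by blast
    have "?R (omega (scalar a * x + y)) = ?R (scalar a * omega x + omega y)"
      using alg_hom_onD(1)[OF alg_hom_omega ax, of y] alg_hom_onD(2)[OF alg_hom_omega x] step(2) by simp
    also have "\<dots> = scalar a * ?R (omega x) + ?R (omega y)"
      using linear_on_mpsD[OF lin] omega_sym_fun x step(2) by (simp add: mult_sym_fun)
    also have "\<dots> = in_alphabet {1} (scalar a * x + y)"
      using step(2) Rx by (simp add: in_alphabet_add in_alphabet_scalar)
    finally show ?case using ax step(2) by blast
  qed
  thus ?thesis ..
qed

lemma rho_hat_rho:
  assumes "g \<in> sym_fun" shows "rho_hat \<psi> c (rho (in_alphabet {1} g)) = in_alphabet {1} g"
  unfolding rho_in_alphabet_1[OF assms] by (rule rho_hat_omega[OF assms])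

end

section \<open>Values of the Gelfand-Graev character\<close>

subsection \<open>Matrices with a block at the lower right\<close>

lemma GL_iff: "x \<in> carrier (GL n :: 'k :: field mat monoid) \<longleftrightarrow>
    x \<in> carrier_mat n n \<and> (\<exists>y\<in>carrier_mat n n. x * y = 1\<^sub>m n \<and> y * x = 1\<^sub>m n)"
  by (auto simp: GL_def units_of_def Units_def ring_mat_simps)

lemma GL_simps [simp]: "monoid.mult (GL n :: 'k :: field mat monoid) = (*)" "monoid.one (GL n :: 'k :: field mat monoid) = 1\<^sub>m n"
  by (simp_all add: GL_def units_of_def ring_mat_simps)

lemma GL_group: "group (GL n :: 'k :: field mat monoid)"
  unfolding GL_def by (rule monoid.units_group) (rule ring.is_monoid[OF ring_mat])

lemma GL_inv:
  assumes "x \<in> carrier_mat n n" "y \<in> carrier_mat n n" "x * y = 1\<^sub>m n" "y * x = 1\<^sub>m n"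
  shows "m_inv (GL n :: 'k :: field mat monoid) x = y"
  by (rule group.inv_equality[OF GL_group]) (use assms in \<open>auto simp: GL_iff\<close>)

lemma GL_finite: "finite (carrier (GL n :: 'k :: {field, finite} mat monoid))"
proof (rule finite_subset)
  show "carrier (GL n :: 'k mat monoid) \<subseteq> (\<lambda>f. mat n n f) ` (PiE ({..<n} \<times> {..<n}) (\<lambda>_. UNIV))"
  proof
    fix x :: "'k mat" assume "x \<in> carrier (GL n)"
    hence x: "x \<in> carrier_mat n n" by (simp add: GL_iff)
    have "x = mat n n (restrict (\<lambda>ij. x $$ ij) ({..<n} \<times> {..<n}))" by (rule eq_matI) (use x in auto)
    from image_eqI[of x "mat n n", OF this] show "x \<in> (\<lambda>f. mat n n f) ` (PiE ({..<n} \<times> {..<n}) (\<lambda>_. UNIV))" by auto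
  qed
qed (auto intro!: finite_PiE)

lemma bij_betw_vec: "bij_betw (vec n) ({..<n} \<rightarrow>\<^sub>E UNIV) (carrier_vec n :: 'k vec set)"
proof (rule bij_betwI[where g = "\<lambda>v :: 'k vec. restrict (\<lambda>i. v $ i) {..<n}"])
  show "restrict (\<lambda>i. vec n f $ i) {..<n} = f" if "f \<in> {..<n} \<rightarrow>\<^sub>E UNIV" for f :: "nat \<Rightarrow> 'k"
    using that by (auto simp: PiE_iff extensional_def restrict_def)
qed (auto intro: eq_vecI)

lemma finite_carrier_vec: "finite (carrier_vec n :: 'k :: {field, finite} vec set)"
  and card_carrier_vec: "card (carrier_vec n :: 'k :: {field, finite} vec set) = CARD('k) ^ n"
  using bij_betw_finite[OF bij_betw_vec[where n = n and 'k = 'k]] bij_betw_same_card[OF bij_betw_vec[where n = n and 'k = 'k]]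
  by (auto simp: card_PiE finite_PiE)

definition blk :: "'k :: field \<Rightarrow> (nat \<Rightarrow> 'k) \<Rightarrow> 'k mat \<Rightarrow> 'k mat" where
  "blk a s z = mat (Suc (dim_row z)) (Suc (dim_row z)) (\<lambda>(i, j).
     case i of 0 \<Rightarrow> (case j of 0 \<Rightarrow> a | Suc j' \<Rightarrow> s j') | Suc i' \<Rightarrow> (case j of 0 \<Rightarrow> 0 | Suc j' \<Rightarrow> z $$ (i', j')))"

lemma blk_carrier: "z \<in> carrier_mat n n \<Longrightarrow> blk a s z \<in> carrier_mat (Suc n) (Suc n)"
  by (auto simp: blk_def)

lemma blk_index:
  assumes "z \<in> carrier_mat n n"
  shows "blk a s z $$ (0, 0) = a" "j < n \<Longrightarrow> blk a s z $$ (0, Suc j) = s j"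
    "i < n \<Longrightarrow> blk a s z $$ (Suc i, 0) = 0" "i < n \<Longrightarrow> j < n \<Longrightarrow> blk a s z $$ (Suc i, Suc j) = z $$ (i, j)"
  using assms by (auto simp: blk_def)

lemma mat_mult_index:
  assumes "A \<in> carrier_mat n n" "B \<in> carrier_mat n n" "i < n" "j < n"
  shows "(A * B) $$ (i, j) = (\<Sum>k<n. A $$ (i, k) * B $$ (k, j))"
  using assms by (simp add: scalar_prod_def atLeast0LessThan)

lemma mat_vec_index:
  assumes "A \<in> carrier_mat n n" "v \<in> carrier_vec n" "i < n"
  shows "(A *\<^sub>v v) $ i = (\<Sum>k<n. A $$ (i, k) * v $ k)"
  using assms by (simp add: scalar_prod_def atLeast0LessThan)

lemma blk_eqI:
  assumes "x \<in> carrier_mat (Suc n) (Suc n)" "z \<in> carrier_mat n n" "x $$ (0, 0) = a" "\<And>j. j < n \<Longrightarrow> x $$ (0, Suc j) = s j"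
    "\<And>i. i < n \<Longrightarrow> x $$ (Suc i, 0) = 0" "\<And>i j. i < n \<Longrightarrow> j < n \<Longrightarrow> x $$ (Suc i, Suc j) = z $$ (i, j)"
  shows "x = blk a s z"
proof (rule eq_matI)
  fix i j assume "i < dim_row (blk a s z)" "j < dim_col (blk a s z)"
  thus "x $$ (i, j) = blk a s z $$ (i, j)"
    using assms by (cases i; cases j) (auto simp: blk_def)
qed (use carrier_matD[OF assms(1)] carrier_matD[OF blk_carrier[OF assms(2)]] in auto)

lemma blk_mult:
  assumes "z \<in> carrier_mat n n" "z' \<in> carrier_mat n n"
  shows "blk a s z * blk a' s' z' = blk (a * a') (\<lambda>j. a * s' j + (\<Sum>k<n. s k * z' $$ (k, j))) (z * z')"
proof (rule blk_eqI[where n = n])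
  note c = blk_carrier[OF assms(1), of a s] blk_carrier[OF assms(2), of a' s']
  show "blk a s z * blk a' s' z' \<in> carrier_mat (Suc n) (Suc n)" using c by simp
  show "z * z' \<in> carrier_mat n n" using assms by simp
  note m = mat_mult_index[OF c] sum.lessThan_Suc_shift blk_index[OF assms(1)] blk_index[OF assms(2)]
  show "(blk a s z * blk a' s' z') $$ (0, 0) = a * a'" by (simp add: m del: sum.lessThan_Suc)
  fix i j assume ij: "j < n"
  show "(blk a s z * blk a' s' z') $$ (0, Suc j) = a * s' j + (\<Sum>k<n. s k * z' $$ (k, j))" using ij by (simp add: m del: sum.lessThan_Suc)
  assume i: "i < n"
  show "(blk a s z * blk a' s' z') $$ (Suc i, Suc j) = (z * z') $$ (i, j)" using ij i by (simp add: m mat_mult_index[OF assms] del: sum.lessThan_Suc)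
next
  note c = blk_carrier[OF assms(1), of a s] blk_carrier[OF assms(2), of a' s']
  note m = mat_mult_index[OF c] sum.lessThan_Suc_shift blk_index[OF assms(1)] blk_index[OF assms(2)]
  fix i assume "i < n" thus "(blk a s z * blk a' s' z') $$ (Suc i, 0) = 0" by (simp add: m del: sum.lessThan_Suc)
qed

lemma blk_cong: "(\<And>j. j < dim_row z \<Longrightarrow> s j = s' j) \<Longrightarrow> blk a s z = blk a s' z"
  unfolding blk_def by (intro cong_mat) (auto split: nat.splits)

lemma blk_one: "blk 1 (\<lambda>_. 0) (1\<^sub>m n) = 1\<^sub>m (Suc n)"
  by (rule blk_eqI[symmetric, where n = n]) auto

lemma blk_inject:
  assumes "blk a s z = blk a' s' z'" "z \<in> carrier_mat n n" "z' \<in> carrier_mat n n"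
  shows "a = a'" "\<And>j. j < n \<Longrightarrow> s j = s' j" "z = z'"
proof -
  show "a = a'" "\<And>j. j < n \<Longrightarrow> s j = s' j" using blk_index[OF assms(2)] blk_index[OF assms(3)] assms(1) by metis+
  show "z = z'" by (rule eq_matI) (use blk_index(4)[OF assms(2)] blk_index(4)[OF assms(3)] assms in \<open>auto, metis\<close>)
qed

lemma blk_exists:
  assumes "x \<in> carrier_mat (Suc n) (Suc n)" "\<And>i. i < n \<Longrightarrow> x $$ (Suc i, 0) = 0"
  shows "x = blk (x $$ (0, 0)) (\<lambda>j. x $$ (0, Suc j)) (mat n n (\<lambda>(i, j). x $$ (Suc i, Suc j)))"
  by (rule blk_eqI[where n = n]) (use assms in auto)

lemma blk_GL:
  assumes "z \<in> carrier (GL n)"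
  shows "blk 1 s z \<in> carrier (GL (Suc n))"
    "m_inv (GL (Suc n)) (blk 1 s z) = blk 1 (\<lambda>j. - (\<Sum>k<n. s k * m_inv (GL n) z $$ (k, j))) (m_inv (GL n) z)"
proof -
  obtain z' where z: "z \<in> carrier_mat n n" "z' \<in> carrier_mat n n" "z * z' = 1\<^sub>m n" "z' * z = 1\<^sub>m n"
    using assms by (auto simp: GL_iff)
  have inv: "m_inv (GL n) z = z'" by (rule GL_inv[OF z])
  let ?s = "\<lambda>j. - (\<Sum>k<n. s k * z' $$ (k, j))"
  have 1: "blk 1 s z * blk 1 ?s z' = 1\<^sub>m (Suc n)"
    unfolding blk_mult[OF z(1,2)] z(3) blk_one[symmetric] by (simp)
  have "(\<Sum>k<n. (\<Sum>l<n. s l * z' $$ (l, k)) * z $$ (k, j)) = s j" if "j < n" for j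
  proof -
    have "(\<Sum>k<n. (\<Sum>l<n. s l * z' $$ (l, k)) * z $$ (k, j)) = (\<Sum>l<n. s l * (\<Sum>k<n. z' $$ (l, k) * z $$ (k, j)))"
      unfolding sum_distrib_left sum_distrib_right mult.assoc by (rule sum.swap)
    also have "\<dots> = (\<Sum>l<n. s l * (if l = j then 1 else 0))"
      by (rule sum.cong[OF refl]) (use that in \<open>simp add: mat_mult_index[OF z(2,1), symmetric] z(4)\<close>)
    also have "\<dots> = s j" using that by (simp add: if_distrib cong: if_cong)
    finally show ?thesis .
  qed
  hence 2: "blk 1 ?s z' * blk 1 s z = 1\<^sub>m (Suc n)"
    unfolding blk_mult[OF z(2,1)] z(4) blk_one[symmetric] mult_1_left by (intro blk_cong) (simp add: sum_negf)
  show "blk 1 s z \<in> carrier (GL (Suc n))"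
    unfolding GL_iff using 1 2 blk_carrier[OF z(1)] blk_carrier[OF z(2)] by blast
  show "m_inv (GL (Suc n)) (blk 1 s z) = blk 1 (\<lambda>j. - (\<Sum>k<n. s k * m_inv (GL n) z $$ (k, j))) (m_inv (GL n) z)"
    unfolding inv by (rule GL_inv[OF blk_carrier[OF z(1)] blk_carrier[OF z(2)] 1 2])
qed

lemma blk_GL_D:
  assumes "blk 1 s z \<in> carrier (GL (Suc n))" "z \<in> carrier_mat n n"
  shows "z \<in> carrier (GL n)"
proof -
  obtain y where y: "y \<in> carrier_mat (Suc n) (Suc n)" "blk 1 s z * y = 1\<^sub>m (Suc n)" "y * blk 1 s z = 1\<^sub>m (Suc n)"
    using assms(1) by (auto simp: GL_iff)
  note c = blk_carrier[OF assms(2), of 1 s]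
  have "y $$ (i, 0) = (y * blk 1 s z) $$ (i, 0)" if "i < Suc n" for i
    using that by (simp add: mat_mult_index[OF y(1) c] sum.lessThan_Suc_shift blk_index[OF assms(2)] del: index_mult_mat sum.lessThan_Suc)
  hence "y $$ (Suc i, 0) = 0" if "i < n" for i using that y(3) by simp
  then obtain a t w where w: "y = blk a t w" "w \<in> carrier_mat n n" using blk_exists[OF y(1)] by auto
  have "z * w = 1\<^sub>m n" "w * z = 1\<^sub>m n"
    using blk_inject(3)[where n = n, OF y(2)[unfolded w(1) blk_mult[OF assms(2) w(2)] blk_one[symmetric]]]
      blk_inject(3)[where n = n, OF y(3)[unfolded w(1) blk_mult[OF w(2) assms(2)] blk_one[symmetric]]] assms(2) w(2) by auto
  thus ?thesis using assms(2) w(2) by (auto simp: GL_iff)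
qed

lemma GL_first_col:
  assumes "v \<in> carrier_vec (Suc n)" "v \<noteq> 0\<^sub>v (Suc n)"
  shows "\<exists>y \<in> carrier (GL (Suc n)). col y 0 = (v :: 'k :: field vec)"
proof -
  obtain k where k: "k < Suc n" "v $ k \<noteq> 0" using assms by (metis carrier_vecD eq_vecI index_zero_vec(1,2))
  \<comment> \<open>As v has a nonzero entry at k, it forms a basis together with the unit vectors
    other than the k-th; the unit vector of index 0 takes the column that has become free.\<close>
  define y where "y = mat (Suc n) (Suc n) (\<lambda>(i, j). if j = 0 then v $ i else if j = k then (if i = 0 then 1 else 0) else (if i = j then 1 else 0))"
  have y: "y \<in> carrier_mat (Suc n) (Suc n)" by (simp add: y_def)
  have "det y \<noteq> 0"
  proof
    assume "det y = 0"
    then obtain w where w: "w \<in> carrier_vec (Suc n)" "w \<noteq> 0\<^sub>v (Suc n)" "y *\<^sub>v w = 0\<^sub>v (Suc n)"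
      using det_0_iff_vec_prod_zero_field[OF y] by auto
    have row: "(\<Sum>j<Suc n. y $$ (i, j) * w $ j) = 0" if "i < Suc n" for i
      using mat_vec_index[OF y w(1) that] that w(3) by simp
    have w0: "w $ 0 = 0"
    proof (cases "k = 0")
      case True
      have "(\<Sum>j<Suc n. y $$ (0, j) * w $ j) = (\<Sum>j\<in>{0}. y $$ (0, j) * w $ j)"
        by (rule sum.mono_neutral_right) (auto simp: y_def True)
      thus ?thesis using row[of 0] k True by (simp add: y_def)
    next
      case False
      have "(\<Sum>j<Suc n. y $$ (k, j) * w $ j) = (\<Sum>j\<in>{0}. y $$ (k, j) * w $ j)"
        by (rule sum.mono_neutral_right) (use k False in \<open>auto simp: y_def\<close>)
      thus ?thesis using row[of k] k by (simp add: y_def)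
    qed
    have wi: "w $ i = 0" if "i < Suc n" "i \<noteq> 0" "i \<noteq> k" for i
    proof -
      have "(\<Sum>j<Suc n. y $$ (i, j) * w $ j) = (\<Sum>j\<in>{i}. y $$ (i, j) * w $ j)"
        by (rule sum.mono_neutral_right) (use that w0 in \<open>auto simp: y_def\<close>)
      thus ?thesis using row[of i] that by (simp add: y_def)
    qed
    have "w $ k = 0"
    proof (cases "k = 0")
      case False
      have "(\<Sum>j<Suc n. y $$ (0, j) * w $ j) = (\<Sum>j\<in>{k}. y $$ (0, j) * w $ j)"
        by (rule sum.mono_neutral_right) (use k False w0 in \<open>auto simp: y_def\<close>)
      thus ?thesis using row[of 0] k False by (simp add: y_def)
    qed (use w0 in simp)
    hence "w $ i = 0" if "i < Suc n" for i using that w0 wi[of i] by (cases "i = 0"; cases "i = k") auto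
    hence "w = 0\<^sub>v (Suc n)" using w(1) by (intro eq_vecI) auto
    thus False using w(2) by simp
  qed
  hence "y \<in> carrier (GL (Suc n))"
    using det_non_zero_imp_unit[OF y] by (simp add: GL_def units_of_def)
  moreover have "col y 0 = v" by (rule eq_vecI) (use assms in \<open>auto simp: y_def\<close>)
  ultimately show ?thesis by blast
qed

definition strict_upper :: "nat \<Rightarrow> 'k :: zero mat \<Rightarrow> bool" where
  "strict_upper n B \<longleftrightarrow> (\<forall>i<n. \<forall>j\<le>i. B $$ (i, j) = 0)"

lemma strict_upper_blk:
  assumes "z \<in> carrier_mat n n"
  shows "strict_upper (Suc n) (blk 0 s z) \<longleftrightarrow> strict_upper n z"
proof
  assume *: "strict_upper (Suc n) (blk 0 s z)"
  show "strict_upper n z" unfolding strict_upper_def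
  proof (intro allI impI)
    fix i j assume ij: "i < n" "j \<le> i"
    hence "blk 0 s z $$ (Suc i, Suc j) = 0" using * by (simp add: strict_upper_def)
    thus "z $$ (i, j) = 0" using blk_index(4)[OF assms] ij by simp
  qed
next
  assume *: "strict_upper n z"
  show "strict_upper (Suc n) (blk 0 s z)" unfolding strict_upper_def
  proof (intro allI impI)
    fix i j assume "i < Suc n" "j \<le> i"
    thus "blk 0 s z $$ (i, j) = 0" using * blk_index[OF assms] by (cases i; cases j) (auto simp: strict_upper_def)
  qed
qed

lemma UT_iff: "1\<^sub>m n + A \<in> UT n \<longleftrightarrow> strict_upper n A" if "A \<in> carrier_mat n n" for A :: "'k :: field mat"
proof -
  have "(\<forall>i<n. \<forall>j<i. A $$ (i, j) = 0) \<and> (\<forall>i<n. A $$ (i, i) = 0) \<longleftrightarrow> strict_upper n A"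
    unfolding strict_upper_def by (auto simp: le_less)
  thus ?thesis using that by (auto simp: UT_def upper_triangular_def)
qed

lemma card_UT: "finite (UT n :: 'k :: {field, finite} mat set) \<and> card (UT n :: 'k mat set) > 0 \<and>
    card (UT (Suc n) :: 'k mat set) = CARD('k) ^ n * card (UT n :: 'k mat set)"
proof -
  have bij: "bij_betw (\<lambda>(s, z). blk 1 s z) (({..<n} \<rightarrow>\<^sub>E UNIV) \<times> UT n) (UT (Suc n) :: 'k mat set)" for n
  proof (rule bij_betwI[where g = "\<lambda>x. (restrict (\<lambda>j. x $$ (0, Suc j)) {..<n}, mat n n (\<lambda>(i, j). x $$ (Suc i, Suc j)))"])
    show "(\<lambda>(s, z). blk 1 s z) \<in> ({..<n} \<rightarrow>\<^sub>E UNIV) \<times> UT n \<rightarrow> (UT (Suc n) :: 'k mat set)"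
    proof (rule funcsetI, clarify)
      fix s :: "nat \<Rightarrow> 'k" and z :: "'k mat" assume z: "z \<in> UT n"
      hence c: "z \<in> carrier_mat n n" by (simp add: UT_def)
      have "blk 1 s z $$ (i, j) = 0" if "i < Suc n" "j < i" for i j
        using that z blk_index[OF c] by (cases i; cases j) (auto simp: UT_def upper_triangular_def)
      moreover have "blk 1 s z $$ (i, i) = 1" if "i < Suc n" for i
        using that z blk_index[OF c] by (cases i) (auto simp: UT_def)
      ultimately show "blk 1 s z \<in> UT (Suc n)" using blk_carrier[OF c, of 1 s] by (auto simp: UT_def upper_triangular_def)
    qed
    show "(\<lambda>x. (restrict (\<lambda>j. x $$ (0, Suc j)) {..<n}, mat n n (\<lambda>(i, j). x $$ (Suc i, Suc j)))) \<in>
       (UT (Suc n) :: 'k mat set) \<rightarrow> ({..<n} \<rightarrow>\<^sub>E UNIV) \<times> UT n"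
      by (auto simp: UT_def upper_triangular_def split: if_splits)
    fix x :: "(nat \<Rightarrow> 'k) \<times> 'k mat" assume x: "x \<in> ({..<n} \<rightarrow>\<^sub>E UNIV) \<times> UT n"
    obtain s z where sz: "x = (s, z)" "s \<in> {..<n} \<rightarrow>\<^sub>E UNIV" "z \<in> carrier_mat n n" using x by (auto simp: UT_def)
    have "restrict (\<lambda>j. blk 1 s z $$ (0, Suc j)) {..<n} = s"
      using sz(2) blk_index(2)[OF sz(3)] by (auto simp: PiE_iff extensional_def restrict_def)
    moreover have "mat n n (\<lambda>(i, j). blk 1 s z $$ (Suc i, Suc j)) = z"
      by (rule eq_matI) (use sz(3) blk_index(4)[OF sz(3)] in auto)
    ultimately show "(restrict (\<lambda>j. (case x of (s, z) \<Rightarrow> blk 1 s z) $$ (0, Suc j)) {..<n},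
        mat n n (\<lambda>(i, j). (case x of (s, z) \<Rightarrow> blk 1 s z) $$ (Suc i, Suc j))) = x" by (simp add: sz(1))
  next
    fix x :: "'k mat" assume x: "x \<in> UT (Suc n)"
    hence "x = blk (x $$ (0, 0)) (\<lambda>j. x $$ (0, Suc j)) (mat n n (\<lambda>(i, j). x $$ (Suc i, Suc j)))"
      by (intro blk_exists) (auto simp: UT_def upper_triangular_def)
    also have "\<dots> = blk 1 (restrict (\<lambda>j. x $$ (0, Suc j)) {..<n}) (mat n n (\<lambda>(i, j). x $$ (Suc i, Suc j)))"
      using x by (simp add: UT_def) (rule blk_cong, simp)
    finally show "(case (restrict (\<lambda>j. x $$ (0, Suc j)) {..<n}, mat n n (\<lambda>(i, j). x $$ (Suc i, Suc j))) of (s, z) \<Rightarrow> blk 1 s z) = x" by simp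
  qed
  have fin: "finite (UT n :: 'k mat set)" for n
  proof (induction n)
    case 0
    have "UT 0 \<subseteq> {1\<^sub>m 0 :: 'k mat}" by (auto simp: UT_def intro: eq_matI)
    thus ?case by (rule finite_subset) simp
  next
    case (Suc n) thus ?case using bij_betw_finite[OF bij[of n]] by (simp add: finite_PiE)
  qed
  have "1\<^sub>m n \<in> (UT n :: 'k mat set)" by (auto simp: UT_def upper_triangular_def)
  hence "card (UT n :: 'k mat set) > 0" using fin[of n] card_gt_0_iff by blast
  thus ?thesis using fin[of n] bij_betw_same_card[OF bij[of n]] by (simp add: card_cartesian_product card_PiE)
qed

subsection \<open>Kernels and linear functionals\<close>

definition subsp :: "nat \<Rightarrow> 'k :: field vec set \<Rightarrow> bool" where
  "subsp n V \<longleftrightarrow> V \<subseteq> carrier_vec n \<and> 0\<^sub>v n \<in> V \<and> (\<forall>v\<in>V. \<forall>w\<in>V. v + w \<in> V) \<and> (\<forall>a. \<forall>v\<in>V. a \<cdot>\<^sub>v v \<in> V)"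

definition functional :: "nat \<Rightarrow> (nat \<Rightarrow> 'k :: field) \<Rightarrow> 'k vec \<Rightarrow> 'k" where
  "functional n r v = (\<Sum>k<n. r k * v $ k)"

definition mat_ker :: "nat \<Rightarrow> 'k :: field mat \<Rightarrow> 'k vec set" where
  "mat_ker n A = {v \<in> carrier_vec n. A *\<^sub>v v = 0\<^sub>v n}"

lemma functional_add: "v \<in> carrier_vec n \<Longrightarrow> w \<in> carrier_vec n \<Longrightarrow> functional n r (v + w) = functional n r v + functional n r w"
  by (simp add: functional_def distrib_left sum.distrib)

lemma functional_smult: "v \<in> carrier_vec n \<Longrightarrow> functional n r (a \<cdot>\<^sub>v v) = a * functional n r v"
  by (simp add: functional_def sum_distrib_left mult.left_commute)

lemma functional_0 [simp]: "functional n r (0\<^sub>v n) = 0"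
  by (simp add: functional_def)

lemma subsp_mat_ker: "A \<in> carrier_mat n n \<Longrightarrow> subsp n (mat_ker n A)"
  unfolding subsp_def mat_ker_def
  by (auto simp: mult_add_distrib_mat_vec[of A n n] mult_mat_vec[of A n n])

lemma subsp_D:
  assumes "subsp n V"
  shows "v \<in> V \<Longrightarrow> v \<in> carrier_vec n" "0\<^sub>v n \<in> V" "v \<in> V \<Longrightarrow> w \<in> V \<Longrightarrow> v + w \<in> V" "v \<in> V \<Longrightarrow> a \<cdot>\<^sub>v v \<in> V"
  using assms by (auto simp: subsp_def)

lemma subsp_finite: "subsp n (V :: 'k :: {field, finite} vec set) \<Longrightarrow> finite V"
  using finite_subset[OF _ finite_carrier_vec] by (auto simp: subsp_def)

lemma subsp_translate:
  assumes "subsp n V" "u \<in> V"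
  shows "bij_betw (\<lambda>v. v + u) V (V :: 'k :: field vec set)"
proof (rule bij_betwI[where g = "\<lambda>v. v + (-1) \<cdot>\<^sub>v u"])
  note V = subsp_D[OF assms(1)]
  fix v assume v: "v \<in> V"
  have "v \<in> carrier_vec n" "u \<in> carrier_vec n" using V v assms(2) by auto
  thus "v + u + (-1) \<cdot>\<^sub>v u = v" "v + (-1) \<cdot>\<^sub>v u + u = v" by (auto intro!: eq_vecI)
qed (use subsp_D[OF assms(1)] assms(2) in auto)

lemma card_functional_kernel:
  fixes V :: "'k :: {field, finite} vec set"
  assumes V: "subsp n V" and v0: "v0 \<in> V" "functional n r v0 \<noteq> 0"
  shows "card V = CARD('k) * card {v \<in> V. functional n r v = 0}"
proof -
  note D = subsp_D[OF V]
  have bij: "bij_betw (\<lambda>(a, v). v + a \<cdot>\<^sub>v v0) (UNIV \<times> {v \<in> V. functional n r v = 0}) V"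
  proof (rule bij_betwI[where g = "\<lambda>v. (functional n r v / functional n r v0, v + (- (functional n r v / functional n r v0)) \<cdot>\<^sub>v v0)"])
    show "(\<lambda>(a, v). v + a \<cdot>\<^sub>v v0) \<in> UNIV \<times> {v \<in> V. functional n r v = 0} \<rightarrow> V" using D v0 by auto
    show "(\<lambda>v. (functional n r v / functional n r v0, v + (- (functional n r v / functional n r v0)) \<cdot>\<^sub>v v0)) \<in> V \<rightarrow> UNIV \<times> {v \<in> V. functional n r v = 0}"
      using D v0 by (auto simp: functional_add[of _ n] functional_smult[of _ n])
    show "(case (functional n r v / functional n r v0, v + (- (functional n r v / functional n r v0)) \<cdot>\<^sub>v v0) of (a, v) \<Rightarrow> v + a \<cdot>\<^sub>v v0) = v"
      if "v \<in> V" for v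
      using D(1)[OF that] D(1)[OF v0(1)] by (auto intro!: eq_vecI)
    show "(functional n r (case x of (a, v) \<Rightarrow> v + a \<cdot>\<^sub>v v0) / functional n r v0,
        (case x of (a, v) \<Rightarrow> v + a \<cdot>\<^sub>v v0) + (- (functional n r (case x of (a, v) \<Rightarrow> v + a \<cdot>\<^sub>v v0) / functional n r v0)) \<cdot>\<^sub>v v0) = x"
      if x: "x \<in> UNIV \<times> {v \<in> V. functional n r v = 0}" for x
    proof -
      obtain a v where av: "x = (a, v)" "v \<in> V" "functional n r v = 0" using x by auto
      have "functional n r (v + a \<cdot>\<^sub>v v0) = a * functional n r v0"
        using D(1)[OF av(2)] D(1)[OF v0(1)] av(3) by (simp add: functional_add[of _ n] functional_smult[of _ n])
      thus ?thesis using D(1)[OF av(2)] D(1)[OF v0(1)] v0(2) by (auto simp: av(1) intro!: eq_vecI)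
    qed
  qed
  show ?thesis using bij_betw_same_card[OF bij] by (simp add: card_cartesian_product)
qed

definition nilpotent_mat :: "nat \<Rightarrow> 'k :: field mat \<Rightarrow> bool" where
  "nilpotent_mat n A \<longleftrightarrow> (\<exists>N. \<forall>v\<in>carrier_vec n. ((\<lambda>v. A *\<^sub>v v) ^^ N) v = 0\<^sub>v n)"

lemma funpow_mat_vec_carrier:
  "A \<in> carrier_mat n n \<Longrightarrow> v \<in> carrier_vec n \<Longrightarrow> ((\<lambda>v. A *\<^sub>v v) ^^ N) v \<in> carrier_vec n"
  by (induction N) auto

lemma blk_mult_vec:
  fixes A :: "'k :: field mat"
  assumes A: "A \<in> carrier_mat n n" and w: "w \<in> carrier_vec n"
  shows "blk 0 t A *\<^sub>v vCons a w = vCons (functional n t w) (A *\<^sub>v w)"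
proof (rule eq_vecI)
  note c = blk_carrier[OF A, of 0 t]
  have vc: "vCons a w \<in> carrier_vec (Suc n)" using w by simp
  fix i assume "i < dim_vec (vCons (functional n t w) (A *\<^sub>v w))"
  hence i: "i < Suc n" using A by simp
  have "(blk 0 t A *\<^sub>v vCons a w) $ i = (\<Sum>k<Suc n. blk 0 t A $$ (i, k) * vCons a w $ k)"
    by (rule mat_vec_index[OF c vc i])
  also have "\<dots> = blk 0 t A $$ (i, 0) * a + (\<Sum>k<n. blk 0 t A $$ (i, Suc k) * w $ k)"
    unfolding sum.lessThan_Suc_shift by simp
  also have "\<dots> = vCons (functional n t w) (A *\<^sub>v w) $ i"
  proof (cases i)
    case 0 thus ?thesis by (simp add: blk_index[OF A] functional_def)
  next
    case (Suc j)
    hence "j < n" using i by simp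
    thus ?thesis using Suc mat_vec_index[OF A w, of j] A by (simp add: blk_index[OF A] del: index_mult_mat_vec)
  qed
  finally show "(blk 0 t A *\<^sub>v vCons a w) $ i = vCons (functional n t w) (A *\<^sub>v w) $ i" .
qed (use A in \<open>simp add: blk_def\<close>)

lemma vCons_eq_0: "vCons a w = 0\<^sub>v (Suc n) \<longleftrightarrow> a = (0 :: 'k :: field) \<and> w = 0\<^sub>v n"
proof
  assume e: "vCons a w = 0\<^sub>v (Suc n)"
  have d: "dim_vec w = n" using arg_cong[OF e, of dim_vec] by simp
  have "vCons a w $ 0 = 0" "\<And>i. i < n \<Longrightarrow> vCons a w $ Suc i = 0" unfolding e by auto
  thus "a = 0 \<and> w = 0\<^sub>v n" using d by (auto intro: eq_vecI)
qed (auto intro!: eq_vecI simp: vec_index_vCons)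

lemma vCons_surj:
  assumes "v \<in> carrier_vec (Suc n)"
  obtains a w where "v = vCons (a :: 'k) w" "w \<in> carrier_vec n"
proof (rule that)
  show "v = vCons (v $ 0) (vec n (\<lambda>i. v $ Suc i))"
    by (rule eq_vecI) (use assms in \<open>auto simp: vec_index_vCons\<close>)
qed simp

text \<open>The first column of the block matrix is zero, so the first coordinate of a kernel vector
  is free; the first row imposes the condition that t vanishes on the rest.\<close>

lemma card_mat_ker_blk:
  fixes A :: "'k :: {field, finite} mat"
  assumes A: "A \<in> carrier_mat n n"
  shows "card (mat_ker (Suc n) (blk 0 t A)) = CARD('k) * card {w \<in> mat_ker n A. functional n t w = 0}"
proof -
  have "bij_betw (\<lambda>(a, w). vCons a w) (UNIV \<times> {w \<in> mat_ker n A. functional n t w = 0}) (mat_ker (Suc n) (blk 0 t A))"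
    unfolding bij_betw_def
  proof (intro conjI equalityI subsetI)
    show "inj_on (\<lambda>(a, w). vCons a w) (UNIV \<times> {w \<in> mat_ker n A. functional n t w = 0})"
      by (auto intro!: inj_onI)
    fix v assume "v \<in> (\<lambda>(a, w). vCons a w) ` (UNIV \<times> {w \<in> mat_ker n A. functional n t w = 0})"
    thus "v \<in> mat_ker (Suc n) (blk 0 t A)"
      by (auto simp: mat_ker_def blk_mult_vec[OF A] vCons_eq_0)
  next
    fix v assume "v \<in> mat_ker (Suc n) (blk 0 t A)"
    hence v: "v \<in> carrier_vec (Suc n)" "blk 0 t A *\<^sub>v v = 0\<^sub>v (Suc n)" by (auto simp: mat_ker_def)
    obtain a w where w: "v = vCons a w" "w \<in> carrier_vec n" using vCons_surj[OF v(1)] .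
    have "functional n t w = 0 \<and> A *\<^sub>v w = 0\<^sub>v n"
      using v(2) unfolding w(1) blk_mult_vec[OF A w(2)] vCons_eq_0 .
    thus "v \<in> (\<lambda>(a, w). vCons a w) ` (UNIV \<times> {w \<in> mat_ker n A. functional n t w = 0})"
      using w by (intro image_eqI[of _ _ "(a, w)"]) (auto simp: mat_ker_def)
  qed
  from bij_betw_same_card[OF this] show ?thesis by (simp add: card_cartesian_product)
qed

lemma conj_mult_vec:
  fixes A :: "'k :: field mat"
  assumes "A \<in> carrier_mat n n" "y \<in> carrier_mat n n" "y' \<in> carrier_mat n n" "y * y' = 1\<^sub>m n" "v \<in> carrier_vec n"
  shows "(y' * A * y) *\<^sub>v (y' *\<^sub>v v) = y' *\<^sub>v (A *\<^sub>v v)"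
proof -
  have "(y' * A * y) *\<^sub>v (y' *\<^sub>v v) = y' *\<^sub>v (A *\<^sub>v (y *\<^sub>v (y' *\<^sub>v v)))"
    using assms by (simp add: assoc_mult_mat_vec[of _ n n _ n])
  also have "y *\<^sub>v (y' *\<^sub>v v) = v" using assms assoc_mult_mat_vec[of y n n y' n v] by simp
  finally show ?thesis .
qed

lemma card_mat_ker_conj:
  fixes A :: "'k :: field mat"
  assumes "A \<in> carrier_mat n n" "y \<in> carrier_mat n n" "y' \<in> carrier_mat n n" "y * y' = 1\<^sub>m n" "y' * y = 1\<^sub>m n"
  shows "card (mat_ker n (y' * A * y)) = card (mat_ker n A)"
proof -
  have i: "y *\<^sub>v (y' *\<^sub>v v) = v" "y' *\<^sub>v (y *\<^sub>v v) = v" if "v \<in> carrier_vec n" for v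
    using assms that assoc_mult_mat_vec[of y n n y' n v] assoc_mult_mat_vec[of y' n n y n v] by simp_all
  have z: "y' *\<^sub>v 0\<^sub>v n = 0\<^sub>v n" "y *\<^sub>v 0\<^sub>v n = 0\<^sub>v n" using assms by (auto intro!: eq_vecI)
  have "bij_betw (\<lambda>v. y' *\<^sub>v v) (mat_ker n A) (mat_ker n (y' * A * y))"
  proof (rule bij_betwI[where g = "\<lambda>v. y *\<^sub>v v"])
    show "(\<lambda>v. y' *\<^sub>v v) \<in> mat_ker n A \<rightarrow> mat_ker n (y' * A * y)"
      using assms(3) conj_mult_vec[OF assms(1-4)] z by (auto simp: mat_ker_def)
    show "(\<lambda>v. y *\<^sub>v v) \<in> mat_ker n (y' * A * y) \<rightarrow> mat_ker n A"
    proof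
      fix v assume "v \<in> mat_ker n (y' * A * y)"
      hence v: "v \<in> carrier_vec n" "(y' * A * y) *\<^sub>v v = 0\<^sub>v n" by (auto simp: mat_ker_def)
      have yv: "y *\<^sub>v v \<in> carrier_vec n" using assms v by simp
      have "A *\<^sub>v (y *\<^sub>v v) = y *\<^sub>v (y' *\<^sub>v (A *\<^sub>v (y *\<^sub>v v)))" using i(1) assms(1) yv by simp
      also have "\<dots> = y *\<^sub>v ((y' * A * y) *\<^sub>v (y' *\<^sub>v (y *\<^sub>v v)))" by (simp only: conj_mult_vec[OF assms(1-4) yv])
      also have "\<dots> = 0\<^sub>v n" using v i(2) z by simp
      finally show "y *\<^sub>v v \<in> mat_ker n A" using yv by (simp add: mat_ker_def)
    qed
  qed (auto simp: mat_ker_def i)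
  from bij_betw_same_card[OF this] show ?thesis ..
qed

lemma nilpotent_blk:
  fixes A :: "'k :: field mat"
  assumes A: "A \<in> carrier_mat (Suc n) (Suc n)" and nil: "nilpotent_mat (Suc n) A"
    and y: "y \<in> carrier_mat (Suc n) (Suc n)" "y' \<in> carrier_mat (Suc n) (Suc n)" "y * y' = 1\<^sub>m (Suc n)" "y' * y = 1\<^sub>m (Suc n)"
    and A1: "A1 \<in> carrier_mat n n" "y' * A * y = blk 0 t A1"
  shows "nilpotent_mat n A1"
proof -
  obtain N where N: "\<forall>v\<in>carrier_vec (Suc n). ((\<lambda>v. A *\<^sub>v v) ^^ N) v = 0\<^sub>v (Suc n)" using nil by (auto simp: nilpotent_mat_def)
  have conj: "((\<lambda>v. (y' * A * y) *\<^sub>v v) ^^ k) (y' *\<^sub>v v) = y' *\<^sub>v ((\<lambda>v. A *\<^sub>v v) ^^ k) v" if "v \<in> carrier_vec (Suc n)" for k v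
    by (induction k) (auto simp del: assoc_mult_mat_vec simp: conj_mult_vec[OF A y(1-3)] funpow_mat_vec_carrier[OF A that])
  have bl: "\<exists>a'. ((\<lambda>v. blk 0 t A1 *\<^sub>v v) ^^ k) (vCons a w) = vCons a' (((\<lambda>v. A1 *\<^sub>v v) ^^ k) w)" if "w \<in> carrier_vec n" for k a w
    by (induction k) (auto simp: blk_mult_vec[OF A1(1)] funpow_mat_vec_carrier[OF A1(1) that])
  have "((\<lambda>v. A1 *\<^sub>v v) ^^ N) w = 0\<^sub>v n" if w: "w \<in> carrier_vec n" for w
  proof -
    let ?u = "y *\<^sub>v vCons 0 w"
    have vc: "vCons 0 w \<in> carrier_vec (Suc n)" using w by simp
    have u: "?u \<in> carrier_vec (Suc n)" using y(1) vc by simp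
    have yu: "y' *\<^sub>v ?u = vCons 0 w" using assoc_mult_mat_vec[OF y(2,1) vc] y(4) vc by simp
    obtain a' where "((\<lambda>v. blk 0 t A1 *\<^sub>v v) ^^ N) (vCons 0 w) = vCons a' (((\<lambda>v. A1 *\<^sub>v v) ^^ N) w)" using bl[OF w] by blast
    moreover have "((\<lambda>v. blk 0 t A1 *\<^sub>v v) ^^ N) (vCons 0 w) = 0\<^sub>v (Suc n)"
      using conj[OF u, of N] N u y(2) unfolding A1(2) yu by (auto intro!: eq_vecI)
    ultimately have "vCons a' (((\<lambda>v. A1 *\<^sub>v v) ^^ N) w) = 0\<^sub>v (Suc n)" by simp
    thus ?thesis using vCons_eq_0 by blast
  qed
  thus ?thesis by (auto simp: nilpotent_mat_def)
qed

lemma nilpotent_ker_nontrivial: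
  fixes A :: "'k :: field mat"
  assumes A: "A \<in> carrier_mat (Suc n) (Suc n)" and nil: "nilpotent_mat (Suc n) A"
  obtains v where "v \<in> mat_ker (Suc n) A" "v \<noteq> 0\<^sub>v (Suc n)"
proof -
  obtain N where N: "\<forall>v\<in>carrier_vec (Suc n). ((\<lambda>v. A *\<^sub>v v) ^^ N) v = 0\<^sub>v (Suc n)" using nil by (auto simp: nilpotent_mat_def)
  have "\<exists>v. v \<in> mat_ker (Suc n) A \<and> v \<noteq> 0\<^sub>v (Suc n)"
  proof (rule ccontr)
    assume no: "\<not> ?thesis"
    have z: "v = 0\<^sub>v (Suc n)" if "v \<in> carrier_vec (Suc n)" "((\<lambda>v. A *\<^sub>v v) ^^ k) v = 0\<^sub>v (Suc n)" for k v
      using that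
    proof (induction k)
      case (Suc k)
      have "((\<lambda>v. A *\<^sub>v v) ^^ k) v \<in> mat_ker (Suc n) A"
        using Suc.prems funpow_mat_vec_carrier[OF A Suc.prems(1)] by (simp add: mat_ker_def)
      thus ?case using no Suc by blast
    qed simp
    have "unit_vec (Suc n) 0 = (0\<^sub>v (Suc n) :: 'k vec)" by (rule z[of _ N]) (use N in auto)
    hence "unit_vec (Suc n) 0 $ 0 = (0\<^sub>v (Suc n) :: 'k vec) $ 0" by simp
    thus False by simp
  qed
  thus thesis using that by blast
qed

locale additive_char =
  fixes \<psi> :: "'k :: {field, finite} \<Rightarrow> complex"
  assumes \<psi>: "nontrivial_additive_char \<psi>"
begin

lemma \<psi>_add: "\<psi> (a + b) = \<psi> a * \<psi> b" and \<psi>_nz: "\<psi> a \<noteq> 0"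
  using \<psi> by (auto simp: nontrivial_additive_char_def)

lemma \<psi>_0 [simp]: "\<psi> 0 = 1"
  using \<psi>_add[of 0 0] \<psi>_nz[of 0] by simp

text \<open>If the functional is not zero on V, some u in V takes a value x with \<psi> x \<noteq>
  1, and translation by u multiplies the sum by \<psi> x.\<close>

lemma sum_\<psi>_functional:
  assumes V: "subsp n V"
  shows "(\<Sum>v\<in>V. \<psi> (functional n r v)) = (if \<forall>v\<in>V. functional n r v = 0 then of_nat (card V) else 0)"
proof (cases "\<forall>v\<in>V. functional n r v = 0")
  case False
  then obtain v where v: "v \<in> V" "functional n r v \<noteq> 0" by blast
  obtain x where x: "\<psi> x \<noteq> 1" using \<psi> by (auto simp: nontrivial_additive_char_def)
  define u where "u = (x / functional n r v) \<cdot>\<^sub>v v"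
  have u: "u \<in> V" using subsp_D(4)[OF V v(1)] by (simp add: u_def)
  have fu: "functional n r u = x" using v subsp_D(1)[OF V v(1)] by (simp add: u_def functional_smult[of _ n])
  have "(\<Sum>v\<in>V. \<psi> (functional n r v)) = (\<Sum>v\<in>V. \<psi> (functional n r (v + u)))"
    by (rule sum.reindex_bij_betw[OF subsp_translate[OF V u], symmetric])
  also have "\<dots> = \<psi> x * (\<Sum>v\<in>V. \<psi> (functional n r v))"
    unfolding sum_distrib_left
    by (rule sum.cong[OF refl]) (use subsp_D(1)[OF V] u in \<open>simp add: functional_add[of _ n] fu \<psi>_add\<close>)
  finally have "(\<Sum>v\<in>V. \<psi> (functional n r v)) = 0" using x by (simp add: mult_cancel_right1)
  thus ?thesis by (simp only: False if_False)
qed simp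

subsection \<open>Peeling off the first column\<close>

text \<open>
  For \<open>r = 0\<close> this is, up to the factor \<open>card (UT n)\<close>, the value of the induced character at
  \<open>1 + A\<close>. The functional \<open>r\<close> keeps track of the first row that is split off in the induction.
\<close>

definition gg_weight :: "nat \<Rightarrow> (nat \<Rightarrow> 'k) \<Rightarrow> 'k mat \<Rightarrow> complex" where
  "gg_weight n d B = (if strict_upper n B then \<Prod>i\<in>{1..<n}. \<psi> (d i * B $$ (i - 1, i)) else 0)"

definition gg_sum :: "nat \<Rightarrow> (nat \<Rightarrow> 'k) \<Rightarrow> 'k mat \<Rightarrow> (nat \<Rightarrow> 'k) \<Rightarrow> complex" where
  "gg_sum n d A r = (\<Sum>x\<in>carrier (GL n).
     (if n = 0 then 1 else \<psi> (functional n r (col x 0))) * gg_weight n d (m_inv (GL n) x * A * x))"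

lemma gg_weight_blk:
  assumes "C \<in> carrier_mat n n"
  shows "gg_weight (Suc n) d (blk 0 t C) = (if n = 0 then 1 else \<psi> (d 1 * t 0)) * gg_weight n (\<lambda>i. d (Suc i)) C"
proof -
  have "(\<Prod>i\<in>{1..<Suc n}. \<psi> (d i * blk 0 t C $$ (i - 1, i))) = (\<Prod>i<n. \<psi> (d (Suc i) * blk 0 t C $$ (i, Suc i)))"
    by (rule prod.reindex_bij_witness[of _ Suc "\<lambda>i. i - 1"]) auto
  also have "\<dots> = (if n = 0 then 1 else \<psi> (d 1 * t 0)) * (\<Prod>i\<in>{1..<n}. \<psi> (d (Suc i) * C $$ (i - 1, i)))"
  proof (cases n)
    case (Suc m)
    have "(\<Prod>i<n. \<psi> (d (Suc i) * blk 0 t C $$ (i, Suc i))) =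
        \<psi> (d 1 * t 0) * (\<Prod>i<m. \<psi> (d (Suc (Suc i)) * blk 0 t C $$ (Suc i, Suc (Suc i))))"
      unfolding Suc prod.lessThan_Suc_shift using blk_index(2)[OF assms, of 0] Suc by (simp del: prod.lessThan_Suc)
    also have "(\<Prod>i<m. \<psi> (d (Suc (Suc i)) * blk 0 t C $$ (Suc i, Suc (Suc i)))) = (\<Prod>i<m. \<psi> (d (Suc (Suc i)) * C $$ (i, Suc i)))"
      by (rule prod.cong[OF refl]) (use blk_index(4)[OF assms] Suc in simp)
    also have "\<dots> = (\<Prod>i\<in>{1..<n}. \<psi> (d (Suc i) * C $$ (i - 1, i)))"
      by (rule prod.reindex_bij_witness[of _ "\<lambda>i. i - 1" Suc]) (auto simp: Suc)
    finally show ?thesis by (simp add: Suc)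
  qed simp
  finally show ?thesis using strict_upper_blk[OF assms] by (simp add: gg_weight_def)
qed

text \<open>The matrices with first column v are exactly y * blk 1 s z for one fixed y. Conjugating
  A by them gives a block matrix with lower corner z^-1 A1 z, and its weight does not depend on s.
  Summing over s gives q^n, and the entry next to the diagonal in the first row becomes a functional
  of the first column of z.\<close>

lemma gg_sum_fibre:
  assumes A: "A \<in> carrier_mat (Suc n) (Suc n)" and v: "v \<in> mat_ker (Suc n) A" "v \<noteq> 0\<^sub>v (Suc n)"
  obtains y y' t A1 where "y \<in> carrier_mat (Suc n) (Suc n)" "y' \<in> carrier_mat (Suc n) (Suc n)" "y * y' = 1\<^sub>m (Suc n)" "y' * y = 1\<^sub>m (Suc n)"
    "A1 \<in> carrier_mat n n" "y' * A * y = blk 0 t A1"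
    "(\<Sum>x | x \<in> carrier (GL (Suc n)) \<and> col x 0 = v. gg_weight (Suc n) d (m_inv (GL (Suc n)) x * A * x)) =
      of_nat (CARD('k) ^ n) * gg_sum n (\<lambda>i. d (Suc i)) A1 (\<lambda>k. d 1 * t k)"
proof -
  have vc: "v \<in> carrier_vec (Suc n)" and Av: "A *\<^sub>v v = 0\<^sub>v (Suc n)" using v by (auto simp: mat_ker_def)
  obtain y where "y \<in> carrier (GL (Suc n))" and yv: "col y 0 = v" using GL_first_col[OF vc v(2)] by blast
  then obtain y' where y: "y \<in> carrier_mat (Suc n) (Suc n)" "y' \<in> carrier_mat (Suc n) (Suc n)"
      "y * y' = 1\<^sub>m (Suc n)" "y' * y = 1\<^sub>m (Suc n)" by (auto simp: GL_iff)
  have B: "y' * A * y \<in> carrier_mat (Suc n) (Suc n)" using y A by simp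
  have "col (y' * A * y) 0 = (y' * A) *\<^sub>v col y 0" using y A by (intro col_mult2) auto
  also have "\<dots> = y' *\<^sub>v (A *\<^sub>v v)" unfolding yv using y A vc by (intro assoc_mult_mat_vec) auto
  also have "\<dots> = 0\<^sub>v (Suc n)" unfolding Av using y(2) by (auto intro!: eq_vecI)
  finally have col0: "col (y' * A * y) 0 = 0\<^sub>v (Suc n)" .
  have z: "(y' * A * y) $$ (i, 0) = 0" if "i < Suc n" for i
    using arg_cong[OF col0, of "\<lambda>w :: 'k vec. w $ i"] that B by (simp del: index_mult_mat)
  define t where "t = (\<lambda>j. (y' * A * y) $$ (0, Suc j))"
  define A1 where "A1 = mat n n (\<lambda>(i, j). (y' * A * y) $$ (Suc i, Suc j))"
  have A1: "A1 \<in> carrier_mat n n" by (simp add: A1_def)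
  have By: "y' * A * y = blk 0 t A1"
    using blk_exists[OF B] z unfolding t_def A1_def by simp
  define S where "S = {x. x \<in> carrier (GL (Suc n)) \<and> col x 0 = v}"
  define D where "D = ({..<n} \<rightarrow>\<^sub>E (UNIV :: 'k set)) \<times> carrier (GL n :: 'k mat monoid)"
  have zD: "z \<in> carrier_mat n n" if "z \<in> carrier (GL n)" for z :: "'k mat" using that by (simp add: GL_iff)
  have inj: "inj_on (\<lambda>(s, z). y * blk 1 s z) D"
  proof (rule inj_onI, clarify)
    fix s s' :: "nat \<Rightarrow> 'k" and z z' :: "'k mat"
    assume sz: "(s, z) \<in> D" "(s', z') \<in> D" and eq: "y * blk 1 s z = y * blk 1 s' z'"
    have c: "z \<in> carrier_mat n n" "z' \<in> carrier_mat n n" using sz zD by (auto simp: D_def)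
    have "y' * (y * blk 1 s z) = y' * (y * blk 1 s' z')" by (simp only: eq)
    hence "blk 1 s z = blk 1 s' z'"
      using assoc_mult_mat[OF y(2,1) blk_carrier[OF c(1), of 1 s], symmetric]
        assoc_mult_mat[OF y(2,1) blk_carrier[OF c(2), of 1 s'], symmetric] y(4) blk_carrier[OF c(1), of 1 s] blk_carrier[OF c(2), of 1 s'] by simp
    hence "z = z'" "\<And>j. j < n \<Longrightarrow> s j = s' j" using blk_inject[OF _ c] by blast+
    moreover from this have "s = s'" using sz unfolding D_def by (intro PiE_ext[of s _ _ s']) auto
    ultimately show "s = s' \<and> z = z'" by simp
  qed
  have onto: "(\<lambda>(s, z). y * blk 1 s z) ` D = S"
  proof (intro equalityI subsetI)
    fix x assume "x \<in> (\<lambda>(s, z). y * blk 1 s z) ` D"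
    then obtain s z where x: "x = y * blk 1 s z" "z \<in> carrier (GL n)" by (auto simp: D_def)
    note zc = zD[OF x(2)]
    have "x \<in> carrier (GL (Suc n))"
      unfolding x(1) using monoid.m_closed[OF group.is_monoid[OF GL_group[of "Suc n"]] \<open>y \<in> carrier (GL (Suc n))\<close> blk_GL(1)[OF x(2), of s]] by simp
    moreover have "col x 0 = y *\<^sub>v col (blk 1 s z) 0" unfolding x(1) by (rule col_mult2[OF y(1) blk_carrier[OF zc]]) simp
    moreover have "col (blk 1 s z) 0 = unit_vec (Suc n) 0"
    proof (rule eq_vecI)
      fix i assume "i < dim_vec (unit_vec (Suc n) 0 :: 'k vec)"
      thus "col (blk 1 s z) 0 $ i = unit_vec (Suc n) 0 $ i"
        using blk_carrier[OF zc, of 1 s] blk_index(1,3)[OF zc] by (cases i) auto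
    qed (use blk_carrier[OF zc, of 1 s] in auto)
    moreover have "y *\<^sub>v unit_vec (Suc n) 0 = v"
      unfolding yv[symmetric] by (rule eq_vecI) (use y(1) in auto)
    ultimately show "x \<in> S" by (simp add: S_def)
  next
    fix x assume "x \<in> S"
    hence x: "x \<in> carrier (GL (Suc n))" "col x 0 = v" by (auto simp: S_def)
    hence xc: "x \<in> carrier_mat (Suc n) (Suc n)" by (simp add: GL_iff)
    have "y' \<in> carrier (GL (Suc n))" using y by (auto simp: GL_iff)
    hence G: "y' * x \<in> carrier (GL (Suc n))"
      using monoid.m_closed[OF group.is_monoid[OF GL_group[of "Suc n"]] _ x(1)] by fastforce
    have c: "y' * x \<in> carrier_mat (Suc n) (Suc n)" using y xc by simp
    have "col (y' * x) 0 = y' *\<^sub>v col x 0" by (rule col_mult2[OF y(2) xc]) simp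
    also have "\<dots> = col (y' * y) 0" unfolding x(2) yv[symmetric] by (rule col_mult2[OF y(2,1), symmetric]) simp
    finally have e: "col (y' * x) 0 = unit_vec (Suc n) 0" unfolding y(4) by simp
    have e': "(y' * x) $$ (i, 0) = (if i = 0 then 1 else 0)" if "i < Suc n" for i
      using arg_cong[OF e, of "\<lambda>w :: 'k vec. w $ i"] that c by (simp del: index_mult_mat)
    define s where "s = restrict (\<lambda>j. (y' * x) $$ (0, Suc j)) {..<n}"
    define z where "z = mat n n (\<lambda>(i, j). (y' * x) $$ (Suc i, Suc j))"
    have zc: "z \<in> carrier_mat n n" by (simp add: z_def)
    have bl: "y' * x = blk 1 s z"
      by (rule blk_eqI[OF c zc]) (use e' in \<open>auto simp: s_def z_def simp del: index_mult_mat\<close>)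
    have "z \<in> carrier (GL n)" using blk_GL_D[OF G[unfolded bl] zc] .
    moreover have "x = y * blk 1 s z"
      unfolding bl[symmetric] using assoc_mult_mat[OF y(1,2) xc, symmetric] y(3) xc by simp
    ultimately show "x \<in> (\<lambda>(s, z). y * blk 1 s z) ` D" by (intro image_eqI[of _ _ "(s, z)"]) (auto simp: D_def s_def)
  qed
  have summand: "gg_weight (Suc n) d (m_inv (GL (Suc n)) (y * blk 1 s z) * A * (y * blk 1 s z)) =
      (if n = 0 then 1 else \<psi> (functional n (\<lambda>k. d 1 * t k) (col z 0))) * gg_weight n (\<lambda>i. d (Suc i)) (m_inv (GL n) z * A1 * z)"
    if zG: "z \<in> carrier (GL n)" for s z
  proof -
    obtain z' where z: "z \<in> carrier_mat n n" "z' \<in> carrier_mat n n" "z * z' = 1\<^sub>m n" "z' * z = 1\<^sub>m n"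
      using zG by (auto simp: GL_iff)
    have iz: "m_inv (GL n) z = z'" by (rule GL_inv[OF z])
    define s' where "s' = (\<lambda>j. - (\<Sum>k<n. s k * z' $$ (k, j)))"
    let ?b = "blk 1 s z" and ?b' = "blk 1 s' z'"
    note bc = blk_carrier[OF z(1), of 1 s] blk_carrier[OF z(2), of 1 s']
    have ib: "m_inv (GL (Suc n)) ?b = ?b'" using blk_GL(2)[OF zG, of s] by (simp add: iz s'_def)
    have inv: "m_inv (GL (Suc n)) (y * ?b) = ?b' * y'"
      using group.inv_mult_group[OF GL_group[of "Suc n"] \<open>y \<in> carrier (GL (Suc n))\<close> blk_GL(1)[OF zG, of s]] GL_inv[OF y] ib by simp
    have "?b' * y' * A * (y * ?b) = ?b' * (y' * A * y) * ?b"
      using y A bc by (simp add: assoc_mult_mat[of _ "Suc n" "Suc n" _ "Suc n" _ "Suc n"])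
    also have "\<dots> = blk 0 (\<lambda>j. \<Sum>k<n. (t k + (\<Sum>l<n. s' l * A1 $$ (l, k))) * z $$ (k, j)) (z' * A1 * z)"
      unfolding By blk_mult[OF z(2) A1] using z A1 by (subst blk_mult[where n = n]) auto
    finally have C: "m_inv (GL (Suc n)) (y * ?b) * A * (y * ?b) =
        blk 0 (\<lambda>j. \<Sum>k<n. (t k + (\<Sum>l<n. s' l * A1 $$ (l, k))) * z $$ (k, j)) (z' * A1 * z)" unfolding inv .
    have Cc: "z' * A1 * z \<in> carrier_mat n n" using z A1 by simp
    show ?thesis
    \<comment> \<open>If the lower corner is not strictly upper triangular, both sides are zero; for
      n = 0 there is no entry of the first row to compare.\<close>
    proof (cases "n > 0 \<and> strict_upper n (z' * A1 * z)")
      case True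
      have cl: "(z' * A1 * z) $$ (k, 0) = 0" if "k < n" for k
        using True that by (simp add: strict_upper_def del: index_mult_mat)
      have "A1 * z = z * (z' * A1 * z)"
        using z A1 assoc_mult_mat[of z n n z' n "A1 * z" n] by (simp add: assoc_mult_mat[of _ n n _ n _ n])
      \<comment> \<open>The first column of z lies in the kernel of A1, which removes the only terms
        that contain s.\<close>
      hence A1z: "(A1 * z) $$ (l, 0) = 0" if "l < n" for l
        using that True cl mat_mult_index[OF z(1) Cc that, of 0] by (simp del: index_mult_mat)
      have "(\<Sum>k<n. (\<Sum>l<n. s' l * A1 $$ (l, k)) * z $$ (k, 0)) = (\<Sum>l<n. s' l * (\<Sum>k<n. A1 $$ (l, k) * z $$ (k, 0)))"
        unfolding sum_distrib_left sum_distrib_right mult.assoc by (rule sum.swap)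
      also have "\<dots> = 0"
        by (rule sum.neutral) (use True A1z mat_mult_index[OF A1 z(1), of _ 0] in \<open>auto simp del: index_mult_mat\<close>)
      finally have "(\<Sum>k<n. (t k + (\<Sum>l<n. s' l * A1 $$ (l, k))) * z $$ (k, 0)) = (\<Sum>k<n. t k * z $$ (k, 0))"
        by (simp add: distrib_right sum.distrib)
      hence "d 1 * (\<Sum>k<n. (t k + (\<Sum>l<n. s' l * A1 $$ (l, k))) * z $$ (k, 0)) = functional n (\<lambda>k. d 1 * t k) (col z 0)"
        using z(1) True by (simp add: functional_def sum_distrib_left mult.assoc)
      thus ?thesis unfolding C gg_weight_blk[OF Cc] iz by simp
    next
      case False
      thus ?thesis unfolding C gg_weight_blk[OF Cc] iz by (auto simp: gg_weight_def)
    qed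
  qed
  have "(\<Sum>x\<in>S. gg_weight (Suc n) d (m_inv (GL (Suc n)) x * A * x)) =
      (\<Sum>(s, z)\<in>D. (if n = 0 then 1 else \<psi> (functional n (\<lambda>k. d 1 * t k) (col z 0))) * gg_weight n (\<lambda>i. d (Suc i)) (m_inv (GL n) z * A1 * z))"
    unfolding onto[symmetric] sum.reindex[OF inj]
  proof (rule sum.cong[OF refl])
    fix p assume "p \<in> D"
    then obtain s z where p: "p = (s, z)" "z \<in> carrier (GL n)" by (auto simp: D_def)
    show "((\<lambda>x. gg_weight (Suc n) d (m_inv (GL (Suc n)) x * A * x)) \<circ> (\<lambda>(s, z). y * blk 1 s z)) p =
      (case p of (s, z) \<Rightarrow> (if n = 0 then 1 else \<psi> (functional n (\<lambda>k. d 1 * t k) (col z 0))) * gg_weight n (\<lambda>i. d (Suc i)) (m_inv (GL n) z * A1 * z))"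
      by (simp only: p(1) comp_def split summand[OF p(2)])
  qed
  also have "\<dots> = of_nat (CARD('k) ^ n) * gg_sum n (\<lambda>i. d (Suc i)) A1 (\<lambda>k. d 1 * t k)"
    unfolding D_def sum.cartesian_product[symmetric] gg_sum_def by (simp add: card_PiE)
  finally show thesis using that[OF y A1 By] unfolding S_def by blast
qed

definition unit_prod :: "nat \<Rightarrow> complex" where
  "unit_prod l = (\<Prod>j=1..l. of_nat (CARD('k)) ^ j - 1)"

text \<open>A nonzero weight requires the first column of x^-1 A x to vanish, so the first column of
  x is a nonzero vector in the kernel of A.\<close>

lemma gg_sum_Suc:
  assumes A: "A \<in> carrier_mat (Suc n) (Suc n)"
  shows "gg_sum (Suc n) d A r = (\<Sum>v\<in>mat_ker (Suc n) A - {0\<^sub>v (Suc n)}. \<psi> (functional (Suc n) r v) *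
    (\<Sum>x | x \<in> carrier (GL (Suc n)) \<and> col x 0 = v. gg_weight (Suc n) d (m_inv (GL (Suc n)) x * A * x)))"
proof -
  let ?W = "\<lambda>x. gg_weight (Suc n) d (m_inv (GL (Suc n)) x * A * x)"
  have "gg_sum (Suc n) d A r = (\<Sum>x\<in>carrier (GL (Suc n)). \<psi> (functional (Suc n) r (col x 0)) * ?W x)"
    by (simp add: gg_sum_def)
  also have "\<dots> = (\<Sum>v\<in>carrier_vec (Suc n). \<Sum>x | x \<in> carrier (GL (Suc n)) \<and> col x 0 = v. \<psi> (functional (Suc n) r (col x 0)) * ?W x)"
    by (rule sum.group[symmetric, OF GL_finite finite_carrier_vec]) (auto simp: GL_iff intro!: carrier_vecI)
  also have "\<dots> = (\<Sum>v\<in>carrier_vec (Suc n). \<psi> (functional (Suc n) r v) * (\<Sum>x | x \<in> carrier (GL (Suc n)) \<and> col x 0 = v. ?W x))"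
    unfolding sum_distrib_left by (intro sum.cong refl) auto
  also have "\<dots> = (\<Sum>v\<in>mat_ker (Suc n) A - {0\<^sub>v (Suc n)}. \<psi> (functional (Suc n) r v) * (\<Sum>x | x \<in> carrier (GL (Suc n)) \<and> col x 0 = v. ?W x))"
  proof (rule sum.mono_neutral_right[OF finite_carrier_vec])
    show "mat_ker (Suc n) A - {0\<^sub>v (Suc n)} \<subseteq> carrier_vec (Suc n)" by (auto simp: mat_ker_def)
    have "?W x = 0" if x: "x \<in> carrier (GL (Suc n))" and nk: "col x 0 \<notin> mat_ker (Suc n) A - {0\<^sub>v (Suc n)}" for x
    proof (rule ccontr)
      assume "?W x \<noteq> 0"
      hence su: "strict_upper (Suc n) (m_inv (GL (Suc n)) x * A * x)" by (auto simp: gg_weight_def split: if_splits)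
      obtain x' where x': "x \<in> carrier_mat (Suc n) (Suc n)" "x' \<in> carrier_mat (Suc n) (Suc n)" "x * x' = 1\<^sub>m (Suc n)" "x' * x = 1\<^sub>m (Suc n)"
        using x by (auto simp: GL_iff)
      have iv: "m_inv (GL (Suc n)) x = x'" by (rule GL_inv[OF x'])
      have xc: "col x 0 \<in> carrier_vec (Suc n)" using x'(1) by (intro carrier_vecI) simp
      let ?C = "x' * A * x"
      have C: "?C \<in> carrier_mat (Suc n) (Suc n)" using x' A by simp
      have "col ?C 0 = 0\<^sub>v (Suc n)"
        by (rule eq_vecI) (use su C in \<open>auto simp: strict_upper_def iv simp del: index_mult_mat\<close>)
      moreover have "x * ?C = A * x"
        using x' A assoc_mult_mat[of x "Suc n" "Suc n" x' "Suc n" "A * x" "Suc n"] by (simp add: assoc_mult_mat[of _ "Suc n" "Suc n" _ "Suc n" _ "Suc n"])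
      ultimately have "A *\<^sub>v col x 0 = x *\<^sub>v 0\<^sub>v (Suc n)"
        using col_mult2[OF A x'(1), of 0] col_mult2[OF x'(1) C, of 0] by simp
      also have "\<dots> = 0\<^sub>v (Suc n)" using x'(1) by (auto intro!: eq_vecI)
      finally have "col x 0 \<in> mat_ker (Suc n) A" using xc by (simp add: mat_ker_def)
      hence c0: "col x 0 = 0\<^sub>v (Suc n)" using nk by blast
      have "col (x' * x) 0 = x' *\<^sub>v col x 0" by (rule col_mult2[OF x'(2,1)]) simp
      also have "\<dots> = 0\<^sub>v (Suc n)" unfolding c0 using x'(2) by (auto intro!: eq_vecI)
      finally have "unit_vec (Suc n) 0 $ 0 = (0\<^sub>v (Suc n) :: 'k vec) $ 0" unfolding x'(4) by simp
      thus False by simp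
    qed
    thus "\<forall>v\<in>carrier_vec (Suc n) - (mat_ker (Suc n) A - {0\<^sub>v (Suc n)}).
        \<psi> (functional (Suc n) r v) * (\<Sum>x | x \<in> carrier (GL (Suc n)) \<and> col x 0 = v. ?W x) = 0"
      by (auto intro!: sum.neutral)
  qed
  finally show ?thesis .
qed

text \<open>The exponent l is the dimension of the kernel. The kernel of the smaller matrix has
  dimension l - 1 if t vanishes on it and l otherwise; the two forms of the induction hypothesis,
  with the sign (-1)^(n + l), then give the same contribution for every first column v. What is left
  is the sum of \<psi>(r v) over the nonzero kernel vectors, which is q^l - 1 or -1.\<close>

theorem gg_sum_eval:
  assumes "A \<in> carrier_mat n n" "nilpotent_mat n A" "\<And>i. 1 \<le> i \<Longrightarrow> i < n \<Longrightarrow> d i \<noteq> 0"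
  shows "\<exists>l. card (mat_ker n A) = CARD('k) ^ l \<and> ((\<exists>v\<in>mat_ker n A. functional n r v \<noteq> 0) \<longrightarrow> l \<ge> 1) \<and>
    gg_sum n d A r = of_nat (card (UT n :: 'k mat set)) * (-1) ^ (n + l) *
      (if \<forall>v\<in>mat_ker n A. functional n r v = 0 then unit_prod l else - unit_prod (l - 1))"
  using assms
proof (induction n arbitrary: A d r)
  case 0
  have v0: "v = 0\<^sub>v 0" if "v \<in> carrier_vec 0" for v :: "'k vec" using that by (intro eq_vecI) auto
  have m0: "x = 1\<^sub>m 0" if "x \<in> carrier_mat 0 0" for x :: "'k mat" using that by (intro eq_matI) auto
  have K: "mat_ker 0 A = {0\<^sub>v 0}" using v0 0 by (auto simp: mat_ker_def)
  have "1\<^sub>m 0 \<in> carrier (GL 0 :: 'k mat monoid)" using group.is_monoid[OF GL_group[of 0]] monoid.one_closed by fastforce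
  hence G: "carrier (GL 0 :: 'k mat monoid) = {1\<^sub>m 0}" using m0 by (auto simp: GL_iff)
  have U: "UT 0 = {1\<^sub>m 0 :: 'k mat}" using m0 by (auto simp: UT_def upper_triangular_def)
  show ?case by (rule exI[of _ 0]) (simp add: K U gg_sum_def G gg_weight_def strict_upper_def unit_prod_def functional_def)
next
  case (Suc n)
  note A = Suc.prems(1)
  let ?K = "mat_ker (Suc n) A"
  let ?F = "\<lambda>v. \<Sum>x | x \<in> carrier (GL (Suc n)) \<and> col x 0 = v. gg_weight (Suc n) d (m_inv (GL (Suc n)) x * A * x)"
  have fibre: "\<exists>l\<ge>1. card ?K = CARD('k) ^ l \<and> ?F v = of_nat (card (UT (Suc n) :: 'k mat set)) * (-1) ^ (Suc n + l) * unit_prod (l - 1)"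
    if v: "v \<in> ?K" "v \<noteq> 0\<^sub>v (Suc n)" for v
  proof -
    obtain y y' t A1 where y: "y \<in> carrier_mat (Suc n) (Suc n)" "y' \<in> carrier_mat (Suc n) (Suc n)" "y * y' = 1\<^sub>m (Suc n)" "y' * y = 1\<^sub>m (Suc n)"
      and A1: "A1 \<in> carrier_mat n n" "y' * A * y = blk 0 t A1"
      and F: "?F v = of_nat (CARD('k) ^ n) * gg_sum n (\<lambda>i. d (Suc i)) A1 (\<lambda>k. d 1 * t k)"
      by (rule gg_sum_fibre[OF A v, where d = d])
    let ?K1 = "mat_ker n A1"
    have fd: "functional n (\<lambda>k. d 1 * t k) w = 0 \<longleftrightarrow> functional n t w = 0" for w
    proof -
      have e: "functional n (\<lambda>k. d 1 * t k) w = d 1 * functional n t w"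
        by (simp add: functional_def sum_distrib_left mult.assoc)
      show ?thesis
      \<comment> \<open>For n = 0 nothing is known about d 1, but then the functional is an empty
        sum.\<close>
      proof (cases "n = 0")
        case True thus ?thesis by (simp add: functional_def)
      next
        case False thus ?thesis unfolding e using Suc.prems(3)[of 1] by simp
      qed
    qed
    have nil: "nilpotent_mat n A1" by (rule nilpotent_blk[OF A Suc.prems(2) y A1])
    obtain l1 where l1: "card ?K1 = CARD('k) ^ l1" "(\<exists>w\<in>?K1. functional n t w \<noteq> 0) \<Longrightarrow> l1 \<ge> 1"
      and gs: "gg_sum n (\<lambda>i. d (Suc i)) A1 (\<lambda>k. d 1 * t k) = of_nat (card (UT n :: 'k mat set)) * (-1) ^ (n + l1) *
        (if \<forall>w\<in>?K1. functional n t w = 0 then unit_prod l1 else - unit_prod (l1 - 1))"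
      using Suc.IH[OF A1(1) nil, of "\<lambda>i. d (Suc i)" "\<lambda>k. d 1 * t k"] Suc.prems(3) unfolding fd by auto
    have cK: "card ?K = CARD('k) * card {w \<in> ?K1. functional n t w = 0}"
      using card_mat_ker_conj[OF A y] card_mat_ker_blk[OF A1(1), of t] unfolding A1(2) by simp
    have F': "?F v = of_nat (card (UT (Suc n) :: 'k mat set)) * (-1) ^ (n + l1) *
        (if \<forall>w\<in>?K1. functional n t w = 0 then unit_prod l1 else - unit_prod (l1 - 1))"
      unfolding F gs using card_UT[of n, where 'k = 'k] by simp
    show ?thesis
    proof (cases "\<forall>w\<in>?K1. functional n t w = 0")
      case True
      hence "{w \<in> ?K1. functional n t w = 0} = ?K1" by blast
      hence "card ?K = CARD('k) ^ Suc l1" using cK l1(1) by simp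
      moreover have "?F v = of_nat (card (UT (Suc n) :: 'k mat set)) * (-1) ^ (Suc n + Suc l1) * unit_prod (Suc l1 - 1)"
        unfolding F' using True by simp
      ultimately show ?thesis by (intro exI[of _ "Suc l1"]) simp
    next
      case False
      then obtain w where w: "w \<in> ?K1" "functional n t w \<noteq> 0" by blast
      have "card ?K = CARD('k) ^ l1"
        using cK card_functional_kernel[OF subsp_mat_ker[OF A1(1)] w] l1(1) by simp
      moreover have "?F v = of_nat (card (UT (Suc n) :: 'k mat set)) * (-1) ^ (Suc n + l1) * unit_prod (l1 - 1)"
        unfolding F' by (simp only: False if_False) simp
      ultimately show ?thesis using l1(2) w by blast
    qed
  qed
  obtain v0 where v0: "v0 \<in> ?K" "v0 \<noteq> 0\<^sub>v (Suc n)" using nilpotent_ker_nontrivial[OF A Suc.prems(2)] .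
  obtain l where l: "l \<ge> 1" "card ?K = CARD('k) ^ l" using fibre[OF v0] by blast
  have q: "CARD('k) > 1" using CARD_gt_1[where 'a = 'k] by simp
  let ?c = "of_nat (card (UT (Suc n) :: 'k mat set)) * (-1) ^ (Suc n + l) * unit_prod (l - 1)"
  have Fv: "?F v = ?c" if "v \<in> ?K - {0\<^sub>v (Suc n)}" for v
  proof -
    obtain l' where "card ?K = CARD('k) ^ l'" "?F v = of_nat (card (UT (Suc n) :: 'k mat set)) * (-1) ^ (Suc n + l') * unit_prod (l' - 1)"
      using fibre[of v] \<open>v \<in> _\<close> by blast
    moreover from this have "l' = l" using l(2) q by (simp add: power_inject_exp)
    ultimately show ?thesis by simp
  qed
  note sK = subsp_mat_ker[OF A]
  have fK: "finite ?K" by (rule subsp_finite[OF sK])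
  have "gg_sum (Suc n) d A r = (\<Sum>v\<in>?K - {0\<^sub>v (Suc n)}. \<psi> (functional (Suc n) r v) * ?c)"
    unfolding gg_sum_Suc[OF A] by (rule sum.cong[OF refl]) (simp only: Fv)
  also have "\<dots> = ((\<Sum>v\<in>?K. \<psi> (functional (Suc n) r v)) - 1) * ?c"
    unfolding sum_distrib_right[symmetric] using fK subsp_D(2)[OF sK] by (simp add: sum_diff1)
  also have "\<dots> = ((if \<forall>v\<in>?K. functional (Suc n) r v = 0 then of_nat (CARD('k)) ^ l else 0) - 1) * ?c"
    unfolding sum_\<psi>_functional[OF sK] l(2) by simp
  also have "\<dots> = of_nat (card (UT (Suc n) :: 'k mat set)) * (-1) ^ (Suc n + l) *
      (if \<forall>v\<in>?K. functional (Suc n) r v = 0 then unit_prod l else - unit_prod (l - 1))"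
  proof -
    have "unit_prod l = (of_nat (CARD('k)) ^ l - 1) * unit_prod (l - 1)"
      using l(1) by (cases l) (auto simp: unit_prod_def)
    thus ?thesis by (simp add: mult_ac)
  qed
  finally show ?case using l by blast
qed

end

lemma induced_lin_char:
  fixes A :: "'k :: {field, finite} mat"
  assumes A: "A \<in> carrier_mat n n" and "additive_char \<psi>"
  shows "induced (GL n) (UT n) (lin_char \<psi> c n) (1\<^sub>m n + A) = additive_char.gg_sum \<psi> n (c n) A (\<lambda>_. 0) / of_nat (card (UT n :: 'k mat set))"
proof -
  interpret additive_char \<psi> by fact
  show ?thesis unfolding induced_def gg_sum_def
  proof (rule arg_cong[where f = "\<lambda>x. x / _"], rule sum.cong[OF refl])
    fix x :: "'k mat" assume "x \<in> carrier (GL n)"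
    then obtain x' where x: "x \<in> carrier_mat n n" "x' \<in> carrier_mat n n" "x * x' = 1\<^sub>m n" "x' * x = 1\<^sub>m n" by (auto simp: GL_iff)
    have iv: "m_inv (GL n) x = x'" by (rule GL_inv[OF x])
    let ?C = "x' * A * x"
    have C: "?C \<in> carrier_mat n n" using A x by simp
    have e: "x' * (1\<^sub>m n + A) * x = 1\<^sub>m n + ?C"
      using A x by (simp add: mult_add_distrib_mat[of _ n n _ n] add_mult_distrib_mat[of _ n n _ _ n])
    have f: "functional n (\<lambda>_. 0 :: 'k) v = 0" for v by (simp add: functional_def)
    have "lin_char \<psi> c n (1\<^sub>m n + ?C) = (\<Prod>i\<in>{1..<n}. \<psi> (c n i * ?C $$ (i - 1, i)))"
      unfolding lin_char_def by (rule prod.cong[OF refl]) (use C x in \<open>auto simp del: index_mult_mat(1)\<close>)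
    thus "(let y = m_inv (GL n) x \<otimes>\<^bsub>GL n\<^esub> (1\<^sub>m n + A) \<otimes>\<^bsub>GL n\<^esub> x in if y \<in> UT n then lin_char \<psi> c n y else 0) =
      (if n = 0 then 1 else \<psi> (functional n (\<lambda>_. 0) (col x 0))) * gg_weight n (c n) (m_inv (GL n) x * A * x)"
      by (simp add: Let_def iv e UT_iff[OF C] gg_weight_def f)
  qed
qed

theorem induced_lin_char_unipotent:
  fixes A :: "'k :: {field, finite} mat"
  assumes A: "A \<in> carrier_mat n n" "\<forall>v\<in>carrier_vec n. ((\<lambda>v. A *\<^sub>v v) ^^ N) v = 0\<^sub>v n" and \<psi>: "nontrivial_additive_char \<psi>"
    and c: "\<And>i. 1 \<le> i \<Longrightarrow> i < n \<Longrightarrow> c n i \<noteq> 0" and l: "card (mat_ker n A) = CARD('k) ^ l"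
  shows "induced (GL n) (UT n) (lin_char \<psi> c n) (1\<^sub>m n + A) = (-1) ^ n * (\<Prod>j=1..l. 1 - of_nat (CARD('k)) ^ j)"
proof -
  interpret additive_char \<psi> by unfold_locales (rule \<psi>)
  have nil: "nilpotent_mat n A" using A(2) by (auto simp: nilpotent_mat_def)
  have f: "functional n (\<lambda>_. 0 :: 'k) v = 0" for v by (simp add: functional_def)
  obtain l' where l': "card (mat_ker n A) = CARD('k) ^ l'"
    "gg_sum n (c n) A (\<lambda>_. 0) = of_nat (card (UT n :: 'k mat set)) * (-1) ^ (n + l') * unit_prod l'"
    using gg_sum_eval[OF A(1) nil, where d = "c n" and r = "\<lambda>_. 0", OF c] unfolding f by auto
  have "CARD('k) > 1" using CARD_gt_1[where 'a = 'k] by simp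
  hence "l' = l" using l l'(1) by (simp add: power_inject_exp)
  moreover have "(\<Prod>j=1..l. 1 - of_nat (CARD('k)) ^ j) = (-1) ^ l * (unit_prod l :: complex)"
    unfolding unit_prod_def by (induction l) (auto simp: algebra_simps)
  moreover have "card (UT n :: 'k mat set) \<noteq> 0" using card_UT[of n, where 'k = 'k] by linarith
  ultimately show ?thesis
    using induced_lin_char[OF A(1) additive_char_axioms, of c] l'(2) by (simp add: power_add)
qed

section \<open>Conjugacy classes\<close>

subsection \<open>Polynomials of orbits\<close>

lemma map_poly_to_ac_inject:
  assumes "map_poly to_ac p = map_poly to_ac (q :: 'a :: field poly)" shows "p = q"
proof (rule poly_eqI)
  fix i show "Polynomial.coeff p i = Polynomial.coeff q i"
    using arg_cong[OF assms, of "\<lambda>p. Polynomial.coeff p i"] by (simp add: coeff_map_poly)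
qed

text \<open>Frobenius permutes the roots, so it fixes the coefficients, and these lie in the
  embedded finite field by \<open>range_to_ac\<close>.\<close>

lemma map_poly_orbit_poly:
  assumes f: "f \<in> (Phi :: ('a :: {field, finite}) alg_closure set set)"
  shows "map_poly to_ac (orbit_poly f) = (\<Prod>z\<in>f. [:- z, 1:])"
proof -
  let ?P = "\<Prod>z\<in>f. [:- z, 1:]"
  note fD = Phi_D[OF f]
  interpret fr: comm_ring_hom "\<lambda>z :: 'a alg_closure. z ^ CARD('a)"
    by unfold_locales (use frob_add[of _ _ 1, where 'a = 'a] in \<open>auto simp: power_mult_distrib\<close>)
  interpret mf: map_poly_comm_ring_hom "\<lambda>z :: 'a alg_closure. z ^ CARD('a)" ..
  have "z ^ CARD('a) \<in> f" if "z \<in> f" for z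
  proof -
    have "f = frob_orbit (z ^ CARD('a))" using fD(4)[OF that] frob_orbit_frob[of z 1] by simp
    moreover have "z ^ CARD('a) \<in> frob_orbit (z ^ CARD('a))" unfolding frob_orbit_def by (auto intro: exI[of _ 0])
    ultimately show ?thesis by simp
  qed
  hence "(\<lambda>z. z ^ CARD('a)) ` f \<subseteq> f" by auto
  moreover have inj: "inj_on (\<lambda>z. z ^ CARD('a)) f" using frob_inj[of _ 1] by (auto intro: inj_onI)
  ultimately have bij: "bij_betw (\<lambda>z. z ^ CARD('a)) f f"
    using endo_inj_surj[OF fD(1)] by (simp add: bij_betw_def)
  have "map_poly (\<lambda>z. z ^ CARD('a)) ?P = (\<Prod>z\<in>f. [:- (z ^ CARD('a)), 1:])"
    unfolding mf.hom_prod using frob_minus[of _ 1, where 'a = 'a] by (intro prod.cong) (auto simp: map_poly_pCons)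
  also have "\<dots> = ?P" by (rule prod.reindex_bij_betw[OF bij])
  finally have fP: "map_poly (\<lambda>z. z ^ CARD('a)) ?P = ?P" .
  have "Polynomial.coeff ?P i ^ CARD('a) = Polynomial.coeff ?P i" for i
    using arg_cong[OF fP, of "\<lambda>p. Polynomial.coeff p i"] by (simp add: coeff_map_poly)
  hence c: "Polynomial.coeff ?P i \<in> range to_ac" for i using range_to_ac by blast
  have of0: "of_ac (0 :: 'a alg_closure) = 0" by (rule of_ac_eqI) simp
  have ex: "map_poly to_ac (map_poly of_ac ?P :: 'a poly) = ?P"
    by (rule poly_eqI) (use c in \<open>simp add: coeff_map_poly of0 to_ac_of_ac\<close>)
  show ?thesis unfolding orbit_poly_def
  proof (rule theI[where P = "\<lambda>p. map_poly to_ac p = ?P", OF ex])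
    fix p assume "map_poly to_ac p = ?P"
    hence "map_poly to_ac p = map_poly to_ac (map_poly of_ac ?P :: 'a poly)" using ex by simp
    thus "p = map_poly of_ac ?P" by (rule map_poly_to_ac_inject)
  qed
qed

lemma orbit_poly_props:
  assumes f: "f \<in> (Phi :: ('a :: {field, finite}) alg_closure set set)"
  shows "Polynomial.degree (orbit_poly f) = card f" "lead_coeff (orbit_poly f) = 1" "Polynomial.coeff (orbit_poly f) 0 \<noteq> 0"
proof -
  let ?P = "\<Prod>z\<in>f. [:- z, 1:]"
  note fD = Phi_D[OF f] and m = map_poly_orbit_poly[OF f]
  have "Polynomial.degree (map_poly to_ac (orbit_poly f) :: 'a alg_closure poly) = Polynomial.degree (orbit_poly f)"
    by (rule degree_map_poly) simp
  moreover have "Polynomial.degree ?P = card f" by (subst degree_prod_eq_sum_degree) auto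
  ultimately show d: "Polynomial.degree (orbit_poly f) = card f" unfolding m by simp
  have c: "to_ac (Polynomial.coeff (orbit_poly f) i) = Polynomial.coeff ?P i" for i
    unfolding m[symmetric] by (simp add: coeff_map_poly)
  have "lead_coeff ?P = 1" by (simp add: lead_coeff_prod)
  hence "to_ac (lead_coeff (orbit_poly f)) = 1" unfolding c d \<open>Polynomial.degree ?P = card f\<close>[symmetric] .
  thus "lead_coeff (orbit_poly f) = 1" by (metis to_ac_1 to_ac_eq_iff)
  have "Polynomial.coeff ?P 0 = (\<Prod>z\<in>f. - z)" unfolding poly_0_coeff_0[symmetric] poly_prod by simp
  also have "\<dots> \<noteq> 0" using fD(1,3) by auto
  finally show "Polynomial.coeff (orbit_poly f) 0 \<noteq> 0" unfolding c[symmetric] by simp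
qed

lemma orbit_poly_1: "orbit_poly ({1} :: ('a :: {field, finite}) alg_closure set) = [:-1, 1:]"
  by (simp add: map_poly_orbit_poly one_in_Phi map_poly_pCons map_poly_to_ac_inject)

lemma orbit_poly_dvd_power:
  assumes f: "f \<in> (Phi :: ('a :: {field, finite}) alg_closure set set)" and dvd: "orbit_poly f dvd [:-1, 1:] ^ N"
  shows "f = {1}"
proof -
  interpret h: comm_ring_hom "to_ac :: 'a \<Rightarrow> 'a alg_closure" by unfold_locales auto
  interpret mh: map_poly_comm_ring_hom "to_ac :: 'a \<Rightarrow> 'a alg_closure" ..
  obtain z where z: "z \<in> f" using Phi_D(2)[OF f] by (cases "f = {}") auto
  obtain u where "[:-1, 1:] ^ N = orbit_poly f * u" using dvd by (rule dvdE)
  hence "map_poly to_ac ([:-1, 1:] ^ N :: 'a poly) = (\<Prod>z\<in>f. [:- z, 1:]) * map_poly to_ac u"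
    by (simp only: mh.hom_mult map_poly_orbit_poly[OF f])
  hence "poly (map_poly to_ac ([:-1, 1:] ^ N :: 'a poly)) z = 0"
    using z Phi_D(1)[OF f] by (auto simp: poly_prod)
  moreover have "map_poly to_ac ([:-1, 1:] ^ N :: 'a poly) = [:-1, 1:] ^ N"
    unfolding mh.hom_power by (simp add: map_poly_pCons)
  ultimately have "z = 1" by (auto simp: poly_power)
  thus ?thesis using Phi_D(4)[OF f z] frob_orbit_1 by blast
qed

subsection \<open>The companion matrix of a sum of cyclic modules\<close>

lemma poly_mod_sum: "(\<Sum>k\<in>A. f k) mod m = (\<Sum>k\<in>A. f k mod (m :: 'k :: field poly))"
  by (induction A rule: infinite_finite_induct) (auto simp: poly_mod_add_left)

text \<open>The powers of X below the degree of m x form a basis of each summand, and g is the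
  matrix of multiplication by X. Nonzero constant terms make this multiplication invertible.\<close>

lemma cyclic_sum_matrix:
  fixes m :: "'i \<Rightarrow> 'k :: field poly"
  assumes I: "finite I" and m: "\<And>x. x \<in> I \<Longrightarrow> Polynomial.degree (m x) \<ge> 1" "\<And>x. x \<in> I \<Longrightarrow> Polynomial.coeff (m x) 0 \<noteq> 0"
    and n: "(\<Sum>x\<in>I. Polynomial.degree (m x)) = n"
  defines "Q \<equiv> {s. \<forall>x. if x \<in> I then s x mod m x = s x else s x = 0}"
  obtains g T where "g \<in> carrier (GL n)" "bij_betw T (carrier_vec n) Q"
    "\<And>v w. v \<in> carrier_vec n \<Longrightarrow> w \<in> carrier_vec n \<Longrightarrow> T (v + w) = (\<lambda>x. T v x + T w x)"
    "\<And>p v. v \<in> carrier_vec n \<Longrightarrow> T (poly_act n g p v) = (\<lambda>x. (p * T v x) mod m x)"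
proof -
  define C where "C = Sigma I (\<lambda>x. {..<Polynomial.degree (m x)})"
  have "card C = n" "finite C" using I n by (auto simp: C_def)
  then obtain e where e: "bij_betw e {..<n} C" using ex_bij_betw_nat_finite[of C] by (auto simp: atLeast0LessThan)
  define b where "b = (\<lambda>k x. if x = fst (e k) then monom (1 :: 'k) (snd (e k)) else 0)"
  define T where "T = (\<lambda>(v :: 'k vec) x. \<Sum>k<n. smult (v $ k) (b k x))"
  define S where "S = (\<lambda>s :: 'i \<Rightarrow> 'k poly. vec n (\<lambda>k. Polynomial.coeff (s (fst (e k))) (snd (e k))))"
  have cb: "Polynomial.coeff (b k x) j = (if e k = (x, j) then 1 else 0)" for k x j
    by (auto simp: b_def prod_eq_iff)
  have cT: "Polynomial.coeff (T v x) j = (\<Sum>k<n. if e k = (x, j) then v $ k else 0)" for v x j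
    unfolding T_def coeff_sum by (rule sum.cong) (auto simp: cb)
  have cT1: "Polynomial.coeff (T v (fst (e k))) (snd (e k)) = v $ k" if "k < n" for v k
  proof -
    have "(\<Sum>k'<n. if e k' = (fst (e k), snd (e k)) then v $ k' else 0) = (\<Sum>k'<n. if k' = k then v $ k' else 0)"
      by (rule sum.cong[OF refl]) (use e that in \<open>auto simp: bij_betw_def dest: inj_onD\<close>)
    thus ?thesis using that by (simp add: cT)
  qed
  have cT0: "Polynomial.coeff (T v x) j = 0" if "(x, j) \<notin> C" for v x j
  proof -
    have "e k \<noteq> (x, j)" if "k < n" for k using bij_betwE[OF e] that \<open>(x, j) \<notin> C\<close> by (metis lessThan_iff)
    thus ?thesis unfolding cT by (intro sum.neutral) auto
  qed
  have TQ: "T v \<in> Q" for v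
    unfolding Q_def
  proof (intro CollectI allI)
    fix x
    show "if x \<in> I then T v x mod m x = T v x else T v x = 0"
    proof (cases "x \<in> I")
      case True
      have "Polynomial.degree (T v x) < Polynomial.degree (m x)"
        by (rule degree_lessI) (use m(1)[OF True] cT0 in \<open>auto simp: C_def\<close>)
      thus ?thesis using True by (simp add: mod_poly_less)
    next
      case False
      have "T v x = 0" by (rule poly_eqI) (use False cT0 in \<open>auto simp: C_def\<close>)
      thus ?thesis using False by simp
    qed
  qed
  have ST: "S (T v) = v" if "v \<in> carrier_vec n" for v
    by (rule eq_vecI) (use that cT1 in \<open>auto simp: S_def\<close>)
  have TS: "T (S s) = s" if s: "s \<in> Q" for s
  proof
    fix x show "T (S s) x = s x"
    proof (rule poly_eqI)
      fix j show "Polynomial.coeff (T (S s) x) j = Polynomial.coeff (s x) j"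
      proof (cases "(x, j) \<in> C")
        case True
        then obtain k where "k < n" "e k = (x, j)" using e by (force simp: bij_betw_def)
        thus ?thesis using cT1[of k "S s"] by (simp add: S_def)
      next
        case False
        have "Polynomial.coeff (s x) j = 0"
        proof (cases "x \<in> I")
          case True
          hence "s x mod m x = s x" using s by (auto simp: Q_def)
          moreover have "m x \<noteq> 0" using m(1)[OF True] by auto
          ultimately have "s x = 0 \<or> Polynomial.degree (s x) < Polynomial.degree (m x)" by (metis degree_mod_less')
          thus ?thesis using False True by (auto simp: C_def intro: coeff_eq_0)
        next
          case False
          hence "s x = 0" using s by (auto simp: Q_def)
          thus ?thesis by simp
        qed
        thus ?thesis using cT0[OF False] by simp
      qed
    qed
  qed
  have Sc: "S s \<in> carrier_vec n" for s by (simp add: S_def)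
  define sh where "sh = (\<lambda>v x. (monom 1 1 * T v x) mod m x)"
  have shQ: "(\<lambda>x. (p * T v x) mod m x) \<in> Q" for p v
    using TQ that by (auto simp: Q_def)
  define g where "g = mat n n (\<lambda>(j, k). S (sh (unit_vec n k)) $ j)"
  have g: "g \<in> carrier_mat n n" by (simp add: g_def)
  have Tu: "T (unit_vec n k) x = b k x" if "k < n" for k x
  proof -
    have "T (unit_vec n k) x = (\<Sum>k'<n. if k' = k then b k' x else 0)"
      unfolding T_def by (rule sum.cong) (use that in auto)
    thus ?thesis using that by simp
  qed
  have gv: "g *\<^sub>v v = S (sh v)" if v: "v \<in> carrier_vec n" for v
  proof (rule eq_vecI)
    fix j assume "j < dim_vec (S (sh v))"
    hence j: "j < n" by (simp add: S_def)
    let ?c = "\<lambda>p. Polynomial.coeff (p :: 'k poly) (snd (e j))" and ?x = "fst (e j)"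
    have "(S (sh v)) $ j = ?c ((\<Sum>k<n. smult (v $ k) (monom 1 1 * b k ?x)) mod m ?x)"
      using j by (simp add: S_def sh_def T_def sum_distrib_left)
    also have "\<dots> = (\<Sum>k<n. v $ k * ?c ((monom 1 1 * b k ?x) mod m ?x))"
      by (simp add: poly_mod_sum mod_smult_left coeff_sum)
    also have "\<dots> = (\<Sum>k<n. g $$ (j, k) * v $ k)"
      by (rule sum.cong[OF refl]) (use j in \<open>simp add: g_def S_def sh_def Tu\<close>)
    also have "\<dots> = (g *\<^sub>v v) $ j" using mat_vec_index[OF g v j] by simp
    finally show "(g *\<^sub>v v) $ j = S (sh v) $ j" ..
  qed (use g in \<open>simp add: S_def\<close>)
  have Tg: "T (g *\<^sub>v v) = sh v" if "v \<in> carrier_vec n" for v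
    unfolding gv[OF that] by (rule TS) (simp add: sh_def shQ)
  have pw: "g ^\<^sub>m i \<in> carrier_mat n n" for i by (rule pow_carrier_mat[OF g])
  have Tgi: "T ((g ^\<^sub>m i) *\<^sub>v v) x = (monom 1 i * T v x) mod m x" if "v \<in> carrier_vec n" for i v x
    using that
  proof (induction i arbitrary: v)
    case 0
    have "T v x mod m x = T v x" using TQ[of v] by (cases "x \<in> I") (auto simp: Q_def)
    thus ?case using 0 g by (simp add: monom_0)
  next
    case (Suc i)
    have gvc: "g *\<^sub>v v \<in> carrier_vec n" using g Suc.prems by simp
    have "(g ^\<^sub>m Suc i) *\<^sub>v v = (g ^\<^sub>m i) *\<^sub>v (g *\<^sub>v v)"
      using assoc_mult_mat_vec[OF pw g Suc.prems] by simp
    hence "T ((g ^\<^sub>m Suc i) *\<^sub>v v) x = (monom 1 i * ((monom 1 1 * T v x) mod m x)) mod m x"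
      using Suc.IH[OF gvc] Tg[OF Suc.prems] by (simp add: sh_def)
    also have "\<dots> = (monom 1 (Suc i) * T v x) mod m x"
      by (simp add: mod_mult_right_eq mult.assoc[symmetric] mult_monom)
    finally show ?case .
  qed
  have act: "T (poly_act n g p v) = (\<lambda>x. (p * T v x) mod m x)" if v: "v \<in> carrier_vec n" for p v
  proof
    fix x
    let ?D = "{..Polynomial.degree p}"
    have "T (poly_act n g p v) x = (\<Sum>k<n. \<Sum>i\<in>?D. smult (Polynomial.coeff p i * ((g ^\<^sub>m i) *\<^sub>v v) $ k) (b k x))"
      unfolding T_def poly_act_def by (rule sum.cong[OF refl]) (simp add: smult_sum)
    also have "\<dots> = (\<Sum>i\<in>?D. smult (Polynomial.coeff p i) (T ((g ^\<^sub>m i) *\<^sub>v v) x))"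
      unfolding T_def smult_sum2 smult_smult by (rule sum.swap)
    also have "\<dots> = (\<Sum>i\<in>?D. monom (Polynomial.coeff p i) i * T v x) mod m x"
      unfolding poly_mod_sum
    proof (rule sum.cong[OF refl])
      fix i
      show "smult (Polynomial.coeff p i) (T ((g ^\<^sub>m i) *\<^sub>v v) x) = (monom (Polynomial.coeff p i) i * T v x) mod m x"
        unfolding Tgi[OF v] mod_smult_left[symmetric] mult_smult_left[symmetric] smult_monom by simp
    qed
    also have "\<dots> = (p * T v x) mod m x"
      unfolding sum_distrib_right[symmetric] poly_as_sum_of_monoms ..
    finally show "T (poly_act n g p v) x = (p * T v x) mod m x" .
  qed
  have "det g \<noteq> 0"
  proof
    assume "det g = 0"
    then obtain v where v: "v \<in> carrier_vec n" "v \<noteq> 0\<^sub>v n" "g *\<^sub>v v = 0\<^sub>v n"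
      using det_0_iff_vec_prod_zero_field[OF g] by blast
    have "T v x = 0" for x
    proof (cases "x \<in> I")
      case True
      \<comment> \<open>A multiple of m x that is divisible by X comes from a multiple of m x,
        because the constant term of m x is nonzero; so m x divides the reduced element T v x, which
        must be zero.\<close>
      have "sh v x = T (0\<^sub>v n) x" using Tg[OF v(1)] v(3) by simp
      also have "\<dots> = 0" by (simp add: T_def)
      finally have "m x dvd monom 1 1 * T v x" by (simp add: sh_def mod_eq_0_iff_dvd)
      then obtain u where "monom 1 1 * T v x = m x * u" by (rule dvdE)
      hence u: "pCons 0 (T v x) = m x * u" by (simp add: monom_Suc monom_0)
      have "Polynomial.coeff (m x * u) 0 = 0" unfolding u[symmetric] by simp
      hence "Polynomial.coeff u 0 = 0" using m(2)[OF True] by (simp add: coeff_mult)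
      then obtain u' where "u = pCons 0 u'" by (cases u) auto
      hence "T v x = m x * u'" using u by simp
      moreover have "T v x mod m x = T v x" using TQ[of v] True by (auto simp: Q_def)
      ultimately show ?thesis by simp
    next
      case False thus ?thesis using TQ[of v] by (auto simp: Q_def)
    qed
    hence "S (T v) = 0\<^sub>v n" by (auto simp: S_def intro: eq_vecI)
    thus False using ST[OF v(1)] v(2) by simp
  qed
  hence gG: "g \<in> carrier (GL n)" using det_non_zero_imp_unit[OF g] by (simp add: GL_def units_of_def)
  have bij: "bij_betw T (carrier_vec n) Q"
    by (rule bij_betwI[where g = S]) (use TQ Sc ST TS in auto)
  have add: "T (v + w) = (\<lambda>x. T v x + T w x)" if "v \<in> carrier_vec n" "w \<in> carrier_vec n" for v w
    using that by (auto simp: T_def smult_add_left sum.distrib)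
  show thesis by (rule that[OF gG bij add act])
qed

text \<open>\<open>ch\<close> evaluates a class function at a chosen element of each class, and the
  choice is meaningful only if there is one.\<close>

lemma conj_class_nonempty:
  assumes \<mu>: "\<mu> \<in> partition_funs (Phi :: ('a :: {field, finite}) alg_closure set set) n"
  shows "conj_class n \<mu> \<noteq> {}"
proof -
  define m where "m = (\<lambda>(f, i). orbit_poly f ^ (\<mu> f ! i))"
  define I where "I = Sigma {f. \<mu> f \<noteq> []} (\<lambda>f. {..<length (\<mu> f)})"
  have Ph: "f \<in> Phi" if "\<mu> f \<noteq> []" for f using \<mu> that by (auto simp: partition_funs_def)
  have fin: "finite {f. \<mu> f \<noteq> []}" and sum: "(\<Sum>f | \<mu> f \<noteq> []. card f * sum_list (\<mu> f)) = n"
    using \<mu> by (auto simp: partition_funs_def)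
  have pos: "\<mu> f ! i \<ge> 1" if "i < length (\<mu> f)" for f i
  proof -
    have "0 \<notin> set (\<mu> f)" using \<mu> by (auto simp: partition_funs_def is_partition_def)
    thus ?thesis using nth_mem[OF that] by (metis Suc_leI One_nat_def gr0I)
  qed
  have deg: "Polynomial.degree (m (f, i)) = card f * \<mu> f ! i" if "\<mu> f \<noteq> []" for f i
    using orbit_poly_props[OF Ph[OF that]] unfolding m_def by (subst split) (subst degree_power_eq, auto)
  have "(\<Sum>x\<in>I. Polynomial.degree (m x)) = (\<Sum>f | \<mu> f \<noteq> []. \<Sum>i<length (\<mu> f). card f * \<mu> f ! i)"
    unfolding I_def by (subst sum.Sigma) (use fin deg in \<open>auto intro!: sum.cong\<close>)
  also have "\<dots> = n"
    unfolding sum[symmetric] by (simp add: sum_list_sum_nth sum_distrib_left atLeast0LessThan)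
  finally have n: "(\<Sum>x\<in>I. Polynomial.degree (m x)) = n" .
  have I: "finite I" unfolding I_def using fin by auto
  have m1: "Polynomial.degree (m x) \<ge> 1" if xI: "x \<in> I" for x
  proof -
    obtain f i where x: "x = (f, i)" "\<mu> f \<noteq> []" "i < length (\<mu> f)" using xI by (cases x) (auto simp: I_def)
    thus ?thesis using deg[OF x(2), of i] pos[OF x(3)] Phi_D(2)[OF Ph[OF x(2)]] by simp
  qed
  have m2: "Polynomial.coeff (m x) 0 \<noteq> 0" if xI: "x \<in> I" for x
  proof -
    obtain f i where x: "x = (f, i)" "\<mu> f \<noteq> []" using xI by (cases x) (auto simp: I_def)
    thus ?thesis using orbit_poly_props(3)[OF Ph[OF x(2)]] by (simp add: m_def coeff_0_power)
  qed
  have Q: "{s. \<forall>x. if x \<in> I then s x mod m x = s x else s x = 0} = quotient_sum \<mu>"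
  proof -
    have "(f, i) \<in> I \<longleftrightarrow> i < length (\<mu> f)" for f i by (auto simp: I_def)
    thus ?thesis unfolding quotient_sum_def m_def split_paired_All by simp
  qed
  obtain g T where "g \<in> carrier (GL n)" "bij_betw T (carrier_vec n) (quotient_sum \<mu>)"
    "\<And>v w. v \<in> carrier_vec n \<Longrightarrow> w \<in> carrier_vec n \<Longrightarrow> T (v + w) = (\<lambda>x. T v x + T w x)"
    "\<And>p v. v \<in> carrier_vec n \<Longrightarrow> T (poly_act n g p v) = (\<lambda>x. (p * T v x) mod m x)"
    using cyclic_sum_matrix[OF I m1 m2 n, unfolded Q] by blast
  hence "g \<in> conj_class n \<mu>"
    unfolding conj_class_def by (auto simp: m_def fun_eq_iff intro!: exI[of _ T])
  thus ?thesis by blast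
qed

subsection \<open>Unipotent classes\<close>

text \<open>A = g - 1 acts on the module as multiplication by X - 1, so its nilpotency and its
  kernel become questions of divisibility by powers of X - 1.\<close>

lemma conj_class_module:
  fixes \<mu> :: "('a :: {field, finite}) alg_closure set \<Rightarrow> nat list"
  assumes g: "g \<in> conj_class n \<mu>"
  obtains A T where "A \<in> carrier_mat n n" "g = 1\<^sub>m n + A" "bij_betw T (carrier_vec n) (quotient_sum \<mu>)" "T (0\<^sub>v n) = (\<lambda>x. 0)"
    "\<And>v k f i. v \<in> carrier_vec n \<Longrightarrow>
      T (((\<lambda>v. A *\<^sub>v v) ^^ k) v) (f, i) = ([:-1, 1:] ^ k * T v (f, i)) mod orbit_poly f ^ (\<mu> f ! i)"
proof -
  obtain T where g: "g \<in> carrier (GL n)" and T1: "bij_betw T (carrier_vec n) (quotient_sum \<mu>)"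
    and T2: "\<forall>v\<in>carrier_vec n. \<forall>w\<in>carrier_vec n. T (v + w) = (\<lambda>x. T v x + T w x)"
    and T3: "\<forall>p. \<forall>v\<in>carrier_vec n. T (poly_act n g p v) = (\<lambda>(f, i). (p * T v (f, i)) mod orbit_poly f ^ (\<mu> f ! i))"
    using assms unfolding conj_class_def mem_Collect_eq by (elim conjE exE)
  note T = T1 bspec[OF bspec[OF T2]] bspec[OF spec[OF T3]]
  have gc: "g \<in> carrier_mat n n" using g by (simp add: GL_iff)
  define A where "A = g - 1\<^sub>m n"
  have A: "A \<in> carrier_mat n n" unfolding A_def by (rule minus_carrier_mat) simp
  have gA: "g = 1\<^sub>m n + A" by (rule eq_matI) (use gc in \<open>auto simp: A_def\<close>)
  have e: "T (0\<^sub>v n) = (\<lambda>x. T (0\<^sub>v n) x + T (0\<^sub>v n) x)"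
    using T(2)[of "0\<^sub>v n" "0\<^sub>v n"] by (simp only: left_zero_vec zero_carrier_vec simp_thms)
  have T0: "T (0\<^sub>v n) = (\<lambda>x. 0)" by (rule ext) (metis fun_cong[OF e] add_cancel_right_right)
  have act: "A *\<^sub>v v = poly_act n g [:-1, 1:] v" if v: "v \<in> carrier_vec n" for v
  proof (rule eq_vecI)
    fix j assume "j < dim_vec (poly_act n g [:-1, 1:] v)"
    hence j: "j < n" by (simp add: poly_act_def)
    have "A *\<^sub>v v = g *\<^sub>v v - 1\<^sub>m n *\<^sub>v v"
      unfolding A_def by (rule minus_mult_distrib_mat_vec[of _ n n]) (use gc v in auto)
    thus "(A *\<^sub>v v) $ j = poly_act n g [:-1, 1:] v $ j" using j gc v by (simp add: poly_act_def)
  qed (use A in \<open>simp add: poly_act_def\<close>)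
  have Ak: "T (((\<lambda>v. A *\<^sub>v v) ^^ k) v) (f, i) = ([:-1, 1:] ^ k * T v (f, i)) mod orbit_poly f ^ (\<mu> f ! i)"
    if v: "v \<in> carrier_vec n" for v k f i
  proof (induction k)
    case 0
    have "T v \<in> quotient_sum \<mu>" using T(1) v by (auto simp: bij_betw_def)
    hence "T v (f, i) mod orbit_poly f ^ (\<mu> f ! i) = T v (f, i)"
      unfolding quotient_sum_def by (cases "i < length (\<mu> f)") auto
    thus ?case by simp
  next
    case (Suc k)
    have "((\<lambda>v. A *\<^sub>v v) ^^ Suc k) v = poly_act n g [:-1, 1:] (((\<lambda>v. A *\<^sub>v v) ^^ k) v)"
      using act[OF funpow_mat_vec_carrier[OF A v]] by simp
    hence "T (((\<lambda>v. A *\<^sub>v v) ^^ Suc k) v) (f, i) =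
        ([:-1, 1:] * (([:-1, 1:] ^ k * T v (f, i)) mod orbit_poly f ^ (\<mu> f ! i))) mod orbit_poly f ^ (\<mu> f ! i)"
      by (simp only: T(3)[OF funpow_mat_vec_carrier[OF A v]] split Suc.IH)
    also have "\<dots> = ([:-1, 1:] ^ Suc k * T v (f, i)) mod orbit_poly f ^ (\<mu> f ! i)"
      by (simp only: mod_mult_right_eq mult.assoc[symmetric] power_Suc)
    finally show ?case .
  qed
  show thesis by (rule that[OF A gA T(1) T0 Ak])
qed

lemma strict_upper_nilpotent:
  fixes B :: "'k :: field mat"
  assumes B: "B \<in> carrier_mat n n" "strict_upper n B" and v: "v \<in> carrier_vec n"
  shows "((\<lambda>v. B *\<^sub>v v) ^^ n) v = 0\<^sub>v n"
proof -
  have "(((\<lambda>v. B *\<^sub>v v) ^^ k) v) $ i = 0" if "i < n" "n \<le> i + k" for i k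
    using that
  proof (induction k arbitrary: i)
    case (Suc k)
    let ?w = "((\<lambda>v. B *\<^sub>v v) ^^ k) v"
    have "(B *\<^sub>v ?w) $ i = (\<Sum>j<n. B $$ (i, j) * ?w $ j)"
      by (rule mat_vec_index[OF B(1) funpow_mat_vec_carrier[OF B(1) v] Suc.prems(1)])
    also have "\<dots> = 0"
    proof (rule sum.neutral, rule ballI)
      fix j assume j: "j \<in> {..<n}"
      show "B $$ (i, j) * ?w $ j = 0"
      proof (cases "j \<le> i")
        case True thus ?thesis using B(2) Suc.prems(1) by (simp add: strict_upper_def)
      next
        case False thus ?thesis using Suc.IH[of j] Suc.prems j by simp
      qed
    qed
    finally show ?case by simp
  qed simp
  thus ?thesis using funpow_mat_vec_carrier[OF B(1) v, of n] by (intro eq_vecI) auto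
qed

text \<open>A conjugate of g in U_n would make A^n zero. Tested on the residue class of 1 in a
  summand belonging to f, this makes the polynomial of f divide (X - 1)^n, so f would be the orbit
  of 1.\<close>

lemma induced_not_unipotent:
  fixes \<mu> :: "('a :: {field, finite}) alg_closure set \<Rightarrow> nat list"
  assumes \<mu>: "\<mu> \<in> partition_funs Phi n" and f: "\<mu> f \<noteq> []" "f \<noteq> {1}" and g: "g \<in> conj_class n \<mu>"
  shows "induced (GL n) (UT n) \<chi> g = 0"
proof -
  obtain A T where A: "A \<in> carrier_mat n n" "g = 1\<^sub>m n + A"
    and T: "bij_betw T (carrier_vec n) (quotient_sum \<mu>)" "T (0\<^sub>v n) = (\<lambda>x. 0)"
    "\<And>v k f i. v \<in> carrier_vec n \<Longrightarrow>
      T (((\<lambda>v. A *\<^sub>v v) ^^ k) v) (f, i) = ([:-1, 1:] ^ k * T v (f, i)) mod orbit_poly f ^ (\<mu> f ! i)"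
    using conj_class_module[OF g] by metis
  have fP: "f \<in> Phi" using \<mu> f(1) by (auto simp: partition_funs_def)
  have "0 \<notin> set (\<mu> f)" using \<mu> by (auto simp: partition_funs_def is_partition_def)
  hence a: "\<mu> f ! 0 > 0" using nth_mem[of 0 "\<mu> f"] f(1) by (metis gr0I length_greater_0_conv)
  have deg: "Polynomial.degree (orbit_poly f ^ (\<mu> f ! 0)) > 0"
    using orbit_poly_props(1,2)[OF fP] Phi_D(2)[OF fP] a by (subst degree_power_eq) auto
  define s where "s = (\<lambda>x. if x = (f, 0 :: nat) then (1 :: 'a poly) else 0)"
  have "s \<in> quotient_sum \<mu>"
    using f(1) deg by (auto simp: quotient_sum_def s_def mod_poly_less)
  hence "s \<in> T ` carrier_vec n" using T(1) by (simp add: bij_betw_def)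
  then obtain v where v: "v \<in> carrier_vec n" "T v = s" by blast
  have ns: "\<not> strict_upper n (x' * A * x)"
    if x: "x \<in> carrier_mat n n" "x' \<in> carrier_mat n n" "x * x' = 1\<^sub>m n" "x' * x = 1\<^sub>m n" for x x'
  proof
    assume su: "strict_upper n (x' * A * x)"
    let ?B = "x' * A * x"
    have B: "?B \<in> carrier_mat n n" using x A by simp
    have conj: "((\<lambda>v. ?B *\<^sub>v v) ^^ k) (x' *\<^sub>v v) = x' *\<^sub>v ((\<lambda>v. A *\<^sub>v v) ^^ k) v" for k
      by (induction k) (auto simp del: assoc_mult_mat_vec simp: conj_mult_vec[OF A(1) x(1-3)] funpow_mat_vec_carrier[OF A(1) v(1)])
    have "x' *\<^sub>v ((\<lambda>v. A *\<^sub>v v) ^^ n) v = 0\<^sub>v n"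
      unfolding conj[symmetric] by (rule strict_upper_nilpotent[OF B su]) (use x v in simp)
    hence "x *\<^sub>v (x' *\<^sub>v ((\<lambda>v. A *\<^sub>v v) ^^ n) v) = 0\<^sub>v n" using x(1) by (auto intro!: eq_vecI)
    hence "((\<lambda>v. A *\<^sub>v v) ^^ n) v = 0\<^sub>v n"
      using assoc_mult_mat_vec[OF x(1,2) funpow_mat_vec_carrier[OF A(1) v(1), of n]] x(3) funpow_mat_vec_carrier[OF A(1) v(1), of n] by simp
    hence "([:-1, 1:] ^ n * s (f, 0)) mod orbit_poly f ^ (\<mu> f ! 0) = 0"
      using T(3)[OF v(1), of n f 0] T(2) v(2) by simp
    hence "orbit_poly f ^ (\<mu> f ! 0) dvd [:-1, 1:] ^ n" by (simp add: s_def mod_eq_0_iff_dvd)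
    hence "orbit_poly f dvd [:-1, 1:] ^ n" using a dvd_power[of "\<mu> f ! 0" "orbit_poly f"] dvd_trans by blast
    thus False using orbit_poly_dvd_power[OF fP] f(2) by blast
  qed
  have "(let y = m_inv (GL n) x \<otimes>\<^bsub>GL n\<^esub> g \<otimes>\<^bsub>GL n\<^esub> x in if y \<in> UT n then \<chi> y else 0) = 0" if xG: "x \<in> carrier (GL n)" for x
  proof -
    obtain x' where x: "x \<in> carrier_mat n n" "x' \<in> carrier_mat n n" "x * x' = 1\<^sub>m n" "x' * x = 1\<^sub>m n"
      using xG by (auto simp: GL_iff)
    have "x' * (1\<^sub>m n + A) * x = 1\<^sub>m n + x' * A * x"
      using A(1) x by (simp add: mult_add_distrib_mat[of _ n n _ n] add_mult_distrib_mat[of _ n n _ _ n])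
    moreover have "x' * A * x \<in> carrier_mat n n" using A x by simp
    ultimately show ?thesis using ns[OF x] by (simp add: A(2) GL_inv[OF x] UT_iff Let_def)
  qed
  thus ?thesis unfolding induced_def by (simp add: sum.neutral)
qed

text \<open>Multiplication by X - 1 modulo (X - 1)^a has the one-dimensional kernel spanned by (X -
  1)^(a - 1), so every part of the partition contributes one dimension.\<close>

lemma unipotent_class:
  fixes \<mu> :: "('a :: {field, finite}) alg_closure set \<Rightarrow> nat list"
  assumes \<mu>: "\<mu> \<in> partition_funs Phi n" and supp: "\<And>f. f \<noteq> {1} \<Longrightarrow> \<mu> f = []" and g: "g \<in> conj_class n \<mu>"
  obtains A where "A \<in> carrier_mat n n" "g = 1\<^sub>m n + A" "\<forall>v\<in>carrier_vec n. ((\<lambda>v. A *\<^sub>v v) ^^ n) v = 0\<^sub>v n"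
    "card (mat_ker n A) = CARD('a) ^ length (\<mu> {1})"
proof -
  obtain A T where A: "A \<in> carrier_mat n n" "g = 1\<^sub>m n + A"
    and T: "bij_betw T (carrier_vec n) (quotient_sum \<mu>)" "T (0\<^sub>v n) = (\<lambda>x. 0)"
    "\<And>v k f i. v \<in> carrier_vec n \<Longrightarrow>
      T (((\<lambda>v. A *\<^sub>v v) ^^ k) v) (f, i) = ([:-1, 1:] ^ k * T v (f, i)) mod orbit_poly f ^ (\<mu> f ! i)"
    using conj_class_module[OF g] by metis
  define l where "l = \<mu> {1}"
  let ?L = "[:-1, 1:] :: 'a poly"
  have part: "is_partition l" using \<mu> by (simp add: partition_funs_def l_def)
  have pos: "l ! i \<ge> 1" if "i < length l" for i
    using part nth_mem[OF that] by (metis Suc_leI One_nat_def gr0I is_partition_def)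
  have "(\<Sum>f | \<mu> f \<noteq> []. card f * sum_list (\<mu> f)) = (\<Sum>f\<in>{{1}}. card f * sum_list (\<mu> f))"
    by (rule sum.mono_neutral_left) (use supp in auto)
  hence n: "sum_list l = n" using \<mu> by (simp add: partition_funs_def l_def)
  have le: "l ! i \<le> n" if "i < length l" for i
    unfolding n[symmetric] using member_le_sum_list[of "l ! i" l] that by simp
  have TQ: "T v \<in> quotient_sum \<mu>" if "v \<in> carrier_vec n" for v using T(1) that by (auto simp: bij_betw_def)
  have Qout: "s (f, i) = 0" if "s \<in> quotient_sum \<mu>" "\<not> (f = {1} \<and> i < length l)" for s f i
  proof -
    have "\<not> i < length (\<mu> f)" using that(2) supp[of f] by (cases "f = {1}") (auto simp: l_def)
    thus ?thesis using that(1) by (auto simp: quotient_sum_def)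
  qed
  have Qin: "s ({1}, i) mod ?L ^ (l ! i) = s ({1}, i)" if "s \<in> quotient_sum \<mu>" "i < length l" for s i
  proof -
    have "\<forall>f i. if i < length (\<mu> f) then s (f, i) mod orbit_poly f ^ (\<mu> f ! i) = s (f, i) else s (f, i) = 0"
      using that(1) by (simp only: quotient_sum_def mem_Collect_eq)
    from spec[OF spec[OF this, of "{1}"], of i] show ?thesis
      using that(2) by (simp only: l_def if_True orbit_poly_1)
  qed
  have T_eq_0: "w = 0\<^sub>v n" if w: "w \<in> carrier_vec n" "\<And>i. i < length l \<Longrightarrow> T w ({1}, i) = 0" for w
  proof -
    have "T w = T (0\<^sub>v n)"
    proof
      fix x :: "'a alg_closure set \<times> nat"
      obtain f i where x: "x = (f, i)" by fastforce
      show "T w x = T (0\<^sub>v n) x"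
        using w(2)[of i] Qout[OF TQ[OF w(1)], of f i] unfolding T(2) x by (cases "f = {1} \<and> i < length l") auto
    qed
    thus ?thesis using T(1) w(1) by (auto simp: bij_betw_def dest: inj_onD)
  qed
  have T1: "T (((\<lambda>v. A *\<^sub>v v) ^^ k) v) ({1}, i) = (?L ^ k * T v ({1}, i)) mod ?L ^ (l ! i)" if "v \<in> carrier_vec n" for v k i
    using T(3)[OF that, of k "{1}" i] by (simp only: orbit_poly_1 l_def)
  have nil: "((\<lambda>v. A *\<^sub>v v) ^^ n) v = 0\<^sub>v n" if v: "v \<in> carrier_vec n" for v
    by (simp add: T_eq_0 funpow_mat_vec_carrier A(1) v le le_imp_power_dvd dvd_mult2 T1 mod_eq_0_iff_dvd)
  define Q0 where "Q0 = {s \<in> quotient_sum \<mu>. \<forall>i<length l. (?L * s ({1}, i)) mod ?L ^ (l ! i) = 0}"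
  have ker: "v \<in> mat_ker n A \<longleftrightarrow> v \<in> carrier_vec n \<and> T v \<in> Q0" for v
  proof (cases "v \<in> carrier_vec n")
    case v: True
    have Av: "A *\<^sub>v v \<in> carrier_vec n" using A(1) v by simp
    have e: "T (A *\<^sub>v v) ({1}, i) = (?L * T v ({1}, i)) mod ?L ^ (l ! i)" for i using T1[OF v, of 1 i] by simp
    have "A *\<^sub>v v = 0\<^sub>v n \<longleftrightarrow> (\<forall>i<length l. T (A *\<^sub>v v) ({1}, i) = 0)"
      using T_eq_0[OF Av] T(2) by auto
    thus ?thesis using v TQ[OF v] unfolding e by (auto simp: mat_ker_def Q0_def)
  qed (simp add: mat_ker_def)
  have "bij_betw T (mat_ker n A) Q0"
  proof -
    have "T ` mat_ker n A = Q0"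
    proof (intro equalityI subsetI)
      fix s assume s: "s \<in> Q0"
      hence "s \<in> T ` carrier_vec n" using T(1) by (auto simp: bij_betw_def Q0_def)
      thus "s \<in> T ` mat_ker n A" using s ker by auto
    qed (use ker in auto)
    moreover have "inj_on T (mat_ker n A)" using T(1) ker by (auto simp: bij_betw_def inj_on_def)
    ultimately show ?thesis by (simp add: bij_betw_def)
  qed
  hence "card (mat_ker n A) = card Q0" by (rule bij_betw_same_card)
  also have "card Q0 = card ({..<length l} \<rightarrow>\<^sub>E (UNIV :: 'a set))"
  proof -
    define E where "E = (\<lambda>(c :: nat \<Rightarrow> 'a) (f, i). if f = {1 :: 'a alg_closure} \<and> i < length l then smult (c i) (?L ^ (l ! i - 1)) else 0)"
    have L0: "?L ^ k \<noteq> 0" for k by simp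
    have dL: "Polynomial.degree (?L ^ k) = k" for k by (simp add: degree_power_eq)
    have E1: "E c ({1}, i) = smult (c i) (?L ^ (l ! i - 1))" if "i < length l" for c i using that by (simp add: E_def)
    have "bij_betw E ({..<length l} \<rightarrow>\<^sub>E UNIV) Q0"
      unfolding bij_betw_def
    proof (intro conjI equalityI subsetI)
      show "inj_on E ({..<length l} \<rightarrow>\<^sub>E UNIV)"
      proof (rule inj_onI)
        fix c c' assume c: "c \<in> {..<length l} \<rightarrow>\<^sub>E UNIV" "c' \<in> {..<length l} \<rightarrow>\<^sub>E UNIV" "E c = E c'"
        have "c i = c' i" if "i < length l" for i
        proof -
          have "smult (c i - c' i) (?L ^ (l ! i - 1)) = 0"
            using E1[OF that, of c] E1[OF that, of c'] c(3) by (simp add: smult_diff_left)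
          thus ?thesis using L0[of "l ! i - 1"] by simp
        qed
        thus "c = c'" using c(1,2) by (intro PiE_ext) auto
      qed
      fix s assume "s \<in> E ` ({..<length l} \<rightarrow>\<^sub>E UNIV)"
      then obtain c where s: "s = E c" by blast
      have "s (f, i) mod orbit_poly f ^ (\<mu> f ! i) = s (f, i)" if "i < length (\<mu> f)" for f i
      proof -
        have f: "f = {1}" using that supp[of f] by (cases "f = {1}") auto
        hence i: "i < length l" using that by (simp add: l_def)
        have "Polynomial.degree (smult (c i) (?L ^ (l ! i - 1))) < Polynomial.degree (?L ^ (l ! i))"
          using degree_smult_le[of "c i" "?L ^ (l ! i - 1)"] pos[OF i] by (simp only: dL)
        thus ?thesis using f i by (simp add: s E1 orbit_poly_1 l_def[symmetric] mod_poly_less)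
      qed
      moreover have "s (f, i) = 0" if "\<not> i < length (\<mu> f)" for f i using that by (auto simp: s E_def l_def)
      moreover have "(?L * s ({1}, i)) mod ?L ^ (l ! i) = 0" if "i < length l" for i
      proof -
        have "?L ^ (l ! i) = ?L * ?L ^ (l ! i - 1)" using pos[OF that] by (metis Suc_diff_1 One_nat_def Suc_le_lessD power_Suc)
        hence "?L * s ({1}, i) = smult (c i) (?L ^ (l ! i))" by (simp only: s E1[OF that] mult_smult_right)
        thus ?thesis by (simp add: mod_smult_left)
      qed
      ultimately show "s \<in> Q0" by (auto simp: Q0_def quotient_sum_def)
    next
      fix s assume s: "s \<in> Q0"
      hence sQ: "s \<in> quotient_sum \<mu>" by (simp add: Q0_def)
      have "\<exists>c. s ({1}, i) = smult c (?L ^ (l ! i - 1))" if i: "i < length l" for i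
      proof -
        have pw: "?L ^ (l ! i) = ?L * ?L ^ (l ! i - 1)" using pos[OF i] by (metis Suc_diff_1 One_nat_def Suc_le_lessD power_Suc)
        have "?L * ?L ^ (l ! i - 1) dvd ?L * s ({1}, i)"
          using s i unfolding pw[symmetric] by (simp add: Q0_def mod_eq_0_iff_dvd)
        hence "?L ^ (l ! i - 1) dvd s ({1}, i)" by (subst (asm) dvd_mult_cancel_left) simp
        then obtain u where u: "s ({1}, i) = ?L ^ (l ! i - 1) * u" by (rule dvdE)
        have "Polynomial.degree u = 0"
        proof (cases "u = 0")
          case False
          have "s ({1}, i) \<noteq> 0" using u False by simp
          hence "Polynomial.degree (s ({1}, i)) < Polynomial.degree (?L ^ (l ! i))"
            using Qin[OF sQ i] by (metis L0 degree_mod_less')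
          moreover have "Polynomial.degree (s ({1}, i)) = Polynomial.degree (?L ^ (l ! i - 1)) + Polynomial.degree u"
            unfolding u by (rule degree_mult_eq) (use False in auto)
          ultimately show ?thesis unfolding dL by simp
        qed simp
        then obtain c where "u = [:c:]" by (rule degree_eq_zeroE)
        thus ?thesis using u by auto
      qed
      then obtain c where c: "\<And>i. i < length l \<Longrightarrow> s ({1}, i) = smult (c i) (?L ^ (l ! i - 1))" by metis
      have "s = E (restrict c {..<length l})"
      proof
        fix x :: "'a alg_closure set \<times> nat"
        obtain f i where x: "x = (f, i)" by fastforce
        show "s x = E (restrict c {..<length l}) x"
          using c[of i] Qout[OF sQ, of f i] unfolding x by (cases "f = {1} \<and> i < length l") (auto simp: E_def)
      qed
      from image_eqI[of s E, OF this] show "s \<in> E ` ({..<length l} \<rightarrow>\<^sub>E UNIV)" by simp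
    qed
    from bij_betw_same_card[OF this] show ?thesis ..
  qed
  also have "\<dots> = CARD('a) ^ length l" by (simp add: card_PiE)
  finally show thesis by (intro that[OF A]) (auto simp: nil l_def)
qed

section \<open>The characteristic of a character induced from the unipotent group\<close>

lemma finite_Phi_le: "finite {f \<in> (Phi :: ('a :: {field, finite}) alg_closure set set). card f \<le> n}"
proof (rule finite_subset)
  show "{f \<in> (Phi :: 'a alg_closure set set). card f \<le> n} \<subseteq> (\<Union>j\<in>{1..n}. frob_orbit ` field_units j)"
  proof
    fix f assume f: "f \<in> {f \<in> (Phi :: 'a alg_closure set set). card f \<le> n}"
    then obtain z where z: "f = frob_orbit z" "z \<noteq> 0" by (auto simp: Phi_def)
    have "z \<in> field_units (card f)" using frob_orbit_finite(3)[of z "card f"] z by (simp add: field_units_def)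
    thus "f \<in> (\<Union>j\<in>{1..n}. frob_orbit ` field_units j)" using f z(1) Phi_D(2)[of f] by auto
  qed
qed (use field_units_card(1)[where 'a = 'a] in auto)

lemma finite_partition_funs_Phi: "finite (partition_funs (Phi :: ('a :: {field, finite}) alg_closure set set) n)"
proof (rule finite_subset)
  let ?F = "{f \<in> (Phi :: 'a alg_closure set set). card f \<le> n}" and ?B = "\<Union>m\<le>n. partitions m"
  show "partition_funs Phi n \<subseteq> {\<mu>. \<forall>f. (f \<in> ?F \<longrightarrow> \<mu> f \<in> ?B) \<and> (f \<notin> ?F \<longrightarrow> \<mu> f = [])}"
  proof (rule subsetI, rule CollectI, rule allI)
    fix \<mu> f assume m: "\<mu> \<in> partition_funs (Phi :: 'a alg_closure set set) n"
    have \<mu>: "is_partition (\<mu> f)" "f \<notin> Phi \<Longrightarrow> \<mu> f = []" "finite {f. \<mu> f \<noteq> []}" "(\<Sum>f | \<mu> f \<noteq> []. card f * sum_list (\<mu> f)) = n"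
      using m by (auto simp: partition_funs_def)
    have main: "f \<in> ?F \<and> sum_list (\<mu> f) \<le> n" if ne: "\<mu> f \<noteq> []"
    proof -
      have f: "f \<in> Phi" using \<mu>(2) ne by blast
      have "card f * sum_list (\<mu> f) \<le> n"
        unfolding \<mu>(4)[symmetric] by (rule member_le_sum) (use ne \<mu>(3) in auto)
      moreover have "sum_list (\<mu> f) \<ge> 1" using ne \<mu>(1) by (cases "\<mu> f") (auto simp: is_partition_def)
      moreover have "card f \<ge> 1" by (rule Phi_D(2)[OF f])
      ultimately have "card f \<le> n" "sum_list (\<mu> f) \<le> n"
        by (metis le_trans mult_le_mono2 mult.right_neutral, metis le_trans mult_le_mono1 mult.left_neutral)
      thus ?thesis using f by simp
    qed
    thus "(f \<in> ?F \<longrightarrow> \<mu> f \<in> ?B) \<and> (f \<notin> ?F \<longrightarrow> \<mu> f = [])"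
      using \<mu>(1) by (cases "\<mu> f = []") (auto simp: partitions_def)
  qed
  show "finite {\<mu>. \<forall>f. (f \<in> ?F \<longrightarrow> \<mu> f \<in> ?B) \<and> (f \<notin> ?F \<longrightarrow> \<mu> f = [])}"
    by (rule finite_set_of_finite_funs[OF finite_Phi_le]) (auto simp: finite_partitions)
qed

definition unipotent_type :: "nat list \<Rightarrow> ('a :: {field, finite}) alg_closure set \<Rightarrow> nat list" where
  "unipotent_type l = (\<lambda>f. if f = {1} then l else [])"

lemma unipotent_type_in:
  assumes "l \<in> partitions n"
  shows "unipotent_type l \<in> partition_funs (Phi :: ('a :: {field, finite}) alg_closure set set) n"
proof -
  have sub: "{f. unipotent_type l f \<noteq> []} \<subseteq> {{1 :: 'a alg_closure}}" by (auto simp: unipotent_type_def)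
  have "(\<Sum>f :: 'a alg_closure set | unipotent_type l f \<noteq> []. card f * sum_list (unipotent_type l f)) =
      (\<Sum>f\<in>{{1 :: 'a alg_closure}}. card f * sum_list (unipotent_type l f))"
    by (rule sum.mono_neutral_left[OF _ sub]) auto
  thus ?thesis
    using assms finite_subset[OF sub] one_in_Phi[where 'a = 'a]
    by (auto simp: partition_funs_def partitions_def unipotent_type_def is_partition_def)
qed

text \<open>Read off from Gamma_0 = 1, whose expansion has the empty partition as its only term,
  with coefficient 1.\<close>

lemma hall_littlewood_Nil: "hall_littlewood [] (inverse (of_nat CARD('a :: {field, finite}))) = 1"
proof -
  have "x = []" if "x \<in> partitions 0" for x using that by (cases x) (auto simp: partitions_def is_partition_def)
  hence "partitions 0 = {[]}" by (auto simp: partitions_def is_partition_def)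
  thus ?thesis
    using gg_0[where 'a = 'a] hl_parameter.gg_sym_def[OF hl_parameter_CARD[where 'a = 'a], of 0]
    by (simp add: hl_parameter.beta_def[OF hl_parameter_CARD] n_stat_def)
qed

lemma P_tilde_unipotent_type:
  "P_tilde (unipotent_type l :: ('a :: {field, finite}) alg_closure set \<Rightarrow> _) = in_alphabet {1} (HL_tilde l CARD('a))"
proof (cases "l = []")
  case True
  hence "{f. unipotent_type l f \<noteq> []} = ({} :: 'a alg_closure set set)" by (auto simp: unipotent_type_def)
  thus ?thesis using True by (simp add: P_tilde_def HL_tilde_def hall_littlewood_Nil n_stat_def)
next
  case False
  hence "{f. unipotent_type l f \<noteq> []} = {{1 :: 'a alg_closure}}" by (auto simp: unipotent_type_def)
  thus ?thesis by (simp add: P_tilde_def) (simp add: unipotent_type_def)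
qed

lemma ch_induced:
  fixes \<chi> :: "('a :: {field, finite}) mat \<Rightarrow> complex"
  shows "ch n (induced (GL n) (UT n) \<chi>) = in_alphabet {1} (\<Sum>l\<in>partitions n.
    scalar (induced (GL n) (UT n) \<chi> (SOME g. g \<in> conj_class n (unipotent_type l))) * HL_tilde l CARD('a))"
proof -
  let ?h = "\<lambda>\<mu>. scalar (induced (GL n) (UT n) \<chi> (SOME g. g \<in> conj_class n \<mu>)) * P_tilde \<mu>"
  let ?M = "partition_funs (Phi :: 'a alg_closure set set) n"
  have "ch n (induced (GL n) (UT n) \<chi>) = (\<Sum>\<mu> | \<mu> \<in> ?M \<and> (\<forall>f. f \<noteq> {1} \<longrightarrow> \<mu> f = []). ?h \<mu>)"
    unfolding ch_def
  proof (rule sum.mono_neutral_right[OF finite_partition_funs_Phi])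
    show "\<forall>\<mu>\<in>?M - {\<mu>. \<mu> \<in> ?M \<and> (\<forall>f. f \<noteq> {1} \<longrightarrow> \<mu> f = [])}. ?h \<mu> = 0"
    proof
      fix \<mu> assume "\<mu> \<in> ?M - {\<mu>. \<mu> \<in> ?M \<and> (\<forall>f. f \<noteq> {1} \<longrightarrow> \<mu> f = [])}"
      then obtain f where \<mu>: "\<mu> \<in> ?M" "\<mu> f \<noteq> []" "f \<noteq> {1}" by blast
      have "(SOME g. g \<in> conj_class n \<mu>) \<in> conj_class n \<mu>"
        using conj_class_nonempty[OF \<mu>(1)] by (simp add: some_in_eq)
      thus "?h \<mu> = 0" using induced_not_unipotent[OF \<mu>] by simp
    qed
  qed auto
  also have "\<dots> = (\<Sum>l\<in>partitions n. ?h (unipotent_type l))"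
  proof (rule sum.reindex_bij_witness[of _ unipotent_type "\<lambda>\<mu>. \<mu> {1}"])
    fix \<mu> assume a: "\<mu> \<in> {\<mu>. \<mu> \<in> ?M \<and> (\<forall>f. f \<noteq> {1} \<longrightarrow> \<mu> f = [])}"
    show e: "unipotent_type (\<mu> {1}) = \<mu>" using a by (auto simp: unipotent_type_def)
    have "(\<Sum>f | \<mu> f \<noteq> []. card f * sum_list (\<mu> f)) = (\<Sum>f\<in>{{1 :: 'a alg_closure}}. card f * sum_list (\<mu> f))"
      by (rule sum.mono_neutral_left) (use a in auto)
    thus "\<mu> {1} \<in> partitions n" using a by (simp add: partition_funs_def partitions_def)
    show "?h (unipotent_type (\<mu> {1})) = ?h \<mu>" unfolding e ..
  next
    fix l assume "l \<in> partitions n"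
    thus "unipotent_type l \<in> {\<mu>. \<mu> \<in> ?M \<and> (\<forall>f. f \<noteq> {1} \<longrightarrow> \<mu> f = [])}"
      using unipotent_type_in by (auto simp: unipotent_type_def)
  qed (auto simp: unipotent_type_def)
  finally show ?thesis
    by (simp only: in_alphabet_sum in_alphabet_scalar P_tilde_unipotent_type)
qed

lemma ch_induced_sym_fun:
  fixes \<chi> :: "('a :: {field, finite}) mat \<Rightarrow> complex"
  obtains g where "g \<in> sym_fun" "ch n (induced (GL n) (UT n) \<chi>) = in_alphabet {1} g"
proof (rule that[OF _ ch_induced])
  show "(\<Sum>l\<in>partitions n. scalar (induced (GL n) (UT n) \<chi> (SOME g. g \<in> conj_class n (unipotent_type l))) *
      HL_tilde l CARD('a)) \<in> sym_fun"
    by (intro sum_sym_fun mult_sym_fun scalar_sym_fun)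
      (auto simp: HL_tilde_def partitions_def intro!: mult_sym_fun hl_parameter.HL_sym_fun[OF hl_parameter_CARD])
qed

text \<open>Compares coefficients: the powers of 1/q in \<open>HL_tilde\<close> are the powers of t
  in \<open>gg_sym\<close>, and the character values are the factors (-1)^n
  \<open>beta\<close>.\<close>

lemma ch_induced_lin_char:
  fixes \<psi> :: "'a :: {field, finite} \<Rightarrow> complex"
  assumes \<psi>: "nontrivial_additive_char \<psi>" and c: "\<forall>m i. 1 \<le> i \<and> i < m \<longrightarrow> c m i \<noteq> 0"
  shows "ch n (induced (GL n) (UT n) (lin_char \<psi> c n)) = in_alphabet {1} (gg TYPE('a) n)"
proof -
  have "scalar (induced (GL n) (UT n) (lin_char \<psi> c n) (SOME g. g \<in> conj_class n (unipotent_type l))) * HL_tilde l CARD('a) =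
    scalar ((-1) ^ n * hl_parameter.beta (inverse (of_nat CARD('a))) (length l) * inverse (of_nat CARD('a)) ^ n_stat l) *
      hall_littlewood l (inverse (of_nat CARD('a)))" if l: "l \<in> partitions n" for l
  proof -
    let ?\<mu> = "unipotent_type l :: 'a alg_closure set \<Rightarrow> _"
    have \<mu>: "?\<mu> \<in> partition_funs Phi n" by (rule unipotent_type_in[OF l])
    have g: "(SOME g. g \<in> conj_class n ?\<mu>) \<in> conj_class n ?\<mu>" using conj_class_nonempty[OF \<mu>] by (simp add: some_in_eq)
    obtain A where A: "A \<in> carrier_mat n n" "(SOME g. g \<in> conj_class n ?\<mu>) = 1\<^sub>m n + A"
      "\<forall>v\<in>carrier_vec n. ((\<lambda>v. A *\<^sub>v v) ^^ n) v = 0\<^sub>v n" "card (mat_ker n A) = CARD('a) ^ length (?\<mu> {1})"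
      using unipotent_class[OF \<mu> _ g] by (auto simp: unipotent_type_def)
    have "card (mat_ker n A) = CARD('a) ^ length l" using A(4) by (simp add: unipotent_type_def)
    hence "induced (GL n) (UT n) (lin_char \<psi> c n) (SOME g. g \<in> conj_class n ?\<mu>) =
        (-1) ^ n * (\<Prod>j=1..length l. 1 - of_nat (CARD('a)) ^ j)"
      unfolding A(2) by (intro induced_lin_char_unipotent[OF A(1,3) \<psi>]) (use c in auto)
    also have "(\<Prod>j=1..length l. 1 - of_nat (CARD('a)) ^ j) = hl_parameter.beta (inverse (of_nat CARD('a))) (length l)"
      by (simp add: hl_parameter.beta_def[OF hl_parameter_CARD])
    finally have e: "induced (GL n) (UT n) (lin_char \<psi> c n) (SOME g. g \<in> conj_class n ?\<mu>) =
        (-1) ^ n * hl_parameter.beta (inverse (of_nat CARD('a))) (length l)" .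
    show ?thesis unfolding e HL_tilde_def scalar_mult power_inverse mult.assoc ..
  qed
  thus ?thesis
    unfolding ch_induced hl_parameter.gg_sym_def[OF hl_parameter_CARD] by (intro arg_cong[where f = "in_alphabet {1}"] sum.cong refl)
qed

theorem proposition3p20:
  fixes \<psi> :: "'a :: {field, finite} \<Rightarrow> complex"
    and c :: "nat \<Rightarrow> nat \<Rightarrow> 'a"
    and n :: nat
    and \<chi> :: "'a mat \<Rightarrow> complex"
  assumes "nontrivial_additive_char \<psi>"
    and "\<forall>m i. 1 \<le> i \<and> i < m \<longrightarrow> c m i \<noteq> 0"
    and "is_character ((GL n :: 'a mat monoid)\<lparr>carrier := UT n\<rparr>) \<chi>"
  shows "(rho_hat \<psi> c \<circ> rho) (ch n (induced (GL n) (UT n) \<chi>)) = ch n (induced (GL n) (UT n) \<chi>)"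
proof -
  obtain g where g: "g \<in> sym_fun" "ch n (induced (GL n) (UT n) \<chi>) = in_alphabet {1} g"
    by (rule ch_induced_sym_fun)
  show ?thesis
    unfolding comp_def g(2) by (rule rho_hat_rho[OF ch_induced_lin_char[OF assms(1,2)] g(1)])
qed

end
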